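(* Let $k\ge 2$ and let $A_{ij}\in\mathbb{C}^{n_i\times n_i}$ ($i=1,\dots,k$, $j=0,\dots,k$) define a multiparameter eigenvalue problem (MEP) with intrinsic dimension $(d_1,\dots,d_k)$. Consider the fiber product homotopy $\boldsymbol{H}_{\mathrm{FP}}=(1-t)\boldsymbol{Q}_{\mathrm{FP}}+t\boldsymbol{P}_{\mathrm{FP}}$ for this MEP, built from affine linear maps $L_1,\dots,L_k$ and generic matrices $R_1,\dots,R_k$. If the set $S$ of start solutions satisfies $|S|=\prod_{i=1}^k d_i$, then with probability one the start system $\boldsymbol{Q}_{\mathrm{FP}}=0$ is chosen correctly for the fiber product homotopy.
   Context: Setting. For $\boldsymbol{\lambda}=(\lambda_1,\dots,\lambda_k)\in\mathbb{C}^k$ put $H_i(\boldsymbol{\lambda})=A_{i0}-\lambda_1A_{i1}-\dots-\lambda_kA_{ik}$. The MEP is to find $\boldsymbol{\lambda}\in\mathbb{C}^k$ and $(\boldsymbol{x}_1,\dots,\boldsymbol{x}_k)\in\mathbb{P}^{n_1-1}\times\dots\times\mathbb{P}^{n_k-1}$ (complex projective spaces) with $H_i(\boldsymbol{\lambda})\boldsymbol{x}_i=0$ for $i=1,\dots,k$. The MEP has intrinsic dimension $(d_1,\dots,d_k)$, where each $d_i$ is a positive integer, if the polynomial $\det H_i(\boldsymbol{\lambda})$ in $\lambda_1,\dots,\lambda_k$ has total degree $d_i$ for each $i$. Start system. Let $L_i:\mathbb{C}^k\to\mathbb{C}^{k-1}$, $i=1,\dots,k$, be affine linear maps with linear part $\nabla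 L_i$ of rank $k-1$. With $\boldsymbol{\lambda}_1,\dots,\boldsymbol{\lambda}_k\in\mathbb{C}^k$ independent vectors of unknowns, define on $\mathbb{C}^{k^2}\times\mathbb{P}^{n_1-1}\times\dots\times\mathbb{P}^{n_k-1}$ the system $$\boldsymbol{Q}_{\mathrm{FP}}=\bigl[H_1(\boldsymbol{\lambda}_1)\boldsymbol{x}_1;\dots;H_k(\boldsymbol{\lambda}_k)\boldsymbol{x}_k;L_1(\boldsymbol{\lambda}_1);\dots;L_k(\boldsymbol{\lambda}_k)\bigr].$$ Start solutions. For each $i$, choose $\boldsymbol{p}_i\in\mathbb{C}^k$ with $L_i(\boldsymbol{p}_i)=0$ and $\boldsymbol{q}_i$ spanning $\ker(\nabla L_i)$. Substituting $\boldsymbol{\lambda}_i=\beta\boldsymbol{q}_i+\boldsymbol{p}_i$, the equations $H_i(\boldsymbol{\lambda}_i)\boldsymbol{x}_i=0$, $L_i(\boldsymbol{\lambda}_i)=0$ become the generalized eigenvalue problem $H_i(\beta\boldsymbol{q}_i+\boldsymbol{p}_i)\boldsymbol{x}_i=0$ in $(\beta,\boldsymbol{x}_i)$; its associated eigenpairs are the $(\boldsymbol{\lambda}_i,\boldsymbol{x}_i)\in\mathbb{C}^k\times\mathbb{P}^{n_i-1}$ with $\boldsymbol{\lambda}_i=\beta\boldsymbol{q}_i+\boldsymbol{p}_i$ and $H_i(\beta\boldsymbol{q}_i+\boldsymbol{p}_i)\boldsymbol{x}_i=0$. Let $S_i$ be the set of associated eigenpairs having distinct generalized eigenvalues, i.e.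 whose $\beta$ is a simple root of $\det H_i(\beta\boldsymbol{q}_i+\boldsymbol{p}_i)$; thus $|S_i|\le d_i$. Put $S=S_1\times\dots\times S_k$. Target system. Let $R_i\in\mathbb{C}^{(k-1)\times k(k-1)}$, $i=1,\dots,k$, be generic, let $I_k$ be the $k\times k$ identity matrix, and let $D_k\in\mathbb{C}^{k(k-1)\times k^2}$ be the block bidiagonal matrix with $D_k[\boldsymbol{\lambda}_1;\dots;\boldsymbol{\lambda}_k]=[\boldsymbol{\lambda}_1-\boldsymbol{\lambda}_2;\boldsymbol{\lambda}_2-\boldsymbol{\lambda}_3;\dots;\boldsymbol{\lambda}_{k-1}-\boldsymbol{\lambda}_k]$. Put $G_i(\boldsymbol{\lambda}_1,\dots,\boldsymbol{\lambda}_k)=R_iD_k[\boldsymbol{\lambda}_1;\dots;\boldsymbol{\lambda}_k]\in\mathbb{C}^{k-1}$ and $$\boldsymbol{P}_{\mathrm{FP}}=\bigl[H_1(\boldsymbol{\lambda}_1)\boldsymbol{x}_1;\dots;H_k(\boldsymbol{\lambda}_k)\boldsymbol{x}_k;G_1;\dots;G_k\bigr].$$ Fiber product homotopy. For $t\in[0,1]$, $\boldsymbol{H}_{\mathrm{FP}}=(1-t)\boldsymbol{Q}_{\mathrm{FP}}+t\boldsymbol{P}_{\mathrm{FP}}$; explicitly its components are $H_i(\boldsymbol{\lambda}_i)\boldsymbol{x}_i$ and $(1-t)L_i(\boldsymbol{\lambda}_i)+tG_i(\boldsymbol{\lambda}_1,\dots,\boldsymbol{\lambda}_k)$, $i=1,\dots,k$.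 Chosen correctly. For a homotopy $\boldsymbol{H}(\boldsymbol{z},t)=(1-t)\boldsymbol{Q}(\boldsymbol{z})+t\boldsymbol{P}(\boldsymbol{z})$, the start system $\boldsymbol{Q}=0$ is chosen correctly if: (i) the solution set of $\boldsymbol{Q}(\boldsymbol{z})=0$ is known or easy to obtain (here: by solving the $k$ generalized eigenvalue problems above, of sizes $n_1,\dots,n_k$); (ii) the solution set of $\boldsymbol{H}(\boldsymbol{z},t)=0$ for $0\le t<1$ consists of a finite number of smooth paths, each parametrized by $t\in[0,1)$; (iii) for each isolated solution of the target system $\boldsymbol{P}(\boldsymbol{z})=0$, there is some path originating from a solution of the start system that leads to it. Probability. "With probability one" refers to the generic (random, e.g. drawn from a distribution with a density) choice of the coefficients of the homotopy, in particular of the matrices $R_1,\dots,R_k$. *)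

theory Defs
  imports
    "HOL-Probability.Probability"
    "HOL-Library.Poly_Mapping"
    "Jordan_Normal_Form.DL_Rank"
    "Jordan_Normal_Form.Matrix_Kernel"
begin

unbundle no vec_syntax

text \<open>Conventions: the indices \<open>i\<close> of the \<open>k\<close> equations and the components of vectors count from 0;
  the matrix \<open>A i 0\<close> is the constant term of \<open>H i\<close>, and \<open>A i (Suc j)\<close> is the coefficient of
  component \<open>j\<close> of \<open>\<lambda>\<close>.\<close>

section \<open>The multiparameter eigenvalue problem\<close>

text \<open>The matrix \<open>A 0 - \<lambda> 0 A 1 - \<dots> - \<lambda> (k - 1) A k\<close> over an arbitrary commutative ring into which
  the complex numbers are mapped by \<open>emb\<close>: the complex numbers, the polynomials in one variable and
  the polynomials in \<open>\<lambda>\<close> are all needed.\<close>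

definition mep_matrix ::
    "(complex \<Rightarrow> 'a::comm_ring_1) \<Rightarrow> nat \<Rightarrow> nat \<Rightarrow> (nat \<Rightarrow> complex mat) \<Rightarrow> (nat \<Rightarrow> 'a) \<Rightarrow> 'a mat" where
  "mep_matrix emb k m A lam =
     mat m m (\<lambda>(r, s). emb (A 0 $$ (r, s)) - (\<Sum>j<k. lam j * emb (A (Suc j) $$ (r, s))))"

definition H_mat :: "nat \<Rightarrow> nat \<Rightarrow> (nat \<Rightarrow> complex mat) \<Rightarrow> complex vec \<Rightarrow> complex mat" where
  "H_mat k m A lam = mep_matrix (\<lambda>a. a) k m A (\<lambda>j. lam $ j)"

text \<open>Multivariate polynomials are finitely supported maps from monomials to coefficients, with the
  convolution product of \<open>Poly_Mapping\<close>; a monomial is a finitely supported map from the indices of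
  the variables to exponents.\<close>

type_synonym cmpoly = "(nat \<Rightarrow>\<^sub>0 nat) \<Rightarrow>\<^sub>0 complex"

definition mpoly_const :: "complex \<Rightarrow> cmpoly" where
  "mpoly_const a = Poly_Mapping.single 0 a"

definition mpoly_var :: "nat \<Rightarrow> cmpoly" where
  "mpoly_var j = Poly_Mapping.single (Poly_Mapping.single j 1) 1"

text \<open>The total degree of the zero polynomial is 0 here; this is harmless below, where degrees are
  required to be positive.\<close>

definition total_degree :: "cmpoly \<Rightarrow> nat" where
  "total_degree f = Max (insert 0
     ((\<lambda>m. \<Sum>j\<in>Poly_Mapping.keys m. Poly_Mapping.lookup m j) ` Poly_Mapping.keys f))"

definition det_H_poly :: "nat \<Rightarrow> nat \<Rightarrow> (nat \<Rightarrow> complex mat) \<Rightarrow> cmpoly" where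
  "det_H_poly k m A = Determinant.det (mep_matrix mpoly_const k m A mpoly_var)"

definition has_intrinsic_dimension ::
    "nat \<Rightarrow> (nat \<Rightarrow> nat) \<Rightarrow> (nat \<Rightarrow> nat \<Rightarrow> complex mat) \<Rightarrow> (nat \<Rightarrow> nat) \<Rightarrow> bool" where
  "has_intrinsic_dimension k n A d \<longleftrightarrow>
     (\<forall>i<k. 0 < d i \<and> total_degree (det_H_poly k (n i) (A i)) = d i)"

section \<open>Projective spaces and the solution space\<close>

text \<open>\<open>proj_space m\<close> is the projective space of dimension \<open>m - 1\<close>; its points are the classes of
  nonzero vectors of length \<open>m\<close> modulo scaling.\<close>

definition proj_point :: "complex vec \<Rightarrow> complex vec set" where
  "proj_point v = {c \<cdot>\<^sub>v v | c. c \<noteq> 0}"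

definition proj_space :: "nat \<Rightarrow> complex vec set set" where
  "proj_space m = proj_point ` (carrier_vec m - {0\<^sub>v m})"

definition cvec_topology :: "nat \<Rightarrow> complex vec topology" where
  "cvec_topology m = pullback_topology (carrier_vec m) (\<lambda>v. \<lambda>j\<in>{..<m}. v $ j)
     (product_topology (\<lambda>_. euclidean) {..<m})"

text \<open>The quotient topology.\<close>

definition proj_topology :: "nat \<Rightarrow> complex vec set topology" where
  "proj_topology m = topology (\<lambda>U. U \<subseteq> proj_space m \<and>
     openin (subtopology (cvec_topology m) (carrier_vec m - {0\<^sub>v m}))
       {v \<in> carrier_vec m - {0\<^sub>v m}. proj_point v \<in> U})"

text \<open>A point of the solution space assigns to each \<open>i\<close> the pair of \<open>\<lambda> i\<close> and \<open>x i\<close>.\<close>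

type_synonym fp_point = "nat \<Rightarrow> complex vec \<times> complex vec set"

definition fp_space :: "nat \<Rightarrow> (nat \<Rightarrow> nat) \<Rightarrow> fp_point set" where
  "fp_space k n = (\<Pi>\<^sub>E i\<in>{..<k}. carrier_vec k \<times> proj_space (n i))"

definition fp_topology :: "nat \<Rightarrow> (nat \<Rightarrow> nat) \<Rightarrow> fp_point topology" where
  "fp_topology k n =
     product_topology (\<lambda>i. prod_topology (cvec_topology k) (proj_topology (n i))) {..<k}"

lemma topspace_cvec_topology: "topspace (cvec_topology m) = carrier_vec m"
  by (auto simp: cvec_topology_def topspace_pullback_topology)

lemma openin_proj_topology:
  "openin (proj_topology m) U \<longleftrightarrow> U \<subseteq> proj_space m \<and>
     openin (subtopology (cvec_topology m) (carrier_vec m - {0\<^sub>v m}))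
       {v \<in> carrier_vec m - {0\<^sub>v m}. proj_point v \<in> U}"
proof -
  let ?X = "subtopology (cvec_topology m) (carrier_vec m - {0\<^sub>v m})"
  let ?W = "\<lambda>U. {v \<in> carrier_vec m - {0\<^sub>v m}. proj_point v \<in> U}"
  have "istopology (\<lambda>U. U \<subseteq> proj_space m \<and> openin ?X (?W U))"
    unfolding istopology_def
  proof (intro conjI allI impI)
    fix S T
    assume S: "S \<subseteq> proj_space m \<and> openin ?X (?W S)" and T: "T \<subseteq> proj_space m \<and> openin ?X (?W T)"
    show "S \<inter> T \<subseteq> proj_space m" using S by blast
    have "?W (S \<inter> T) = ?W S \<inter> ?W T" by blast
    then show "openin ?X (?W (S \<inter> T))" using S T by (simp add: openin_Int)
  next
    fix K assume K: "\<forall>S\<in>K. S \<subseteq> proj_space m \<and> openin ?X (?W S)"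
    show "\<Union>K \<subseteq> proj_space m" using K by blast
    have "?W (\<Union>K) = \<Union>(?W ` K)" by blast
    then show "openin ?X (?W (\<Union>K))" using K by auto
  qed
  then show ?thesis by (simp add: proj_topology_def topology_inverse')
qed

lemma topspace_proj_topology: "topspace (proj_topology m) = proj_space m"
proof -
  let ?X = "subtopology (cvec_topology m) (carrier_vec m - {0\<^sub>v m})"
  have "{v \<in> carrier_vec m - {0\<^sub>v m}. proj_point v \<in> proj_space m} = topspace ?X"
    by (auto simp: proj_space_def topspace_cvec_topology)
  then have "openin (proj_topology m) (proj_space m)"
    unfolding openin_proj_topology by (metis openin_topspace subset_refl)
  then show ?thesis
    by (meson openin_proj_topology openin_subset openin_topspace subset_antisym)
qed

lemma topspace_fp_topology: "topspace (fp_topology k n) = fp_space k n"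
  by (simp add: fp_topology_def fp_space_def topspace_cvec_topology topspace_proj_topology)

lemma quotient_map_proj_point:
  "quotient_map (subtopology (cvec_topology m) (carrier_vec m - {0\<^sub>v m})) (proj_topology m) proj_point"
proof -
  let ?X = "subtopology (cvec_topology m) (carrier_vec m - {0\<^sub>v m})"
  have X: "topspace ?X = carrier_vec m - {0\<^sub>v m}"
    by (auto simp: topspace_cvec_topology)
  show ?thesis
    unfolding quotient_map_def X topspace_proj_topology
    by (auto simp only: proj_space_def openin_proj_topology)
qed

section \<open>Smooth paths\<close>

text \<open>Infinitely differentiable on \<open>T\<close>, with one-sided derivatives at end points belonging to \<open>T\<close>;
  \<open>F m\<close> is the \<open>m\<close>-th derivative.\<close>

definition C_infinity_on :: "real set \<Rightarrow> (real \<Rightarrow> complex) \<Rightarrow> bool" where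
  "C_infinity_on T f \<longleftrightarrow> (\<exists>F :: nat \<Rightarrow> real \<Rightarrow> complex. (\<forall>t\<in>T. F 0 t = f t) \<and>
     (\<forall>m. \<forall>t\<in>T. (F m has_vector_derivative F (Suc m) t) (at t within T)))"

text \<open>As the projection from nonzero vectors to projective space is a surjective submersion, a path
  in projective space is smooth iff it locally lifts to a smooth path of nonzero vectors.\<close>

definition smooth_proj_path :: "nat \<Rightarrow> (real \<Rightarrow> complex vec set) \<Rightarrow> bool" where
  "smooth_proj_path m x \<longleftrightarrow>
     (\<forall>s\<in>{0..<1}. \<exists>e>0. \<exists>v :: real \<Rightarrow> complex vec.
        (\<forall>t\<in>{0..<1} \<inter> ball s e. v t \<in> carrier_vec m - {0\<^sub>v m} \<and> x t = proj_point (v t)) \<and>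
        (\<forall>j<m. C_infinity_on ({0..<1} \<inter> ball s e) (\<lambda>t. v t $ j)))"

definition smooth_fp_path :: "nat \<Rightarrow> (nat \<Rightarrow> nat) \<Rightarrow> (real \<Rightarrow> fp_point) \<Rightarrow> bool" where
  "smooth_fp_path k n \<gamma> \<longleftrightarrow> (\<forall>t\<in>{0..<1}. \<gamma> t \<in> fp_space k n) \<and>
     (\<forall>i<k. (\<forall>j<k. C_infinity_on {0..<1} (\<lambda>t. fst (\<gamma> t i) $ j)) \<and>
            smooth_proj_path (n i) (\<lambda>t. snd (\<gamma> t i)))"

section \<open>The fiber product homotopy\<close>

text \<open>A system takes \<open>\<lambda> i\<close> and homogeneous coordinate vectors \<open>x i\<close> to the list of its blocks.\<close>

type_synonym fp_system = "(nat \<Rightarrow> complex vec) \<Rightarrow> (nat \<Rightarrow> complex vec) \<Rightarrow> complex vec list"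

definition solutions :: "nat \<Rightarrow> (nat \<Rightarrow> nat) \<Rightarrow> fp_system \<Rightarrow> fp_point set" where
  "solutions k n F = {z \<in> fp_space k n. \<forall>x. (\<forall>i<k. x i \<in> snd (z i)) \<longrightarrow>
     (\<forall>w\<in>set (F (\<lambda>i. fst (z i)) x). w = 0\<^sub>v (dim_vec w))}"

text \<open>\<open>L i\<close> is the affine linear map with linear part \<open>B i\<close> and constant term \<open>c i\<close>.\<close>

definition L_map :: "complex mat \<Rightarrow> complex vec \<Rightarrow> complex vec \<Rightarrow> complex vec" where
  "L_map B c lam = B *\<^sub>v lam + c"

definition Q_FP :: "nat \<Rightarrow> (nat \<Rightarrow> nat) \<Rightarrow> (nat \<Rightarrow> nat \<Rightarrow> complex mat) \<Rightarrow>
    (nat \<Rightarrow> complex mat) \<Rightarrow> (nat \<Rightarrow> complex vec) \<Rightarrow> fp_system" where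
  "Q_FP k n A B c lam x =
     map (\<lambda>i. H_mat k (n i) (A i) (lam i) *\<^sub>v x i) [0..<k] @
     map (\<lambda>i. L_map (B i) (c i) (lam i)) [0..<k]"

definition stack :: "nat \<Rightarrow> (nat \<Rightarrow> complex vec) \<Rightarrow> complex vec" where
  "stack k lam = vec (k^2) (\<lambda>r. lam (r div k) $ (r mod k))"

definition D_mat :: "nat \<Rightarrow> complex mat" where
  "D_mat k = mat (k * (k - 1)) (k^2) (\<lambda>(r, s). if s = r then 1 else if s = r + k then - 1 else 0)"

definition G_map :: "nat \<Rightarrow> complex mat \<Rightarrow> (nat \<Rightarrow> complex vec) \<Rightarrow> complex vec" where
  "G_map k R lam = R *\<^sub>v (D_mat k *\<^sub>v stack k lam)"

definition P_FP :: "nat \<Rightarrow> (nat \<Rightarrow> nat) \<Rightarrow> (nat \<Rightarrow> nat \<Rightarrow> complex mat) \<Rightarrow>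
    (nat \<Rightarrow> complex mat) \<Rightarrow> fp_system" where
  "P_FP k n A R lam x =
     map (\<lambda>i. H_mat k (n i) (A i) (lam i) *\<^sub>v x i) [0..<k] @
     map (\<lambda>i. G_map k (R i) lam) [0..<k]"

definition homotopy :: "fp_system \<Rightarrow> fp_system \<Rightarrow> real \<Rightarrow> fp_system" where
  "homotopy Q P t lam x =
     map2 (\<lambda>u w. of_real (1 - t) \<cdot>\<^sub>v u + of_real t \<cdot>\<^sub>v w) (Q lam x) (P lam x)"

section \<open>Start solutions\<close>

definition pencil_det ::
    "nat \<Rightarrow> nat \<Rightarrow> (nat \<Rightarrow> complex mat) \<Rightarrow> complex vec \<Rightarrow> complex vec \<Rightarrow> complex poly" where
  "pencil_det k m A p q =
     Determinant.det (mep_matrix (\<lambda>a. [:a:]) k m A (\<lambda>j. [:p $ j, q $ j:]))"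

definition gep_eigenpairs :: "nat \<Rightarrow> nat \<Rightarrow> (nat \<Rightarrow> complex mat) \<Rightarrow> complex vec \<Rightarrow> complex vec \<Rightarrow>
    (complex vec \<times> complex vec set) set" where
  "gep_eigenpairs k m A p q = {(\<beta> \<cdot>\<^sub>v q + p, x) | \<beta> x. x \<in> proj_space m \<and>
     (\<forall>v\<in>x. H_mat k m A (\<beta> \<cdot>\<^sub>v q + p) *\<^sub>v v = 0\<^sub>v m)}"

definition simple_gep_eigenpairs :: "nat \<Rightarrow> nat \<Rightarrow> (nat \<Rightarrow> complex mat) \<Rightarrow> complex vec \<Rightarrow> complex vec \<Rightarrow>
    (complex vec \<times> complex vec set) set" where
  "simple_gep_eigenpairs k m A p q = {(\<beta> \<cdot>\<^sub>v q + p, x) | \<beta> x. x \<in> proj_space m \<and>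
     (\<forall>v\<in>x. H_mat k m A (\<beta> \<cdot>\<^sub>v q + p) *\<^sub>v v = 0\<^sub>v m) \<and>
     pencil_det k m A p q \<noteq> 0 \<and> Polynomial.order \<beta> (pencil_det k m A p q) = 1}"

definition start_solutions :: "nat \<Rightarrow> (nat \<Rightarrow> nat) \<Rightarrow> (nat \<Rightarrow> nat \<Rightarrow> complex mat) \<Rightarrow>
    (nat \<Rightarrow> complex vec) \<Rightarrow> (nat \<Rightarrow> complex vec) \<Rightarrow> fp_point set" where
  "start_solutions k n A p q = (\<Pi>\<^sub>E i\<in>{..<k}. simple_gep_eigenpairs k (n i) (A i) (p i) (q i))"

section \<open>Correctly chosen start systems\<close>

text \<open>\<open>Q\<close>, \<open>H t\<close> and \<open>P\<close> are the solution sets of the start system, of the homotopy at \<open>t\<close> and of the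
  target system; \<open>K\<close> is the set that is regarded as known. The injectivity says that distinct paths
  do not meet. A solution is isolated if it is not a limit point of the solution set.\<close>

definition chosen_correctly :: "'z topology \<Rightarrow> ((real \<Rightarrow> 'z) \<Rightarrow> bool) \<Rightarrow> 'z set \<Rightarrow>
    'z set \<Rightarrow> (real \<Rightarrow> 'z set) \<Rightarrow> 'z set \<Rightarrow> bool" where
  "chosen_correctly X smooth K Q H P \<longleftrightarrow>
     (finite K \<and> Q = K) \<and>
     (\<exists>\<Gamma>. (finite \<Gamma> \<and> (\<forall>\<gamma>\<in>\<Gamma>. smooth \<gamma>) \<and>
            (\<forall>t\<in>{0..<1}. H t = (\<lambda>\<gamma>. \<gamma> t) ` \<Gamma> \<and> inj_on (\<lambda>\<gamma>. \<gamma> t) \<Gamma>)) \<and>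
          (\<forall>z\<in>P. z \<notin> X derived_set_of P \<longrightarrow>
             (\<exists>\<gamma>\<in>\<Gamma>. \<gamma> 0 \<in> Q \<and> limitin X \<gamma> z (at_left 1))))"

text \<open>For the fiber product homotopy, the known set consists of all solutions of the \<open>k\<close> generalized
  eigenvalue problems.\<close>

definition fp_chosen_correctly :: "nat \<Rightarrow> (nat \<Rightarrow> nat) \<Rightarrow> (nat \<Rightarrow> nat \<Rightarrow> complex mat) \<Rightarrow>
    (nat \<Rightarrow> complex mat) \<Rightarrow> (nat \<Rightarrow> complex vec) \<Rightarrow> (nat \<Rightarrow> complex vec) \<Rightarrow> (nat \<Rightarrow> complex vec) \<Rightarrow>
    (nat \<Rightarrow> complex mat) \<Rightarrow> bool" where
  "fp_chosen_correctly k n A B c p q R \<longleftrightarrow>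
     chosen_correctly (fp_topology k n) (smooth_fp_path k n)
       (\<Pi>\<^sub>E i\<in>{..<k}. gep_eigenpairs k (n i) (A i) (p i) (q i))
       (solutions k n (Q_FP k n A B c))
       (\<lambda>t. solutions k n (homotopy (Q_FP k n A B c) (P_FP k n A R) t))
       (solutions k n (P_FP k n A R))"

section \<open>Generic coefficients\<close>

text \<open>Lebesgue measure on the space of all entries of \<open>R 0, \<dots>, R (k - 1)\<close>; the point \<open>\<omega>\<close> has
  the entry of \<open>R i\<close> in row \<open>r\<close> and column \<open>s\<close> as its component \<open>(i, r, s)\<close>.\<close>

definition R_lebesgue :: "nat \<Rightarrow> (nat \<times> nat \<times> nat \<Rightarrow> complex) measure" where
  "R_lebesgue k = PiM ({..<k} \<times> {..<k - 1} \<times> {..<k * (k - 1)}) (\<lambda>_. lborel)"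

definition R_of :: "nat \<Rightarrow> (nat \<times> nat \<times> nat \<Rightarrow> complex) \<Rightarrow> nat \<Rightarrow> complex mat" where
  "R_of k \<omega> i = mat (k - 1) (k * (k - 1)) (\<lambda>(r, s). \<omega> (i, r, s))"

end

(*
  In coordinates adapted to the kernels of the linear parts of the L_i, the conditions det H_i = 0 and
  (1 - t) L_i + t G_i = 0 form a square system of k^2 equations of degrees 1 and d_i with Bezout
  number N = d_1 ... d_k.  If a Macaulay determinant dl is nonzero, there are at most N zeros, and they
  stay bounded; the determinant of Hermite's trace form then detects whether there are N distinct
  zeros.  Both determinants are polynomials in the coefficients and nonzero at the start system, since
  |S| = N.  Hence on the complex line through the start and the target system only finitely many t are
  bad, and the zeros form a covering of a convex neighbourhood of [0,1) in the t-plane, whose sections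
  are the paths.  Rotating R about the origin shows that [0,1) itself avoids the bad parameters for
  almost all R.  At a simple zero the cofactors of H_i do not all vanish, so x_i is determined by the
  other coordinates and smooth.  An isolated solution of the target system has a one-dimensional kernel
  for each H_i, and an isolated zero of a limit of good systems is the limit of zeros of these systems.
*)

theory Submission
  imports Defs "HOL-Complex_Analysis.Cauchy_Integral_Formula"
begin

unbundle no vec_syntax

section \<open>Polynomial systems as coefficient arrays\<close>

text \<open>Elimination of the eigenvectors makes the Bezout number the product of the
  \<open>d i\<close>: only the degree of \<open>det H_i\<close> counts, which may be below the size
  \<open>n i\<close>. The eigenvectors return as columns of adjugates. Goodness is tested by
  determinants because these are explicit polynomials in the coefficients: one closure argument
  shows that they depend polynomially on the parameter, continuously on the system and measurably on
  \<open>R\<close>. The parameters to be avoided form a real ray, so the bad \<open>R\<close> form a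
  set that need not lie in a complex hypersurface; hence the measure argument rotates
  \<open>R\<close>. Rotation applies since, once the linear equations are divided by
  \<open>1 - t\<close>, only the product \<open>s R\<close> with \<open>s = t / (1 - t)\<close>
  occurs. The target system may itself be bad, with multiple or non-isolated zeros, so nothing at
  \<open>t = 1\<close> can rest on a nonsingular Jacobian. There a decoupled good system through the
  given zero serves for comparison: along a connected family of good systems the presence of a zero
  in a polydisc cannot change if no zero meets its boundary.\<close>

definition expos :: "nat set \<Rightarrow> nat \<Rightarrow> (nat \<Rightarrow> nat) set" where
  "expos S d = {e. (\<forall>j. j \<notin> S \<longrightarrow> e j = 0) \<and> sum e S \<le> d}"

definition mon :: "nat \<Rightarrow> (nat \<Rightarrow> nat) \<Rightarrow> (nat \<Rightarrow> complex) \<Rightarrow> complex" where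
  "mon n e x = (\<Prod>j<n. x j ^ e j)"

lemma finite_expos [simp]:
  assumes "finite S"
  shows "finite (expos S d)"
proof (rule finite_subset)
  show "expos S d \<subseteq> {e. \<forall>j. (j \<in> S \<longrightarrow> e j \<in> {..d}) \<and> (j \<notin> S \<longrightarrow> e j = 0)}"
  proof
    fix e assume e: "e \<in> expos S d"
    have "e j \<le> d" if "j \<in> S" for j
      using e member_le_sum [OF that _ assms, of e] by (auto simp: expos_def intro: order_trans)
    then show "e \<in> {e. \<forall>j. (j \<in> S \<longrightarrow> e j \<in> {..d}) \<and> (j \<notin> S \<longrightarrow> e j = 0)}"
      using e by (auto simp: expos_def)
  qed
  show "finite {e. \<forall>j. (j \<in> S \<longrightarrow> e j \<in> {..d}) \<and> (j \<notin> S \<longrightarrow> e j = (0::nat))}"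
    by (rule finite_set_of_finite_funs) (use assms in auto)
qed

lemma mon_add: "mon n (\<lambda>j. a j + b j) x = mon n a x * mon n b x"
  by (simp add: mon_def power_add prod.distrib)

lemma mon_zero [simp]: "mon n (\<lambda>_. 0) x = 1"
  by (simp add: mon_def)

lemma mon_unit: "i < n \<Longrightarrow> mon n (\<lambda>j. if j = i then 1 else 0) x = x i"
  by (simp add: mon_def if_distrib [of "\<lambda>e. _ ^ e"] prod.delta' cong: if_cong)

text \<open>With fewer equations than unknowns the coefficient matrix can be padded by zero rows to
  a square one; the zero row at index \<open>card A\<close> makes every term of the Leibniz formula
  vanish. It yields the Bezout bound and a nonzero kernel vector of each \<open>B i\<close>.\<close>

lemma underdetermined_system:
  fixes f :: "'a \<Rightarrow> 'b \<Rightarrow> complex"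
  assumes "finite A" "finite F" "card A < card F"
  obtains c where "\<exists>x\<in>F. c x \<noteq> 0" "\<And>a. a \<in> A \<Longrightarrow> (\<Sum>x\<in>F. c x * f a x) = 0"
proof -
  define m where "m = card F"
  obtain \<alpha> where \<alpha>: "bij_betw \<alpha> {0..<card A} A"
    using ex_bij_betw_nat_finite [OF assms(1)] by blast
  obtain \<phi> where \<phi>: "bij_betw \<phi> {0..<m} F"
    using ex_bij_betw_nat_finite [OF assms(2)] unfolding m_def by blast
  define B where "B = mat m m (\<lambda>(r, s). if r < card A then f (\<alpha> r) (\<phi> s) else 0)"
  have B: "B \<in> carrier_mat m m" by (simp add: B_def)
  have "Determinant.det B = 0"
  proof -
    have "(\<Prod>i = 0..<m. B $$ (i, p i)) = 0" if "p permutes {0..<m}" for p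
      using assms(3) permutes_in_image [OF that, of "card A"]
      by (intro prod_zero) (auto simp: B_def m_def intro!: bexI [of _ "card A"])
    then have "(\<Sum>p | p permutes {0..<m}. signof p * (\<Prod>i = 0..<m. B $$ (i, p i))) = 0"
      by (intro sum.neutral) simp
    then show ?thesis by (simp only: det_def' [OF B])
  qed
  then obtain v where v: "v \<in> carrier_vec m" "v \<noteq> 0\<^sub>v m" "B *\<^sub>v v = 0\<^sub>v m"
    using det_0_iff_vec_prod_zero [OF B] by blast
  define c where "c x = v $ inv_into {0..<m} \<phi> x" for x
  have c: "c (\<phi> s) = v $ s" if "s < m" for s
    using that \<phi> by (simp add: c_def bij_betw_inv_into_left)
  show ?thesis
  proof (rule that)
    obtain s where "s < m" "v $ s \<noteq> 0" using v by (metis carrier_vecD eq_vecI index_zero_vec)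
    moreover have "\<phi> s \<in> F" using \<phi> \<open>s < m\<close> by (auto simp: bij_betw_def)
    ultimately show "\<exists>x\<in>F. c x \<noteq> 0" using c by metis
  next
    fix a assume "a \<in> A"
    then have "a \<in> \<alpha> ` {0..<card A}" using \<alpha> by (simp add: bij_betw_def)
    then obtain r where r: "r < card A" "a = \<alpha> r" by auto
    have "(\<Sum>x\<in>F. c x * f a x) = (\<Sum>s = 0..<m. v $ s * f a (\<phi> s))"
      using sum.reindex_bij_betw [OF \<phi>, of "\<lambda>x. c x * f a x"] by (simp add: c cong: sum.cong_simp)
    also have "\<dots> = (B *\<^sub>v v) $ r"
      using r v(1) assms(3)
      by (auto simp: B_def m_def scalar_prod_def mult.commute intro!: sum.cong)
    also have "\<dots> = 0" using r assms(3) v by (simp add: m_def)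
    finally show "(\<Sum>x\<in>F. c x * f a x) = 0" .
  qed
qed

text \<open>Determinants, adjugates and everything built from them are polynomial expressions in
  their entries, so a single closure argument covers each property of functions that is stable under
  sums and products: being polynomial in a parameter, converging along a filter, measurability,
  holomorphy.\<close>

definition fun_algebra :: "('a \<Rightarrow> complex) set \<Rightarrow> bool" where
  "fun_algebra \<A> \<longleftrightarrow> (\<forall>c. (\<lambda>_. c) \<in> \<A>) \<and>
     (\<forall>f\<in>\<A>. \<forall>g\<in>\<A>. (\<lambda>x. f x + g x) \<in> \<A> \<and> (\<lambda>x. f x * g x) \<in> \<A>)"

context
  fixes \<A> :: "('a \<Rightarrow> complex) set"
  assumes \<A>: "fun_algebra \<A>"
begin

lemma fun_algebra_const: "(\<lambda>_. c) \<in> \<A>"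
  and fun_algebra_add: "f \<in> \<A> \<Longrightarrow> g \<in> \<A> \<Longrightarrow> (\<lambda>x. f x + g x) \<in> \<A>"
  and fun_algebra_mult: "f \<in> \<A> \<Longrightarrow> g \<in> \<A> \<Longrightarrow> (\<lambda>x. f x * g x) \<in> \<A>"
  using \<A> by (auto simp: fun_algebra_def)

lemma fun_algebra_sum: "(\<And>i. i \<in> I \<Longrightarrow> (\<lambda>x. f x i) \<in> \<A>) \<Longrightarrow> (\<lambda>x. \<Sum>i\<in>I. f x i) \<in> \<A>"
  by (induction I rule: infinite_finite_induct) (auto intro: fun_algebra_const fun_algebra_add)

lemma fun_algebra_prod: "(\<And>i. i \<in> I \<Longrightarrow> (\<lambda>x. f x i) \<in> \<A>) \<Longrightarrow> (\<lambda>x. \<Prod>i\<in>I. f x i) \<in> \<A>"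
  by (induction I rule: infinite_finite_induct) (auto intro: fun_algebra_const fun_algebra_mult)

lemma fun_algebra_uminus: "f \<in> \<A> \<Longrightarrow> (\<lambda>x. - f x) \<in> \<A>"
  using fun_algebra_mult [OF fun_algebra_const [of "- 1"]] by simp

lemma fun_algebra_det:
  assumes "\<And>r s. r < m \<Longrightarrow> s < m \<Longrightarrow> (\<lambda>x. f x r s) \<in> \<A>"
  shows "(\<lambda>x. Determinant.det (mat m m (\<lambda>(r, s). f x r s))) \<in> \<A>"
proof -
  have *: "Determinant.det (mat m m (\<lambda>(r, s). f x r s)) =
      (\<Sum>p | p permutes {0..<m}. signof p * (\<Prod>i = 0..<m. f x i (p i)))" for x
    by (subst det_def' [where n = m]) (auto intro!: sum.cong prod.cong)
  show ?thesis
    unfolding * by (intro fun_algebra_sum fun_algebra_mult fun_algebra_const fun_algebra_prod assms) auto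
qed

lemma fun_algebra_adj_mat:
  assumes "\<And>r s. r < m \<Longrightarrow> s < m \<Longrightarrow> (\<lambda>x. f x r s) \<in> \<A>" "i < m" "j < m"
  shows "(\<lambda>x. adj_mat (mat m m (\<lambda>(r, s). f x r s)) $$ (i, j)) \<in> \<A>"
proof -
  \<comment> \<open>Position in the full matrix of entry \<open>(r', s')\<close> of the minor
    without row \<open>r\<close> and column \<open>s\<close>. It is used as \<open>g j i\<close>
    because entry \<open>(i, j)\<close> of the adjugate is the cofactor at
    \<open>(j, i)\<close>.\<close>
  define g where "g r s r' s' = ((if r' < r then r' else Suc r'), (if s' < s then s' else Suc s'))" 
    for r s r' s' :: nat
  have *: "adj_mat (mat m m (\<lambda>(r, s). f x r s)) $$ (i, j) = (- 1) ^ (j + i) *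
     Determinant.det (mat (m - 1) (m - 1) (\<lambda>(r, s). f x (fst (g j i r s)) (snd (g j i r s))))" for x
    using assms(2,3) unfolding adj_mat_def cofactor_def mat_delete_def g_def
    by (auto intro!: arg_cong [where f = Determinant.det] eq_matI)
  show ?thesis
    unfolding * using assms(2,3)
    by (intro fun_algebra_mult fun_algebra_const fun_algebra_det assms(1)) (auto simp: g_def)
qed

end

text \<open>Equation \<open>i\<close> of degree \<open>D i\<close> is paired with variable
  \<open>i\<close>, whose power \<open>D i\<close> plays the role of a leading monomial. The choice
  \<open>sel\<close> among the powers dividing a monomial is a parameter because the invertibility
  of the Macaulay matrix of a given system can depend on it.\<close>

locale square_system =
  fixes n :: nat and D :: "nat \<Rightarrow> nat" and sel :: "(nat \<Rightarrow> nat) \<Rightarrow> nat"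
  assumes D_pos: "i < n \<Longrightarrow> 1 \<le> D i"
    and sel: "\<exists>i<n. D i \<le> m i \<Longrightarrow> sel m < n \<and> D (sel m) \<le> m (sel m)"
begin

definition ev :: "(nat \<Rightarrow> (nat \<Rightarrow> nat) \<Rightarrow> complex) \<Rightarrow> nat \<Rightarrow> (nat \<Rightarrow> complex) \<Rightarrow> complex" where
  "ev C i x = (\<Sum>e\<in>expos {..<n} (D i). C i e * mon n e x)"

definition points :: "(nat \<Rightarrow> complex) set" where
  "points = {x. \<forall>j\<ge>n. x j = 0}"

definition zeros :: "(nat \<Rightarrow> (nat \<Rightarrow> nat) \<Rightarrow> complex) \<Rightarrow> (nat \<Rightarrow> complex) set" where
  "zeros C = {x \<in> points. \<forall>i<n. ev C i x = 0}"

text \<open>The monomials divisible by no \<open>x_j ^ D j\<close>. They form a basis of the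
  quotient ring of the system \<open>x_j ^ D j = 0\<close>, and their number \<open>N\<close> is the
  Bezout number.\<close>

definition red :: "(nat \<Rightarrow> nat) set" where
  "red = {e. (\<forall>j. n \<le> j \<longrightarrow> e j = 0) \<and> (\<forall>j<n. e j < D j)}"

text \<open>Large enough for products of three reduced monomials and for products of a reduced monomial
  with a variable.\<close>

definition big :: "(nat \<Rightarrow> nat) set" where
  "big = expos {..<n} (3 * (\<Sum>i<n. D i - 1) + 1)"

definition nred :: "(nat \<Rightarrow> nat) set" where
  "nred = big - red"

text \<open>Replaces the factor \<open>x_i ^ D i\<close> of \<open>m\<close>, where
  \<open>i = sel m\<close>, by the monomial \<open>e\<close>. The truncated subtraction is exact on
  \<open>nred\<close>, where \<open>D (sel m) \<le> m (sel m)\<close>.\<close>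

definition shift :: "(nat \<Rightarrow> nat) \<Rightarrow> (nat \<Rightarrow> nat) \<Rightarrow> nat \<Rightarrow> nat" where
  "shift m e = (\<lambda>j. (if j = sel m then m j - D j else m j) + e j)"

text \<open>A Macaulay system: the vector \<open>X\<close> of values of the monomials of bounded degree satisfies
  one equation for each monomial \<open>m\<close> that is not reduced, namely equation \<open>sel m\<close> multiplied by
  the cofactor of the power of variable \<open>sel m\<close> in \<open>m\<close>.\<close>

definition rel :: "(nat \<Rightarrow> (nat \<Rightarrow> nat) \<Rightarrow> complex) \<Rightarrow> ((nat \<Rightarrow> nat) \<Rightarrow> complex) \<Rightarrow> bool" where
  "rel C X \<longleftrightarrow> (\<forall>m\<in>nred. (\<Sum>e\<in>expos {..<n} (D (sel m)). C (sel m) e * X (shift m e)) = 0)"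

definition N :: nat where "N = card red"

definition ridx :: "nat \<Rightarrow> nat \<Rightarrow> nat" where
  "ridx = (SOME f. bij_betw f {0..<N} red)"

definition nidx :: "nat \<Rightarrow> nat \<Rightarrow> nat" where
  "nidx = (SOME f. bij_betw f {0..<card nred} nred)"

definition mac_entry :: "(nat \<Rightarrow> (nat \<Rightarrow> nat) \<Rightarrow> complex) \<Rightarrow> (nat \<Rightarrow> nat) \<Rightarrow> (nat \<Rightarrow> nat) \<Rightarrow> complex" where
  "mac_entry C m m' = (\<Sum>e | e \<in> expos {..<n} (D (sel m)) \<and> shift m e = m'. C (sel m) e)"

definition mac :: "(nat \<Rightarrow> (nat \<Rightarrow> nat) \<Rightarrow> complex) \<Rightarrow> complex mat" where
  "mac C = mat (card nred) (card nred) (\<lambda>(r, s). mac_entry C (nidx r) (nidx s))"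

definition dl :: "(nat \<Rightarrow> (nat \<Rightarrow> nat) \<Rightarrow> complex) \<Rightarrow> complex" where
  "dl C = Determinant.det (mac C)"

text \<open>Numerators of Cramer's rule for the Macaulay system: \<open>dl C * X m\<close> is the
  sum of \<open>K C m b * X b\<close> over the reduced \<open>b\<close>. Not dividing by
  \<open>dl C\<close> keeps every entry polynomial in the coefficients, which accounts for the
  diagonal entry \<open>dl C\<close> at reduced \<open>m\<close>.\<close>

definition K :: "(nat \<Rightarrow> (nat \<Rightarrow> nat) \<Rightarrow> complex) \<Rightarrow> (nat \<Rightarrow> nat) \<Rightarrow> (nat \<Rightarrow> nat) \<Rightarrow> complex" where
  "K C m b = (if m \<in> red then if b = m then dl C else 0
     else - (\<Sum>s<card nred. adj_mat (mac C) $$ (inv_into {0..<card nred} nidx m, s) *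
        mac_entry C (nidx s) b))"

text \<open>The determinant of Hermite's trace form.\<close>

definition hdet :: "(nat \<Rightarrow> (nat \<Rightarrow> nat) \<Rightarrow> complex) \<Rightarrow> complex" where
  "hdet C = Determinant.det (mat N N (\<lambda>(r, s).
     \<Sum>t<N. K C (\<lambda>j. (ridx r j + ridx s j) + ridx t j) (ridx t)))"

text \<open>As many distinct zeros as the Bezout bound allows and, through \<open>dl\<close>,
  control of all monomials in \<open>big\<close> by the reduced ones. All zeros are then simple
  (\<open>jac_nonsingular\<close>).\<close>

definition good :: "(nat \<Rightarrow> (nat \<Rightarrow> nat) \<Rightarrow> complex) \<Rightarrow> bool" where
  "good C \<longleftrightarrow> dl C \<noteq> 0 \<and> card (zeros C) = N"

lemma finite_red: "finite red" and card_red: "N = (\<Prod>i<n. D i)"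
proof -
  define ex where "ex e = (\<lambda>j. if j < n then e j else 0)" for e :: "nat \<Rightarrow> nat"
  have *: "bij_betw (\<lambda>e. restrict e {..<n}) red (\<Pi>\<^sub>E i\<in>{..<n}. {..<D i})"
  proof (rule bij_betw_byWitness [where f' = ex])
    show "\<forall>e\<in>red. ex (restrict e {..<n}) = e"
      by (auto simp: red_def ex_def fun_eq_iff)
    show "\<forall>e\<in>\<Pi>\<^sub>E i\<in>{..<n}. {..<D i}. restrict (ex e) {..<n} = e"
    proof (intro ballI ext)
      fix e j assume "e \<in> (\<Pi>\<^sub>E i\<in>{..<n}. {..<D i})"
      then show "restrict (ex e) {..<n} j = e j"
        using PiE_arb [of e "{..<n}" _ j] by (simp add: ex_def)
    qed
    show "(\<lambda>e. restrict e {..<n}) ` red \<subseteq> (\<Pi>\<^sub>E i\<in>{..<n}. {..<D i})"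
      by (intro image_subsetI) (simp add: red_def restrict_PiE_iff)
    show "ex ` (\<Pi>\<^sub>E i\<in>{..<n}. {..<D i}) \<subseteq> red"
    proof (intro image_subsetI)
      fix e assume e: "e \<in> (\<Pi>\<^sub>E i\<in>{..<n}. {..<D i})"
      have "e j < D j" if "j < n" for j using PiE_mem [OF e, of j] that by simp
      then show "ex e \<in> red" by (simp add: red_def ex_def)
    qed
  qed
  show "finite red" using bij_betw_finite [OF *] by (simp add: finite_PiE)
  show "N = (\<Prod>i<n. D i)" using bij_betw_same_card [OF *] by (simp add: N_def card_PiE)
qed

lemma finite_big: "finite big" and finite_nred: "finite nred"
  by (auto simp: big_def nred_def)

lemma ridx: "bij_betw ridx {0..<N} red"
  unfolding ridx_def N_def using someI_ex [OF ex_bij_betw_nat_finite [OF finite_red]] .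

lemma nidx: "bij_betw nidx {0..<card nred} nred"
  unfolding nidx_def using someI_ex [OF ex_bij_betw_nat_finite [OF finite_nred]] .

lemma ridx_in: "r < N \<Longrightarrow> ridx r \<in> red" and nidx_in: "r < card nred \<Longrightarrow> nidx r \<in> nred"
  using ridx nidx by (auto simp: bij_betw_def)

lemma sum_red: "(\<Sum>a\<in>red. f a) = (\<Sum>r<N. f (ridx r))"
  using sum.reindex_bij_betw [OF ridx, of f] by (simp add: atLeast0LessThan)

lemma sum_nred: "(\<Sum>a\<in>nred. f a) = (\<Sum>r<card nred. f (nidx r))"
  using sum.reindex_bij_betw [OF nidx, of f] by (simp add: atLeast0LessThan)

lemma zero_in_red: "(\<lambda>_. 0) \<in> red"
  using D_pos by (fastforce simp: red_def)

lemma red_degree: "a \<in> red \<Longrightarrow> sum a {..<n} \<le> (\<Sum>i<n. D i - 1)"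
  by (rule sum_mono) (auto simp: red_def)

lemma red3_in_big:
  assumes "a \<in> red" "b \<in> red" "c \<in> red"
  shows "(\<lambda>j. (a j + b j) + c j) \<in> big"
  using assms red_degree [OF assms(1)] red_degree [OF assms(2)] red_degree [OF assms(3)]
  by (auto simp: big_def expos_def red_def sum.distrib)

lemma red_unit_in_big:
  assumes "a \<in> red" "i < n"
  shows "(\<lambda>j. (if j = i then 1 else 0) + a j) \<in> big"
  using assms red_degree [OF assms(1)]
  by (auto simp: big_def expos_def red_def sum.distrib)

lemma red_subset_big: "red \<subseteq> big"
proof
  fix a assume "a \<in> red"
  then show "a \<in> big" using red3_in_big [OF \<open>a \<in> red\<close> zero_in_red zero_in_red] by simp
qed

lemma sel_nred:
  assumes "m \<in> nred"
  shows "sel m < n" "D (sel m) \<le> m (sel m)"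
proof -
  have "\<exists>i<n. D i \<le> m i"
    using assms by (auto simp: nred_def big_def red_def expos_def not_less [symmetric])
  from sel [OF this] show "sel m < n" "D (sel m) \<le> m (sel m)" by auto
qed

lemma sum_lower_sel:
  assumes "m \<in> nred"
  shows "(\<Sum>j<n. if j = sel m then m j - D j else m j) + D (sel m) = sum m {..<n}"
proof -
  note s = sel_nred [OF assms]
  have "(\<Sum>j<n. (if j = sel m then m j - D j else m j) + (if j = sel m then D j else 0)) = sum m {..<n}"
    using s by (intro sum.cong) auto
  then show ?thesis using s by (simp add: sum.distrib)
qed

text \<open>A step of reduction trades \<open>x_i ^ D i\<close> for a monomial of degree at most
  \<open>D i\<close>, so a set of monomials given by a degree bound is closed under it.\<close>

lemma shift_in_big:
  assumes "m \<in> nred" "e \<in> expos {..<n} (D (sel m))"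
  shows "shift m e \<in> big"
proof -
  note s = sel_nred [OF assms(1)]
  have "sum (shift m e) {..<n} \<le> sum m {..<n}"
    using sum_lower_sel [OF assms(1)] assms(2) by (simp add: shift_def sum.distrib expos_def)
  then show ?thesis
    using assms s by (auto simp: nred_def big_def expos_def shift_def)
qed

lemma mon_shift: "mon n (shift m e) x = mon n (\<lambda>j. if j = sel m then m j - D j else m j) x * mon n e x"
  unfolding shift_def mon_add ..

lemma rel_mon:
  assumes "x \<in> zeros C"
  shows "rel C (\<lambda>e. mon n e x)"
proof -
  have "(\<Sum>e\<in>expos {..<n} (D (sel m)). C (sel m) e * mon n (shift m e) x) =
      mon n (\<lambda>j. if j = sel m then m j - D j else m j) x * ev C (sel m) x" for m
    by (simp add: mon_shift ev_def sum_distrib_left mult_ac)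
  then show ?thesis using assms sel_nred(1) by (auto simp: rel_def zeros_def)
qed

lemma sum_mac_entry:
  assumes "m \<in> nred"
  shows "(\<Sum>e\<in>expos {..<n} (D (sel m)). C (sel m) e * X (shift m e)) =
    (\<Sum>m'\<in>big. mac_entry C m m' * X m')"
proof -
  have "(\<Sum>m'\<in>big. mac_entry C m m' * X m') =
     (\<Sum>m'\<in>big. \<Sum>e | e \<in> expos {..<n} (D (sel m)) \<and> shift m e = m'. C (sel m) e * X (shift m e))"
    by (auto simp: mac_entry_def sum_distrib_right intro!: sum.cong)
  also have "\<dots> = (\<Sum>e\<in>expos {..<n} (D (sel m)). C (sel m) e * X (shift m e))"
    by (rule sum.group) (use shift_in_big [OF assms] finite_big in auto)
  finally show ?thesis ..
qed

lemma sum_big: "(\<Sum>m\<in>big. f m) = (\<Sum>r<card nred. f (nidx r)) + (\<Sum>b\<in>red. f b)"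
  for f :: "_ \<Rightarrow> complex"
proof -
  have "sum f big = sum f nred + sum f red"
    unfolding nred_def by (rule sum.subset_diff [OF red_subset_big finite_big])
  then show ?thesis by (simp only: sum_nred)
qed

lemma mac_carrier: "mac C \<in> carrier_mat (card nred) (card nred)"
  by (simp add: mac_def)

text \<open>Splitting the Macaulay relations into reduced and other monomials gives a square system
  with matrix \<open>mac C\<close> for the values of \<open>X\<close> at the latter; multiplying by
  the adjugate solves it up to the factor \<open>dl C\<close>. \<open>X\<close> may be any solution
  of \<open>rel\<close>, so that the lemma also applies to derivatives of monomials.\<close>

lemma K_reduction:
  assumes X: "rel C X" and m: "m \<in> big"
  shows "dl C * X m = (\<Sum>b\<in>red. K C m b * X b)"
proof (cases "m \<in> red")
  case True
  then show ?thesis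
    by (simp add: K_def finite_red if_distrib [of "\<lambda>x. x * _"] sum.delta' cong: if_cong)
next
  case False
  define M where "M = card nred"
  define A where "A = adj_mat (mac C)"
  have A: "A \<in> carrier_mat M M" "A * mac C = dl C \<cdot>\<^sub>m 1\<^sub>m M"
    using adj_mat [OF mac_carrier] by (auto simp: A_def M_def dl_def)
  have "m \<in> nidx ` {0..<M}"
    using False m nidx unfolding M_def by (metis DiffI bij_betw_def nred_def)
  then obtain p where p: "p < M" "m = nidx p" by auto
  have pinv: "inv_into {0..<card nred} nidx m = p"
    using nidx p by (simp add: bij_betw_inv_into_left M_def)
  have row: "(\<Sum>r<M. mac_entry C (nidx s) (nidx r) * X (nidx r)) =
      - (\<Sum>b\<in>red. mac_entry C (nidx s) b * X b)" if "s < M" for s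
  proof -
    have "nidx s \<in> nred" using that nidx_in by (simp add: M_def)
    then show ?thesis
      using X sum_mac_entry [of "nidx s" C X] unfolding sum_big rel_def M_def
      by (simp add: eq_neg_iff_add_eq_0)
  qed
  have prod: "(dl C \<cdot>\<^sub>m 1\<^sub>m M) $$ (p, r) = (\<Sum>s<M. A $$ (p, s) * mac_entry C (nidx s) (nidx r))"
    if "r < M" for r
  proof -
    have "(A * mac C) $$ (p, r) = (\<Sum>s<M. A $$ (p, s) * mac_entry C (nidx s) (nidx r))"
      using A(1) p that by (auto simp: scalar_prod_def mac_def M_def atLeast0LessThan intro!: sum.cong)
    then show ?thesis unfolding A(2) .
  qed
  have "dl C * X m = (\<Sum>r<M. (dl C \<cdot>\<^sub>m 1\<^sub>m M) $$ (p, r) * X (nidx r))"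
    using p by (simp add: if_distrib [of "\<lambda>x. _ * x"] if_distrib [of "\<lambda>x. x * _"] sum.delta' cong: if_cong)
  also have "\<dots> = (\<Sum>r<M. (\<Sum>s<M. A $$ (p, s) * mac_entry C (nidx s) (nidx r)) * X (nidx r))"
    by (intro sum.cong refl) (simp only: prod lessThan_iff)
  also have "\<dots> = (\<Sum>s<M. A $$ (p, s) * (\<Sum>r<M. mac_entry C (nidx s) (nidx r) * X (nidx r)))"
    unfolding sum_distrib_left sum_distrib_right by (subst sum.swap) (simp add: mult_ac)
  also have "\<dots> = (\<Sum>s<M. A $$ (p, s) * - (\<Sum>b\<in>red. mac_entry C (nidx s) b * X b))"
    by (intro sum.cong) (auto simp: row)
  also have "\<dots> = (\<Sum>b\<in>red. - (\<Sum>s<M. A $$ (p, s) * mac_entry C (nidx s) b) * X b)"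
    unfolding sum_distrib_left sum_distrib_right sum_negf mult_minus_right mult_minus_left
    by (subst sum.swap) (simp add: mult_ac)
  also have "\<dots> = (\<Sum>b\<in>red. K C m b * X b)"
    using False by (simp add: K_def pinv A_def M_def)
  finally show ?thesis .
qed

text \<open>Instantiating the algebra turns \<open>dl\<close> and \<open>hdet\<close> into
  polynomials along a line, continuous functions of the system and measurable functions of
  \<open>R\<close>.\<close>

lemma fun_algebra_system:
  assumes \<A>: "fun_algebra \<A>" and C: "\<And>i e. i < n \<Longrightarrow> (\<lambda>x. C x i e) \<in> \<A>"
  shows fun_algebra_dl: "(\<lambda>x. dl (C x)) \<in> \<A>"
    and fun_algebra_K: "m \<in> big \<Longrightarrow> (\<lambda>x. K (C x) m b) \<in> \<A>"
    and fun_algebra_hdet: "(\<lambda>x. hdet (C x)) \<in> \<A>"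
proof -
  have E: "(\<lambda>x. mac_entry (C x) m m') \<in> \<A>" if "m \<in> nred" for m m'
    unfolding mac_entry_def by (intro fun_algebra_sum [OF \<A>] C sel_nred(1) that)
  show dl: "(\<lambda>x. dl (C x)) \<in> \<A>"
    unfolding dl_def mac_def by (intro fun_algebra_det [OF \<A>] E nidx_in)
  show K: "(\<lambda>x. K (C x) m b) \<in> \<A>" if "m \<in> big" for m b
  proof (cases "m \<in> red")
    case True
    then show ?thesis using dl fun_algebra_const [OF \<A>] by (cases "b = m") (simp_all add: K_def)
  next
    case False
    then have "m \<in> nidx ` {0..<card nred}"
      using that nidx by (metis DiffI bij_betw_def nred_def)
    then have "inv_into {0..<card nred} nidx m < card nred"
      using inv_into_into [of m nidx "{0..<card nred}"] by simp
    then have "(\<lambda>x. adj_mat (mac (C x)) $$ (inv_into {0..<card nred} nidx m, s)) \<in> \<A>"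
      if "s < card nred" for s
      unfolding mac_def using that E nidx_in by (intro fun_algebra_adj_mat [OF \<A>]) auto
    then have "(\<lambda>x. adj_mat (mac (C x)) $$ (inv_into {0..<card nred} nidx m, s) *
        mac_entry (C x) (nidx s) b) \<in> \<A>" if "s < card nred" for s
      using that E nidx_in by (intro fun_algebra_mult [OF \<A>]) auto
    then have "(\<lambda>x. - (\<Sum>s<card nred. adj_mat (mac (C x)) $$ (inv_into {0..<card nred} nidx m, s) *
        mac_entry (C x) (nidx s) b)) \<in> \<A>"
      by (intro fun_algebra_uminus [OF \<A>] fun_algebra_sum [OF \<A>]) simp
    then show ?thesis using False by (simp add: K_def)
  qed
  show "(\<lambda>x. hdet (C x)) \<in> \<A>"
    unfolding hdet_def
    by (intro fun_algebra_det [OF \<A>] fun_algebra_sum [OF \<A>] K red3_in_big ridx_in) auto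
qed

lemma points_eqI:
  assumes "x \<in> points" "y \<in> points" "\<And>i. i < n \<Longrightarrow> x i = y i"
  shows "x = y"
proof
  fix i show "x i = y i" using assms by (cases "i < n") (auto simp: points_def)
qed

lemma points_neq: "x \<in> points \<Longrightarrow> y \<in> points \<Longrightarrow> x \<noteq> y \<Longrightarrow> \<exists>i<n. x i \<noteq> y i"
  using points_eqI by blast

text \<open>The weights on \<open>F\<close> that annihilate all reduced monomials are stable under
  multiplication by \<open>x_i - \<alpha>\<close>, since at every zero \<open>x_i\<close> times a
  reduced monomial is a combination of reduced ones. Such factors remove the points other than
  \<open>y\<close> one by one; testing the result against the monomial 1 leaves a nonzero multiple
  of \<open>c y\<close>.\<close>

lemma monomials_independent:
  assumes dl: "dl C \<noteq> 0" and F: "finite F" "F \<subseteq> zeros C"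
    and c: "\<And>a. a \<in> red \<Longrightarrow> (\<Sum>x\<in>F. c x * mon n a x) = 0" and y: "y \<in> F"
  shows "c y = 0"
proof (rule ccontr)
  assume "c y \<noteq> 0"
  define S where "S = {c. \<forall>a\<in>red. (\<Sum>x\<in>F. c x * mon n a x) = 0}"
  have step: "(\<lambda>x. c x * (x i - \<alpha>)) \<in> S" if "c \<in> S" "i < n" for c i \<alpha>
    unfolding S_def
  proof (intro CollectI ballI)
    fix a assume a: "a \<in> red"
    have *: "dl C * (x i * mon n a x) = (\<Sum>b\<in>red. K C (\<lambda>j. (if j = i then 1 else 0) + a j) b * mon n b x)"
      if "x \<in> F" for x
      using K_reduction [OF rel_mon red_unit_in_big [OF a \<open>i < n\<close>], of x C] F that \<open>i < n\<close>
      by (auto simp: mon_add mon_unit)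
    have "dl C * (\<Sum>x\<in>F. c x * (x i * mon n a x)) =
        (\<Sum>x\<in>F. c x * (dl C * (x i * mon n a x)))"
      by (simp add: sum_distrib_left mult_ac)
    also have "\<dots> = (\<Sum>x\<in>F. c x * (\<Sum>b\<in>red. K C (\<lambda>j. (if j = i then 1 else 0) + a j) b * mon n b x))"
      by (intro sum.cong refl) (simp only: *)
    also have "\<dots> = (\<Sum>b\<in>red. K C (\<lambda>j. (if j = i then 1 else 0) + a j) b * (\<Sum>x\<in>F. c x * mon n b x))"
      unfolding sum_distrib_left by (subst sum.swap) (simp add: mult_ac)
    also have "\<dots> = 0" using that(1) by (simp add: S_def)
    finally have "(\<Sum>x\<in>F. c x * (x i * mon n a x)) = 0" using dl by simp
    moreover have "(\<Sum>x\<in>F. c x * mon n a x) = 0" using that(1) a by (simp add: S_def)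
    moreover have "(\<Sum>x\<in>F. c x * (x i - \<alpha>) * mon n a x) =
        (\<Sum>x\<in>F. c x * (x i * mon n a x)) - \<alpha> * (\<Sum>x\<in>F. c x * mon n a x)"
      by (simp add: sum_distrib_left sum_subtractf [symmetric] algebra_simps)
    ultimately show "(\<Sum>x\<in>F. c x * (x i - \<alpha>) * mon n a x) = 0" by simp
  qed
  \<comment> \<open>Each point \<open>z\<close> of \<open>G\<close> costs one factor
    \<open>x_i - z_i\<close>, for a coordinate \<open>i\<close> in which \<open>y\<close> and
    \<open>z\<close> differ: it is zero at \<open>z\<close> and nonzero at \<open>y\<close>.\<close>
  have "\<exists>c'\<in>S. c' y \<noteq> 0 \<and> (\<forall>x\<in>G. c' x = 0)" if "G \<subseteq> F - {y}" "finite G" for G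
    using that(2,1)
  proof (induction G rule: finite_induct)
    case empty
    then show ?case using c \<open>c y \<noteq> 0\<close> by (auto simp: S_def)
  next
    case (insert z G)
    then obtain c' where c': "c' \<in> S" "c' y \<noteq> 0" "\<forall>x\<in>G. c' x = 0" by auto
    obtain i where "i < n" "y i \<noteq> z i"
      using points_neq [of y z] F y insert.prems by (auto simp: zeros_def)
    then show ?case
      using c' step [of c' i "z i"] by (intro bexI [of _ "\<lambda>x. c' x * (x i - z i)"]) auto
  qed
  then obtain c' where c': "c' \<in> S" "c' y \<noteq> 0" "\<forall>x\<in>F - {y}. c' x = 0"
    using F(1) by (metis finite_Diff order_refl)
  have "0 = (\<Sum>x\<in>F. c' x * mon n (\<lambda>_. 0) x)" using c'(1) zero_in_red by (auto simp: S_def)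
  also have "\<dots> = c' y" using c'(3) F(1) y by (simp add: sum.remove)
  finally show False using c'(2) by simp
qed

text \<open>More than \<open>N\<close> points would carry a nonzero weight annihilating the
  \<open>N\<close> reduced monomials, against their independence. Bounding the finite subsets yields
  finiteness as well.\<close>

lemma zeros_bound:
  assumes "dl C \<noteq> 0"
  shows "finite (zeros C)" "card (zeros C) \<le> N"
proof -
  have "card F \<le> N" if F: "finite F" "F \<subseteq> zeros C" for F
  proof (rule ccontr)
    assume "\<not> ?thesis"
    then have "card red < card F" by (simp add: N_def)
    then obtain c where "\<exists>x\<in>F. c x \<noteq> 0" "\<And>a. a \<in> red \<Longrightarrow> (\<Sum>x\<in>F. c x * mon n a x) = 0"
      using underdetermined_system [OF finite_red F(1), where f = "mon n"] by blast
    then show False using monomials_independent [OF assms F] by blast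
  qed
  then show "finite (zeros C)" "card (zeros C) \<le> N"
    using finite_if_finite_subsets_card_bdd [of "zeros C" N] by blast+
qed

section \<open>The generalized Vandermonde matrix and Hermite's trace form\<close>

definition vand :: "(nat \<Rightarrow> nat \<Rightarrow> complex) \<Rightarrow> complex mat" where
  "vand xs = mat N N (\<lambda>(r, j). mon n (ridx r) (xs j))"

lemma vand_carrier: "vand xs \<in> carrier_mat N N"
  by (simp add: vand_def)

lemma det_vand_nonzero:
  assumes "dl C \<noteq> 0" and xs: "bij_betw xs {0..<N} (zeros C)"
  shows "Determinant.det (vand xs) \<noteq> 0"
proof
  assume "Determinant.det (vand xs) = 0"
  then obtain v where v: "v \<in> carrier_vec N" "v \<noteq> 0\<^sub>v N" "vand xs *\<^sub>v v = 0\<^sub>v N"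
    using det_0_iff_vec_prod_zero [OF vand_carrier] by blast
  define c where "c x = v $ inv_into {0..<N} xs x" for x
  have c: "c (xs s) = v $ s" if "s < N" for s
    using that xs by (simp add: c_def bij_betw_inv_into_left)
  have "(\<Sum>x\<in>zeros C. c x * mon n a x) = 0" if "a \<in> red" for a
  proof -
    have "a \<in> ridx ` {0..<N}" using that ridx by (simp add: bij_betw_def)
    then obtain r where r: "r < N" "a = ridx r" by auto
    have "(\<Sum>x\<in>zeros C. c x * mon n a x) = (\<Sum>s = 0..<N. v $ s * mon n a (xs s))"
      using sum.reindex_bij_betw [OF xs, of "\<lambda>x. c x * mon n a x"] by (simp add: c cong: sum.cong_simp)
    also have "\<dots> = (vand xs *\<^sub>v v) $ r"
      using r v(1) by (auto simp: vand_def scalar_prod_def mult.commute intro!: sum.cong)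
    finally show ?thesis using v r by simp
  qed
  moreover have "finite (zeros C)" by (rule zeros_bound [OF assms(1)])
  ultimately have "c x = 0" if "x \<in> zeros C" for x
    using monomials_independent [OF assms(1) _ order_refl] that by blast
  moreover have "xs s \<in> zeros C" if "s < N" for s using xs that by (auto simp: bij_betw_def)
  ultimately have "v $ s = 0" if "s < N" for s using c that by metis
  then show False using v by (metis carrier_vecD eq_vecI index_zero_vec)
qed

text \<open>Stated by sums over entries, the form in which the trace computation and the expansion
  of derivatives insert the identity matrix.\<close>

lemma vand_inverse:
  assumes "dl C \<noteq> 0" and xs: "bij_betw xs {0..<N} (zeros C)"
  shows "\<exists>W. (\<forall>j<N. \<forall>l<N. (\<Sum>r<N. W j r * mon n (ridx r) (xs l)) = (if j = l then 1 else 0)) \<and>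
    (\<forall>r<N. \<forall>s<N. (\<Sum>j<N. mon n (ridx r) (xs j) * W j s) = (if r = s then 1 else 0))"
proof -
  define V where "V = vand xs"
  note V = vand_carrier [of xs, folded V_def]
  define W where "W = inverse (Determinant.det V) \<cdot>\<^sub>m adj_mat V"
  have W: "W \<in> carrier_mat N N" using adj_mat(1) [OF V] by (simp add: W_def)
  have "Determinant.det V \<noteq> 0" using det_vand_nonzero [OF assms] by (simp add: V_def)
  then have WV: "W * V = 1\<^sub>m N" "V * W = 1\<^sub>m N"
    using adj_mat [OF V] V
    by (auto simp: W_def mult_smult_distrib [OF V] mult_smult_assoc_mat [OF adj_mat(1) [OF V] V] intro!: eq_matI)
  show ?thesis
  proof (intro exI [of _ "\<lambda>j r. W $$ (j, r)"] conjI allI impI)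
    fix j l assume "j < N" "l < N"
    then have "(\<Sum>r<N. W $$ (j, r) * mon n (ridx r) (xs l)) = (W * V) $$ (j, l)"
      using W by (auto simp: V_def vand_def scalar_prod_def atLeast0LessThan intro!: sum.cong)
    then show "(\<Sum>r<N. W $$ (j, r) * mon n (ridx r) (xs l)) = (if j = l then 1 else 0)"
      using \<open>j < N\<close> \<open>l < N\<close> by (simp add: WV)
  next
    fix r s assume "r < N" "s < N"
    then have "(\<Sum>j<N. mon n (ridx r) (xs j) * W $$ (j, s)) = (V * W) $$ (r, s)"
      using W by (auto simp: V_def vand_def scalar_prod_def atLeast0LessThan intro!: sum.cong)
    then show "(\<Sum>j<N. mon n (ridx r) (xs j) * W $$ (j, s)) = (if r = s then 1 else 0)"
      using \<open>r < N\<close> \<open>s < N\<close> by (simp add: WV)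
  qed
qed

text \<open>Up to the factor \<open>dl C\<close>, the trace form is the Gram matrix of the reduced
  monomials for the bilinear form that sums products over the zeros, hence \<open>vand xs\<close>
  times its transpose. The power of \<open>dl C\<close> comes from the \<open>N\<close>
  rows.\<close>

lemma hdet_eq:
  assumes "dl C \<noteq> 0" and xs: "bij_betw xs {0..<N} (zeros C)"
  shows "hdet C = dl C ^ N * Determinant.det (vand xs) ^ 2"
proof -
  obtain W where W0:
    "(\<forall>j<N. \<forall>l<N. (\<Sum>r<N. W j r * mon n (ridx r) (xs l)) = (if j = l then 1 else 0)) \<and>
     (\<forall>r<N. \<forall>s<N. (\<Sum>j<N. mon n (ridx r) (xs j) * W j s) = (if r = s then 1 else 0))"
    using vand_inverse [OF assms] ..
  have W: "\<And>j l. j < N \<Longrightarrow> l < N \<Longrightarrow> (\<Sum>r<N. W j r * mon n (ridx r) (xs l)) = (if j = l then 1 else 0)"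
    "\<And>r s. r < N \<Longrightarrow> s < N \<Longrightarrow> (\<Sum>j<N. mon n (ridx r) (xs j) * W j s) = (if r = s then 1 else 0)"
    using W0 by simp_all
  have xs_in: "xs j \<in> zeros C" if "j < N" for j using xs that by (auto simp: bij_betw_def)
  \<comment> \<open>Trace of multiplication by the monomial \<open>c\<close> on the span of the
    reduced monomials, whose eigenvalues are the values of \<open>c\<close> at the zeros. The
    diagonal entries are computed by inserting the Vandermonde matrix times its inverse
    \<open>W\<close>; the product in the other order collapses the sum over
    \<open>t\<close>.\<close>
  have tr: "(\<Sum>t<N. K C (\<lambda>j. c j + ridx t j) (ridx t)) = (\<Sum>j<N. dl C * mon n c (xs j))"
    if c: "\<And>t. t < N \<Longrightarrow> (\<lambda>j. c j + ridx t j) \<in> big" for c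
  proof -
    define k where "k t b = K C (\<lambda>j. c j + ridx t j) (ridx b)" for t b
    have 1: "(\<Sum>b<N. k t b * mon n (ridx b) (xs j)) = dl C * mon n c (xs j) * mon n (ridx t) (xs j)"
      if "t < N" "j < N" for t j
      using K_reduction [OF rel_mon [OF xs_in [OF that(2)]] c [OF that(1)]]
      by (simp add: k_def sum_red mon_add mult.assoc)
    have "k t t = (\<Sum>j<N. dl C * mon n c (xs j) * (mon n (ridx t) (xs j) * W j t))" if "t < N" for t
    proof -
      have "k t t = (\<Sum>b<N. k t b * (\<Sum>j<N. mon n (ridx b) (xs j) * W j t))"
        using that by (simp add: W(2) if_distrib [of "\<lambda>x. _ * x"] sum.delta' cong: if_cong sum.cong_simp)
      also have "\<dots> = (\<Sum>j<N. (\<Sum>b<N. k t b * mon n (ridx b) (xs j)) * W j t)"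
        unfolding sum_distrib_left sum_distrib_right by (subst sum.swap) (simp add: mult_ac)
      also have "\<dots> = (\<Sum>j<N. dl C * mon n c (xs j) * (mon n (ridx t) (xs j) * W j t))"
        using that by (intro sum.cong refl) (simp add: 1 mult_ac)
      finally show ?thesis .
    qed
    then have "(\<Sum>t<N. k t t) = (\<Sum>t<N. \<Sum>j<N. dl C * mon n c (xs j) * (mon n (ridx t) (xs j) * W j t))"
      by simp
    also have "\<dots> = (\<Sum>j<N. dl C * mon n c (xs j) * (\<Sum>t<N. W j t * mon n (ridx t) (xs j)))"
      unfolding sum_distrib_left by (subst sum.swap) (simp add: mult_ac)
    also have "\<dots> = (\<Sum>j<N. dl C * mon n c (xs j))" by (simp add: W(1))
    finally show ?thesis by (simp add: k_def)
  qed
  have "mat N N (\<lambda>(r, s). \<Sum>t<N. K C (\<lambda>j. (ridx r j + ridx s j) + ridx t j) (ridx t)) =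
      dl C \<cdot>\<^sub>m (vand xs * transpose_mat (vand xs))"
  proof (rule eq_matI, goal_cases)
    case (1 r s)
    then have rs: "r < N" "s < N" by (auto simp: vand_def)
    have "(\<Sum>t<N. K C (\<lambda>j. (ridx r j + ridx s j) + ridx t j) (ridx t)) =
        (\<Sum>j<N. dl C * mon n (\<lambda>j. ridx r j + ridx s j) (xs j))"
      by (rule tr) (auto intro!: red3_in_big ridx_in rs)
    also have "\<dots> = dl C * (\<Sum>j<N. vand xs $$ (r, j) * vand xs $$ (s, j))"
      using rs by (simp add: vand_def mon_add sum_distrib_left cong: sum.cong_simp)
    also have "(\<Sum>j<N. vand xs $$ (r, j) * vand xs $$ (s, j)) =
        (vand xs * transpose_mat (vand xs)) $$ (r, s)"
      using rs vand_carrier [of xs] by (auto simp: scalar_prod_def atLeast0LessThan intro!: sum.cong)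
    finally show ?case using rs by (simp add: vand_def)
  qed (auto simp: vand_def)
  then show ?thesis
    using vand_carrier [of xs]
    by (simp add: hdet_def det_mult [OF vand_carrier] det_transpose [OF vand_carrier] power2_eq_square)
qed

lemma zeros_enum:
  assumes "good C"
  obtains xs where "bij_betw xs {0..<N} (zeros C)"
  using ex_bij_betw_nat_finite zeros_bound(1) assms unfolding good_def by metis

lemma hdet_nonzero: "good C \<Longrightarrow> hdet C \<noteq> 0"
  using zeros_enum [of C] hdet_eq [of C] det_vand_nonzero [of C]
  by (metis good_def mult_eq_0_iff power_eq_0_iff)

end

section \<open>Divided differences\<close>

text \<open>Coefficients of a telescoping sum in which the coordinates pass from \<open>y\<close> to
  \<open>x\<close> one at a time: at index \<open>j\<close> the coordinates below are already those
  of \<open>x\<close>, those above still those of \<open>y\<close>. For \<open>x = y\<close> this is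
  the partial derivative of the monomial.\<close>

primrec qmon :: "nat \<Rightarrow> (nat \<Rightarrow> nat) \<Rightarrow> nat \<Rightarrow> (nat \<Rightarrow> complex) \<Rightarrow> (nat \<Rightarrow> complex) \<Rightarrow> complex" where
  "qmon 0 e j x y = 0"
| "qmon (Suc n) e j x y = (if j = n then mon n e x * (\<Sum>r<e n. y n ^ (e n - Suc r) * x n ^ r)
     else qmon n e j x y * y n ^ e n)"

lemma mon_Suc: "mon (Suc n) e x = mon n e x * x n ^ e n"
  by (simp add: mon_def)

lemma mon_diff: "mon n e x - mon n e y = (\<Sum>j<n. qmon n e j x y * (x j - y j))"
proof (induction n)
  case (Suc n)
  have "mon (Suc n) e x - mon (Suc n) e y =
      mon n e x * (x n ^ e n - y n ^ e n) + (mon n e x - mon n e y) * y n ^ e n"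
    by (simp add: mon_Suc algebra_simps)
  also have "\<dots> = mon n e x * (\<Sum>r<e n. y n ^ (e n - Suc r) * x n ^ r) * (x n - y n) +
      (\<Sum>j<n. qmon n e j x y * y n ^ e n * (x j - y j))"
    unfolding Suc.IH
    by (simp add: power_diff_sumr2 sum_distrib_left sum_distrib_right mult_ac)
  also have "\<dots> = (\<Sum>j<Suc n. qmon (Suc n) e j x y * (x j - y j))"
    by simp
  finally show ?case .
qed (simp add: mon_def)

lemma tendsto_mon:
  "(\<And>j. j < n \<Longrightarrow> ((\<lambda>s. f s j) \<longlongrightarrow> a j) F) \<Longrightarrow> ((\<lambda>s. mon n e (f s)) \<longlongrightarrow> mon n e a) F"
  unfolding mon_def by (intro tendsto_intros) auto

lemma tendsto_qmon:
  assumes "\<And>j. j < n \<Longrightarrow> ((\<lambda>s. f s j) \<longlongrightarrow> a j) F" "\<And>j. j < n \<Longrightarrow> ((\<lambda>s. g s j) \<longlongrightarrow> b j) F"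
  shows "((\<lambda>s. qmon n e j (f s) (g s)) \<longlongrightarrow> qmon n e j a b) F"
  using assms
proof (induction n)
  case (Suc n)
  then show ?case
    by (cases "j = n") (auto intro!: tendsto_intros tendsto_mon)
qed simp

lemma has_field_derivative_mon:
  "((\<lambda>z. mon n e (\<lambda>j. x j + z * v j)) has_field_derivative (\<Sum>j<n. qmon n e j x x * v j)) (at 0)"
proof -
  have "((\<lambda>h. \<Sum>j<n. qmon n e j (\<lambda>j. x j + h * v j) x * v j) \<longlongrightarrow> (\<Sum>j<n. qmon n e j x x * v j)) (at 0)"
    by (intro tendsto_sum tendsto_mult tendsto_qmon tendsto_const) (auto intro!: tendsto_eq_intros)
  \<comment> \<open>Away from \<open>h = 0\<close> the telescoping identity makes this the
    difference quotient itself, so no remainder has to be estimated.\<close>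
  moreover have "eventually (\<lambda>h. (\<Sum>j<n. qmon n e j (\<lambda>j. x j + h * v j) x * v j) =
      (mon n e (\<lambda>j. x j + (0 + h) * v j) - mon n e (\<lambda>j. x j + 0 * v j)) / h) (at 0)"
    unfolding eventually_at_filter
    by (rule always_eventually) (auto simp: mon_diff sum_divide_distrib)
  ultimately show ?thesis
    unfolding DERIV_def by (rule Lim_transform_eventually)
qed

context square_system
begin

text \<open>A two-point Jacobian: it turns increments into exact linear expressions
  (\<open>ev_diff\<close>), and on the diagonal it is the usual Jacobian matrix.\<close>

definition jac :: "(nat \<Rightarrow> (nat \<Rightarrow> nat) \<Rightarrow> complex) \<Rightarrow> nat \<Rightarrow> nat \<Rightarrow> (nat \<Rightarrow> complex) \<Rightarrow> (nat \<Rightarrow> complex) \<Rightarrow> complex" where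
  "jac C i j x y = (\<Sum>e\<in>expos {..<n} (D i). C i e * qmon n e j x y)"

lemma ev_diff: "ev C i x - ev C i y = (\<Sum>j<n. jac C i j x y * (x j - y j))"
proof -
  have "ev C i x - ev C i y = (\<Sum>e\<in>expos {..<n} (D i). C i e * (mon n e x - mon n e y))"
    by (simp add: ev_def sum_subtractf right_diff_distrib)
  also have "\<dots> = (\<Sum>j<n. jac C i j x y * (x j - y j))"
    unfolding mon_diff jac_def sum_distrib_left sum_distrib_right
    by (subst sum.swap) (simp add: mult_ac)
  finally show ?thesis .
qed

text \<open>Along a vector in the kernel of the Jacobian, the derivatives of the monomials satisfy the
  Macaulay system as well; expanding them in terms of the monomials at the \<open>N\<close> zeros shows that the
  vector is zero.\<close>

lemma jac_nonsingular:
  assumes "good C" and x: "x \<in> zeros C" and v: "\<And>i. i < n \<Longrightarrow> (\<Sum>j<n. jac C i j x x * v j) = 0"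
    and i: "i < n"
  shows "v i = 0"
proof -
  have dl: "dl C \<noteq> 0" using assms by (simp add: good_def)
  obtain xs where xs: "bij_betw xs {0..<N} (zeros C)" using zeros_enum [OF assms(1)] .
  obtain W where W0:
    "(\<forall>j<N. \<forall>l<N. (\<Sum>r<N. W j r * mon n (ridx r) (xs l)) = (if j = l then 1 else 0)) \<and>
     (\<forall>r<N. \<forall>s<N. (\<Sum>j<N. mon n (ridx r) (xs j) * W j s) = (if r = s then 1 else 0))"
    using vand_inverse [OF dl xs] ..
  have W: "(\<Sum>j<N. mon n (ridx r) (xs j) * W j s) = (if r = s then 1 else 0)" if "r < N" "s < N" for r s
    using W0 that by simp
  define X where "X m = (\<Sum>j<n. qmon n m j x x * v j)" for m
  have DX: "((\<lambda>z. mon n m (\<lambda>j. x j + z * v j)) has_field_derivative X m) (at 0)" for m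
    unfolding X_def by (rule has_field_derivative_mon)
  have X_add: "X (\<lambda>j. a j + b j) = X a * mon n b x + X b * mon n a x" for a b
    using DERIV_unique [OF DX [of "\<lambda>j. a j + b j", unfolded mon_add] DERIV_mult [OF DX DX]] by simp
  have X_unit: "X (\<lambda>j. if j = i then 1 else 0) = v i"
  proof -
    have "((\<lambda>z. x i + z * v i) has_field_derivative v i) (at 0)"
      by (auto intro!: derivative_eq_intros)
    with DX [of "\<lambda>j. if j = i then 1 else 0"] show ?thesis
      using DERIV_unique i by (simp add: mon_unit) blast
  qed
  \<comment> \<open>By the Leibniz rule the relation of \<open>m\<close> is a combination of the
    value of equation \<open>sel m\<close> at \<open>x\<close> and of its derivative along
    \<open>v\<close>; both vanish.\<close>
  have "rel C X"
    unfolding rel_def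
  proof
    fix m assume m: "m \<in> nred"
    define l where "l = (\<lambda>j. if j = sel m then m j - D j else m j)"
    have "(\<Sum>e\<in>expos {..<n} (D (sel m)). C (sel m) e * X (shift m e)) =
        X l * ev C (sel m) x + mon n l x * (\<Sum>e\<in>expos {..<n} (D (sel m)). C (sel m) e * X e)"
      by (simp add: shift_def X_add l_def [symmetric] ev_def sum_distrib_left sum.distrib algebra_simps)
    also have "(\<Sum>e\<in>expos {..<n} (D (sel m)). C (sel m) e * X e) =
        (\<Sum>j<n. jac C (sel m) j x x * v j)"
      unfolding X_def jac_def sum_distrib_left sum_distrib_right by (subst sum.swap) (simp add: mult_ac)
    finally show "(\<Sum>e\<in>expos {..<n} (D (sel m)). C (sel m) e * X (shift m e)) = 0"
      using x v sel_nred(1) [OF m] by (simp add: zeros_def)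
  qed
  \<comment> \<open>Weights at the \<open>N\<close> zeros that reproduce \<open>X\<close> on the
    reduced monomials, by the inverse Vandermonde matrix; the reduction extends this to all of
    \<open>big\<close>.\<close>
  define c where "c y = (\<Sum>s<N. W (inv_into {0..<N} xs y) s * X (ridx s))" for y
  have c: "c (xs j) = (\<Sum>s<N. W j s * X (ridx s))" if "j < N" for j
    using that xs by (simp add: c_def bij_betw_inv_into_left)
  have span: "X a = (\<Sum>y\<in>zeros C. c y * mon n a y)" if "a \<in> red" for a
  proof -
    have "a \<in> ridx ` {0..<N}" using that ridx by (simp add: bij_betw_def)
    then obtain r where r: "r < N" "a = ridx r" by auto
    have "(\<Sum>y\<in>zeros C. c y * mon n a y) = (\<Sum>j<N. (\<Sum>s<N. W j s * X (ridx s)) * mon n a (xs j))"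
      using sum.reindex_bij_betw [OF xs, of "\<lambda>x. c x * mon n a x"]
      by (simp add: c atLeast0LessThan cong: sum.cong_simp)
    also have "\<dots> = (\<Sum>s<N. (\<Sum>j<N. mon n (ridx r) (xs j) * W j s) * X (ridx s))"
      unfolding sum_distrib_left sum_distrib_right r by (subst sum.swap) (simp add: mult_ac)
    also have "\<dots> = X a"
      using r by (simp add: W if_distrib [of "\<lambda>x. x * _"] sum.delta' cong: if_cong sum.cong_simp)
    finally show ?thesis ..
  qed
  have span_big: "X m = (\<Sum>y\<in>zeros C. c y * mon n m y)" if "m \<in> big" for m
  proof -
    have "dl C * X m = (\<Sum>b\<in>red. K C m b * (\<Sum>y\<in>zeros C. c y * mon n b y))"
      using K_reduction [OF \<open>rel C X\<close> that] by (simp add: span cong: sum.cong_simp)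
    also have "\<dots> = (\<Sum>y\<in>zeros C. c y * (\<Sum>b\<in>red. K C m b * mon n b y))"
      unfolding sum_distrib_left by (subst sum.swap) (simp add: mult_ac)
    also have "\<dots> = (\<Sum>y\<in>zeros C. c y * (dl C * mon n m y))"
      by (intro sum.cong refl) (simp add: K_reduction [OF rel_mon that])
    also have "\<dots> = dl C * (\<Sum>y\<in>zeros C. c y * mon n m y)"
      by (simp add: sum_distrib_left mult_ac)
    finally show ?thesis using dl by simp
  qed
  have fin: "finite (zeros C)" by (rule zeros_bound [OF dl])
  \<comment> \<open>Evaluating \<open>X\<close> at \<open>x_i\<close> times \<open>a\<close> by the
    Leibniz rule and by the weights shows that the combined weight annihilates all reduced
    monomials. At the point \<open>x\<close> it equals \<open>- v i\<close>, as its first term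
    vanishes there.\<close>
  have "(\<Sum>y\<in>zeros C. (c y * (y i - x i) - (if y = x then v i else 0)) * mon n a y) = 0"
    if a: "a \<in> red" for a
  proof -
    have "(\<Sum>y\<in>zeros C. c y * (y i * mon n a y)) = v i * mon n a x + X a * x i"
      using span_big [OF red_unit_in_big [OF a i]] X_add [of "\<lambda>j. if j = i then 1 else 0" a]
      by (simp add: X_unit mon_unit i mon_add)
    moreover have "(\<Sum>y\<in>zeros C. (if y = x then v i else 0) * mon n a y) = v i * mon n a x"
      using x fin by (simp add: if_distrib [of "\<lambda>x. x * _"] sum.delta' cong: if_cong)
    moreover have "(\<Sum>y\<in>zeros C. (c y * (y i - x i) - (if y = x then v i else 0)) * mon n a y) =
        (\<Sum>y\<in>zeros C. c y * (y i * mon n a y)) - x i * (\<Sum>y\<in>zeros C. c y * mon n a y) -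
        (\<Sum>y\<in>zeros C. (if y = x then v i else 0) * mon n a y)"
      by (simp add: left_diff_distrib right_diff_distrib sum_subtractf sum_distrib_left mult_ac)
    ultimately show ?thesis using span [OF a] by simp
  qed
  from monomials_independent [OF dl fin order_refl this x] show ?thesis by simp
qed

end

section \<open>Persistence of nonsingular zeros\<close>

text \<open>A product of discs is compact by Tychonoff's theorem and, the index set being countable,
  metrizable, hence sequentially compact.\<close>

lemma bounded_functions_convergent_subseq:
  fixes f :: "nat \<Rightarrow> 'i::countable \<Rightarrow> complex"
  assumes b: "\<And>m i. norm (f m i) \<le> b i"
  obtains r l where "strict_mono (r :: nat \<Rightarrow> nat)" "\<And>i. (\<lambda>m. f (r m) i) \<longlonglongrightarrow> l i"
proof -
  have "compactin (product_topology (\<lambda>_. euclidean) UNIV) (PiE UNIV (\<lambda>i. cball (0::complex) (b i)))"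
    by (subst compactin_PiE) auto
  then have sc: "seq_compact (PiE UNIV (\<lambda>i. cball (0::complex) (b i)))"
    by (simp add: euclidean_product_topology compact_eq_seq_compact_metric)
  have fm: "\<forall>m. f m \<in> PiE UNIV (\<lambda>i. cball (0::complex) (b i))"
    using b by auto
  obtain l r where r: "strict_mono (r :: nat \<Rightarrow> nat)" "(f \<circ> r) \<longlonglongrightarrow> l"
    by (rule seq_compactE [OF sc fm])
  have "(\<lambda>m. f (r m) i) \<longlonglongrightarrow> l i" for i
  proof -
    have "isCont (\<lambda>x :: 'i \<Rightarrow> complex. x i) l"
      by (rule continuous_on_interior [OF continuous_on_product_coordinates]) simp
    from isCont_tendsto_compose [OF this r(2)] show ?thesis by (simp add: o_def)
  qed
  then show ?thesis using r that by blast
qed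

lemma solve_linear_system:
  fixes A :: "complex mat"
  assumes A: "A \<in> carrier_mat m m" and "Determinant.det A \<noteq> 0" and b: "b \<in> carrier_vec m"
  obtains v where "v \<in> carrier_vec m" "A *\<^sub>v v = b"
proof
  have "A *\<^sub>v (adj_mat A *\<^sub>v b) = Determinant.det A \<cdot>\<^sub>v b"
    using A b adj_mat(1) [OF A]
    by (simp add: assoc_mult_mat_vec [symmetric, OF A adj_mat(1) [OF A] b] adj_mat(2) [OF A])
      (auto simp: mult_mat_vec_def scalar_prod_def sum.delta' if_distrib [of "\<lambda>x. _ * x"]
        if_distrib [of "\<lambda>x. x * _"] intro!: eq_vecI cong: if_cong)
  then show "A *\<^sub>v (inverse (Determinant.det A) \<cdot>\<^sub>v (adj_mat A *\<^sub>v b)) = b"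
    using assms adj_mat(1) [OF A]
    by (subst mult_mat_vec [OF A]) (auto simp: smult_smult_assoc)
  show "inverse (Determinant.det A) \<cdot>\<^sub>v (adj_mat A *\<^sub>v b) \<in> carrier_vec m"
    using A b adj_mat(1) [OF A] by auto
qed

text \<open>\<open>None\<close> carries the limit and \<open>Some s\<close> the approximants. In
  this encoding convergence is an algebra of functions, so continuity of determinants, of adjugates
  and of \<open>dl\<close>, \<open>K\<close> and \<open>hdet\<close> follows from the general
  closure lemmas.\<close>

lemma fun_algebra_tendsto:
  "fun_algebra {f :: 'a option \<Rightarrow> complex. ((\<lambda>s. f (Some s)) \<longlongrightarrow> f None) F}"
  by (auto simp: fun_algebra_def intro: tendsto_add tendsto_mult)

lemma tendsto_det:
  assumes "\<And>i j. i < m \<Longrightarrow> j < m \<Longrightarrow> ((\<lambda>s. f s i j) \<longlongrightarrow> a i j) F"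
  shows "((\<lambda>s. Determinant.det (mat m m (\<lambda>(i, j). f s i j))) \<longlongrightarrow>
     (Determinant.det (mat m m (\<lambda>(i, j). a i j)) :: complex)) F"
  using fun_algebra_det [OF fun_algebra_tendsto, of m "\<lambda>s i j. case s of None \<Rightarrow> a i j | Some s \<Rightarrow> f s i j" F]
    assms by simp

section \<open>Convergence of systems and the polydisc distance\<close>

context square_system
begin

definition sys_tendsto where
  "sys_tendsto C C0 F \<longleftrightarrow> (\<forall>i<n. \<forall>e. ((\<lambda>s. C s i e) \<longlongrightarrow> (C0 i e :: complex)) F)"

definition pd :: "(nat \<Rightarrow> complex) \<Rightarrow> (nat \<Rightarrow> complex) \<Rightarrow> real" where
  "pd x y = Max (insert 0 ((\<lambda>j. norm (x j - y j)) ` {..<n}))"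

lemma pd_le_iff: "0 \<le> e \<Longrightarrow> pd x y \<le> e \<longleftrightarrow> (\<forall>j<n. norm (x j - y j) \<le> e)"
  by (auto simp: pd_def)

lemma pd_less_iff: "0 < e \<Longrightarrow> pd x y < e \<longleftrightarrow> (\<forall>j<n. norm (x j - y j) < e)"
  by (auto simp: pd_def)

lemma pd_nonneg: "0 \<le> pd x y"
  by (simp add: pd_def)

lemma norm_le_pd: "j < n \<Longrightarrow> norm (x j - y j) \<le> pd x y"
  using pd_le_iff [of "pd x y" x y] pd_nonneg by auto

lemma pd_commute: "pd x y = pd y x"
  by (simp add: pd_def norm_minus_commute)

lemma pd_triangle: "pd x z \<le> pd x y + pd y z"
proof (subst pd_le_iff, simp_all add: pd_nonneg, intro allI impI)
  fix j assume "j < n"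
  have "norm (x j - z j) \<le> norm (x j - y j) + norm (y j - z j)"
    by (rule norm_triangle_ineq4 [THEN order_trans, of "x j - y j" "z j - y j", simplified, folded norm_minus_commute]) 
      (simp add: norm_minus_commute)
  then show "norm (x j - z j) \<le> pd x y + pd y z"
    using norm_le_pd [OF \<open>j < n\<close>] by (meson add_mono order_trans)
qed

lemma pd_pos: "x \<in> points \<Longrightarrow> y \<in> points \<Longrightarrow> x \<noteq> y \<Longrightarrow> 0 < pd x y"
  using points_neq [of x y] norm_le_pd [of _ x y] by (metis less_le_trans zero_less_norm_iff right_minus_eq)

lemma tendsto_ev:
  assumes "\<And>e. ((\<lambda>s. C s i e) \<longlongrightarrow> C0 i e) F" "\<And>j. j < n \<Longrightarrow> ((\<lambda>s. f s j) \<longlongrightarrow> a j) F"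
  shows "((\<lambda>s. ev (C s) i (f s)) \<longlongrightarrow> ev C0 i a) F"
  unfolding ev_def by (intro tendsto_sum tendsto_mult tendsto_mon assms)

lemma tendsto_jac:
  assumes "\<And>e. ((\<lambda>s. C s i e) \<longlongrightarrow> C0 i e) F" "\<And>j. j < n \<Longrightarrow> ((\<lambda>s. f s j) \<longlongrightarrow> a j) F"
    "\<And>j. j < n \<Longrightarrow> ((\<lambda>s. g s j) \<longlongrightarrow> b j) F"
  shows "((\<lambda>s. jac (C s) i j (f s) (g s)) \<longlongrightarrow> jac C0 i j a b) F"
  unfolding jac_def by (intro tendsto_sum tendsto_mult tendsto_qmon assms)

lemma sys_tendsto_option:
  assumes "sys_tendsto C C0 F" "i < n"
  shows "(\<lambda>s. (case s of None \<Rightarrow> C0 | Some s \<Rightarrow> C s) i e) \<in> {f. ((\<lambda>s. f (Some s)) \<longlongrightarrow> f None) F}"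
  using assms by (simp add: sys_tendsto_def)

lemma tendsto_dl: "sys_tendsto C C0 F \<Longrightarrow> ((\<lambda>s. dl (C s)) \<longlongrightarrow> dl C0) F"
  using fun_algebra_dl [OF fun_algebra_tendsto sys_tendsto_option] by fastforce

lemma tendsto_K: "sys_tendsto C C0 F \<Longrightarrow> m \<in> big \<Longrightarrow> ((\<lambda>s. K (C s) m b) \<longlongrightarrow> K C0 m b) F"
  using fun_algebra_K [OF fun_algebra_tendsto sys_tendsto_option] by fastforce

lemma tendsto_hdet: "sys_tendsto C C0 F \<Longrightarrow> ((\<lambda>s. hdet (C s)) \<longlongrightarrow> hdet C0) F"
  using fun_algebra_hdet [OF fun_algebra_tendsto sys_tendsto_option] by fastforce

lemma sys_tendsto_subseq:
  "sys_tendsto C C0 sequentially \<Longrightarrow> strict_mono r \<Longrightarrow> sys_tendsto (\<lambda>k. C (r k)) C0 sequentially"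
  unfolding sys_tendsto_def using LIMSEQ_subseq_LIMSEQ by (fastforce simp: o_def)

definition jdet where "jdet C x = Determinant.det (mat n n (\<lambda>(i, j). jac C i j x x))"

lemma jdet_nonzero:
  assumes "good C" "x \<in> zeros C"
  shows "jdet C x \<noteq> 0"
proof
  assume "jdet C x = 0"
  then obtain v where v: "v \<in> carrier_vec n" "v \<noteq> 0\<^sub>v n"
      "mat n n (\<lambda>(i, j). jac C i j x x) *\<^sub>v v = 0\<^sub>v n"
    unfolding jdet_def using det_0_iff_vec_prod_zero [of "mat n n (\<lambda>(i, j). jac C i j x x)" n] by auto
  have "(\<Sum>j<n. jac C i j x x * v $ j) = 0" if "i < n" for i
    using arg_cong [OF v(3), of "\<lambda>w. w $ i"] that v(1)
    by (simp add: scalar_prod_def atLeast0LessThan)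
  then have "v $ i = 0" if "i < n" for i
    using jac_nonsingular [OF assms, of "\<lambda>j. v $ j" i] that by blast
  then show False using v by (metis carrier_vecD eq_vecI index_zero_vec)
qed

section \<open>Zeros as minima of the sum of squared norms\<close>

definition phi where "phi C x = (\<Sum>i<n. (norm (ev C i x))\<^sup>2)"

lemma phi_eq_0_iff: "phi C x = 0 \<longleftrightarrow> (\<forall>i<n. ev C i x = 0)"
  by (auto simp: phi_def sum_nonneg_eq_0_iff)

lemma has_field_derivative_ev:
  "((\<lambda>z. ev C i (\<lambda>j. x j + z * v j)) has_field_derivative (\<Sum>j<n. jac C i j x x * v j)) (at 0)"
proof -
  have "(\<Sum>j<n. jac C i j x x * v j) =
      (\<Sum>e\<in>expos {..<n} (D i). C i e * (\<Sum>j<n. qmon n e j x x * v j))"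
    unfolding jac_def sum_distrib_left sum_distrib_right by (subst sum.swap) (simp add: mult_ac)
  then show ?thesis
    unfolding ev_def by (auto intro!: DERIV_sum DERIV_cmult has_field_derivative_mon)
qed

text \<open>A Newton direction would decrease \<open>phi\<close>.\<close>

lemma min_phi_zero:
  assumes x: "x \<in> points" and "jdet C x \<noteq> 0" and "0 < e"
    and min: "\<And>y. y \<in> points \<Longrightarrow> pd y x \<le> e \<Longrightarrow> phi C x \<le> phi C y"
  shows "phi C x = 0"
proof -
  obtain w where w: "w \<in> carrier_vec n"
      "mat n n (\<lambda>(i, j). jac C i j x x) *\<^sub>v w = vec n (\<lambda>i. - ev C i x)"
    using solve_linear_system [of "mat n n (\<lambda>(i, j). jac C i j x x)" n "vec n (\<lambda>i. - ev C i x)"] assms(2)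
    unfolding jdet_def by auto
  define v where "v j = (if j < n then w $ j else 0)" for j
  have v: "(\<Sum>j<n. jac C i j x x * v j) = - ev C i x" if "i < n" for i
    using arg_cong [OF w(2), of "\<lambda>w. w $ i"] that w(1)
    by (simp add: scalar_prod_def atLeast0LessThan v_def cong: sum.cong_simp)
  define f where "f i t = ev C i (\<lambda>j. x j + of_real t * v j)" for i and t :: real
  have f: "(f i has_vector_derivative - ev C i x) (at 0)" if "i < n" for i
    unfolding f_def using has_vector_derivative_real_field [of "\<lambda>z. ev C i (\<lambda>j. x j + z * v j)" _ 0 UNIV]
      has_field_derivative_ev [of C i x v] v [OF that] by simp
  have f0: "f i 0 = ev C i x" for i by (simp add: f_def)
  \<comment> \<open>The squared norm is only real differentiable, so it is split into real and
    imaginary parts.\<close>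
  define g where "g t = (\<Sum>i<n. (Re (f i t))\<^sup>2 + (Im (f i t))\<^sup>2)" for t
  have g: "g t = phi C (\<lambda>j. x j + of_real t * v j)" for t
    by (simp add: g_def f_def phi_def cmod_power2)
  have "(g has_field_derivative (\<Sum>i<n. 2 * Re (f i 0) * - Re (ev C i x) + 2 * Im (f i 0) * - Im (ev C i x))) (at 0)"
    unfolding g_def
  proof (rule DERIV_sum)
    fix i assume "i \<in> {..<n}"
    then have "((\<lambda>t. Re (f i t)) has_field_derivative - Re (ev C i x)) (at 0)"
        "((\<lambda>t. Im (f i t)) has_field_derivative - Im (ev C i x)) (at 0)"
      using has_field_derivative_Re [OF f] has_field_derivative_Im [OF f] by auto
    from DERIV_add [OF DERIV_power [OF this(1), of 2] DERIV_power [OF this(2), of 2]]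
    show "((\<lambda>t. (Re (f i t))\<^sup>2 + (Im (f i t))\<^sup>2) has_field_derivative
        2 * Re (f i 0) * - Re (ev C i x) + 2 * Im (f i 0) * - Im (ev C i x)) (at 0)"
      by (rule DERIV_cong) simp
  qed
  moreover have "(\<Sum>i<n. 2 * Re (f i 0) * - Re (ev C i x) + 2 * Im (f i 0) * - Im (ev C i x)) = - 2 * phi C x"
    unfolding phi_def sum_distrib_left f0 cmod_power2
    by (intro sum.cong refl) (simp add: power2_eq_square algebra_simps)
  ultimately have D: "(g has_field_derivative - 2 * phi C x) (at 0)" by simp
  \<comment> \<open>Bounds all components of the direction; the summand 1 keeps \<open>e / s\<close>
    meaningful when \<open>v\<close> is zero.\<close>
  define s where "s = (\<Sum>j<n. norm (v j)) + 1"
  have s: "0 < s" "norm (v j) \<le> s" if "j < n" for j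
    using that member_le_sum [of j "{..<n}" "\<lambda>j. norm (v j)"]
    by (auto simp: s_def add_pos_pos sum_nonneg add_nonneg_pos)
  have "0 < s" by (auto simp: s_def sum_nonneg add_nonneg_pos)
  have "g 0 \<le> g t" if "\<bar>0 - t\<bar> < e / s" for t
    unfolding g
  proof -
    have "norm (of_real t * v j) \<le> e" if "j < n" for j
    proof -
      have "norm (of_real t * v j) \<le> \<bar>t\<bar> * s"
        using s(2) [OF that] by (simp add: norm_mult mult_left_mono)
      also have "\<dots> \<le> e" using \<open>\<bar>0 - t\<bar> < e / s\<close> \<open>0 < s\<close> by (simp add: field_simps)
      finally show ?thesis .
    qed
    then show "phi C (\<lambda>j. x j + of_real 0 * v j) \<le> phi C (\<lambda>j. x j + of_real t * v j)"
      using x \<open>0 < e\<close> by (auto simp: points_def v_def pd_le_iff intro!: min)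
  qed
  then have "- 2 * phi C x = 0"
    using DERIV_local_min [OF D, of "e / s"] \<open>0 < e\<close> \<open>0 < s\<close> by simp
  then show ?thesis by simp
qed

lemma phi_minimum:
  assumes "x0 \<in> points" "0 \<le> e"
  obtains x where "x \<in> points" "pd x x0 \<le> e"
    "\<And>y. y \<in> points \<Longrightarrow> pd y x0 \<le> e \<Longrightarrow> phi C x \<le> phi C y"
proof -
  \<comment> \<open>The polydisc as a product over all indices, with the factor \<open>{0}\<close>
    from \<open>n\<close> on, so that Tychonoff's theorem gives its compactness.\<close>
  define B where "B = PiE UNIV (\<lambda>j. if j < n then cball (x0 j) e else {0})"
  have B: "y \<in> B \<longleftrightarrow> y \<in> points \<and> pd y x0 \<le> e" for y
  proof -
    have "y \<in> B \<longleftrightarrow> (\<forall>j. y j \<in> (if j < n then cball (x0 j) e else {0}))"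
      by (simp add: B_def PiE_iff)
    also have "\<dots> \<longleftrightarrow> (\<forall>j<n. norm (y j - x0 j) \<le> e) \<and> (\<forall>j\<ge>n. y j = 0)"
      by (metis dist_commute dist_norm leD mem_cball not_le singletonD singletonI)
    finally show ?thesis using assms by (auto simp: points_def pd_le_iff)
  qed
  have "compactin (product_topology (\<lambda>_. euclidean) UNIV) B"
    unfolding B_def by (subst compactin_PiE) auto
  then have "compact B" by (simp add: euclidean_product_topology)
  moreover have "x0 \<in> B" using assms by (simp add: B pd_le_iff)
  moreover have "continuous_on UNIV (mon n a)" for a
    unfolding mon_def by (intro continuous_intros continuous_on_product_coordinates)
  then have "continuous_on UNIV (phi C)"
    unfolding phi_def ev_def by (intro continuous_intros)
  then have "continuous_on B (phi C)" using continuous_on_subset by blast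
  ultimately obtain x where "x \<in> B" "\<forall>y\<in>B. phi C x \<le> phi C y"
    using continuous_attains_inf [of B "phi C"] by blast
  then show ?thesis using that B by blast
qed

lemma zeros_separated:
  assumes "finite Z" "Z \<subseteq> points"
  obtains e where "0 < e" "\<And>x y. x \<in> Z \<Longrightarrow> y \<in> Z \<Longrightarrow> x \<noteq> y \<Longrightarrow> e \<le> pd x y"
proof -
  define S where "S = insert 1 ((\<lambda>(x, y). pd x y) ` {(x, y) \<in> Z \<times> Z. x \<noteq> y})"
  have "finite S"
    unfolding S_def using assms(1) by (auto intro: finite_subset [of _ "Z \<times> Z"])
  then have "0 < Min S"
    using assms(2) pd_pos by (auto simp: S_def)
  moreover have "Min S \<le> pd x y" if "x \<in> Z" "y \<in> Z" "x \<noteq> y" for x y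
    using \<open>finite S\<close> that by (intro Min_le) (auto simp: S_def)
  ultimately show ?thesis using that by blast
qed

lemma zeros_subset_points: "zeros C \<subseteq> points"
  by (auto simp: zeros_def)

text \<open>Minimize \<open>phi (C k)\<close> over a small closed polydisc about \<open>x0\<close>.
  Limit points of the minima are zeros of \<open>C0\<close> in this polydisc, hence equal to
  \<open>x0\<close>. So along a subsequence the minima end up in the interior with nonsingular
  Jacobian, where a minimum is a zero. This plays the part of the implicit function theorem.\<close>

lemma persist:
  assumes cv: "sys_tendsto C C0 sequentially" and "good C0" and x0: "x0 \<in> zeros C0" and "0 < e"
  shows "\<forall>\<^sub>F k in sequentially. \<exists>x\<in>zeros (C k). pd x x0 < e"
proof (rule ccontr)
  assume neg: "\<not> ?thesis"
  obtain s where s: "strict_mono (s :: nat \<Rightarrow> nat)" "\<And>k. \<not> (\<exists>x\<in>zeros (C (s k)). pd x x0 < e)"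
    using not_eventually_sequentiallyD [OF neg] by blast
  have x0p: "x0 \<in> points" using x0 by (simp add: zeros_def)
  obtain e1 where e1: "0 < e1" "\<And>x y. x \<in> zeros C0 \<Longrightarrow> y \<in> zeros C0 \<Longrightarrow> x \<noteq> y \<Longrightarrow> e1 \<le> pd x y"
    using zeros_separated [OF _ zeros_subset_points] zeros_bound(1) \<open>good C0\<close> by (metis good_def)
  \<comment> \<open>Less than the distance \<open>e1\<close> between zeros, so that
    \<open>x0\<close> is the only zero of \<open>C0\<close> in the closed polydisc of radius
    \<open>d\<close>; less than \<open>e\<close> for the conclusion.\<close>
  define d where "d = min e e1 / 2"
  have d: "0 < d" "d < e" "d < e1" using \<open>0 < e\<close> e1 by (auto simp: d_def)
  have "\<exists>x. x \<in> points \<and> pd x x0 \<le> d \<and>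
      (\<forall>y. y \<in> points \<longrightarrow> pd y x0 \<le> d \<longrightarrow> phi (C (s k)) x \<le> phi (C (s k)) y)" for k
    using phi_minimum [OF x0p, of d "C (s k)"] d by (metis less_imp_le)
  then obtain X where X: "\<And>k. X k \<in> points" "\<And>k. pd (X k) x0 \<le> d"
      "\<And>k y. y \<in> points \<Longrightarrow> pd y x0 \<le> d \<Longrightarrow> phi (C (s k)) (X k) \<le> phi (C (s k)) y"
    by metis
  have "norm (X k j) \<le> norm (x0 j) + d" for k j
  proof (cases "j < n")
    case True
    then have "norm (X k j - x0 j) \<le> d" using norm_le_pd X(2) order_trans by blast
    then show ?thesis using norm_triangle_sub [of "X k j" "x0 j"] by simp
  next
    case False
    then show ?thesis using X(1) [of k] d by (simp add: points_def)
  qed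
  then obtain r l where r: "strict_mono (r :: nat \<Rightarrow> nat)" "\<And>j. (\<lambda>k. X (r k) j) \<longlonglongrightarrow> l j"
    using bounded_functions_convergent_subseq [of X "\<lambda>j. norm (x0 j) + d"] by blast
  define C' where "C' k = C (s (r k))" for k
  have cv': "sys_tendsto C' C0 sequentially"
    unfolding C'_def using sys_tendsto_subseq [OF cv strict_mono_o [OF s(1) r(1)]] by simp
  have cvc: "\<And>e. (\<lambda>k. C' k i e) \<longlonglongrightarrow> C0 i e" if "i < n" for i
    using cv' that by (simp add: sys_tendsto_def)
  have "l \<in> points"
    unfolding points_def
  proof (intro CollectI allI impI)
    fix j assume "n \<le> j"
    then have "(\<lambda>k. X (r k) j) = (\<lambda>_. 0)" using X(1) by (auto simp: points_def)
    then show "l j = 0" using r(2) [of j] by (simp add: LIMSEQ_const_iff)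
  qed
  have ld: "pd l x0 \<le> d"
  proof (subst pd_le_iff)
    show "\<forall>j<n. norm (l j - x0 j) \<le> d"
    proof (intro allI impI)
      fix j assume "j < n"
      have "(\<lambda>k. norm (X (r k) j - x0 j)) \<longlonglongrightarrow> norm (l j - x0 j)"
        by (intro tendsto_intros r(2))
      moreover have "norm (X (r k) j - x0 j) \<le> d" for k
        using norm_le_pd [OF \<open>j < n\<close>] X(2) order_trans by blast
      ultimately show "norm (l j - x0 j) \<le> d" using LIMSEQ_le_const2 by blast
    qed
  qed (use d in auto)
  have "(\<lambda>k. phi (C' k) (X (r k))) \<longlonglongrightarrow> phi C0 l"
    unfolding phi_def by (intro tendsto_intros tendsto_ev cvc r(2)) auto
  moreover have "(\<lambda>k. phi (C' k) x0) \<longlonglongrightarrow> phi C0 x0"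
    unfolding phi_def by (intro tendsto_intros tendsto_ev cvc) auto
  moreover have "phi (C' k) (X (r k)) \<le> phi (C' k) x0" for k
    unfolding C'_def using X(3) [OF x0p] d by (simp add: pd_le_iff)
  ultimately have "phi C0 l \<le> phi C0 x0" by (intro LIMSEQ_le) auto
  moreover have "phi C0 x0 = 0" using x0 by (simp add: phi_eq_0_iff zeros_def)
  moreover have "0 \<le> phi C0 l" by (simp add: phi_def sum_nonneg)
  ultimately have "phi C0 l = 0" by simp
  then have "l \<in> zeros C0" using \<open>l \<in> points\<close> by (simp add: phi_eq_0_iff zeros_def)
  then have l: "l = x0" using e1(2) [OF _ x0] ld d by fastforce
  have "(\<lambda>k. jdet (C' k) (X (r k))) \<longlonglongrightarrow> jdet C0 x0"
    unfolding jdet_def by (intro tendsto_det tendsto_jac cvc) (use r(2) l in auto)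
  then have "\<forall>\<^sub>F k in sequentially. jdet (C' k) (X (r k)) \<noteq> 0"
    by (rule tendsto_imp_eventually_ne) (rule jdet_nonzero [OF \<open>good C0\<close> x0])
  moreover have "\<forall>\<^sub>F k in sequentially. \<forall>j\<in>{..<n}. norm (X (r k) j - x0 j) < d"
  proof (rule eventually_ball_finite)
    show "\<forall>j\<in>{..<n}. \<forall>\<^sub>F k in sequentially. norm (X (r k) j - x0 j) < d"
      using r(2) l d(1) unfolding tendsto_iff dist_norm by auto
  qed auto
  ultimately have "\<forall>\<^sub>F k in sequentially. jdet (C' k) (X (r k)) \<noteq> 0 \<and> pd (X (r k)) x0 < d"
    by eventually_elim (use d in \<open>auto simp: pd_less_iff\<close>)
  from eventually_happens' [OF sequentially_bot this]
  obtain k where k: "jdet (C' k) (X (r k)) \<noteq> 0" "pd (X (r k)) x0 < d" by blast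
  have "phi (C' k) (X (r k)) = 0"
  proof (rule min_phi_zero [OF X(1) k(1)])
    show "0 < d - pd (X (r k)) x0" using k by simp
    fix y assume "y \<in> points" "pd y (X (r k)) \<le> d - pd (X (r k)) x0"
    then show "phi (C' k) (X (r k)) \<le> phi (C' k) y"
      unfolding C'_def using pd_triangle [of y x0 "X (r k)"] by (intro X(3)) auto
  qed
  then have "X (r k) \<in> zeros (C (s (r k)))"
    using X(1) by (simp add: zeros_def phi_eq_0_iff C'_def)
  moreover have "pd (X (r k)) x0 < e" using k(2) d(2) by (rule less_trans)
  ultimately show False using s(2) by blast
qed

text \<open>Persistent zeros near different zeros of \<open>C0\<close> are distinct, because the
  polydiscs are disjoint; as \<open>dl (C k)\<close> is eventually nonzero, the Bezout bound leaves
  no room for further zeros.\<close>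

lemma nearby:
  assumes cv: "sys_tendsto C C0 sequentially" and "good C0" and "0 < e"
  shows "\<forall>\<^sub>F k in sequentially. good (C k) \<and>
    (\<exists>f. bij_betw f (zeros C0) (zeros (C k)) \<and> (\<forall>x\<in>zeros C0. pd (f x) x < e))"
proof -
  have fin: "finite (zeros C0)" and card: "card (zeros C0) = N" and dl: "dl C0 \<noteq> 0"
    using \<open>good C0\<close> zeros_bound(1) by (auto simp: good_def)
  obtain e1 where e1: "0 < e1" "\<And>x y. x \<in> zeros C0 \<Longrightarrow> y \<in> zeros C0 \<Longrightarrow> x \<noteq> y \<Longrightarrow> e1 \<le> pd x y"
    using zeros_separated [OF fin zeros_subset_points] by metis
  define d where "d = min e (e1 / 2)"
  have d: "0 < d" "d \<le> e" "2 * d \<le> e1" using \<open>0 < e\<close> e1 by (auto simp: d_def)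
  have "\<forall>\<^sub>F k in sequentially. \<forall>x\<in>zeros C0. \<exists>y\<in>zeros (C k). pd y x < d"
    using persist [OF cv \<open>good C0\<close>] d(1) by (intro eventually_ball_finite [OF fin]) auto
  moreover have "\<forall>\<^sub>F k in sequentially. dl (C k) \<noteq> 0"
    using tendsto_imp_eventually_ne [OF tendsto_dl [OF cv] dl] .
  ultimately show ?thesis
  proof eventually_elim
    case (elim k)
    then obtain f where f: "\<And>x. x \<in> zeros C0 \<Longrightarrow> f x \<in> zeros (C k)" "\<And>x. x \<in> zeros C0 \<Longrightarrow> pd (f x) x < d"
      by metis
    have inj: "inj_on f (zeros C0)"
    proof (rule inj_onI, rule ccontr)
      fix x y assume xy: "x \<in> zeros C0" "y \<in> zeros C0" "f x = f y" "x \<noteq> y"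
      have "pd x y \<le> pd x (f x) + pd (f y) y" using pd_triangle [of x y "f x"] xy by simp
      also have "\<dots> < 2 * d" using f(2) [OF xy(1)] f(2) [OF xy(2)] pd_commute [of x "f x"] by linarith
      finally show False using e1(2) [OF xy(1,2,4)] d by simp
    qed
    have "card (zeros (C k)) \<le> N" "finite (zeros (C k))" using zeros_bound elim by auto
    moreover have "f ` zeros C0 \<subseteq> zeros (C k)" "card (f ` zeros C0) = N"
      using f(1) card card_image [OF inj] by auto
    ultimately have "f ` zeros C0 = zeros (C k)"
      by (intro card_seteq) auto
    then have "bij_betw f (zeros C0) (zeros (C k))" using inj by (simp add: bij_betw_def)
    moreover from this have "good (C k)"
      using elim(2) card by (simp add: good_def bij_betw_same_card [symmetric])
    moreover have "pd (f x) x < e" if "x \<in> zeros C0" for x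
      using f(2) [OF that] d(2) by (rule less_le_trans)
    ultimately show ?case by blast
  qed
qed

section \<open>Lines in the space of systems\<close>

definition polyfam where
  "polyfam C \<longleftrightarrow> (\<forall>i<n. \<forall>e. \<exists>p. \<forall>z::complex. (C z i e :: complex) = poly p z)"

lemma fun_algebra_poly: "fun_algebra {f :: complex \<Rightarrow> complex. \<exists>p. \<forall>z. f z = poly p z}"
  unfolding fun_algebra_def
proof (intro conjI allI ballI CollectI; (elim CollectE exE)?)
  show "\<exists>p. \<forall>z::complex. c = poly p z" for c by (rule exI [of _ "[:c:]"]) simp
  fix f g :: "complex \<Rightarrow> complex" and p q
  assume "\<forall>z. f z = poly p z" "\<forall>z. g z = poly q z"
  then show "\<exists>p. \<forall>z. f z + g z = poly p z" "\<exists>p. \<forall>z. f z * g z = poly p z"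
    by - (rule exI [of _ "p + q"], simp, rule exI [of _ "p * q"], simp)
qed

lemma polyfam_tendsto:
  assumes "polyfam C" "(f \<longlongrightarrow> z) F"
  shows "sys_tendsto (\<lambda>s. C (f s)) (C z) F"
  unfolding sys_tendsto_def
proof (intro allI impI)
  fix i e assume "i < n"
  then obtain p where "\<And>z. C z i e = poly p z" using assms(1) unfolding polyfam_def by blast
  then show "((\<lambda>s. C (f s) i e) \<longlongrightarrow> C z i e) F" using assms(2) by (simp add: tendsto_poly)
qed

text \<open>A property that holds eventually along every sequence tending to \<open>z0\<close> holds
  in a neighbourhood; this carries \<open>nearby\<close> over from sequences to balls.\<close>

lemma nearby_at:
  assumes "polyfam C" "good (C z0)" "0 < e"
  obtains d where "0 < d" "\<And>z. z \<in> ball z0 d \<Longrightarrow> good (C z) \<and>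
    (\<exists>f. bij_betw f (zeros (C z0)) (zeros (C z)) \<and> (\<forall>x\<in>zeros (C z0). pd (f x) x < e))"
proof -
  define P where "P z \<longleftrightarrow> good (C z) \<and>
    (\<exists>f. bij_betw f (zeros (C z0)) (zeros (C z)) \<and> (\<forall>x\<in>zeros (C z0). pd (f x) x < e))" for z
  have "eventually P (at z0)"
    by (rule sequentially_imp_eventually_at)
      (use nearby [OF polyfam_tendsto [OF assms(1)] assms(2,3)] in \<open>auto simp: P_def\<close>)
  moreover have "P z0"
    unfolding P_def using assms(2,3) by (auto intro!: exI [of _ id] simp: pd_less_iff)
  ultimately have "eventually P (nhds z0)"
    by (simp add: eventually_nhds_conv_at)
  then obtain d where "0 < d" "\<And>z. z \<in> ball z0 d \<Longrightarrow> P z"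
    unfolding eventually_nhds_metric by (auto simp: dist_commute)
  then show ?thesis using that unfolding P_def by blast
qed

lemma open_good: "polyfam C \<Longrightarrow> open {z. good (C z)}"
  unfolding open_contains_ball
proof
  fix z0 assume "polyfam C" "z0 \<in> {z. good (C z)}"
  then have "good (C z0)" by simp
  show "\<exists>d>0. ball z0 d \<subseteq> {z. good (C z)}"
    by (rule nearby_at [of C z0 1, OF \<open>polyfam C\<close> \<open>good (C z0)\<close>]) (simp, blast)
qed

text \<open>\<open>dl C * x i\<close> is an eigenvalue of the matrix \<open>K\<close> of
  multiplication by variable \<open>i\<close>, with the reduced monomials at \<open>x\<close> as
  eigenvector. Comparison at the entry of largest norm \<open>S\<close>, which is at least 1 because
  of the monomial 1, gives the bound. Hence zeros cannot escape to infinity while \<open>dl\<close>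
  stays away from 0 and the coefficients stay bounded.\<close>

lemma zero_norm_bound:
  assumes "dl C \<noteq> 0" "x \<in> zeros C" "i < n"
  shows "norm (x i) \<le> (\<Sum>a\<in>red. \<Sum>b\<in>red. norm (K C (\<lambda>j. (if j = i then 1 else 0) + a j) b)) / norm (dl C)"
proof -
  define S where "S = Max ((\<lambda>a. norm (mon n a x)) ` red)"
  have S: "norm (mon n a x) \<le> S" if "a \<in> red" for a
    using that finite_red by (simp add: S_def)
  have "1 \<le> S" using S [OF zero_in_red] by simp
  have "S \<in> (\<lambda>a. norm (mon n a x)) ` red"
    unfolding S_def using finite_red zero_in_red by (intro Max_in) auto
  then obtain a where a: "a \<in> red" "norm (mon n a x) = S" by auto
  have "norm (dl C) * norm (x i) * S = norm (dl C * mon n (\<lambda>j. (if j = i then 1 else 0) + a j) x)"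
    using a assms(3) by (simp add: mon_add mon_unit norm_mult)
  also have "\<dots> = norm (\<Sum>b\<in>red. K C (\<lambda>j. (if j = i then 1 else 0) + a j) b * mon n b x)"
    by (subst K_reduction [OF rel_mon [OF assms(2)] red_unit_in_big [OF a(1) assms(3)]]) simp
  also have "\<dots> \<le> (\<Sum>b\<in>red. norm (K C (\<lambda>j. (if j = i then 1 else 0) + a j) b) * S)"
    by (rule order_trans [OF norm_sum sum_mono]) (auto simp: norm_mult intro!: mult_left_mono S)
  also have "\<dots> \<le> (\<Sum>a\<in>red. \<Sum>b\<in>red. norm (K C (\<lambda>j. (if j = i then 1 else 0) + a j) b)) * S"
    unfolding sum_distrib_right [symmetric] using a(1) finite_red \<open>1 \<le> S\<close>
    by (intro mult_right_mono member_le_sum) (auto intro: sum_nonneg)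
  finally show ?thesis using \<open>1 \<le> S\<close> assms(1) by (simp add: field_simps)
qed

text \<open>The complex plane without the finitely many roots of \<open>dl * hdet\<close> is
  connected. The good parameters form an open subset of it by \<open>nearby_at\<close>, and a closed
  one: near a limit parameter the zeros stay bounded, and \<open>hdet \<noteq> 0\<close> prevents
  their limits from coinciding.\<close>

lemma good_on_line:
  assumes C: "polyfam C" and "good (C z0)" and z: "dl (C z) \<noteq> 0" "hdet (C z) \<noteq> 0"
  shows "good (C z)"
    and "finite {z. \<not> good (C z)}"
proof -
  have entries: "(\<lambda>z. C z i e) \<in> {f. \<exists>p. \<forall>z. f z = poly p z}" if "i < n" for i e
    using C that by (simp add: polyfam_def)
  obtain p1 where p1: "\<And>z. dl (C z) = poly p1 z"
    using fun_algebra_dl [where C = C, OF fun_algebra_poly entries] by blast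
  obtain p2 where p2: "\<And>z. hdet (C z) = poly p2 z"
    using fun_algebra_hdet [where C = C, OF fun_algebra_poly entries] by blast
  define \<Omega> where "\<Omega> = - {z. poly (p1 * p2) z = 0}"
  have \<Omega>: "z \<in> \<Omega> \<longleftrightarrow> dl (C z) \<noteq> 0 \<and> hdet (C z) \<noteq> 0" for z
    by (simp add: \<Omega>_def p1 p2)
  have G: "{z. good (C z)} \<subseteq> \<Omega>"
    using hdet_nonzero by (auto simp: \<Omega> good_def)
  have "z0 \<in> \<Omega>" using G assms(2) by auto
  then have "p1 * p2 \<noteq> 0" by (auto simp: \<Omega>_def)
  then have fin: "finite (- \<Omega>)" by (simp add: \<Omega>_def poly_roots_finite)
  have "connected (UNIV - (- \<Omega>))"
    by (rule connected_open_delete_finite [OF _ _ _ fin]) (auto simp: connected_UNIV)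
  then have conn: "connected \<Omega>" by (simp add: Diff_eq)
  have "\<Omega> \<inter> {z. good (C z)} = {z. good (C z)}" using G by blast
  then have op: "openin (top_of_set \<Omega>) {z. good (C z)}"
    using openin_open_Int [OF open_good [OF C], of \<Omega>] by simp
  have cl: "closedin (top_of_set \<Omega>) {z. good (C z)}"
  proof -
    have gw: "good (C w)" if w: "w \<in> \<Omega>" "w \<in> closure {z. good (C z)}" for w
    proof -
      obtain u where u: "\<And>k. good (C (u k))" "u \<longlonglongrightarrow> w"
        using w(2) unfolding closure_sequential by auto
      have cv: "sys_tendsto (\<lambda>k. C (u k)) (C w) sequentially"
        by (rule polyfam_tendsto [OF C u(2)])
      have dlw: "dl (C w) \<noteq> 0" and hdw: "hdet (C w) \<noteq> 0" using that(1) \<Omega> by auto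
      have "\<forall>k. \<exists>xs. bij_betw xs {0..<N} (zeros (C (u k)))"
      proof
        fix k show "\<exists>xs. bij_betw xs {0..<N} (zeros (C (u k)))"
          by (rule zeros_enum [OF u(1)]) blast
      qed
      from choice [OF this] obtain xs where xs0: "\<forall>k. bij_betw (xs k) {0..<N} (zeros (C (u k)))" ..
      then have xs: "bij_betw (xs k) {0..<N} (zeros (C (u k)))" for k by simp
      have xs_in: "xs k j \<in> zeros (C (u k))" if "j < N" for k j
        using xs [of k] that by (auto simp: bij_betw_def)
      define bd where "bd k i =
        (\<Sum>a\<in>red. \<Sum>b\<in>red. norm (K (C (u k)) (\<lambda>j. (if j = i then 1 else 0) + a j) b)) / norm (dl (C (u k)))"
        for k i
      have "\<exists>b. \<forall>k. bd k i \<le> b" if "i < n" for i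
      proof -
        have "(\<lambda>k. bd k i) \<longlonglongrightarrow>
            (\<Sum>a\<in>red. \<Sum>b\<in>red. norm (K (C w) (\<lambda>j. (if j = i then 1 else 0) + a j) b)) / norm (dl (C w))"
          unfolding bd_def
          by (intro tendsto_divide tendsto_sum tendsto_norm tendsto_K [OF cv] tendsto_dl [OF cv]
              red_unit_in_big that) (use dlw in auto)
        then have "convergent (\<lambda>k. bd k i)" by (rule convergentI)
        then have "Bseq (\<lambda>k. bd k i)" by (rule convergent_imp_Bseq)
        then obtain B where "\<And>k. \<bar>bd k i\<bar> \<le> B" unfolding Bseq_def by auto
        then show ?thesis by (meson abs_ge_self order_trans)
      qed
      then obtain b where b: "\<And>i k. i < n \<Longrightarrow> bd k i \<le> b i" by metis
      \<comment> \<open>Indexed by pairs, so that one subsequence makes all coordinates of all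
        \<open>N\<close> zeros converge.\<close>
      define f where "f k = (\<lambda>(j, i). if j < N \<and> i < n then xs k j i else 0)" for k
      have "norm (f k ji) \<le> \<bar>b (snd ji)\<bar>" for k ji
      proof (cases ji)
        case (Pair j i)
        have "norm (xs k j i) \<le> bd k i" if "j < N" "i < n"
          unfolding bd_def
          by (rule zero_norm_bound) (use u(1) xs_in that in \<open>auto simp: good_def\<close>)
        then show ?thesis using b [of i k] by (force simp: f_def Pair)
      qed
      then obtain r l where r: "strict_mono (r :: nat \<Rightarrow> nat)" "\<And>ji. (\<lambda>k. f (r k) ji) \<longlonglongrightarrow> l ji"
        using bounded_functions_convergent_subseq [of f "\<lambda>ji. \<bar>b (snd ji)\<bar>"] by blast
      define ys where "ys j i = (if i < n then l (j, i) else 0)" for j i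
      have lim: "(\<lambda>k. xs (r k) j i) \<longlonglongrightarrow> ys j i" if "j < N" "i < n" for j i
        using r(2) [of "(j, i)"] that by (simp add: f_def ys_def)
      note cv' = sys_tendsto_subseq [OF cv r(1)]
      have ys_in: "ys j \<in> zeros (C w)" if "j < N" for j
        unfolding zeros_def
      proof (intro CollectI conjI allI impI)
        show "ys j \<in> points" by (auto simp: ys_def points_def)
        fix i assume "i < n"
        have "(\<lambda>k. ev (C (u (r k))) i (xs (r k) j)) \<longlonglongrightarrow> ev (C w) i (ys j)"
          using cv' \<open>i < n\<close> by (intro tendsto_ev lim that) (auto simp: sys_tendsto_def)
        moreover have "(\<lambda>k. ev (C (u (r k))) i (xs (r k) j)) = (\<lambda>_. 0)"
          using xs_in [OF that] \<open>i < n\<close> by (auto simp: zeros_def)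
        ultimately show "ev (C w) i (ys j) = 0" by (simp add: LIMSEQ_const_iff)
      qed
      \<comment> \<open>The formula for \<open>hdet\<close> passes to the limit although
        \<open>C w\<close> is not yet known to be good; as \<open>hdet (C w)\<close> is nonzero, so
        is the Vandermonde determinant of the limits, which are therefore distinct.\<close>
      have "(\<lambda>k. dl (C (u (r k))) ^ N * Determinant.det (vand (xs (r k))) ^ 2) \<longlonglongrightarrow>
          dl (C w) ^ N * Determinant.det (vand ys) ^ 2"
        unfolding vand_def by (intro tendsto_intros tendsto_det tendsto_mon tendsto_dl [OF cv'] lim)
      moreover have "dl (C (u (r k))) ^ N * Determinant.det (vand (xs (r k))) ^ 2 = hdet (C (u (r k)))" for k
        using hdet_eq [OF _ xs] u(1) by (simp add: good_def)
      ultimately have "hdet (C w) = dl (C w) ^ N * Determinant.det (vand ys) ^ 2"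
        using LIMSEQ_unique [OF tendsto_hdet [OF cv']] by simp
      then have dv: "Determinant.det (vand ys) \<noteq> 0" using hdw by auto
      have "inj_on ys {0..<N}"
      proof (rule inj_onI, rule ccontr)
        fix j j' assume "j \<in> {0..<N}" "j' \<in> {0..<N}" "ys j = ys j'" "j \<noteq> j'"
        then have "Determinant.det (vand ys) = 0"
          by (intro det_identical_columns [OF vand_carrier, of j j']) (auto simp: vand_def intro!: eq_vecI)
        then show False using dv by simp
      qed
      then have "card (ys ` {0..<N}) = N" by (simp add: card_image)
      moreover have "ys ` {0..<N} \<subseteq> zeros (C w)" using ys_in by auto
      ultimately have "N \<le> card (zeros (C w))" using card_mono zeros_bound(1) [OF dlw] by metis
      then show ?thesis using zeros_bound(2) [OF dlw] dlw by (simp add: good_def)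
    qed
    have "\<Omega> \<inter> closure {z. good (C z)} = {z. good (C z)}"
    proof (rule equalityI)
      show "\<Omega> \<inter> closure {z. good (C z)} \<subseteq> {z. good (C z)}"
        by (rule subsetI) (simp add: gw)
      show "{z. good (C z)} \<subseteq> \<Omega> \<inter> closure {z. good (C z)}"
        by (rule Int_greatest [OF G closure_subset])
    qed
    then show ?thesis using closedin_closed_Int [OF closed_closure, of \<Omega> "{z. good (C z)}"] by simp
  qed
  have "{z. good (C z)} = {} \<or> {z. good (C z)} = \<Omega>"
    using conn op cl unfolding connected_clopen by (elim allE impE) (rule conjI)
  then have eq: "{z. good (C z)} = \<Omega>" using assms(2) by blast
  then show "good (C z)" using z \<Omega> by blast
  show "finite {z. \<not> good (C z)}" using fin eq by (metis Collect_neg_eq)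
qed

end

section \<open>Solution paths\<close>

text \<open>The lifting theorems for covering spaces need a normed space that contains all finite
  sequences.\<close>

definition emb :: "nat \<Rightarrow> (nat \<Rightarrow> complex) \<Rightarrow> nat \<Rightarrow>\<^sub>C complex" where
  "emb n x = Bcontfun (\<lambda>j. if j < n then x j else 0)"

lemma apply_emb: "apply_bcontfun (emb n x) j = (if j < n then x j else 0)"
proof -
  have "(\<lambda>j. if j < n then x j else 0) \<in> bcontfun"
  proof (rule bcontfun_normI)
    show "norm (if j < n then x j else 0) \<le> (\<Sum>j<n. norm (x j))" for j
      using member_le_sum [of j "{..<n}" "\<lambda>j. norm (x j)"] by (auto simp: sum_nonneg)
  qed simp
  then show ?thesis by (simp add: emb_def Bcontfun_inverse)
qed

lemma continuous_on_emb:
  assumes "\<And>j. j < n \<Longrightarrow> continuous_on S (\<lambda>z. f z j)"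
  shows "continuous_on S (\<lambda>z. emb n (f z))"
  unfolding continuous_on_def
proof
  fix z assume "z \<in> S"
  have "((\<lambda>s. \<Sum>j<n. dist (f s j) (f z j)) \<longlongrightarrow> (\<Sum>j<n. dist (f z j) (f z j))) (at z within S)"
    by (intro tendsto_sum tendsto_dist tendsto_const) (use assms \<open>z \<in> S\<close> in \<open>auto simp: continuous_on_def\<close>)
  then have lim: "((\<lambda>s. \<Sum>j<n. dist (f s j) (f z j)) \<longlongrightarrow> 0) (at z within S)" by simp
  show "((\<lambda>z. emb n (f z)) \<longlongrightarrow> emb n (f z)) (at z within S)"
  proof (rule metric_tendsto_imp_tendsto [OF lim], rule always_eventually, rule allI)
    fix s
    have "dist (emb n (f s)) (emb n (f z)) \<le> (\<Sum>j<n. dist (f s j) (f z j))"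
    proof (rule dist_bound)
      fix j
      show "dist (apply_bcontfun (emb n (f s)) j) (apply_bcontfun (emb n (f z)) j)
          \<le> (\<Sum>j<n. dist (f s j) (f z j))"
        using member_le_sum [of j "{..<n}" "\<lambda>j. dist (f s j) (f z j)"] by (auto simp: apply_emb sum_nonneg)
    qed
    also have "\<dots> \<le> dist (\<Sum>j<n. dist (f s j) (f z j)) 0" by (simp add: dist_real_def)
    finally show "dist (emb n (f s)) (emb n (f z)) \<le> dist (\<Sum>j<n. dist (f s j) (f z j)) 0" .
  qed
qed

lemma continuous_on_apply_coordinate: "continuous_on S (\<lambda>b :: nat \<Rightarrow>\<^sub>C complex. apply_bcontfun b j)"
  unfolding continuous_on_def
proof
  fix b :: "nat \<Rightarrow>\<^sub>C complex" assume "b \<in> S"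
  show "((\<lambda>b. apply_bcontfun b j) \<longlongrightarrow> apply_bcontfun b j) (at b within S)"
    by (rule metric_tendsto_imp_tendsto [OF tendsto_ident_at]) (rule always_eventually, simp add: dist_bounded)
qed

context square_system
begin

lemma N_pos: "0 < N"
  using zero_in_red finite_red by (auto simp: N_def card_gt_0_iff)

text \<open>Zeros over nearby parameters are labelled by the zeros over \<open>z0\<close> to which
  they are close. Continuity at another parameter \<open>z1\<close> holds because the matching of
  zeros supplied by \<open>nearby_at\<close> at \<open>z1\<close> cannot change labels.\<close>

lemma local_sections:
  assumes C: "polyfam C" and W: "open W" "\<And>z. z \<in> W \<Longrightarrow> good (C z)" and z0: "z0 \<in> W"
  obtains d e g where "0 < d" "ball z0 d \<subseteq> W" "0 < e"
    "\<And>x y. x \<in> zeros (C z0) \<Longrightarrow> y \<in> zeros (C z0) \<Longrightarrow> x \<noteq> y \<Longrightarrow> 3 * e \<le> pd x y"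
    "\<And>z. z \<in> ball z0 d \<Longrightarrow> bij_betw (\<lambda>x. g x z) (zeros (C z0)) (zeros (C z))"
    "\<And>x z. x \<in> zeros (C z0) \<Longrightarrow> z \<in> ball z0 d \<Longrightarrow> pd (g x z) x < e"
    "\<And>x j. x \<in> zeros (C z0) \<Longrightarrow> j < n \<Longrightarrow> continuous_on (ball z0 d) (\<lambda>z. g x z j)"
proof -
  have "finite (zeros (C z0))" using W(2) [OF z0] zeros_bound(1) by (simp add: good_def)
  then obtain e1 where e1: "0 < e1"
      "\<And>x y. x \<in> zeros (C z0) \<Longrightarrow> y \<in> zeros (C z0) \<Longrightarrow> x \<noteq> y \<Longrightarrow> e1 \<le> pd x y"
    using zeros_separated [OF _ zeros_subset_points] by metis
  \<comment> \<open>A third of the minimal distance, since a change of label would be bridged by two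
    displacements from the labels and one step between \<open>z1\<close> and \<open>z\<close>, each
    less than \<open>e\<close>.\<close>
  define e where "e = e1 / 3"
  have e: "0 < e" and sep: "3 * e \<le> pd x y" if "x \<in> zeros (C z0)" "y \<in> zeros (C z0)" "x \<noteq> y" for x y
    using e1 that by (auto simp: e_def)
  have e: "0 < e" using e1 by (simp add: e_def)
  obtain d1 where d1: "0 < d1" "\<And>z. z \<in> ball z0 d1 \<Longrightarrow> good (C z) \<and>
      (\<exists>f. bij_betw f (zeros (C z0)) (zeros (C z)) \<and> (\<forall>x\<in>zeros (C z0). pd (f x) x < e))"
    by (rule nearby_at [of C z0 e, OF C W(2) [OF z0] e]) blast
  obtain d2 where d2: "0 < d2" "ball z0 d2 \<subseteq> W" using W(1) z0 open_contains_ball by blast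
  define d where "d = min d1 d2"
  have d: "0 < d" "ball z0 d \<subseteq> W" using d1(1) d2 by (auto simp: d_def)
  have "\<forall>z. \<exists>f. z \<in> ball z0 d \<longrightarrow> bij_betw f (zeros (C z0)) (zeros (C z)) \<and> (\<forall>x\<in>zeros (C z0). pd (f x) x < e)"
    using d1(2) by (simp add: d_def)
  from choice [OF this] obtain G where G: "\<And>z. z \<in> ball z0 d \<Longrightarrow> bij_betw (G z) (zeros (C z0)) (zeros (C z))"
      "\<And>z x. z \<in> ball z0 d \<Longrightarrow> x \<in> zeros (C z0) \<Longrightarrow> pd (G z x) x < e" by blast
  show ?thesis
  proof (rule that [of d e "\<lambda>x z. G z x"])
    fix x j assume x: "x \<in> zeros (C z0)" and j: "j < n"
    show "continuous_on (ball z0 d) (\<lambda>z. G z x j)"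
      unfolding continuous_on_iff
    proof (intro ballI allI impI)
      fix z1 :: complex and \<eta> :: real assume z1: "z1 \<in> ball z0 d" and "0 < \<eta>"
      have pos: "0 < min \<eta> e" using \<open>0 < \<eta>\<close> e by simp
      have g1: "good (C z1)" using z1 d W(2) by blast
      obtain \<delta> where \<delta>: "0 < \<delta>" "\<And>z. z \<in> ball z1 \<delta> \<Longrightarrow> good (C z) \<and>
          (\<exists>f. bij_betw f (zeros (C z1)) (zeros (C z)) \<and> (\<forall>x\<in>zeros (C z1). pd (f x) x < min \<eta> e))"
        by (rule nearby_at [of C z1 "min \<eta> e", OF C g1 pos]) blast
      have "dist (G z x j) (G z1 x j) < \<eta>" if z: "z \<in> ball z0 d" "dist z z1 < \<delta>" for z
      proof -
        obtain f where f: "bij_betw f (zeros (C z1)) (zeros (C z))"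
            "\<forall>x\<in>zeros (C z1). pd (f x) x < min \<eta> e"
          using \<delta>(2) [of z] z by (auto simp: dist_commute)
        have 1: "G z1 x \<in> zeros (C z1)" using bij_betwE [OF G(1) [OF z1]] x by blast
        then have "f (G z1 x) \<in> zeros (C z)" using bij_betwE [OF f(1)] by blast
        then have "f (G z1 x) \<in> G z ` zeros (C z0)" using G(1) [OF z(1)] by (simp add: bij_betw_def)
        then obtain y where y: "y \<in> zeros (C z0)" "f (G z1 x) = G z y" by auto
        have "x = y"
        proof (rule ccontr)
          assume "x \<noteq> y"
          have "pd x y \<le> pd x (G z1 x) + (pd (G z1 x) (G z y) + pd (G z y) y)"
            using pd_triangle [of x y "G z1 x"] pd_triangle [of "G z1 x" y "G z y"] by linarith
          moreover have "pd x (G z1 x) < e" using G(2) [OF z1 x] by (simp add: pd_commute)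
          moreover have "pd (G z1 x) (G z y) < e"
            using bspec [OF f(2) 1] y(2) pd_commute [of "G z1 x" "G z y"] by simp
          moreover have "pd (G z y) y < e" using G(2) [OF z(1) y(1)] .
          ultimately show False using sep [OF x y(1) \<open>x \<noteq> y\<close>] by linarith
        qed
        then have "pd (G z x) (G z1 x) < \<eta>" using bspec [OF f(2) 1] y(2) by simp
        then show ?thesis
          using norm_le_pd [OF j, of "G z x" "G z1 x"] by (simp add: dist_norm)
      qed
      then show "\<exists>\<delta>>0. \<forall>z\<in>ball z0 d. dist z z1 < \<delta> \<longrightarrow> dist (G z x j) (G z1 x j) < \<eta>"
        using \<delta>(1) by blast
    qed
  qed (use d e sep G in auto)
qed

text \<open>The sheets over a small ball are the graphs of the local sections. Each is open in the
  total space, being cut out by the condition that the zero lies within \<open>e\<close> of its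
  label, and injectivity of the labelling keeps different sheets disjoint.\<close>

lemma covering_space_zeros:
  assumes C: "polyfam C" and W: "open W" "\<And>z. z \<in> W \<Longrightarrow> good (C z)"
  shows "covering_space {(z, b). z \<in> W \<and> (\<exists>x\<in>zeros (C z). b = emb n x)} fst W"
    (is "covering_space ?T fst W")
proof
  show "continuous_on ?T fst" by (intro continuous_intros)
  show "fst ` ?T = W"
  proof
    show "W \<subseteq> fst ` ?T"
    proof
      fix z assume z: "z \<in> W"
      then have "zeros (C z) \<noteq> {}" using W(2) [OF z] N_pos by (auto simp: good_def)
      then obtain x where "x \<in> zeros (C z)" by blast
      then have "(z, emb n x) \<in> ?T" using z by auto
      then show "z \<in> fst ` ?T" by (rule rev_image_eqI) simp
    qed
  qed auto
next
  fix z0 assume z0: "z0 \<in> W"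
  show "\<exists>U. z0 \<in> U \<and> openin (top_of_set W) U \<and>
      (\<exists>v. \<Union> v = ?T \<inter> fst -` U \<and> (\<forall>u\<in>v. openin (top_of_set ?T) u) \<and> pairwise disjnt v \<and>
        (\<forall>u\<in>v. \<exists>q. homeomorphism u U fst q))"
  proof (rule local_sections [OF C W(1) _ z0])
    show "good (C z)" if "z \<in> W" for z using W(2) that .
  next
  fix d e g
  assume d: "0 < d" "ball z0 d \<subseteq> W" and e: "0 < e"
    and sep: "\<And>x y. x \<in> zeros (C z0) \<Longrightarrow> y \<in> zeros (C z0) \<Longrightarrow> x \<noteq> y \<Longrightarrow> 3 * e \<le> pd x y"
    and g: "\<And>z. z \<in> ball z0 d \<Longrightarrow> bij_betw (\<lambda>x. g x z) (zeros (C z0)) (zeros (C z))"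
    and ge: "\<And>x z. x \<in> zeros (C z0) \<Longrightarrow> z \<in> ball z0 d \<Longrightarrow> pd (g x z) x < e"
    and gc: "\<And>x j. x \<in> zeros (C z0) \<Longrightarrow> j < n \<Longrightarrow> continuous_on (ball z0 d) (\<lambda>z. g x z j)"
  have gz: "g x z \<in> zeros (C z)" if "x \<in> zeros (C z0)" "z \<in> ball z0 d" for x z
    using bij_betwE [OF g] that by blast
  define sheet where "sheet x = (\<lambda>z. (z, emb n (g x z))) ` ball z0 d" for x
  have embD: "x j = y j" if "emb n x = emb n y" "j < n" for x y j
    using arg_cong [OF that(1), of "\<lambda>b. apply_bcontfun b j"] that(2) by (simp add: apply_emb)
  have emb_inj: "x = y" if "emb n x = emb n y" "x \<in> zeros C1" "y \<in> zeros C2" for x y C1 C2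
    using that embD by (intro points_eqI) (auto simp: zeros_def)
  have near: "x = x'" if "x \<in> zeros (C z0)" "x' \<in> zeros (C z0)" "pd y x < e" "pd y x' < e" for x x' y
  proof (rule ccontr)
    assume "x \<noteq> x'"
    then have "3 * e \<le> pd x x'" using sep that by blast
    then show False using pd_triangle [of x x' y] that e by (simp add: pd_commute [of x y])
  qed
  have sub: "sheet x \<subseteq> ?T" if "x \<in> zeros (C z0)" for x
    using gz that d(2) by (auto simp: sheet_def)
  have un: "\<Union> (sheet ` zeros (C z0)) = ?T \<inter> fst -` ball z0 d"
  proof
    show "\<Union> (sheet ` zeros (C z0)) \<subseteq> ?T \<inter> fst -` ball z0 d"
      using sub by (auto simp: sheet_def)
    show "?T \<inter> fst -` ball z0 d \<subseteq> \<Union> (sheet ` zeros (C z0))"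
    proof
      fix p assume p: "p \<in> ?T \<inter> fst -` ball z0 d"
      then obtain z y where zy: "p = (z, emb n y)" "z \<in> ball z0 d" "y \<in> zeros (C z)" by auto
      then have "y \<in> (\<lambda>x. g x z) ` zeros (C z0)" using g by (simp add: bij_betw_def)
      then obtain x where x: "x \<in> zeros (C z0)" "y = g x z" by auto
      have "p \<in> sheet x"
        unfolding sheet_def by (rule image_eqI [of _ _ z]) (use zy x in auto)
      then show "p \<in> \<Union> (sheet ` zeros (C z0))" using x by blast
    qed
  qed
  have opn: "openin (top_of_set ?T) (sheet x)" if x: "x \<in> zeros (C z0)" for x
  proof -
    define U where "U = {p :: complex \<times> (nat \<Rightarrow>\<^sub>C complex). fst p \<in> ball z0 d} \<inter>
      (\<Inter>j\<in>{..<n}. {p. norm (apply_bcontfun (snd p) j - x j) < e})"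
    have "open {p :: complex \<times> (nat \<Rightarrow>\<^sub>C complex). fst p \<in> ball z0 d}"
      using open_vimage [OF open_ball, of fst z0 d] continuous_on_fst [OF continuous_on_id, of UNIV]
      by (simp add: vimage_def)
    moreover have "open {p :: complex \<times> (nat \<Rightarrow>\<^sub>C complex). norm (apply_bcontfun (snd p) j - x j) < e}" for j
    proof (rule open_Collect_less)
      have "continuous_on UNIV (\<lambda>p :: complex \<times> (nat \<Rightarrow>\<^sub>C complex). apply_bcontfun (snd p) j)"
        by (rule continuous_on_compose2 [OF continuous_on_apply_coordinate [of UNIV]]) (auto intro!: continuous_intros)
      then show "continuous_on UNIV (\<lambda>p :: complex \<times> (nat \<Rightarrow>\<^sub>C complex). norm (apply_bcontfun (snd p) j - x j))"
        by (intro continuous_intros)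
    qed (intro continuous_intros)
    ultimately have "open U" unfolding U_def by (intro open_Int open_INT) auto
    have mem: "(z, emb n y) \<in> U \<longleftrightarrow> z \<in> ball z0 d \<and> pd y x < e" for z y
      using e by (auto simp: U_def apply_emb pd_less_iff)
    have "sheet x = ?T \<inter> U"
    proof
      show "sheet x \<subseteq> ?T \<inter> U" using sub [OF x] ge [OF x] mem by (auto simp: sheet_def)
      show "?T \<inter> U \<subseteq> sheet x"
      proof
        fix p assume p: "p \<in> ?T \<inter> U"
        then obtain z y where zy: "p = (z, emb n y)" "y \<in> zeros (C z)" by auto
        then have z: "z \<in> ball z0 d" "pd y x < e" using p mem by auto
        then have "y \<in> (\<lambda>x. g x z) ` zeros (C z0)" using g zy(2) by (simp add: bij_betw_def)
        then obtain x' where x': "x' \<in> zeros (C z0)" "y = g x' z" by auto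
        then have "x' = x" using near [OF x'(1) x] ge [OF x'(1) z(1)] z(2) by blast
        then show "p \<in> sheet x"
          unfolding sheet_def by (intro image_eqI [of _ _ z]) (use zy x' z in auto)
      qed
    qed
    then show ?thesis using openin_open_Int [OF \<open>open U\<close>, of ?T] by simp
  qed
  have dis: "pairwise disjnt (sheet ` zeros (C z0))"
  proof (rule pairwise_imageI)
    fix x x' assume x: "x \<in> zeros (C z0)" "x' \<in> zeros (C z0)" "x \<noteq> x'"
    show "disjnt (sheet x) (sheet x')"
      unfolding disjnt_iff
    proof (intro allI notI, elim conjE)
      fix p assume p: "p \<in> sheet x" "p \<in> sheet x'"
      then obtain z where z: "z \<in> ball z0 d" "p = (z, emb n (g x z))" by (auto simp: sheet_def)
      then have "emb n (g x z) = emb n (g x' z)" using p(2) by (auto simp: sheet_def)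
      then have "g x z = g x' z" using emb_inj gz x z by blast
      then have "x = x'" using g [OF z(1)] x by (simp add: bij_betw_def inj_on_def)
      then show False using x by simp
    qed
  qed
  have hom: "\<exists>q. homeomorphism (sheet x) (ball z0 d) fst q" if x: "x \<in> zeros (C z0)" for x
  proof (rule exI [of _ "\<lambda>z. (z, emb n (g x z))"], unfold homeomorphism_def, intro conjI ballI)
    show "continuous_on (sheet x) fst" by (intro continuous_intros)
    show "continuous_on (ball z0 d) (\<lambda>z. (z, emb n (g x z)))"
      by (intro continuous_intros continuous_on_emb gc x)
    show "fst ` sheet x = ball z0 d" unfolding sheet_def by (simp add: image_comp o_def)
    show "(\<lambda>z. (z, emb n (g x z))) ` ball z0 d = sheet x" by (simp add: sheet_def)
  qed (auto simp: sheet_def)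
  show ?thesis
  proof (rule exI [of _ "ball z0 d"], intro conjI exI [of _ "sheet ` zeros (C z0)"])
    show "z0 \<in> ball z0 d" using d by simp
    show "openin (top_of_set W) (ball z0 d)" using d(2) by (simp add: open_subset)
  qed (use un opn dis hom in auto)
  qed
qed

text \<open>A convex set is simply connected, so the identity of \<open>W\<close> lifts through
  every point over \<open>z0\<close>. Lifts that meet once coincide by uniqueness, and comparison
  with the cardinality \<open>N\<close> shows that they exhaust the zeros.\<close>

lemma global_sections:
  assumes C: "polyfam C" and W: "open W" "convex W" "\<And>z. z \<in> W \<Longrightarrow> good (C z)" and z0: "z0 \<in> W"
  obtains \<Gamma> where "finite \<Gamma>" "\<And>\<gamma> j. \<gamma> \<in> \<Gamma> \<Longrightarrow> continuous_on W (\<lambda>z. \<gamma> z j)"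
    "\<And>z. z \<in> W \<Longrightarrow> bij_betw (\<lambda>\<gamma>. \<gamma> z) \<Gamma> (zeros (C z))"
proof -
  define T where "T = {(z, b). z \<in> W \<and> (\<exists>x\<in>zeros (C z). b = emb n x)}"
  have cov: "covering_space T fst W"
    unfolding T_def by (rule covering_space_zeros [OF C W(1,3)])
  define co where "co b = (\<lambda>j. if j < n then apply_bcontfun b j else 0)" for b :: "nat \<Rightarrow>\<^sub>C complex"
  have co: "co (emb n x) = x" if "x \<in> zeros C1" for x C1
    using that by (intro points_eqI) (auto simp: co_def apply_emb zeros_def points_def)
  have "\<exists>h. continuous_on W h \<and> h \<in> W \<rightarrow> T \<and> h z0 = (z0, emb n x) \<and> (\<forall>y\<in>W. fst (h y) = y)"
    if x: "x \<in> zeros (C z0)" for x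
  proof -
    have a: "(z0, emb n x) \<in> T" using x z0 by (auto simp: T_def)
    show ?thesis
      by (rule covering_space_lift_strong [OF cov a z0 convex_imp_simply_connected [OF W(2)]
            open_imp_locally_path_connected [OF W(1)], of id]) auto
  qed
  then obtain h where h: "\<And>x. x \<in> zeros (C z0) \<Longrightarrow> continuous_on W (h x)"
      "\<And>x. x \<in> zeros (C z0) \<Longrightarrow> h x \<in> W \<rightarrow> T"
      "\<And>x. x \<in> zeros (C z0) \<Longrightarrow> h x z0 = (z0, emb n x)"
      "\<And>x y. x \<in> zeros (C z0) \<Longrightarrow> y \<in> W \<Longrightarrow> fst (h x y) = y" by metis
  define \<gamma> where "\<gamma> x z = co (snd (h x z))" for x z
  have hz: "\<gamma> x z \<in> zeros (C z) \<and> h x z = (z, emb n (\<gamma> x z))" if xz: "x \<in> zeros (C z0)" "z \<in> W" for x z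
  proof -
    have "h x z \<in> T" using h(2) xz by blast
    then obtain y where y: "y \<in> zeros (C z)" "h x z = (z, emb n y)"
      using h(4) [OF xz] by (auto simp: T_def)
    then have "\<gamma> x z = y" using co by (simp add: \<gamma>_def)
    then show ?thesis using y by simp
  qed
  have inj: "x = x'" if "x \<in> zeros (C z0)" "x' \<in> zeros (C z0)" "z \<in> W" "\<gamma> x z = \<gamma> x' z" for x x' z
  proof -
    have eq: "h x z = h x' z" using hz that by metis
    have "h x z0 = h x' z0"
      by (rule covering_space_lift_unique [where f = id and a = z and T = W and ?g1.0 = "h x" and ?g2.0 = "h x'", OF cov eq])
        (use h that convex_connected [OF W(2)] z0 in \<open>auto\<close>)
    then have "emb n x = emb n x'" using h(3) that by simp
    then show ?thesis using co that by metis
  qed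
  have bij: "bij_betw (\<lambda>x. \<gamma> x z) (zeros (C z0)) (zeros (C z))" if z: "z \<in> W" for z
  proof -
    have i: "inj_on (\<lambda>x. \<gamma> x z) (zeros (C z0))" using inj z by (auto simp: inj_on_def)
    have g: "good (C z)" "good (C z0)" using W(3) z z0 by auto
    then have "finite (zeros (C z))" using zeros_bound(1) by (simp add: good_def)
    moreover have "(\<lambda>x. \<gamma> x z) ` zeros (C z0) \<subseteq> zeros (C z)" using hz z by auto
    ultimately have "(\<lambda>x. \<gamma> x z) ` zeros (C z0) = zeros (C z)"
      using card_image [OF i] g by (intro card_seteq) (auto simp: good_def)
    then show ?thesis using i by (simp add: bij_betw_def)
  qed
  have inj\<gamma>: "inj_on \<gamma> (zeros (C z0))"
    using bij [OF z0] by (auto simp: inj_on_def bij_betw_def dest: fun_cong)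
  show ?thesis
  proof (rule that [of "\<gamma> ` zeros (C z0)"])
    show "finite (\<gamma> ` zeros (C z0))" using W(3) [OF z0] zeros_bound(1) by (simp add: good_def)
    fix g j assume "g \<in> \<gamma> ` zeros (C z0)"
    then obtain x where x: "x \<in> zeros (C z0)" "g = \<gamma> x" by auto
    have "continuous_on W (\<lambda>z. apply_bcontfun (snd (h x z)) j)"
      by (rule continuous_on_compose2 [OF continuous_on_apply_coordinate [of UNIV]])
        (use h(1) [OF x(1)] in \<open>auto intro!: continuous_intros\<close>)
    then show "continuous_on W (\<lambda>z. g z j)"
      by (cases "j < n") (simp_all add: x \<gamma>_def co_def)
  next
    fix z assume z: "z \<in> W"
    have "bij_betw ((\<lambda>\<gamma>. \<gamma> z) \<circ> \<gamma>) (zeros (C z0)) (zeros (C z))" using bij [OF z] by (simp add: o_def)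
    then show "bij_betw (\<lambda>\<gamma>. \<gamma> z) (\<gamma> ` zeros (C z0)) (zeros (C z))"
      using inj\<gamma> bij_betw_comp_iff [of \<gamma> "zeros (C z0)" "\<gamma> ` zeros (C z0)" "\<lambda>\<gamma>. \<gamma> z"]
      by (simp add: inj_on_imp_bij_betw)
  qed
qed

text \<open>Subtracting the equations at \<open>z\<close> and \<open>z0\<close> gives a linear
  system for the difference quotients of the section: its matrix is the two-point Jacobian
  \<open>B z\<close>, its right-hand side the change of the coefficients at the fixed point
  \<open>\<gamma> z0\<close>. Cramer's rule solves it, and mere continuity of
  \<open>\<gamma>\<close> lets \<open>B z\<close> converge to the nonsingular Jacobian at
  \<open>z0\<close>.\<close>

lemma section_holomorphic:
  assumes C: "polyfam C" and W: "open W" "\<And>z. z \<in> W \<Longrightarrow> good (C z)"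
    and \<gamma>: "\<And>z. z \<in> W \<Longrightarrow> \<gamma> z \<in> zeros (C z)" "\<And>j. continuous_on W (\<lambda>z. \<gamma> z j)" and j: "j < n"
  shows "(\<lambda>z. \<gamma> z j) holomorphic_on W"
proof (rule holomorphic_onI)
  fix z0 assume z0: "z0 \<in> W"
  have at: "at z0 within W = at z0" using W(1) z0 by (rule at_within_open [rotated])
  have lim\<gamma>: "((\<lambda>z. \<gamma> z l) \<longlongrightarrow> \<gamma> z0 l) (at z0)" for l
    using \<gamma>(2) [of l] z0 unfolding continuous_on_def at [symmetric] by blast
  have limC: "((\<lambda>z. C z i e) \<longlongrightarrow> C z0 i e) (at z0)" if "i < n" for i e
    using polyfam_tendsto [OF C tendsto_ident_at] that by (simp add: sys_tendsto_def)
  define B where "B z = mat n n (\<lambda>(i, l). jac (C z) i l (\<gamma> z) (\<gamma> z0))" for z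
  have B: "B z \<in> carrier_mat n n" for z by (simp add: B_def)
  have limJ: "((\<lambda>z. jac (C z) i l (\<gamma> z) (\<gamma> z0)) \<longlongrightarrow> jac (C z0) i l (\<gamma> z0) (\<gamma> z0)) (at z0)" if "i < n" for i l
    by (intro tendsto_jac limC that lim\<gamma> tendsto_const)
  have limB: "((\<lambda>z. Determinant.det (B z)) \<longlongrightarrow> Determinant.det (B z0)) (at z0)"
    unfolding B_def by (intro tendsto_det limJ)
  have detB: "Determinant.det (B z0) \<noteq> 0"
    using jdet_nonzero [OF W(2) [OF z0] \<gamma>(1) [OF z0]] by (simp add: B_def jdet_def)
  have limA: "((\<lambda>z. adj_mat (B z) $$ (j, i)) \<longlongrightarrow> adj_mat (B z0) $$ (j, i)) (at z0)" if "i < n" for i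
  proof -
    have "(\<lambda>s. adj_mat (mat n n (\<lambda>(i, l). case s of None \<Rightarrow> jac (C z0) i l (\<gamma> z0) (\<gamma> z0)
        | Some z \<Rightarrow> jac (C z) i l (\<gamma> z) (\<gamma> z0))) $$ (j, i)) \<in> {f. ((\<lambda>s. f (Some s)) \<longlongrightarrow> f None) (at z0)}"
      by (rule fun_algebra_adj_mat [OF fun_algebra_tendsto]) (use limJ j that in auto)
    then show ?thesis by (simp add: B_def)
  qed
  define a where "a i z = ev (C z) i (\<gamma> z0)" for i z
  have "\<exists>D. (a i has_field_derivative D) (at z0)" if "i < n" for i
  proof -
    have "a i \<in> {f. \<exists>p. \<forall>z. f z = poly p z}"
      unfolding a_def ev_def
      by (intro fun_algebra_sum [OF fun_algebra_poly] fun_algebra_mult [OF fun_algebra_poly]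
          fun_algebra_const [OF fun_algebra_poly]) (use C that in \<open>auto simp: polyfam_def\<close>)
    then obtain p where "a i = poly p" by auto
    then show ?thesis using poly_DERIV by metis
  qed
  then obtain a' where a': "\<And>i. i < n \<Longrightarrow> (a i has_field_derivative a' i) (at z0)" by metis
  have key: "(\<gamma> z j - \<gamma> z0 j) / (z - z0) =
      - (\<Sum>i<n. adj_mat (B z) $$ (j, i) * ((a i z - a i z0) / (z - z0))) / Determinant.det (B z)"
    if z: "z \<in> W" "z \<noteq> z0" "Determinant.det (B z) \<noteq> 0" for z
  proof -
    define w where "w = vec n (\<lambda>l. (\<gamma> z l - \<gamma> z0 l) / (z - z0))"
    define u where "u = vec n (\<lambda>i. - ((a i z - a i z0) / (z - z0)))"
    have "B z *\<^sub>v w = u"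
    proof (rule eq_vecI)
      fix i assume "i < dim_vec u"
      then have i: "i < n" by (simp add: u_def)
      have "0 = ev (C z) i (\<gamma> z) - ev (C z0) i (\<gamma> z0)"
        using \<gamma>(1) z(1) z0 i by (simp add: zeros_def)
      also have "\<dots> = (ev (C z) i (\<gamma> z) - ev (C z) i (\<gamma> z0)) + (a i z - a i z0)"
        by (simp add: a_def)
      finally have "(\<Sum>l<n. jac (C z) i l (\<gamma> z) (\<gamma> z0) * (\<gamma> z l - \<gamma> z0 l)) + (a i z - a i z0) = 0"
        unfolding ev_diff by simp
      then have "(\<Sum>l<n. jac (C z) i l (\<gamma> z) (\<gamma> z0) * (\<gamma> z l - \<gamma> z0 l)) = - (a i z - a i z0)"
        by (rule eq_neg_iff_add_eq_0 [THEN iffD2])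
      then have "(\<Sum>l<n. jac (C z) i l (\<gamma> z) (\<gamma> z0) * (\<gamma> z l - \<gamma> z0 l)) / (z - z0) = u $ i"
        using i by (simp add: u_def minus_divide_left)
      then show "(B z *\<^sub>v w) $ i = u $ i"
        using i by (simp add: B_def w_def scalar_prod_def atLeast0LessThan sum_divide_distrib)
    qed (simp add: B_def u_def)
    have "Determinant.det (B z) * w $ j = (Determinant.det (B z) \<cdot>\<^sub>v w) $ j" using j by (simp add: w_def)
    also have "Determinant.det (B z) \<cdot>\<^sub>v w = (adj_mat (B z) * B z) *\<^sub>v w"
      unfolding adj_mat(3) [OF B] by (intro eq_vecI) (auto simp: w_def mult_mat_vec_def row_def scalar_prod_def
          if_distrib [of "\<lambda>x. _ * x"] if_distrib [of "\<lambda>x. x * _"] if_distrib [of "\<lambda>x. x / _"]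
          sum.delta cong: if_cong)
    also have "\<dots> = adj_mat (B z) *\<^sub>v u"
      using \<open>B z *\<^sub>v w = u\<close> by (subst assoc_mult_mat_vec [OF adj_mat(1) [OF B] B]) (auto simp: w_def)
    also have "\<dots> $ j = - (\<Sum>i<n. adj_mat (B z) $$ (j, i) * ((a i z - a i z0) / (z - z0)))"
      using j adj_mat(1) [OF B, of z] by (simp add: u_def scalar_prod_def atLeast0LessThan sum_negf)
    finally have "w $ j = - (\<Sum>i<n. adj_mat (B z) $$ (j, i) * ((a i z - a i z0) / (z - z0))) / Determinant.det (B z)"
      using z(3) by (metis nonzero_mult_div_cancel_left)
    then show ?thesis using j by (simp add: w_def)
  qed
  have "((\<lambda>z. - (\<Sum>i<n. adj_mat (B z) $$ (j, i) * ((a i z - a i z0) / (z - z0))) / Determinant.det (B z))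
      \<longlongrightarrow> - (\<Sum>i<n. adj_mat (B z0) $$ (j, i) * a' i) / Determinant.det (B z0)) (at z0)"
    by (intro tendsto_divide tendsto_minus tendsto_sum tendsto_mult limA limB detB)
      (use a' in \<open>auto simp: has_field_derivative_iff\<close>)
  moreover have "\<forall>\<^sub>F z in at z0. - (\<Sum>i<n. adj_mat (B z) $$ (j, i) * ((a i z - a i z0) / (z - z0))) /
      Determinant.det (B z) = (\<gamma> z j - \<gamma> z0 j) / (z - z0)"
  proof -
    have "\<forall>\<^sub>F z in at z0. Determinant.det (B z) \<noteq> 0" by (rule tendsto_imp_eventually_ne [OF limB detB])
    moreover have "\<forall>\<^sub>F z in at z0. z \<in> W" using W(1) z0 by (rule eventually_at_in_open')
    moreover have "\<forall>\<^sub>F z in at z0. z \<noteq> z0" by (rule eventually_neq_at_within)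
    ultimately show ?thesis by eventually_elim (simp add: key)
  qed
  ultimately have "((\<lambda>z. (\<gamma> z j - \<gamma> z0 j) / (z - z0))
      \<longlongrightarrow> - (\<Sum>i<n. adj_mat (B z0) $$ (j, i) * a' i) / Determinant.det (B z0)) (at z0)"
    by (rule Lim_transform_eventually)
  then show "(\<lambda>z. \<gamma> z j) field_differentiable at z0 within W"
    unfolding at field_differentiable_def has_field_derivative_iff by blast
qed

end

section \<open>Systems without zeros at infinity\<close>

lemma mon_single: "i < n \<Longrightarrow> mon n (\<lambda>j. if j = i then k else 0) x = x i ^ k"
  by (simp add: mon_def if_distrib [of "\<lambda>e. _ ^ e"] prod.delta' cong: if_cong)

lemma single_in_expos: "i < n \<Longrightarrow> (\<lambda>j. if j = i then k else 0) \<in> expos {..<n} d \<longleftrightarrow> k \<le> d"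
  by (auto simp: expos_def)

lemma sum_expos_single:
  fixes f :: "(nat \<Rightarrow> nat) \<Rightarrow> complex"
  assumes i: "i < n" and f: "\<And>e. e \<in> expos {..<n} d \<Longrightarrow> \<exists>j. j \<noteq> i \<and> e j \<noteq> 0 \<Longrightarrow> f e = 0"
  shows "(\<Sum>e\<in>expos {..<n} d. f e) = (\<Sum>k\<le>d. f (\<lambda>j. if j = i then k else 0))"
proof -
  define s where "s k = (\<lambda>j. if j = i then k else 0)" for k :: nat
  have inj: "inj_on s {..d}" by (auto simp: s_def inj_on_def fun_eq_iff)
  have sub: "s ` {..d} \<subseteq> expos {..<n} d" using single_in_expos [OF i] by (auto simp: s_def)
  have "(\<Sum>e\<in>expos {..<n} d. f e) = (\<Sum>e\<in>s ` {..d}. f e)"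
  proof (rule sum.mono_neutral_right [OF _ sub])
    show "\<forall>e\<in>expos {..<n} d - s ` {..d}. f e = 0"
    proof
      fix e assume e: "e \<in> expos {..<n} d - s ` {..d}"
      have "\<exists>j. j \<noteq> i \<and> e j \<noteq> 0"
      proof (rule ccontr)
        assume "\<not> ?thesis"
        then have "e = s (e i)" by (intro ext) (auto simp: s_def)
        moreover from this have "e i \<le> d" using e single_in_expos [OF i, of "e i" d] by (simp add: s_def)
        ultimately show False using e by blast
      qed
      then show "f e = 0" using f e by blast
    qed
  qed simp
  also have "\<dots> = (\<Sum>k\<le>d. f (s k))" by (rule sum.reindex [OF inj, simplified o_def])
  finally show ?thesis by (simp add: s_def)
qed

context square_system
begin

text \<open>A kernel vector of \<open>mac C\<close>, extended by 0 to the reduced monomials, solves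
  the Macaulay relations. So it suffices that a solution with vanishing reduced part vanishes, which
  can be checked without expanding the determinant.\<close>

lemma dl_nonzero:
  assumes "\<And>X m. rel C X \<Longrightarrow> (\<And>a. a \<in> red \<Longrightarrow> X a = 0) \<Longrightarrow> m \<in> nred \<Longrightarrow> X m = 0"
  shows "dl C \<noteq> 0"
proof
  assume "dl C = 0"
  then obtain v where v: "v \<in> carrier_vec (card nred)" "v \<noteq> 0\<^sub>v (card nred)"
      "mac C *\<^sub>v v = 0\<^sub>v (card nred)"
    unfolding dl_def using det_0_iff_vec_prod_zero [OF mac_carrier] by blast
  define X where "X m = (if m \<in> nred then v $ inv_into {0..<card nred} nidx m else 0)" for m
  have X: "X (nidx s) = v $ s" if "s < card nred" for s
    using that nidx nidx_in by (simp add: X_def bij_betw_inv_into_left)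
  have X0: "X a = 0" if "a \<in> red" for a using that by (simp add: X_def nred_def)
  have "rel C X"
    unfolding rel_def
  proof
    fix m assume m: "m \<in> nred"
    then have "m \<in> nidx ` {0..<card nred}" using nidx by (simp add: bij_betw_def)
    then obtain p where p: "p < card nred" "m = nidx p" by auto
    have "(\<Sum>e\<in>expos {..<n} (D (sel m)). C (sel m) e * X (shift m e)) = (mac C *\<^sub>v v) $ p"
      using p v(1) X0 unfolding sum_mac_entry [OF m] sum_big
      by (simp add: mac_def scalar_prod_def X atLeast0LessThan cong: sum.cong_simp)
    then show "(\<Sum>e\<in>expos {..<n} (D (sel m)). C (sel m) e * X (shift m e)) = 0"
      using v p by simp
  qed
  from assms [OF this X0] have "X m = 0" if "m \<in> nred" for m using that by blast
  then have "v $ s = 0" if "s < card nred" for s using X [OF that] nidx_in [OF that] by simp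
  then show False using v by (metis carrier_vecD eq_vecI index_zero_vec)
qed

text \<open>The variables in \<open>Y\<close> are themselves equations, and modulo these every other equation is
  dominated by a power of its own variable.\<close>

lemma dl_nonzero_triangular:
  assumes Y: "\<And>i e. i \<in> Y \<Longrightarrow> i < n \<Longrightarrow> C i e = (if e = (\<lambda>j. if j = i then 1 else 0) then 1 else 0)"
      "\<And>i. i \<in> Y \<Longrightarrow> i < n \<and> D i = 1"
    and selY: "\<And>m i. i \<in> Y \<Longrightarrow> m i \<noteq> 0 \<Longrightarrow> sel m \<in> Y"
    and lead: "\<And>i. i < n \<Longrightarrow> i \<notin> Y \<Longrightarrow> C i (\<lambda>j. if j = i then D i else 0) \<noteq> 0"
    and other: "\<And>i e. i < n \<Longrightarrow> i \<notin> Y \<Longrightarrow> e \<in> expos {..<n} (D i) \<Longrightarrow> sum e {..<n} = D i \<Longrightarrow>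
      e \<noteq> (\<lambda>j. if j = i then D i else 0) \<Longrightarrow> C i e \<noteq> 0 \<Longrightarrow> \<exists>y\<in>Y. e y \<noteq> 0"
  shows "dl C \<noteq> 0"
proof (rule dl_nonzero)
  fix X m assume X: "rel C X" "\<And>a. a \<in> red \<Longrightarrow> X a = 0" and "m \<in> nred"
  \<comment> \<open>Here \<open>sel\<close> picks an index in \<open>Y\<close>, so the relation of
    \<open>m\<close> consists of the single term \<open>X m\<close>.\<close>
  have XY: "X m = 0" if m: "m \<in> big" and y: "y \<in> Y" "m y \<noteq> 0" for m y
  proof -
    have "m \<notin> red" using Y(2) [OF y(1)] y(2) by (auto simp: red_def)
    then have mn: "m \<in> nred" using m by (simp add: nred_def)
    define i where "i = sel m"
    have i: "i \<in> Y" "i < n" "D i = 1" using selY [of y m, OF y] Y(2) by (auto simp: i_def)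
    have "m i \<noteq> 0" using sel_nred(2) [OF mn] i by (simp add: i_def)
    then have sh: "shift m (\<lambda>j. if j = i then 1 else 0) = m"
      by (auto simp: shift_def i_def [symmetric] i(3))
    have "0 = (\<Sum>e\<in>expos {..<n} (D i). C i e * X (shift m e))"
      using X(1) mn by (simp add: rel_def i_def)
    also have "\<dots> = (\<Sum>e\<in>expos {..<n} (D i). if e = (\<lambda>j. if j = i then 1 else 0) then X m else 0)"
      by (intro sum.cong refl) (auto simp: Y(1) [OF i(1,2)] sh)
    also have "\<dots> = X m"
      using single_in_expos [OF i(2), of 1 "D i"] i(3) by (subst sum.delta) auto
    finally show ?thesis by simp
  qed
  have "X m = 0" if "m \<in> big" "sum m {..<n} = k" for m k
    using that
  proof (induction k arbitrary: m rule: less_induct)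
    case (less k m)
    show ?case
    proof (cases "m \<in> red \<or> (\<exists>y\<in>Y. m y \<noteq> 0)")
      case True
      then show ?thesis using X(2) XY less.prems(1) by blast
    next
      case False
      then have mn: "m \<in> nred" using less.prems(1) by (simp add: nred_def)
      define i where "i = sel m"
      define u where "u = (\<lambda>j. if j = i then D i else 0)"
      have i: "i < n" "D i \<le> m i" using sel_nred [OF mn] by (auto simp: i_def)
      then have iY: "i \<notin> Y" using False Y(2) by fastforce
      have su: "shift m u = m" using i by (auto simp: shift_def i_def [symmetric] u_def)
      have ue: "u \<in> expos {..<n} (D i)" using single_in_expos [OF i(1)] by (simp add: u_def)
      \<comment> \<open>A lower degree of \<open>e\<close> lowers the degree of
        \<open>shift m e\<close>, which the induction covers; a term of full degree contains a
        variable of \<open>Y\<close> or has coefficient 0.\<close>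
      have 0: "C i e * X (shift m e) = 0" if e: "e \<in> expos {..<n} (D i)" "e \<noteq> u" for e
      proof -
        have sb: "shift m e \<in> big" using shift_in_big [OF mn] e by (simp add: i_def)
        have deg: "sum (shift m e) {..<n} + D i = k + sum e {..<n}"
          using sum_lower_sel [OF mn] less.prems(2) by (simp add: shift_def sum.distrib i_def)
        consider "sum e {..<n} < D i" | "sum e {..<n} = D i" "C i e = 0"
          | "sum e {..<n} = D i" "C i e \<noteq> 0"
          using e(1) by (fastforce simp: expos_def)
        then show ?thesis
        proof cases
          case 1
          then have "sum (shift m e) {..<n} < k" using deg by linarith
          then show ?thesis using less.IH [OF _ sb refl] by simp
        next
          case 3
          then obtain y where y: "y \<in> Y" "e y \<noteq> 0" using other [OF i(1) iY e(1)] e(2) unfolding u_def by blast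
          then have "shift m e y \<noteq> 0" by (simp add: shift_def)
          then show ?thesis using XY [OF sb y(1)] by simp
        qed simp
      qed
      have "0 = (\<Sum>e\<in>expos {..<n} (D i). C i e * X (shift m e))"
        using X(1) mn by (simp add: rel_def i_def)
      also have "\<dots> = (\<Sum>e\<in>expos {..<n} (D i). if e = u then C i u * X m else 0)"
        by (intro sum.cong refl) (use 0 su in auto)
      also have "\<dots> = C i u * X m" using ue by (subst sum.delta) auto
      finally show ?thesis using lead [OF i(1) iY] by (simp add: u_def)
    qed
  qed
  then show "X m = 0" using \<open>m \<in> nred\<close> by (simp add: nred_def)
qed

text \<open>Equation \<open>i\<close> is a polynomial in variable \<open>i\<close> alone, with roots
  \<open>x i + r\<close> for \<open>r < D i\<close>; the zeros form a grid of \<open>N\<close>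
  points with corner \<open>x\<close>. This supplies a good system through an arbitrary point,
  whatever its multiplicity in the system under study.\<close>

lemma good_decoupled:
  assumes x: "x \<in> points"
  obtains E where "good E" "x \<in> zeros E"
proof -
  define p where "p i = (\<Prod>r<D i. [:- (x i + of_nat r), 1:])" for i
  have deg: "degree (p i) = D i" and lc: "lead_coeff (p i) = 1" for i
    unfolding p_def by (subst degree_prod_eq_sum_degree) (auto simp: lead_coeff_prod)
  define E where "E i e = (if \<exists>j. j \<noteq> i \<and> e j \<noteq> 0 then 0 else coeff (p i) (e i))" for i e
  have ev: "ev E i y = poly (p i) (y i)" if "i < n" for i y
  proof -
    have "ev E i y = (\<Sum>k\<le>D i. coeff (p i) k * y i ^ k)"
      unfolding ev_def by (subst sum_expos_single [OF that]) (auto simp: E_def mon_single [OF that])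
    then show ?thesis by (simp add: poly_altdef deg)
  qed
  have "dl E \<noteq> 0"
  proof (rule dl_nonzero_triangular [of "{}"])
    fix i assume "i < n"
    show "E i (\<lambda>j. if j = i then D i else 0) \<noteq> 0"
      using lc [of i] by (simp add: E_def deg)
  next
    fix i e assume i: "i < n" and e: "sum e {..<n} = D i" "e \<noteq> (\<lambda>j. if j = i then D i else 0)" "E i e \<noteq> 0"
    have e0: "e j = 0" if "j \<noteq> i" for j using e(3) that by (auto simp: E_def split: if_splits)
    then have "sum e {..<n} = (\<Sum>j<n. if j = i then e i else 0)" by (intro sum.cong) auto
    then have "e i = D i" using e(1) i by simp
    then have "e = (\<lambda>j. if j = i then D i else 0)" by (intro ext) (simp add: e0)
    then show "\<exists>y\<in>{}. e y \<noteq> 0" using e(2) by simp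
  qed auto
  define \<phi> where "\<phi> a = (\<lambda>j. if j < n then x j + of_nat (a j) else 0)" for a :: "nat \<Rightarrow> nat"
  have "\<phi> a \<in> zeros E" if "a \<in> red" for a
    using that by (auto simp: zeros_def points_def \<phi>_def ev p_def poly_prod red_def intro!: bexI [of _ "a _"])
  then have sub: "\<phi> ` red \<subseteq> zeros E" by auto
  have "inj_on \<phi> red"
  proof (rule inj_onI)
    fix a b assume ab: "a \<in> red" "b \<in> red" "\<phi> a = \<phi> b"
    show "a = b"
    proof
      fix j
      have "\<phi> a j = \<phi> b j" using ab by simp
      then show "a j = b j" using ab by (cases "j < n") (auto simp: \<phi>_def red_def)
    qed
  qed
  then have "card (\<phi> ` red) = N" by (simp add: card_image N_def)
  then have "N \<le> card (zeros E)" using card_mono [OF zeros_bound(1) [OF \<open>dl E \<noteq> 0\<close>] sub] by simp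
  then have "good E" using zeros_bound(2) [of E] \<open>dl E \<noteq> 0\<close> by (simp add: good_def)
  moreover have "\<phi> (\<lambda>_. 0) = x" using x by (auto simp: \<phi>_def points_def)
  then have "x \<in> zeros E" using sub zero_in_red by force
  ultimately show ?thesis using that by blast
qed

section \<open>Isolated zeros persist\<close>

definition near :: "real \<Rightarrow> (nat \<Rightarrow> (nat \<Rightarrow> nat) \<Rightarrow> complex) \<Rightarrow> (nat \<Rightarrow> (nat \<Rightarrow> nat) \<Rightarrow> complex) \<Rightarrow> bool" where
  "near \<eta> C C' \<longleftrightarrow> (\<forall>i<n. \<forall>e\<in>expos {..<n} (D i). norm (C i e - C' i e) < \<eta>)"

text \<open>Compactness of the boundary of the polydisc: zeros there of systems approaching
  \<open>C\<close> would accumulate at a zero of \<open>C\<close> on the boundary.\<close>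

lemma no_zero_on_sphere:
  assumes x: "x \<in> points" and iso: "\<And>y. y \<in> zeros C \<Longrightarrow> pd y x \<noteq> e" and "0 < e"
  shows "\<exists>\<eta>>0. \<forall>C' y. near \<eta> C' C \<longrightarrow> y \<in> zeros C' \<longrightarrow> pd y x \<noteq> e"
  proof (rule ccontr)
    assume neg: "\<not> ?thesis"
    have "\<forall>k. \<exists>C' y. near (inverse (real (Suc k))) C' C \<and> y \<in> zeros C' \<and> pd y x = e"
    proof
      fix k :: nat
      have "0 < inverse (real (Suc k))" by simp
      then show "\<exists>C' y. near (inverse (real (Suc k))) C' C \<and> y \<in> zeros C' \<and> pd y x = e"
        using neg by blast
    qed
    then obtain C' y where C': "\<And>k. near (inverse (real (Suc k))) (C' k) C"
        and y: "\<And>k. y k \<in> zeros (C' k)" "\<And>k. pd (y k) x = e" by metis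
    \<comment> \<open>\<open>near\<close> controls only the coefficients that occur in
      \<open>ev\<close>; the others are reset to those of \<open>C\<close> so that all coefficients
      converge.\<close>
    define C2 where "C2 k i a = (if a \<in> expos {..<n} (D i) then C' k i a else C i a)" for k i a
    have ev2: "ev (C2 k) i z = ev (C' k) i z" for k i z by (simp add: ev_def C2_def)
    have lim: "(\<lambda>k. C2 k i a) \<longlonglongrightarrow> C i a" if "i < n" for i a
    proof (cases "a \<in> expos {..<n} (D i)")
      case True
      have "norm (C2 k i a - C i a) \<le> inverse (real (Suc k))" for k
        using C' [of k] that True by (auto simp: near_def C2_def less_imp_le)
      then have "\<forall>\<^sub>F k in sequentially. norm (C2 k i a - C i a) \<le> inverse (real (Suc k))"
        by simp
      from Lim_null_comparison [OF this LIMSEQ_inverse_real_of_nat] show ?thesis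
        by (rule LIM_zero_cancel)
    qed (simp add: C2_def)
    have "norm (y k j) \<le> norm (x j) + e" for k j
    proof (cases "j < n")
      case True
      then have "norm (y k j - x j) \<le> e" using norm_le_pd y(2) by metis
      then show ?thesis using norm_triangle_sub [of "y k j" "x j"] by simp
    next
      case False
      then show ?thesis using y(1) [of k] \<open>0 < e\<close> by (simp add: zeros_def points_def)
    qed
    then obtain r l where r: "strict_mono (r :: nat \<Rightarrow> nat)" "\<And>j. (\<lambda>k. y (r k) j) \<longlonglongrightarrow> l j"
      using bounded_functions_convergent_subseq [of y "\<lambda>j. norm (x j) + e"] by blast
    have "l \<in> zeros C"
      unfolding zeros_def points_def
    proof (intro CollectI conjI allI impI)
      fix j assume "n \<le> j"
      then have "(\<lambda>k. y (r k) j) = (\<lambda>_. 0)" using y(1) by (auto simp: zeros_def points_def)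
      then show "l j = 0" using r(2) [of j] by (simp add: LIMSEQ_const_iff)
    next
      fix i assume i: "i < n"
      have "(\<lambda>k. ev (C2 (r k)) i (y (r k))) \<longlonglongrightarrow> ev C i l"
        using LIMSEQ_subseq_LIMSEQ [OF lim [OF i] r(1)] by (intro tendsto_ev r(2)) (simp add: o_def)
      moreover have "(\<lambda>k. ev (C2 (r k)) i (y (r k))) = (\<lambda>_. 0)"
        using y(1) i by (auto simp: ev2 zeros_def)
      ultimately show "ev C i l = 0" by (simp add: LIMSEQ_const_iff)
    qed
    moreover have "pd l x = e"
    proof -
      have "(\<lambda>k. norm (y (r k) j - x j)) \<longlonglongrightarrow> norm (l j - x j)" for j
        by (intro tendsto_intros r(2))
      then have le: "norm (l j - x j) \<le> e" if "j < n" for j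
      proof (rule LIMSEQ_le_const2)
        show "\<exists>N. \<forall>k\<ge>N. norm (y (r k) j - x j) \<le> e" using norm_le_pd [OF that] y(2) by metis
      qed
      then have "pd l x \<le> e" using \<open>0 < e\<close> by (simp add: pd_le_iff)
      moreover have "\<not> pd l x < e"
      proof
        assume "pd l x < e"
        then have "\<forall>j\<in>{..<n}. norm (l j - x j) < e" using \<open>0 < e\<close> by (simp add: pd_less_iff)
        then have "\<forall>j\<in>{..<n}. \<forall>\<^sub>F k in sequentially. norm (y (r k) j - x j) < e"
          using order_tendstoD(2) [OF \<open>\<And>j. (\<lambda>k. norm (y (r k) j - x j)) \<longlonglongrightarrow> norm (l j - x j)\<close>] by blast
        then have "\<forall>\<^sub>F k in sequentially. \<forall>j\<in>{..<n}. norm (y (r k) j - x j) < e"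
          by (intro eventually_ball_finite) auto
        from eventually_happens' [OF sequentially_bot this]
        obtain k where "\<forall>j\<in>{..<n}. norm (y (r k) j - x j) < e" by blast
        then have "pd (y (r k)) x < e" using \<open>0 < e\<close> by (simp add: pd_less_iff)
        then show False using y(2) by simp
      qed
      ultimately show ?thesis by simp
    qed
    ultimately show False using iso by blast
  qed

lemma polyfam_line: "polyfam (\<lambda>z i e. (1 - z) * C i e + z * C' i e)"
  unfolding polyfam_def
proof (intro allI impI)
  fix i e
  show "\<exists>p. \<forall>z. (1 - z) * C i e + z * C' i e = poly p z"
    by (rule exI [of _ "[:C i e, C' i e - C i e:]"]) (simp add: algebra_simps)
qed

text \<open>Close to \<open>C1\<close> there is a good system that vanishes at \<open>x\<close>; on the line from there to \<open>C\<close> no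
  zero crosses the boundary of the polydisc.\<close>

lemma good_system_has_zero_near:
  assumes x: "x \<in> zeros C1" and iso: "\<And>y. y \<in> zeros C1 \<Longrightarrow> pd y x \<noteq> e" and e: "0 < e"
  shows "\<exists>\<eta>>0. (\<forall>C' y. near \<eta> C' C1 \<longrightarrow> y \<in> zeros C' \<longrightarrow> pd y x \<noteq> e) \<and>
    (\<forall>C. near \<eta> C C1 \<longrightarrow> good C \<longrightarrow> (\<exists>y\<in>zeros C. pd y x < e))"
proof -
  have xp: "x \<in> points" using x by (simp add: zeros_def)
  obtain \<eta>0 where \<eta>0: "0 < \<eta>0" "\<And>C' y. near \<eta>0 C' C1 \<Longrightarrow> y \<in> zeros C' \<Longrightarrow> pd y x \<noteq> e"
    using no_zero_on_sphere [OF xp iso e] by blast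
  obtain E where E: "good E" "x \<in> zeros E" by (rule good_decoupled [OF xp])
  define G where "G z i a = (1 - z) * C1 i a + z * E i a" for z i a
  have PG: "polyfam G" unfolding G_def by (rule polyfam_line)
  have G1: "G 1 = E" by (intro ext) (simp add: G_def)
  have "good (G 1)" using E G1 by simp
  moreover from this have "dl (G 1) \<noteq> 0" "hdet (G 1) \<noteq> 0" using hdet_nonzero by (auto simp: good_def)
  ultimately have fin: "finite {z. \<not> good (G z)}" using good_on_line(2) [OF PG] by blast
  define S where "S = insert 0 (\<Union>i\<in>{..<n}. (\<lambda>a. norm (E i a - C1 i a)) ` expos {..<n} (D i))"
  have finS: "finite S" by (simp add: S_def)
  define M where "M = Max S + 1"
  have "0 \<le> Max S" using finS by (simp add: S_def)
  then have M: "0 < M" by (simp add: M_def)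
  have bound: "norm (E i a - C1 i a) < M" if "i < n" "a \<in> expos {..<n} (D i)" for i a
  proof -
    have "norm (E i a - C1 i a) \<le> Max S"
      by (rule Max_ge [OF finS]) (use that in \<open>auto simp: S_def\<close>)
    then show ?thesis by (simp add: M_def)
  qed
  \<comment> \<open>On the disc of radius 2 the norms of \<open>1 - z\<close> and \<open>z\<close>
    are at most 3 and 2, so the systems \<open>L z\<close> below differ from \<open>C1\<close> by at
    most \<open>5 * \<eta>\<close>, which has to stay below \<open>\<eta>0\<close>.\<close>
  define \<eta> where "\<eta> = \<eta>0 / 8"
  have \<eta>: "0 < \<eta>" using \<eta>0 by (simp add: \<eta>_def)
  \<comment> \<open>Only finitely many parameters on the line to \<open>E\<close> are bad, so an
    arbitrarily small positive \<open>s\<close> yields a good system; it still vanishes at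
    \<open>x\<close>, as both ends of the line do.\<close>
  have "infinite {0<..<\<eta> / M}" using \<eta> M by (simp add: infinite_Ioo)
  then have "infinite (complex_of_real ` {0<..<\<eta> / M})"
    by (simp add: finite_image_iff inj_on_def)
  then have "\<not> complex_of_real ` {0<..<\<eta> / M} \<subseteq> {z. \<not> good (G z)}" using fin finite_subset by blast
  then obtain s where s: "0 < s" "s < \<eta> / M" "good (G (of_real s))" by auto
  have near_G: "near \<eta> (G (of_real s)) C1"
    unfolding near_def
  proof (intro allI impI ballI)
    fix i a assume ia: "i < n" "a \<in> expos {..<n} (D i)"
    have "norm (G (of_real s) i a - C1 i a) = norm (of_real s * (E i a - C1 i a))"
      by (simp add: G_def algebra_simps)
    also have "\<dots> = s * norm (E i a - C1 i a)" using s(1) by (simp only: norm_mult norm_of_real abs_of_pos)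
    also have "\<dots> \<le> s * M" using bound [OF ia] s(1) by (simp add: less_imp_le)
    also have "\<dots> < \<eta>" using s(2) M by (simp add: field_simps)
    finally show "norm (G (of_real s) i a - C1 i a) < \<eta>" .
  qed
  have x_G: "x \<in> zeros (G (of_real s))"
  proof -
    have "ev (G z) i x = (1 - z) * ev C1 i x + z * ev E i x" for z i
      unfolding ev_def G_def sum_distrib_left sum.distrib [symmetric]
      by (intro sum.cong refl) (simp add: algebra_simps)
    then show ?thesis using x E(2) by (simp add: zeros_def)
  qed
  show ?thesis
  proof (intro exI [of _ \<eta>] conjI allI impI \<eta>)
    fix C' y assume "near \<eta> C' C1" "y \<in> zeros C'"
    moreover from this have "near \<eta>0 C' C1" using \<eta>0(1) by (force simp: near_def \<eta>_def)
    ultimately show "pd y x \<noteq> e" using \<eta>0(2) by blast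
  next
    fix C assume C: "near \<eta> C C1" "good C"
    define L where "L z i a = (1 - z) * C i a + z * G (of_real s) i a" for z i a
    have PL: "polyfam L" unfolding L_def by (rule polyfam_line)
    have L0: "L 0 = C" and L1: "L 1 = G (of_real s)" by (intro ext; simp add: L_def)+
    have "good (L 0)" using C L0 by simp
    moreover from this have "dl (L 0) \<noteq> 0" "hdet (L 0) \<noteq> 0" using hdet_nonzero by (auto simp: good_def)
    ultimately have finL: "finite {z. \<not> good (L z)}" using good_on_line(2) [OF PL] by blast
    \<comment> \<open>The disc contains the parameters 0 and 1; in the complex plane the finitely
      many bad parameters between them can be bypassed.\<close>
    define W where "W = ball 0 2 - {z. \<not> good (L z)}"
    have conn: "connected W"
      unfolding W_def by (rule connected_open_delete_finite [OF open_ball connected_ball _ finL]) simp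
    have near_L: "near \<eta>0 (L z) C1" if "z \<in> ball 0 2" for z
      unfolding near_def
    proof (intro allI impI ballI)
      fix i a assume ia: "i < n" "a \<in> expos {..<n} (D i)"
      have z: "norm z \<le> 2" "norm (1 - z) \<le> 3"
        using that norm_triangle_ineq4 [of 1 z] by auto
      have "L z i a - C1 i a = (1 - z) * (C i a - C1 i a) + z * (G (of_real s) i a - C1 i a)"
        by (simp add: L_def algebra_simps)
      then have "norm (L z i a - C1 i a) \<le>
          norm (1 - z) * norm (C i a - C1 i a) + norm z * norm (G (of_real s) i a - C1 i a)"
        using norm_triangle_ineq by (metis norm_mult)
      also have "\<dots> \<le> 3 * \<eta> + 2 * \<eta>"
        using C(1) near_G ia z unfolding near_def by (intro add_mono mult_mono) (auto simp: less_imp_le)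
      also have "\<dots> < \<eta>0" using \<eta>0 by (simp add: \<eta>_def)
      finally show "norm (L z i a - C1 i a) < \<eta>0" .
    qed
    \<comment> \<open>This property is locally constant on \<open>W\<close>: the zeros move little,
      and none of them lies on the boundary of the polydisc.\<close>
    define P where "P z \<longleftrightarrow> (\<exists>y\<in>zeros (L z). pd y x < e)" for z
    have "P 0 = P 1"
    proof (rule connected_local_const [OF conn])
      show "0 \<in> W" "1 \<in> W" using C s(3) by (auto simp: W_def L0 L1)
      show "\<forall>z\<in>W. \<forall>\<^sub>F w in at z within W. P z = P w"
      proof
        fix z assume z: "z \<in> W"
        then have gz: "good (L z)" by (simp add: W_def)
        define Q where "Q = insert 1 ((\<lambda>y. \<bar>pd y x - e\<bar>) ` zeros (L z))"
        have finQ: "finite Q" using gz zeros_bound(1) by (simp add: Q_def good_def)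
        have ne: "pd y x \<noteq> e" if "w \<in> W" "y \<in> zeros (L w)" for y w
          using \<eta>0(2) [OF near_L that(2)] that(1) by (simp add: W_def)
        have pos: "0 < Min Q" using finQ ne [OF z] by (auto simp: Q_def)
        have margin: "Min Q \<le> \<bar>pd y x - e\<bar>" if "y \<in> zeros (L z)" for y
          using finQ that by (intro Min_le) (auto simp: Q_def)
        obtain d where d: "0 < d" "\<And>w. w \<in> ball z d \<Longrightarrow> good (L w) \<and>
            (\<exists>f. bij_betw f (zeros (L z)) (zeros (L w)) \<and> (\<forall>y\<in>zeros (L z). pd (f y) y < Min Q))"
          by (rule nearby_at [of L z "Min Q", OF PL gz pos]) blast
        have "P z = P w" if w: "w \<in> W" "dist w z < d" for w
        proof -
          obtain f where f: "bij_betw f (zeros (L z)) (zeros (L w))" "\<forall>y\<in>zeros (L z). pd (f y) y < Min Q"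
            using d(2) [of w] w by (auto simp: dist_commute)
          have "pd (f y) x < e \<longleftrightarrow> pd y x < e" if "y \<in> zeros (L z)" for y
            using margin [OF that] bspec [OF f(2) that] pd_triangle [of "f y" x y] pd_triangle [of y x "f y"]
              pd_commute [of y "f y"] by linarith
          then have "(\<exists>y\<in>zeros (L z). pd y x < e) \<longleftrightarrow> (\<exists>y\<in>f ` zeros (L z). pd y x < e)" by auto
          also have "f ` zeros (L z) = zeros (L w)" using f(1) by (simp add: bij_betw_def)
          finally show ?thesis unfolding P_def .
        qed
        then show "\<forall>\<^sub>F w in at z within W. P z = P w"
          unfolding eventually_at using d(1) by blast
      qed
    qed
    moreover have "P 1" using x_G e by (auto simp: P_def L1 pd_less_iff intro!: bexI [of _ x])
    ultimately show "\<exists>y\<in>zeros C. pd y x < e" by (simp add: P_def L0)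
  qed
qed

text \<open>If no path tended to \<open>x\<close>, finiteness of \<open>\<Gamma>\<close> would give
  one radius \<open>e\<close> within which no path stays eventually. But close to
  \<open>t = 1\<close> the system has a zero within \<open>e\<close> of \<open>x\<close>; the path
  through it cannot cross the boundary of the polydisc and so stays inside.\<close>

lemma path_to_isolated_zero:
  fixes C :: "real \<Rightarrow> nat \<Rightarrow> (nat \<Rightarrow> nat) \<Rightarrow> complex"
  assumes \<Gamma>: "finite \<Gamma>" "\<And>t. t \<in> {0..<1} \<Longrightarrow> zeros (C t) = (\<lambda>\<gamma>. \<gamma> t) ` \<Gamma>"
    and cont: "\<And>\<gamma> j. \<gamma> \<in> \<Gamma> \<Longrightarrow> continuous_on {0..<1} (\<lambda>t. \<gamma> t j)"
    and good: "\<And>t. t \<in> {0..<1} \<Longrightarrow> good (C t)"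
    and lim: "\<And>i a. i < n \<Longrightarrow> ((\<lambda>t. C t i a) \<longlongrightarrow> C1 i a) (at_left 1)"
    and x: "x \<in> zeros C1" and r: "0 < r" "\<And>y. y \<in> zeros C1 \<Longrightarrow> pd y x \<le> r \<Longrightarrow> y = x"
  obtains \<gamma> where "\<gamma> \<in> \<Gamma>" "\<And>j. j < n \<Longrightarrow> ((\<lambda>t. \<gamma> t j) \<longlongrightarrow> x j) (at_left 1)"
proof -
  have "\<exists>\<gamma>\<in>\<Gamma>. \<forall>e>0. \<forall>\<^sub>F t in at_left 1. pd (\<gamma> t) x < e"
  proof (rule ccontr)
    assume "\<not> ?thesis"
    then obtain \<epsilon> where \<epsilon>: "\<And>\<gamma>. \<gamma> \<in> \<Gamma> \<Longrightarrow> 0 < \<epsilon> \<gamma>"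
        "\<And>\<gamma>. \<gamma> \<in> \<Gamma> \<Longrightarrow> \<not> (\<forall>\<^sub>F t in at_left 1. pd (\<gamma> t) x < \<epsilon> \<gamma>)" by metis
    define e where "e = Min (insert r (\<epsilon> ` \<Gamma>))"
    have e: "0 < e" "e \<le> r" and e\<epsilon>: "\<And>\<gamma>. \<gamma> \<in> \<Gamma> \<Longrightarrow> e \<le> \<epsilon> \<gamma>"
      using \<Gamma>(1) r(1) \<epsilon>(1) by (auto simp: e_def)
    have iso: "pd y x \<noteq> e" if "y \<in> zeros C1" for y
    proof
      assume "pd y x = e"
      then have "y = x" using r(2) [OF that] e by simp
      moreover have "pd x x < e" using e by (simp add: pd_less_iff)
      ultimately show False using \<open>pd y x = e\<close> by simp
    qed
    obtain \<eta> where \<eta>: "0 < \<eta>" "\<And>C' y. near \<eta> C' C1 \<Longrightarrow> y \<in> zeros C' \<Longrightarrow> pd y x \<noteq> e"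
        "\<And>C. near \<eta> C C1 \<Longrightarrow> good C \<Longrightarrow> \<exists>y\<in>zeros C. pd y x < e"
      using good_system_has_zero_near [OF x iso e(1)] by blast
    have "\<forall>\<^sub>F t in at_left 1. \<forall>i\<in>{..<n}. \<forall>a\<in>expos {..<n} (D i). norm (C t i a - C1 i a) < \<eta>"
      using lim \<eta>(1) by (intro eventually_ball_finite ballI) (auto simp: tendsto_iff dist_norm)
    moreover have "\<forall>\<^sub>F t in at_left 1. t \<in> {0<..<(1::real)}"
      by (rule eventually_at_leftI [of 0]) auto
    ultimately have "\<forall>\<^sub>F t in at_left 1. near \<eta> (C t) C1 \<and> t \<in> {0..<1}"
      by eventually_elim (auto simp: near_def)
    then obtain b where b: "b < 1" "\<And>t. b < t \<Longrightarrow> t < 1 \<Longrightarrow> near \<eta> (C t) C1 \<and> t \<in> {0..<1}"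
      unfolding eventually_at_left_field by blast
    define t0 where "t0 = (b + 1) / 2"
    have t0: "t0 \<in> {b<..<1}" using b(1) by (simp add: t0_def)
    have "\<exists>y\<in>zeros (C t0). pd y x < e" using \<eta>(3) b(2) t0 good by auto
    then obtain \<gamma> where \<gamma>: "\<gamma> \<in> \<Gamma>" "pd (\<gamma> t0) x < e" using \<Gamma>(2) b(2) t0 by auto
    have ne: "pd (\<gamma> t) x \<noteq> e" if "t \<in> {b<..<1}" for t
      using \<eta>(2) [of "C t" "\<gamma> t"] b(2) that \<Gamma>(2) \<gamma>(1) by auto
    have lim\<gamma>: "((\<lambda>s. norm (\<gamma> s j - x j)) \<longlongrightarrow> norm (\<gamma> t j - x j)) (at t within {b<..<1})" if "t \<in> {b<..<1}" for t j
    proof -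
      have sub: "{b<..<1} \<subseteq> {0..<1}" using b(2) by auto
      have "continuous_on {b<..<1} (\<lambda>t. \<gamma> t j)" by (rule continuous_on_subset [OF cont [OF \<gamma>(1)] sub])
      then show ?thesis using that by (intro tendsto_intros) (auto simp: continuous_on_def)
    qed
    \<comment> \<open>The parameter interval is connected, and being inside is a locally constant
      property since the boundary is never met.\<close>
    have stay: "pd (\<gamma> t) x < e" if t: "t \<in> {b<..<1}" for t
    proof -
      have "(pd (\<gamma> t0) x < e) = (pd (\<gamma> t) x < e)"
      proof (rule connected_local_const [where A = "{b<..<1}" and f = "\<lambda>t. pd (\<gamma> t) x < e"])
        show "\<forall>a\<in>{b<..<1}. \<forall>\<^sub>F s in at a within {b<..<1}. (pd (\<gamma> a) x < e) = (pd (\<gamma> s) x < e)"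
        proof
          fix a assume a: "a \<in> {b<..<1}"
          show "\<forall>\<^sub>F s in at a within {b<..<1}. (pd (\<gamma> a) x < e) = (pd (\<gamma> s) x < e)"
          proof (cases "pd (\<gamma> a) x < e")
            case True
            then have "\<forall>j\<in>{..<n}. norm (\<gamma> a j - x j) < e" using e(1) by (simp add: pd_less_iff)
            then have "\<forall>\<^sub>F s in at a within {b<..<1}. \<forall>j\<in>{..<n}. norm (\<gamma> s j - x j) < e"
              using order_tendstoD(2) [OF lim\<gamma> [OF a]] by (intro eventually_ball_finite) auto
            then show ?thesis
              by eventually_elim (use True e(1) in \<open>simp add: pd_less_iff\<close>)
          next
            case False
            then have "\<not> pd (\<gamma> a) x \<le> e" using ne [OF a] by simp
            then obtain j where j: "j < n" "e < norm (\<gamma> a j - x j)"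
              using e(1) by (auto simp: pd_le_iff not_le)
            have "\<forall>\<^sub>F s in at a within {b<..<1}. e < norm (\<gamma> s j - x j)"
              using order_tendstoD(1) [OF lim\<gamma> [OF a] j(2)] .
            then show ?thesis
            proof eventually_elim
              case (elim s)
              then have "\<not> pd (\<gamma> s) x < e" using norm_le_pd [OF j(1), of "\<gamma> s" x] by linarith
              then show ?case using False by simp
            qed
          qed
        qed
      qed (use t0 t in auto)
      then show ?thesis using \<gamma>(2) by simp
    qed
    have "\<forall>\<^sub>F t in at_left 1. pd (\<gamma> t) x < \<epsilon> \<gamma>"
      using b(1)
    proof (rule eventually_at_leftI [rotated])
      fix t assume "t \<in> {b<..<1}"
      then show "pd (\<gamma> t) x < \<epsilon> \<gamma>" using stay e\<epsilon> [OF \<gamma>(1)] by fastforce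
    qed
    then show False using \<epsilon>(2) [OF \<gamma>(1)] by blast
  qed
  then obtain \<gamma> where \<gamma>: "\<gamma> \<in> \<Gamma>" "\<And>e. 0 < e \<Longrightarrow> \<forall>\<^sub>F t in at_left 1. pd (\<gamma> t) x < e" by blast
  show ?thesis
  proof (rule that [OF \<gamma>(1)])
    fix j assume j: "j < n"
    show "((\<lambda>t. \<gamma> t j) \<longlongrightarrow> x j) (at_left 1)"
      unfolding tendsto_iff dist_norm
    proof (intro allI impI)
      fix e :: real assume "0 < e"
      from \<gamma>(2) [OF this] show "\<forall>\<^sub>F t in at_left 1. norm (\<gamma> t j - x j) < e"
      proof eventually_elim
        case (elim t)
        then show ?case using norm_le_pd [OF j, of "\<gamma> t" x] by linarith
      qed
    qed
  qed
qed

end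

section \<open>Rays that avoid a complex hypersurface\<close>

text \<open>Restricted to \<open>I\<close> so that the space of the product measure is mapped to
  itself.\<close>

definition scale_fun :: "'i set \<Rightarrow> complex \<Rightarrow> ('i \<Rightarrow> complex) \<Rightarrow> 'i \<Rightarrow> complex" where
  "scale_fun I u \<omega> = (\<lambda>i\<in>I. u * \<omega> i)"

interpretation lborel_prod: product_sigma_finite "\<lambda>_. lborel :: complex measure"
  by unfold_locales

text \<open>Division by \<open>u\<close> is differentiable and therefore maps negligible sets to
  negligible sets. This concerns the completed measure, so Borel measurability of the preimage is
  established separately.\<close>

lemma AE_lborel_complex_scale:
  assumes u: "u \<noteq> 0" and E: "E \<in> null_sets (lborel :: complex measure)"
  shows "AE z in lborel. u * z \<notin> E"
proof -
  have "E \<in> null_sets lebesgue" using E null_sets_completionI by blast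
  then have "negligible E" by (simp add: negligible_iff_null_sets)
  then have "negligible ((\<lambda>z. z / u) ` E)"
    by (rule negligible_differentiable_image_negligible [OF order_refl])
      (use u in \<open>auto intro!: derivative_intros simp: differentiable_on_def field_differentiable_imp_differentiable\<close>)
  moreover have eq: "(\<lambda>z. z / u) ` E = {z. u * z \<in> E}"
    using u by (auto simp: image_iff field_simps intro!: bexI [of _ "u * _"])
  ultimately have 1: "{z. u * z \<in> E} \<in> null_sets lebesgue" by (simp add: negligible_iff_null_sets)
  have "(\<lambda>z. u * z) \<in> borel_measurable borel" by (intro borel_measurable_continuous_onI continuous_intros)
  moreover have "E \<in> sets borel" using E by (auto simp: null_sets_def)
  ultimately have "(\<lambda>z. u * z) -` E \<inter> space borel \<in> sets borel" by (rule measurable_sets)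
  then have "{z. u * z \<in> E} \<in> sets lborel" by (simp add: vimage_def)
  then have "{z. u * z \<in> E} \<in> null_sets lborel" using 1 by (simp add: null_sets_completion_iff)
  then show ?thesis by (rule AE_I') auto
qed

lemma measurable_scale_fun: "scale_fun I u \<in> measurable (PiM I (\<lambda>_. lborel)) (PiM I (\<lambda>_. lborel))"
  unfolding scale_fun_def by (intro measurable_restrict) measurable

text \<open>Induction on the number of coordinates with Fubini's theorem: almost all sections of a
  null set are null, the induction hypothesis carries this over to scaled base points, and the
  one-dimensional case scales the sections.\<close>

lemma AE_scale_fun:
  assumes "finite I" "u \<noteq> 0" "E \<in> null_sets (PiM I (\<lambda>_. lborel))"
  shows "AE \<omega> in PiM I (\<lambda>_. lborel). scale_fun I u \<omega> \<notin> E"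
  using assms(1,3)
proof (induction I arbitrary: E rule: finite_induct)
  case empty
  have "E = {}"
    using empty by (auto simp: null_sets_def space_PiM PiM_empty emeasure_count_space_eq_0 sets_PiM_empty)
  then show ?case by simp
next
  case (insert i I E)
  let ?M = "\<lambda>I. PiM I (\<lambda>_. lborel :: complex measure)"
  have E: "E \<in> sets (?M (insert i I))" "emeasure (?M (insert i I)) E = 0"
    using insert.prems by auto
  have meas: "(\<lambda>(x, y). x(i := y)) \<in> measurable (?M I \<Otimes>\<^sub>M lborel) (?M (insert i I))"
    using measurable_add_dim [of i I "\<lambda>_. lborel"] by simp
  have sec: "(\<lambda>y. x(i := y)) \<in> measurable lborel (?M (insert i I))" if "x \<in> space (?M I)" for x
    using measurable_compose [OF measurable_Pair1' [OF that] meas] by simp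
  \<comment> \<open>The measure of the section of \<open>E\<close> over \<open>x\<close>;
    \<open>g\<close> below is its analogue after scaling.\<close>
  define f where "f x = (\<integral>\<^sup>+y. indicator E (x(i := y)) \<partial>lborel)" for x
  have ind: "(\<lambda>p. indicator E ((fst p)(i := snd p)) :: ennreal) \<in> borel_measurable (?M I \<Otimes>\<^sub>M lborel)"
    using measurable_compose [OF meas borel_measurable_indicator [OF E(1)]] by (simp add: case_prod_beta')
  have f: "f \<in> borel_measurable (?M I)"
    unfolding f_def using lborel.borel_measurable_nn_integral_fst [OF ind] by simp
  have "(\<integral>\<^sup>+x. f x \<partial>?M I) = (\<integral>\<^sup>+x. indicator E x \<partial>?M (insert i I))"
    unfolding f_def by (rule lborel_prod.product_nn_integral_insert [symmetric]) (use insert E in auto)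
  also have "\<dots> = 0" using E by simp
  finally have "AE x in ?M I. f x = 0" using f by (simp add: nn_integral_0_iff_AE)
  then have "{x \<in> space (?M I). f x \<noteq> 0} \<in> null_sets (?M I)"
    using f by (subst AE_iff_null_sets) (auto simp: AE_iff_null)
  from insert.IH [OF this]
  have AE1: "AE x in ?M I. f (scale_fun I u x) = 0"
    using measurable_space [OF measurable_scale_fun] by (auto elim!: AE_mp)
  define g where "g x = (\<integral>\<^sup>+y. indicator E (scale_fun (insert i I) u (x(i := y))) \<partial>lborel)" for x
  have "AE x in ?M I. g x = 0"
    using AE1
  proof (rule AE_mp, intro AE_I2 impI)
    fix x assume x: "x \<in> space (?M I)" and 0: "f (scale_fun I u x) = 0"
    have sx: "scale_fun I u x \<in> space (?M I)" using x measurable_space [OF measurable_scale_fun] by blast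
    define E1 where "E1 = {y. (scale_fun I u x)(i := y) \<in> E}"
    have E1: "E1 \<in> sets lborel"
      using measurable_sets [OF sec [OF sx] E(1)] by (simp add: E1_def vimage_def)
    have "f (scale_fun I u x) = (\<integral>\<^sup>+y. indicator E1 y \<partial>lborel)"
      unfolding f_def by (intro nn_integral_cong) (simp add: E1_def indicator_def)
    then have "f (scale_fun I u x) = emeasure lborel E1" using E1 by simp
    then have "E1 \<in> null_sets lborel" using 0 E1 by (simp add: null_sets_def)
    from AE_lborel_complex_scale [OF \<open>u \<noteq> 0\<close> this]
    have "AE y in lborel. (scale_fun I u x)(i := u * y) \<notin> E" by (simp add: E1_def)
    moreover have "(scale_fun I u x)(i := u * y) = scale_fun (insert i I) u (x(i := y))" for y
      using insert.hyps by (auto simp: scale_fun_def fun_eq_iff)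
    ultimately have "AE y in lborel. indicator E (scale_fun (insert i I) u (x(i := y))) = (0::ennreal)"
      by (auto simp: indicator_def)
    then show "g x = 0"
      unfolding g_def by (subst nn_integral_cong_AE [where v = "\<lambda>_. 0"]) auto
  qed
  moreover have "g \<in> borel_measurable (?M I)"
  proof -
    have "(\<lambda>p. indicator E (scale_fun (insert i I) u ((fst p)(i := snd p))) :: ennreal)
        \<in> borel_measurable (?M I \<Otimes>\<^sub>M lborel)"
      using measurable_compose [OF measurable_compose [OF meas measurable_scale_fun]
          borel_measurable_indicator [OF E(1)]] by (simp add: case_prod_beta')
    from lborel.borel_measurable_nn_integral_fst [OF this] show ?thesis unfolding g_def [abs_def] by simp
  qed
  ultimately have "(\<integral>\<^sup>+x. g x \<partial>?M I) = 0" by (simp add: nn_integral_0_iff_AE)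
  moreover have "(\<integral>\<^sup>+x. g x \<partial>?M I) = (\<integral>\<^sup>+x. indicator E (scale_fun (insert i I) u x) \<partial>?M (insert i I))"
    unfolding g_def
    by (rule lborel_prod.product_nn_integral_insert [symmetric])
      (use insert measurable_compose [OF measurable_scale_fun borel_measurable_indicator [OF E(1)]] in auto)
  ultimately have "AE x in ?M (insert i I). indicator E (scale_fun (insert i I) u x) = (0::ennreal)"
    using measurable_compose [OF measurable_scale_fun borel_measurable_indicator [OF E(1)]]
    by (subst nn_integral_0_iff_AE [symmetric]) auto
  then show ?case by (auto simp: indicator_def split: if_splits elim!: AE_mp)
qed

text \<open>Rotating the whole space moves a point into a set that meets each complex line through the
  origin in finitely many rays only for finitely many angles.\<close>

lemma null_set_by_rotation:
  assumes I: "finite I" and E: "E \<in> sets (PiM I (\<lambda>_. lborel))"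
    and fin: "\<And>\<omega>. \<omega> \<in> space (PiM I (\<lambda>_. lborel)) \<Longrightarrow> finite {\<theta> \<in> {0..1}. scale_fun I (cis \<theta>) \<omega> \<in> E}"
  shows "E \<in> null_sets (PiM I (\<lambda>_. lborel))"
proof -
  let ?M = "PiM I (\<lambda>_. lborel :: complex measure)"
  interpret M: sigma_finite_measure ?M by (rule lborel_prod.sigma_finite [OF I])
  interpret P: pair_sigma_finite "lborel :: real measure" ?M ..
  have "(\<lambda>(\<theta>, \<omega>). scale_fun I (cis \<theta>) \<omega>) \<in> measurable (lborel \<Otimes>\<^sub>M ?M) ?M"
    unfolding scale_fun_def case_prod_beta'
  proof (intro measurable_restrict)
    fix i assume "i \<in> I"
    have "cis \<in> borel_measurable borel"
      by (intro borel_measurable_continuous_onI) (simp add: cis_conv_exp continuous_intros)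
    then have c: "(\<lambda>x. cis (fst x)) \<in> borel_measurable (lborel \<Otimes>\<^sub>M ?M)"
      using measurable_compose [of fst "lborel \<Otimes>\<^sub>M ?M" borel cis borel] by (simp add: measurable_fst)
    have "(\<lambda>x. snd x i) \<in> borel_measurable (lborel \<Otimes>\<^sub>M ?M)"
      using measurable_compose [OF measurable_snd measurable_component_singleton [OF \<open>i \<in> I\<close>, of "\<lambda>_. lborel"]]
      by (simp add: o_def)
    from borel_measurable_times [OF c this]
    show "(\<lambda>x. cis (fst x) * snd x i) \<in> measurable (lborel \<Otimes>\<^sub>M ?M) lborel" by simp
  qed
  from measurable_compose [OF this borel_measurable_indicator [OF E]]
  have mE: "(\<lambda>(\<theta>, \<omega>). indicator E (scale_fun I (cis \<theta>) \<omega>) :: ennreal) \<in> borel_measurable (lborel \<Otimes>\<^sub>M ?M)"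
    by (simp add: case_prod_beta')
  define f where "f \<theta> \<omega> = (indicator {0..1} \<theta> * indicator E (scale_fun I (cis \<theta>) \<omega>) :: ennreal)" for \<theta> \<omega>
  have mf: "(\<lambda>(\<theta>, \<omega>). f \<theta> \<omega>) \<in> borel_measurable (lborel \<Otimes>\<^sub>M ?M)"
  proof -
    have "(\<lambda>x. indicator {0..1::real} (fst x) :: ennreal) \<in> borel_measurable (lborel \<Otimes>\<^sub>M ?M)"
      by (rule measurable_compose [OF measurable_fst borel_measurable_indicator]) simp
    from borel_measurable_times_ennreal [OF this mE] show ?thesis by (simp add: f_def case_prod_beta')
  qed
  have "(\<integral>\<^sup>+\<theta>. \<integral>\<^sup>+\<omega>. f \<theta> \<omega> \<partial>?M \<partial>lborel) = (\<integral>\<^sup>+\<omega>. \<integral>\<^sup>+\<theta>. f \<theta> \<omega> \<partial>lborel \<partial>?M)"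
    using P.Fubini' [OF mf] by simp
  also have "\<dots> = (\<integral>\<^sup>+\<omega>. 0 \<partial>?M)"
  \<comment> \<open>After the exchange of the integrals, only finitely many angles count for each
    fixed \<open>\<omega>\<close>.\<close>
  proof (intro nn_integral_cong)
    fix \<omega> assume "\<omega> \<in> space ?M"
    then have "{\<theta> \<in> {0..1}. scale_fun I (cis \<theta>) \<omega> \<in> E} \<in> null_sets lborel"
      using fin by (intro finite_imp_null_set_lborel) auto
    then have "AE \<theta> in lborel. f \<theta> \<omega> = 0"
      by (rule AE_I') (auto simp: f_def indicator_def split: if_splits)
    then show "(\<integral>\<^sup>+\<theta>. f \<theta> \<omega> \<partial>lborel) = 0"
      by (subst nn_integral_cong_AE [where v = "\<lambda>_. 0"]) auto
  qed
  finally have "(\<integral>\<^sup>+\<theta>. \<integral>\<^sup>+\<omega>. f \<theta> \<omega> \<partial>?M \<partial>lborel) = 0" by simp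
  then have AE0: "AE \<theta> in lborel. (\<integral>\<^sup>+\<omega>. f \<theta> \<omega> \<partial>?M) = 0"
    using M.borel_measurable_nn_integral [OF mf] by (subst nn_integral_0_iff_AE [symmetric]) auto
  \<comment> \<open>The interval has positive measure, so some angle in it has a null preimage of
    \<open>E\<close>; rotating back by \<open>- \<theta>\<close> transfers this to \<open>E\<close>
    itself.\<close>
  have "\<exists>\<theta>\<in>{0..1}. (\<integral>\<^sup>+\<omega>. f \<theta> \<omega> \<partial>?M) = 0"
  proof (rule ccontr)
    assume "\<not> ?thesis"
    then have "AE \<theta> in lborel. \<theta> \<notin> {0..1::real}" using AE0 by (auto elim!: AE_mp)
    then have "{0..1::real} \<in> null_sets lborel" by (subst AE_iff_null_sets) auto
    then show False by (simp add: null_sets_def)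
  qed
  then obtain \<theta> where \<theta>: "\<theta> \<in> {0..1}" "(\<integral>\<^sup>+\<omega>. f \<theta> \<omega> \<partial>?M) = 0" by blast
  define E' where "E' = scale_fun I (cis \<theta>) -` E \<inter> space ?M"
  have E': "E' \<in> sets ?M" unfolding E'_def by (rule measurable_sets [OF measurable_scale_fun E])
  have "(\<integral>\<^sup>+\<omega>. f \<theta> \<omega> \<partial>?M) = (\<integral>\<^sup>+\<omega>. indicator E' \<omega> \<partial>?M)"
    using \<theta>(1) by (intro nn_integral_cong) (simp add: f_def E'_def indicator_def)
  then have "(\<integral>\<^sup>+\<omega>. f \<theta> \<omega> \<partial>?M) = emeasure ?M E'" using E' by simp
  then have "E' \<in> null_sets ?M" using \<theta>(2) E' by (simp add: null_sets_def)
  from AE_scale_fun [OF I _ this, of "cis (- \<theta>)"]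
  have "AE \<omega> in ?M. scale_fun I (cis (- \<theta>)) \<omega> \<notin> E'" by simp
  then have "AE \<omega> in ?M. \<omega> \<notin> E"
  proof (rule AE_mp, intro AE_I2 impI)
    fix \<omega> assume \<omega>: "\<omega> \<in> space ?M" "scale_fun I (cis (- \<theta>)) \<omega> \<notin> E'"
    have "scale_fun I (cis \<theta>) (scale_fun I (cis (- \<theta>)) \<omega>) = \<omega>"
    proof
      fix i
      have "cis \<theta> * (cis (- \<theta>) * \<omega> i) = \<omega> i" by (simp add: cis_mult mult.assoc [symmetric])
      then show "scale_fun I (cis \<theta>) (scale_fun I (cis (- \<theta>)) \<omega>) i = \<omega> i"
        using \<omega>(1) by (auto simp: scale_fun_def space_PiM PiE_iff extensional_def)
    qed
    moreover have "scale_fun I (cis (- \<theta>)) \<omega> \<in> space ?M"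
      using \<omega>(1) measurable_space [OF measurable_scale_fun] by blast
    ultimately show "\<omega> \<notin> E" using \<omega>(2) by (simp add: E'_def)
  qed
  then show ?thesis using E by (subst AE_iff_null_sets) auto
qed

text \<open>This turns the uncountable union over the ray into countable operations, which makes the
  bad set measurable. Arbitrarily small values on a bounded interval force a zero because the norm
  attains its minimum there.\<close>

lemma zero_on_ray_iff:
  fixes p :: "complex poly"
  shows "(\<exists>s\<ge>0. poly p (of_real s) = 0) \<longleftrightarrow>
    (\<exists>m::nat. \<forall>q::nat. \<exists>s\<in>\<rat>. 0 \<le> s \<and> s \<le> real m \<and> norm (poly p (of_real s)) < inverse (real (Suc q)))"
proof
  have cont: "continuous_on A (\<lambda>s::real. norm (poly p (of_real s)))" for A
    by (intro continuous_intros continuous_on_poly)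
  assume "\<exists>s\<ge>0. poly p (of_real s) = 0"
  then obtain s :: real where s: "0 \<le> s" "poly p (of_real s) = 0" by blast
  obtain m :: nat where m: "s + 1 \<le> real m" using real_arch_simple by blast
  have "\<exists>r\<in>\<rat>. 0 \<le> r \<and> r \<le> real m \<and> norm (poly p (of_real r)) < inverse (real (Suc q))" for q :: nat
  proof -
    have "0 < inverse (real (Suc q))" by simp
    then obtain d where d: "d > 0"
        "\<And>r. dist r s < d \<Longrightarrow> dist (norm (poly p (of_real r))) (norm (poly p (of_real s))) < inverse (real (Suc q))"
      using cont [of UNIV] unfolding continuous_on_iff by (metis UNIV_I)
    obtain r where r: "r \<in> \<rat>" "s < r" "r < s + min d 1"
      using Rats_dense_in_real [of s "s + min d 1"] d(1) by auto
    then have "norm (poly p (of_real r)) < inverse (real (Suc q))"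
      using d(2) [of r] s(2) by (simp add: dist_real_def)
    then show ?thesis using r s(1) m by (intro bexI [of _ r]) auto
  qed
  then show "\<exists>m::nat. \<forall>q::nat. \<exists>s\<in>\<rat>. 0 \<le> s \<and> s \<le> real m \<and> norm (poly p (of_real s)) < inverse (real (Suc q))"
    by blast
next
  have cont: "continuous_on A (\<lambda>s::real. norm (poly p (of_real s)))" for A
    by (intro continuous_intros continuous_on_poly)
  assume "\<exists>m::nat. \<forall>q::nat. \<exists>s\<in>\<rat>. 0 \<le> s \<and> s \<le> real m \<and> norm (poly p (of_real s)) < inverse (real (Suc q))"
  then obtain m :: nat where m: "\<And>q::nat. \<exists>s\<in>\<rat>. 0 \<le> s \<and> s \<le> real m \<and>
      norm (poly p (of_real s)) < inverse (real (Suc q))" by blast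
  obtain s where s: "s \<in> {0..real m}" "\<And>r. r \<in> {0..real m} \<Longrightarrow> norm (poly p (of_real s)) \<le> norm (poly p (of_real r))"
    using continuous_attains_inf [OF compact_Icc _ cont, of 0 "real m"] by auto
  have "norm (poly p (of_real s)) = 0"
  proof (rule ccontr)
    assume "norm (poly p (of_real s)) \<noteq> 0"
    then have "0 < norm (poly p (of_real s))" by simp
    then obtain q :: nat where "inverse (real (Suc q)) < norm (poly p (of_real s))"
      using reals_Archimedean by blast
    moreover obtain r where "r \<in> {0..real m}" "norm (poly p (of_real r)) < inverse (real (Suc q))"
      using m [of q] by auto
    ultimately show False using s(2) [of r] by linarith
  qed
  then show "\<exists>s\<ge>0. poly p (of_real s) = 0" using s(1) by auto
qed

text \<open>By the scaling hypothesis a rotation of \<open>\<omega>\<close> is a rotation of the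
  parameter. So for fixed \<open>\<omega>\<close> the angle \<open>\<theta>\<close> is bad only if a
  root of the polynomial has direction \<open>cis \<theta>\<close>, and there are finitely many
  roots as the polynomial is nonzero at 0.\<close>

lemma AE_no_zero_on_ray:
  fixes G :: "complex \<Rightarrow> ('i \<Rightarrow> complex) \<Rightarrow> complex"
  assumes I: "finite I"
    and meas: "\<And>z. G z \<in> borel_measurable (PiM I (\<lambda>_. lborel))"
    and poly: "\<And>\<omega>. \<exists>p. \<forall>z. G z \<omega> = poly p z"
    and G0: "\<And>\<omega>. G 0 \<omega> \<noteq> 0"
    and scale: "\<And>z u \<omega>. G z (scale_fun I u \<omega>) = G (z * u) \<omega>"
  shows "AE \<omega> in PiM I (\<lambda>_. lborel). \<forall>s\<ge>0. G (of_real s) \<omega> \<noteq> 0"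
proof -
  let ?M = "PiM I (\<lambda>_. lborel :: complex measure)"
  define E where "E = {\<omega> \<in> space ?M. \<exists>s\<ge>0. G (of_real s) \<omega> = 0}"
  have iff: "(\<exists>s\<ge>0. G (of_real s) \<omega> = 0) \<longleftrightarrow> (\<exists>m::nat. \<forall>q::nat. \<exists>s\<in>\<rat>. 0 \<le> s \<and> s \<le> real m \<and>
      norm (G (of_real s) \<omega>) < inverse (real (Suc q)))" for \<omega>
  proof -
    obtain p where "\<And>z. G z \<omega> = poly p z" using poly by blast
    then show ?thesis using zero_on_ray_iff [of p] by simp
  qed
  have eq: "(\<exists>s\<in>\<rat>. 0 \<le> s \<and> s \<le> real m \<and> P s) \<longleftrightarrow> (\<exists>s\<in>\<rat> \<inter> {0..real m}. P s)" for P m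
    by auto
  define A where "A q s = {\<omega> \<in> space ?M. norm (G (of_real s) \<omega>) < inverse (real (Suc q))}"
    for q :: nat and s :: real
  have mem: "\<omega> \<in> E \<longleftrightarrow> (\<exists>m::nat. \<forall>q. \<exists>s\<in>\<rat> \<inter> {0..real m}. \<omega> \<in> A q s)" for \<omega>
  proof (cases "\<omega> \<in> space ?M")
    case True
    then have "\<omega> \<in> A q s \<longleftrightarrow> norm (G (of_real s) \<omega>) < inverse (real (Suc q))" for q s
      by (simp add: A_def)
    then show ?thesis using True unfolding E_def by (simp only: mem_Collect_eq iff eq simp_thms)
  qed (auto simp: E_def A_def)
  have "E = (\<Union>m::nat. \<Inter>q. \<Union>s\<in>\<rat> \<inter> {0..real m}. A q s)"
    by (rule Set.set_eqI) (simp only: mem UN_iff INT_iff UNIV_I simp_thms bex_simps ball_simps bex_UNIV ball_UNIV)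
  moreover have "A q s \<in> sets ?M" for q s
    unfolding A_def using meas [of "of_real s"] by measurable
  moreover have "countable (\<rat> \<inter> {0..real m})" for m by (simp add: countable_rat countable_Int1)
  ultimately have E: "E \<in> sets ?M"
    by (auto intro!: sets.countable_UN sets.countable_INT sets.countable_UN'')
  have "E \<in> null_sets ?M"
  proof (rule null_set_by_rotation [OF I E])
    fix \<omega> assume \<omega>: "\<omega> \<in> space ?M"
    obtain p where p: "\<And>z. G z \<omega> = poly p z" using poly by blast
    then have "p \<noteq> 0" using G0 [of \<omega>] by (metis poly_0)
    then have fin: "finite {z. poly p z = 0}" by (rule poly_roots_finite)
    \<comment> \<open>The interval lies between 0 and \<open>pi\<close>, where the cosine is
      injective.\<close>
    have inj: "inj_on cis {0..1}"
    proof (rule inj_onI)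
      fix x y :: real assume xy: "x \<in> {0..1}" "y \<in> {0..1}" "cis x = cis y"
      have "cos x = cos y" using arg_cong [OF xy(3), of Re] by (simp only: cis.sel)
      moreover have "0 \<le> x" "x \<le> pi" "0 \<le> y" "y \<le> pi" using xy(1,2) pi_gt3 by auto
      ultimately show "x = y" using cos_inj_pi by blast
    qed
    have "{\<theta> \<in> {0..1}. scale_fun I (cis \<theta>) \<omega> \<in> E} \<subseteq> cis -` (sgn ` {z. poly p z = 0}) \<inter> {0..1}"
    proof
      fix \<theta> assume "\<theta> \<in> {\<theta> \<in> {0..1}. scale_fun I (cis \<theta>) \<omega> \<in> E}"
      then have \<theta>: "\<theta> \<in> {0..1}" "scale_fun I (cis \<theta>) \<omega> \<in> E" by auto
      then have "\<exists>s\<ge>0. G (of_real s) (scale_fun I (cis \<theta>) \<omega>) = 0"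
        unfolding E_def mem_Collect_eq by (elim conjE)
      then obtain s where s0: "0 \<le> s" "G (of_real s) (scale_fun I (cis \<theta>) \<omega>) = 0" by (elim exE conjE)
      then have s: "0 \<le> s" "poly p (of_real s * cis \<theta>) = 0" by (simp_all only: scale p)
      have "s \<noteq> 0" using s(2) G0 [of \<omega>] p by auto
      then have "cis \<theta> = sgn (of_real s * cis \<theta>)"
        using s(1) by (simp add: sgn_eq norm_mult)
      then have "cis \<theta> \<in> sgn ` {z. poly p z = 0}" using s(2) by blast
      then show "\<theta> \<in> cis -` (sgn ` {z. poly p z = 0}) \<inter> {0..1}" using \<theta>(1) by simp
    qed
    moreover have "finite (cis -` (sgn ` {z. poly p z = 0}) \<inter> {0..1})"
      by (rule finite_vimage_IntI [OF finite_imageI [OF fin] inj])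
    ultimately show "finite {\<theta> \<in> {0..1}. scale_fun I (cis \<theta>) \<omega> \<in> E}" by (rule finite_subset)
  qed
  then have "AE \<omega> in ?M. \<omega> \<notin> E" by (rule AE_not_in)
  then show ?thesis by (rule AE_mp, intro AE_I2) (auto simp: E_def)
qed

section \<open>Polynomial functions\<close>

text \<open>A space of polynomial functions whose coefficient arrays stay behind a quantifier until
  they are chosen once for the homotopy; \<open>S\<close> records which variables may occur.\<close>

definition pfun :: "nat \<Rightarrow> nat set \<Rightarrow> nat \<Rightarrow> ((nat \<Rightarrow> complex) \<Rightarrow> complex) \<Rightarrow> bool" where
  "pfun n S d f \<longleftrightarrow> (\<exists>c. \<forall>x. f x = (\<Sum>e\<in>expos S d. c e * mon n e x))"

context
  fixes n :: nat and S :: "nat set"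
  assumes S: "finite S"
begin

lemma pfun_const: "pfun n S d (\<lambda>_. a)"
  unfolding pfun_def
proof (intro exI allI)
  fix x
  have "(\<Sum>e\<in>expos S d. (if e = (\<lambda>_. 0) then a else 0) * mon n e x) =
      (\<Sum>e\<in>expos S d. if e = (\<lambda>_. 0) then a else 0)"
    by (intro sum.cong) auto
  also have "\<dots> = a"
  proof -
    have "(\<lambda>_. 0) \<in> expos S d" by (simp add: expos_def)
    then show ?thesis using finite_expos [OF S, of d] by simp
  qed
  finally show "a = (\<Sum>e\<in>expos S d. (if e = (\<lambda>_. 0) then a else 0) * mon n e x)" ..
qed

lemma pfun_var:
  assumes "j \<in> S" "j < n"
  shows "pfun n S 1 (\<lambda>x. x j)"
  unfolding pfun_def
proof (intro exI allI)
  fix x :: "nat \<Rightarrow> complex"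
  define u where "u = (\<lambda>l. if l = j then 1 else 0 :: nat)"
  have "u \<in> expos S 1" using assms S by (auto simp: expos_def u_def)
  have "(\<Sum>e\<in>expos S 1. (if e = u then 1 else 0) * mon n e x) = (\<Sum>e\<in>expos S 1. if e = u then mon n u x else 0)"
    by (intro sum.cong) auto
  also have "\<dots> = x j" using \<open>u \<in> expos S 1\<close> S assms mon_unit [of j n x] by (subst sum.delta) (auto simp: u_def)
  finally show "x j = (\<Sum>e\<in>expos S 1. (if e = (\<lambda>l. if l = j then 1 else 0) then 1 else 0) * mon n e x)"
    by (simp add: u_def)
qed

lemma pfun_add: "pfun n S d f \<Longrightarrow> pfun n S d g \<Longrightarrow> pfun n S d (\<lambda>x. f x + g x)"
  unfolding pfun_def
proof (elim exE)
  fix c c' assume "\<forall>x. f x = (\<Sum>e\<in>expos S d. c e * mon n e x)" "\<forall>x. g x = (\<Sum>e\<in>expos S d. c' e * mon n e x)"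
  then show "\<exists>c. \<forall>x. f x + g x = (\<Sum>e\<in>expos S d. c e * mon n e x)"
    by (intro exI [of _ "\<lambda>e. c e + c' e"]) (simp add: distrib_right sum.distrib)
qed

lemma pfun_sum: "(\<And>i. i \<in> I \<Longrightarrow> pfun n S d (\<lambda>x. f x i)) \<Longrightarrow> pfun n S d (\<lambda>x. \<Sum>i\<in>I. f x i)"
  by (induction I rule: infinite_finite_induct) (auto intro: pfun_const pfun_add)

lemma pfun_mono:
  assumes "pfun n S d f" "d \<le> d'"
  shows "pfun n S d' f"
proof -
  obtain c where c: "\<And>x. f x = (\<Sum>e\<in>expos S d. c e * mon n e x)" using assms(1) by (auto simp: pfun_def)
  have sub: "expos S d \<subseteq> expos S d'" using assms(2) by (auto simp: expos_def)
  have "f x = (\<Sum>e\<in>expos S d'. (if e \<in> expos S d then c e else 0) * mon n e x)" for x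
    unfolding c by (rule sum.mono_neutral_cong_left [OF finite_expos [OF S] sub]) auto
  then show ?thesis unfolding pfun_def by (intro exI allI)
qed

text \<open>The Cauchy product: pairs of exponent vectors are grouped by their sum.\<close>

lemma pfun_mult:
  assumes "pfun n S d f" "pfun n S d' g"
  shows "pfun n S (d + d') (\<lambda>x. f x * g x)"
proof -
  obtain c where c: "\<And>x. f x = (\<Sum>e\<in>expos S d. c e * mon n e x)" using assms(1) by (auto simp: pfun_def)
  obtain c' where c': "\<And>x. g x = (\<Sum>e\<in>expos S d'. c' e * mon n e x)" using assms(2) by (auto simp: pfun_def)
  define ad where "ad p = (\<lambda>j. fst p j + snd p j)" for p :: "(nat \<Rightarrow> nat) \<times> (nat \<Rightarrow> nat)"
  define P where "P = expos S d \<times> expos S d'"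
  have finP: "finite P" using S by (simp add: P_def)
  have ad: "ad ` P \<subseteq> expos S (d + d')" by (auto simp: ad_def P_def expos_def sum.distrib add_mono)
  have "f x * g x = (\<Sum>e\<in>expos S (d + d'). (\<Sum>p | p \<in> P \<and> ad p = e. c (fst p) * c' (snd p)) * mon n e x)" for x
  proof -
    have "f x * g x = (\<Sum>p\<in>P. c (fst p) * c' (snd p) * mon n (ad p) x)"
      unfolding c c' sum_product sum.cartesian_product P_def
      by (intro sum.cong) (auto simp: ad_def mon_add)
    also have "\<dots> = (\<Sum>e\<in>expos S (d + d'). \<Sum>p | p \<in> P \<and> ad p = e. c (fst p) * c' (snd p) * mon n (ad p) x)"
      by (rule sum.group [symmetric]) (use finP ad S in auto)
    also have "\<dots> = (\<Sum>e\<in>expos S (d + d'). (\<Sum>p | p \<in> P \<and> ad p = e. c (fst p) * c' (snd p)) * mon n e x)"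
      unfolding sum_distrib_right by (intro sum.cong) auto
    finally show ?thesis .
  qed
  then show ?thesis
    unfolding pfun_def
    by (intro exI [of _ "\<lambda>e. \<Sum>p | p \<in> P \<and> ad p = e. c (fst p) * c' (snd p)"] allI)
qed

lemma pfun_power: "pfun n S 1 f \<Longrightarrow> pfun n S k (\<lambda>x. f x ^ k)"
proof (induction k)
  case (Suc k)
  then show ?case using pfun_mult [of 1 f k "\<lambda>x. f x ^ k"] by simp
qed (simp add: pfun_const)

lemma pfun_prod:
  "finite J \<Longrightarrow> (\<And>j. j \<in> J \<Longrightarrow> pfun n S (d j) (\<lambda>x. f x j)) \<Longrightarrow> pfun n S (sum d J) (\<lambda>x. \<Prod>j\<in>J. f x j)"
  by (induction J rule: finite_induct) (auto intro: pfun_const pfun_mult)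

end

section \<open>Evaluation of multivariate polynomials\<close>

definition mval :: "(nat \<Rightarrow>\<^sub>0 nat) \<Rightarrow> (nat \<Rightarrow> complex) \<Rightarrow> complex" where
  "mval m x = (\<Prod>j\<in>Poly_Mapping.keys m. x j ^ Poly_Mapping.lookup m j)"

definition eval_mpoly :: "cmpoly \<Rightarrow> (nat \<Rightarrow> complex) \<Rightarrow> complex" where
  "eval_mpoly f x = (\<Sum>m\<in>Poly_Mapping.keys f. Poly_Mapping.lookup f m * mval m x)"

lemma mval_superset:
  assumes "finite J" "Poly_Mapping.keys m \<subseteq> J"
  shows "mval m x = (\<Prod>j\<in>J. x j ^ Poly_Mapping.lookup m j)"
  unfolding mval_def
  by (rule prod.mono_neutral_left [OF assms]) (auto simp: in_keys_iff)

lemma mval_add: "mval (a + b) x = mval a x * mval b x"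
proof -
  define J where "J = Poly_Mapping.keys a \<union> Poly_Mapping.keys b"
  have J: "finite J" "Poly_Mapping.keys a \<subseteq> J" "Poly_Mapping.keys b \<subseteq> J" "Poly_Mapping.keys (a + b) \<subseteq> J"
    using Poly_Mapping.keys_add [of a b] by (auto simp: J_def)
  show ?thesis
    unfolding mval_superset [OF J(1,2)] mval_superset [OF J(1,3)] mval_superset [OF J(1,4)]
    by (simp add: lookup_add power_add prod.distrib)
qed

lemma eval_mpoly_superset:
  assumes "finite J" "Poly_Mapping.keys f \<subseteq> J"
  shows "eval_mpoly f x = (\<Sum>m\<in>J. Poly_Mapping.lookup f m * mval m x)"
  unfolding eval_mpoly_def
  by (rule sum.mono_neutral_left [OF assms]) (auto simp: in_keys_iff)

lemma eval_mpoly_add: "eval_mpoly (f + g) x = eval_mpoly f x + eval_mpoly g x"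
proof -
  define J where "J = Poly_Mapping.keys f \<union> Poly_Mapping.keys g"
  have J: "finite J" "Poly_Mapping.keys f \<subseteq> J" "Poly_Mapping.keys g \<subseteq> J" "Poly_Mapping.keys (f + g) \<subseteq> J"
    using Poly_Mapping.keys_add [of f g] by (auto simp: J_def)
  show ?thesis
    unfolding eval_mpoly_superset [OF J(1,2)] eval_mpoly_superset [OF J(1,3)] eval_mpoly_superset [OF J(1,4)]
    by (simp add: lookup_add distrib_right sum.distrib)
qed

lemma eval_mpoly_zero: "eval_mpoly 0 x = 0"
  by (simp add: eval_mpoly_def)

lemma eval_mpoly_sum: "eval_mpoly (\<Sum>i\<in>I. f i) x = (\<Sum>i\<in>I. eval_mpoly (f i) x)"
  by (induction I rule: infinite_finite_induct) (auto simp: eval_mpoly_zero eval_mpoly_add)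

lemma eval_mpoly_single: "eval_mpoly (Poly_Mapping.single m a) x = a * mval m x"
  by (cases "a = 0") (auto simp: eval_mpoly_def)

lemma sum_singles: "f = (\<Sum>m\<in>Poly_Mapping.keys f. Poly_Mapping.single m (Poly_Mapping.lookup f m))"
  by (rule poly_mapping_eqI)
    (auto simp: lookup_sum lookup_single when_def in_keys_iff sum.delta')

lemma eval_mpoly_mult: "eval_mpoly (f * g) x = eval_mpoly f x * eval_mpoly g x"
proof -
  have "f * g = (\<Sum>m\<in>Poly_Mapping.keys f. \<Sum>l\<in>Poly_Mapping.keys g.
      Poly_Mapping.single (m + l) (Poly_Mapping.lookup f m * Poly_Mapping.lookup g l))"
    by (subst sum_singles [of f], subst sum_singles [of g]) (simp only: sum_product mult_single)
  then have "eval_mpoly (f * g) x = (\<Sum>m\<in>Poly_Mapping.keys f. \<Sum>l\<in>Poly_Mapping.keys g.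
      (Poly_Mapping.lookup f m * Poly_Mapping.lookup g l) * (mval m x * mval l x))"
    by (simp only: eval_mpoly_sum eval_mpoly_single mval_add)
  also have "\<dots> = eval_mpoly f x * eval_mpoly g x"
    unfolding eval_mpoly_def sum_product by (simp add: mult_ac)
  finally show ?thesis .
qed

lemma eval_mpoly_const: "eval_mpoly (mpoly_const a) x = a"
  by (simp add: mpoly_const_def eval_mpoly_single mval_def)

lemma eval_mpoly_var: "eval_mpoly (mpoly_var j) x = x j"
  by (simp add: mpoly_var_def eval_mpoly_single mval_def)

lemma eval_mpoly_hom: "comm_ring_hom (\<lambda>f :: cmpoly. eval_mpoly f x)"
proof
  show "eval_mpoly 1 x = 1" using eval_mpoly_const [of 1 x] by (simp add: mpoly_const_def)
qed (simp_all add: eval_mpoly_zero eval_mpoly_add eval_mpoly_mult)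

lemma eval_det_H_poly: "eval_mpoly (det_H_poly k m A) x = Determinant.det (mep_matrix (\<lambda>a. a) k m A x)"
proof -
  interpret h: comm_ring_hom "\<lambda>f. eval_mpoly f x" by (rule eval_mpoly_hom)
  have "map_mat (\<lambda>f. eval_mpoly f x) (mep_matrix mpoly_const k m A mpoly_var) = mep_matrix (\<lambda>a. a) k m A x"
    by (rule eq_matI)
      (auto simp: mep_matrix_def h.hom_minus h.hom_sum h.hom_mult eval_mpoly_const eval_mpoly_var)
  then show ?thesis unfolding det_H_poly_def by (metis h.hom_det)
qed

lemma mep_matrix_cong: "(\<And>j. j < k \<Longrightarrow> l j = l' j) \<Longrightarrow> mep_matrix h k m A l = mep_matrix h k m A l'"
  by (auto simp: mep_matrix_def intro!: eq_matI sum.cong)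

text \<open>Substituting functions of degree 1 into a polynomial does not raise its total degree.
  Going through \<open>det_H_poly\<close> rather than through the Leibniz formula gives the bound
  \<open>d i\<close> instead of the possibly larger matrix size.\<close>

lemma pfun_det:
  assumes S: "finite S" and l: "\<And>j. j < k \<Longrightarrow> pfun n S 1 (\<lambda>x. l x j)"
  shows "pfun n S (total_degree (det_H_poly k m A)) (\<lambda>x. Determinant.det (mep_matrix (\<lambda>a. a) k m A (l x)))"
proof -
  define f where "f = det_H_poly k m A"
  \<comment> \<open>Extended by 0, because a monomial of the determinant polynomial is not known to
    avoid variables of index at least \<open>k\<close>, where \<open>l\<close> is arbitrary.\<close>
  define l' where "l' x j = (if j < k then l x j else 0)" for x j
  have l': "pfun n S 1 (\<lambda>x. l' x j)" for j
  proof (cases "j < k")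
    case True
    then show ?thesis using l [OF True] by (simp only: l'_def if_True)
  next
    case False
    then show ?thesis using pfun_const [OF S] by (simp only: l'_def if_False)
  qed
  have "pfun n S (total_degree f) (\<lambda>x. Poly_Mapping.lookup f \<mu> * mval \<mu> (l' x))"
    if "\<mu> \<in> Poly_Mapping.keys f" for \<mu>
  proof -
    have "pfun n S (\<Sum>j\<in>Poly_Mapping.keys \<mu>. Poly_Mapping.lookup \<mu> j) (\<lambda>x. mval \<mu> (l' x))"
      unfolding mval_def by (intro pfun_prod [OF S] pfun_power [OF S] l') simp
    moreover have "(\<Sum>j\<in>Poly_Mapping.keys \<mu>. Poly_Mapping.lookup \<mu> j) \<le> total_degree f"
      unfolding total_degree_def using that by (intro Max_ge) auto
    ultimately have "pfun n S (total_degree f) (\<lambda>x. mval \<mu> (l' x))" by (rule pfun_mono [OF S])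
    from pfun_mult [OF S pfun_const [OF S, of _ 0] this] show ?thesis by simp
  qed
  then have "pfun n S (total_degree f) (\<lambda>x. eval_mpoly f (l' x))"
    unfolding eval_mpoly_def by (intro pfun_sum [OF S])
  moreover have "eval_mpoly f (l' x) = Determinant.det (mep_matrix (\<lambda>a. a) k m A (l x))" for x
    unfolding f_def eval_det_H_poly
    by (intro arg_cong [of _ _ Determinant.det] mep_matrix_cong) (simp add: l'_def)
  ultimately show ?thesis by (simp add: f_def)
qed

section \<open>Pencils with a simple eigenvalue\<close>

lemma poly_at_hom: "comm_ring_hom (\<lambda>f. poly f (\<beta>::complex))"
  by unfold_locales auto

lemma mep_matrix_carrier [simp]: "mep_matrix h k m A l \<in> carrier_mat m m"
  by (simp add: mep_matrix_def)

lemma H_mat_carrier [simp]: "H_mat k m A l \<in> carrier_mat m m"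
  by (simp add: H_mat_def)

lemma poly_pencil_matrix:
  assumes "p \<in> carrier_vec k" "q \<in> carrier_vec k"
  shows "map_mat (\<lambda>f. poly f \<beta>) (mep_matrix (\<lambda>a. [:a:]) k m A (\<lambda>j. [:p $ j, q $ j:])) =
    H_mat k m A (\<beta> \<cdot>\<^sub>v q + p)"
  using assms by (intro eq_matI) (auto simp: H_mat_def mep_matrix_def poly_sum algebra_simps sum.distrib)

lemma poly_pencil_det:
  assumes "p \<in> carrier_vec k" "q \<in> carrier_vec k"
  shows "poly (pencil_det k m A p q) \<beta> = Determinant.det (H_mat k m A (\<beta> \<cdot>\<^sub>v q + p))"
proof -
  interpret h: comm_ring_hom "\<lambda>f. poly f \<beta>" by (rule poly_at_hom)
  show ?thesis unfolding pencil_det_def poly_pencil_matrix [OF assms, symmetric] h.hom_det ..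
qed

text \<open>This is \<open>pfun_det\<close> in one variable, combined with the fact that polynomials
  with equal values everywhere are equal.\<close>

lemma degree_pencil_det:
  assumes pq: "p \<in> carrier_vec k" "q \<in> carrier_vec k"
  shows "degree (pencil_det k m A p q) \<le> total_degree (det_H_poly k m A)"
proof -
  define D where "D = total_degree (det_H_poly k m A)"
  have S: "finite {..<1::nat}" by simp
  have "pfun 1 {..<1} (0 + 1) (\<lambda>x. q $ j * x 0)" for j
    by (rule pfun_mult [OF S pfun_const [OF S] pfun_var [OF S]]) auto
  then have "pfun 1 {..<1} 1 (\<lambda>x. p $ j + q $ j * x 0)" for j
    by (intro pfun_add [OF S] pfun_const [OF S]) simp
  from pfun_det [where l = "\<lambda>x j. p $ j + q $ j * x 0", OF S this, of k m A] obtain c where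
    c: "\<And>x. Determinant.det (mep_matrix (\<lambda>a. a) k m A (\<lambda>j. p $ j + q $ j * x 0)) =
      (\<Sum>e\<in>expos {..<1} D. c e * mon 1 e x)" by (auto simp: pfun_def D_def)
  define P where "P = (\<Sum>i\<le>D. monom (c (\<lambda>j. if j = 0 then i else 0)) i)"
  have "poly (pencil_det k m A p q) \<beta> = poly P \<beta>" for \<beta>
  proof -
    have "poly (pencil_det k m A p q) \<beta> =
        Determinant.det (mep_matrix (\<lambda>a. a) k m A (\<lambda>j. p $ j + q $ j * (\<lambda>_. \<beta>) 0))"
      unfolding poly_pencil_det [OF pq] H_mat_def
      by (intro arg_cong [of _ _ Determinant.det] mep_matrix_cong) (use pq in \<open>auto simp: mult.commute\<close>)
    also have "\<dots> = (\<Sum>e\<in>expos {..<1} D. c e * mon 1 e (\<lambda>_. \<beta>))" by (rule c)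
    also have "\<dots> = poly P \<beta>"
      by (subst sum_expos_single [of 0]) (auto simp: expos_def P_def poly_sum poly_monom mon_def)
    finally show ?thesis .
  qed
  then have "pencil_det k m A p q = P" by (simp add: poly_eq_poly_eq_iff [symmetric] fun_eq_iff)
  moreover have "degree P \<le> D"
    unfolding P_def by (intro degree_sum_le) (auto intro: order_trans [OF degree_monom_le])
  ultimately show ?thesis by (simp add: D_def)
qed

text \<open>If all cofactors vanished at the root, the root would have multiplicity at least \<open>m\<close> in
  \<open>det (adj M) = (det M) ^ (m - 1)\<close>.\<close>

lemma adj_nonzero_of_simple_root:
  assumes pq: "p \<in> carrier_vec k" "q \<in> carrier_vec k"
    and "pencil_det k m A p q \<noteq> 0" and ord: "Polynomial.order \<beta> (pencil_det k m A p q) = 1"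
  obtains r c where "r < m" "c < m" "adj_mat (H_mat k m A (\<beta> \<cdot>\<^sub>v q + p)) $$ (r, c) \<noteq> 0"
proof -
  interpret h: comm_ring_hom "\<lambda>f. poly f \<beta>" by (rule poly_at_hom)
  define Mp where "Mp = mep_matrix (\<lambda>a. [:a:]) k m A (\<lambda>j. [:p $ j, q $ j:])"
  define X where "X = [:- \<beta>, 1:]"
  have Mp: "Mp \<in> carrier_mat m m" by (simp add: Mp_def)
  have P: "Determinant.det Mp = pencil_det k m A p q" by (simp add: Mp_def pencil_det_def)
  have "\<exists>r<m. \<exists>c<m. adj_mat (H_mat k m A (\<beta> \<cdot>\<^sub>v q + p)) $$ (r, c) \<noteq> 0"
  proof (rule ccontr)
    assume neg: "\<not> ?thesis"
    \<comment> \<open>Cofactors commute with evaluation at \<open>\<beta>\<close>, so their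
      vanishing there means divisibility by \<open>X\<close>.\<close>
    have dvd: "X dvd adj_mat Mp $$ (r, c)" if "r < m" "c < m" for r c
    proof -
      have "map_mat (\<lambda>f. poly f \<beta>) (mat_delete Mp c r) = mat_delete (H_mat k m A (\<beta> \<cdot>\<^sub>v q + p)) c r"
        using Mp unfolding poly_pencil_matrix [OF pq, symmetric] Mp_def [symmetric] mat_delete_def
        using that by (intro eq_matI) auto
      then have "poly (adj_mat Mp $$ (r, c)) \<beta> = adj_mat (H_mat k m A (\<beta> \<cdot>\<^sub>v q + p)) $$ (r, c)"
        using that Mp H_mat_carrier [of k m A "\<beta> \<cdot>\<^sub>v q + p"]
        by (auto simp: adj_mat_def cofactor_def poly_power h.hom_det [symmetric]
            carrier_matD [OF H_mat_carrier])
      then show ?thesis using neg that by (auto simp: X_def poly_eq_0_iff_dvd)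
    qed
    have Adj: "adj_mat Mp \<in> carrier_mat m m" using adj_mat(1) [OF Mp] .
    have "X ^ m dvd (\<Prod>i = 0..<m. adj_mat Mp $$ (i, \<pi> i))" if "\<pi> permutes {0..<m}" for \<pi>
    proof -
      have "(\<Prod>i = 0..<m. X) dvd (\<Prod>i = 0..<m. adj_mat Mp $$ (i, \<pi> i))"
        by (rule prod_dvd_prod) (use dvd permutes_in_image [OF that] in auto)
      then show ?thesis by simp
    qed
    then have dvd_det: "X ^ m dvd Determinant.det (adj_mat Mp)"
      unfolding det_def' [OF Adj] by (intro dvd_sum dvd_mult) auto
    have "Determinant.det Mp * Determinant.det (adj_mat Mp) = Determinant.det Mp ^ m"
      using det_mult [OF Mp Adj] adj_mat(2) [OF Mp] by (simp add: det_smult)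
    \<comment> \<open>The empty matrix has determinant 1, which has no root.\<close>
    moreover have "m \<noteq> 0"
    proof
      assume "m = 0"
      then have "Determinant.det Mp = 1" using Mp by (auto intro: det_dim_zero)
      then show False using ord P by simp
    qed
    then obtain m' where m': "m = Suc m'" by (cases m) auto
    ultimately have det_adj: "Determinant.det (adj_mat Mp) = Determinant.det Mp ^ m'"
      using assms(3) P by simp
    \<comment> \<open>The determinant contains the factor \<open>X\<close> exactly once; cancelling
      \<open>X ^ m'\<close> in the divisibility leaves \<open>X dvd Q ^ m'\<close>, which is
      impossible.\<close>
    obtain Q where Q: "Determinant.det Mp = X * Q" "\<not> X dvd Q"
      using order_decomp [OF assms(3), of \<beta>] ord P by (auto simp: X_def)
    have "X ^ m' * X dvd X ^ m' * Q ^ m'"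
      using dvd_det unfolding det_adj Q(1) m' by (simp add: power_mult_distrib mult.commute)
    moreover have "X \<noteq> 0" by (simp add: X_def)
    ultimately have "X dvd Q ^ m'" using dvd_mult_cancel_left [of "X ^ m'" X "Q ^ m'"] by simp
    then have "poly Q \<beta> ^ m' = 0" by (simp add: X_def poly_eq_0_iff_dvd [symmetric] poly_power)
    then have "X dvd Q" by (simp add: X_def poly_eq_0_iff_dvd [symmetric])
    then show False using Q(2) by simp
  qed
  then show ?thesis using that by blast
qed

text \<open>As \<open>M\<close> is singular, the columns of its adjugate lie in the kernel.
  Replacing row \<open>c\<close> of \<open>M\<close> by the unit row at \<open>r\<close> gives a
  matrix whose determinant is the cofactor \<open>adj_mat M $$ (r, c)\<close>, so a kernel vector
  with vanishing component \<open>r\<close> is zero; subtracting a multiple of \<open>w\<close>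
  reduces every kernel vector to this case.\<close>

lemma kernel_spanned_by_adj_column:
  fixes M :: "complex mat"
  assumes M: "M \<in> carrier_mat m m" and det: "Determinant.det M = 0"
    and rc: "r < m" "c < m" "adj_mat M $$ (r, c) \<noteq> 0"
  defines "w \<equiv> col (adj_mat M) c"
  shows "w \<in> carrier_vec m" "w $ r \<noteq> 0" "M *\<^sub>v w = 0\<^sub>v m"
    "\<And>v. v \<in> carrier_vec m \<Longrightarrow> M *\<^sub>v v = 0\<^sub>v m \<Longrightarrow> v = (v $ r / w $ r) \<cdot>\<^sub>v w"
proof -
  have Adj: "adj_mat M \<in> carrier_mat m m" using adj_mat(1) [OF M] .
  show w: "w \<in> carrier_vec m" using Adj by (simp add: w_def col_def)
  show wr: "w $ r \<noteq> 0" using rc Adj by (simp add: w_def)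
  have "M *\<^sub>v w = col (M * adj_mat M) c" unfolding w_def by (rule col_mult2 [OF M Adj rc(2), symmetric])
  also have "\<dots> = 0\<^sub>v m" unfolding adj_mat(2) [OF M] det using rc by (intro eq_vecI) auto
  finally show Mw: "M *\<^sub>v w = 0\<^sub>v m" .
  have zero: "v = 0\<^sub>v m" if v: "v \<in> carrier_vec m" "M *\<^sub>v v = 0\<^sub>v m" "v $ r = 0" for v
  proof -
    define M' where "M' = mat m m (\<lambda>(i, j). if i = c then (if j = r then 1 else 0) else M $$ (i, j))"
    have M': "M' \<in> carrier_mat m m" by (simp add: M'_def)
    have "Determinant.det M' = (\<Sum>j<m. M' $$ (c, j) * cofactor M' c j)"
      by (rule laplace_expansion_row [OF M' rc(2)])
    also have "\<dots> = (\<Sum>j<m. if j = r then cofactor M' c r else 0)"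
      using rc by (intro sum.cong) (auto simp: M'_def)
    also have "\<dots> = cofactor M' c r" using rc by simp
    also have "mat_delete M' c r = mat_delete M c r"
      using M rc unfolding mat_delete_def by (intro eq_matI) (auto simp: M'_def)
    then have "cofactor M' c r = adj_mat M $$ (r, c)"
      using M rc by (simp add: cofactor_def adj_mat_def)
    finally have "Determinant.det M' \<noteq> 0" using rc(3) by simp
    moreover have "M' *\<^sub>v v = 0\<^sub>v m"
    proof (rule eq_vecI)
      fix i assume "i < dim_vec (0\<^sub>v m :: complex vec)"
      then have i: "i < m" by simp
      show "(M' *\<^sub>v v) $ i = 0\<^sub>v m $ i"
      proof (cases "i = c")
        case True
        have "(M' *\<^sub>v v) $ i = (\<Sum>j<m. (if j = r then 1 else 0) * v $ j)"
          using v(1) i True by (simp add: M'_def scalar_prod_def atLeast0LessThan)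
        also have "\<dots> = (\<Sum>j<m. if j = r then v $ r else 0)"
          by (intro sum.cong) auto
        finally show ?thesis using v(3) rc i by simp
      next
        case False
        have "(M' *\<^sub>v v) $ i = (M *\<^sub>v v) $ i"
          using v(1) i False M by (auto simp: M'_def scalar_prod_def intro!: sum.cong)
        then show ?thesis using v(2) by simp
      qed
    qed (simp add: M'_def)
    ultimately show ?thesis using det_0_iff_vec_prod_zero [OF M'] v(1) by blast
  qed
  fix v assume v: "v \<in> carrier_vec m" "M *\<^sub>v v = 0\<^sub>v m"
  define a where "a = v $ r / w $ r"
  have "M *\<^sub>v (v - a \<cdot>\<^sub>v w) = 0\<^sub>v m"
    using M v w Mw by (simp add: mult_minus_distrib_mat_vec mult_mat_vec) (intro eq_vecI, auto)
  moreover have "v - a \<cdot>\<^sub>v w \<in> carrier_vec m" using v w by simp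
  moreover have "(v - a \<cdot>\<^sub>v w) $ r = 0" using v w rc wr by (simp add: a_def)
  ultimately have d: "v - a \<cdot>\<^sub>v w = 0\<^sub>v m" using zero by blast
  have "v = a \<cdot>\<^sub>v w"
  proof (rule eq_vecI)
    fix i assume "i < dim_vec (a \<cdot>\<^sub>v w)"
    then have i: "i < m" using w by simp
    have "(v - a \<cdot>\<^sub>v w) $ i = 0" using d i by simp
    then show "v $ i = (a \<cdot>\<^sub>v w) $ i" using v w i by simp
  qed (use v w in auto)
  then show "v = (v $ r / w $ r) \<cdot>\<^sub>v w" by (simp add: a_def)
qed

section \<open>Coordinates adapted to an affine linear map\<close>

text \<open>\<open>B\<close> is completed by one row that reads off a coordinate \<open>j\<close>
  with \<open>q $ j \<noteq> 0\<close>, scaled so that \<open>q\<close> becomes the last unit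
  vector. The result is invertible because a vector in its kernel is a multiple of \<open>q\<close>
  with vanishing coordinate \<open>j\<close>.\<close>

lemma adapted_coordinates:
  fixes B :: "complex mat"
  assumes k: "1 \<le> k" and B: "B \<in> carrier_mat (k - 1) k" and q: "q \<in> carrier_vec k"
    and ker: "mat_kernel B = range (\<lambda>a. a \<cdot>\<^sub>v q)"
  shows "\<exists>S T. S \<in> carrier_mat k k \<and> T \<in> carrier_mat k k \<and> S * T = 1\<^sub>m k \<and> T * S = 1\<^sub>m k \<and>
    (\<forall>v\<in>carrier_vec k. \<forall>r<k - 1. (S *\<^sub>v v) $ r = (B *\<^sub>v v) $ r) \<and> S *\<^sub>v q = unit_vec k (k - 1)"
proof -
  have kerI: "v \<in> range (\<lambda>a. a \<cdot>\<^sub>v q)" if "v \<in> carrier_vec k" "B *\<^sub>v v = 0\<^sub>v (k - 1)" for v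
    using that B ker by (auto simp: mat_kernel_def)
  have "1 \<cdot>\<^sub>v q \<in> mat_kernel B" unfolding ker by blast
  then have Bq: "B *\<^sub>v q = 0\<^sub>v (k - 1)" using B by (auto simp: mat_kernel_def)
  \<comment> \<open>\<open>B\<close> has more columns than rows, hence a nonzero kernel vector; as
    this is a multiple of \<open>q\<close>, it exhibits a nonzero coordinate of
    \<open>q\<close>.\<close>
  obtain c where c: "\<exists>x\<in>{..<k}. c x \<noteq> 0" "\<And>a. a \<in> {..<k - 1} \<Longrightarrow> (\<Sum>x\<in>{..<k}. c x * B $$ (a, x)) = 0"
    using underdetermined_system [of "{..<k - 1}" "{..<k}" "\<lambda>a x. B $$ (a, x)"] k by auto
  have "B *\<^sub>v vec k c = 0\<^sub>v (k - 1)"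
    using B c(2) by (intro eq_vecI) (auto simp: scalar_prod_def atLeast0LessThan mult.commute)
  then obtain a where a: "vec k c = a \<cdot>\<^sub>v q" using kerI [of "vec k c"] by auto
  obtain j where j: "j < k" "c j \<noteq> 0" using c(1) by auto
  have "a * q $ j = c j" using arg_cong [OF a, of "\<lambda>v. v $ j"] j q by simp
  then have qj: "q $ j \<noteq> 0" using j by auto
  define S where "S = mat k k (\<lambda>(r, s). if r < k - 1 then B $$ (r, s) else if s = j then 1 / q $ j else 0)"
  have S: "S \<in> carrier_mat k k" by (simp add: S_def)
  have S1: "(S *\<^sub>v v) $ r = (B *\<^sub>v v) $ r" if "v \<in> carrier_vec k" "r < k - 1" for v r
    using that B by (auto simp: S_def scalar_prod_def intro!: sum.cong)
  have S2: "(S *\<^sub>v v) $ (k - 1) = v $ j / q $ j" if "v \<in> carrier_vec k" for v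
  proof -
    have "(S *\<^sub>v v) $ (k - 1) = (\<Sum>s<k. (if s = j then 1 / q $ j else 0) * v $ s)"
      using that k by (simp add: S_def scalar_prod_def atLeast0LessThan)
    also have "\<dots> = (\<Sum>s<k. if s = j then v $ j / q $ j else 0)"
      by (intro sum.cong) auto
    finally show ?thesis using j by simp
  qed
  have "Determinant.det S \<noteq> 0"
  proof
    assume "Determinant.det S = 0"
    then obtain v where v: "v \<in> carrier_vec k" "v \<noteq> 0\<^sub>v k" "S *\<^sub>v v = 0\<^sub>v k"
      using det_0_iff_vec_prod_zero [OF S] by blast
    have "B *\<^sub>v v = 0\<^sub>v (k - 1)"
      using S1 [OF v(1)] v(3) B by (intro eq_vecI) auto
    then obtain b where b: "v = b \<cdot>\<^sub>v q" using kerI [OF v(1)] by auto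
    have "v $ j / q $ j = 0" using S2 [OF v(1)] v(3) k by simp
    then have "b = 0" using b j q qj by simp
    then have "v = 0\<^sub>v k" using b q by (intro eq_vecI) auto
    then show False using v(2) by simp
  qed
  then have det: "Determinant.det S \<noteq> 0" .
  define T where "T = inverse (Determinant.det S) \<cdot>\<^sub>m adj_mat S"
  have Adj: "adj_mat S \<in> carrier_mat k k" using adj_mat(1) [OF S] .
  have T: "T \<in> carrier_mat k k" using Adj by (simp add: T_def)
  have ST: "S * T = 1\<^sub>m k" "T * S = 1\<^sub>m k"
    using adj_mat [OF S] S det
    by (auto simp: T_def mult_smult_distrib [OF S] mult_smult_assoc_mat [OF Adj S] intro!: eq_matI)
  have "S *\<^sub>v q = unit_vec k (k - 1)"
  proof (rule eq_vecI)
    fix r assume "r < dim_vec (unit_vec k (k - 1) :: complex vec)"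
    then have r: "r < k" by simp
    show "(S *\<^sub>v q) $ r = unit_vec k (k - 1) $ r"
    proof (cases "r < k - 1")
      case True
      then show ?thesis using S1 [OF q] Bq r by simp
    next
      case False
      then have "r = k - 1" using r by simp
      then show ?thesis using S2 [OF q] qj k by simp
    qed
  qed (use S in simp)
  then show ?thesis using S T ST S1 by blast
qed

context square_system
begin

text \<open>Multiplying the equations by nonzero constants changes neither the zeros nor the
  solutions of the Macaulay relations; the latter gives \<open>dl C' \<noteq> 0\<close> without
  computing this determinant.\<close>

lemma good_scale:
  assumes "good C" and \<gamma>: "\<And>i. i < n \<Longrightarrow> \<gamma> i \<noteq> 0" and C': "\<And>i e. i < n \<Longrightarrow> C' i e = \<gamma> i * C i e"
  shows "good C'"
proof -
  have ev: "ev C' i x = \<gamma> i * ev C i x" if "i < n" for i x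
    using C' that by (simp add: ev_def sum_distrib_left mult_ac)
  have z: "zeros C' = zeros C" using ev \<gamma> by (auto simp: zeros_def)
  have "dl C' \<noteq> 0"
  proof (rule dl_nonzero)
    fix X m assume X: "rel C' X" "\<And>a. a \<in> red \<Longrightarrow> X a = 0" and m: "m \<in> nred"
    have "rel C X"
      unfolding rel_def
    proof
      fix m assume m: "m \<in> nred"
      have "0 = (\<Sum>e\<in>expos {..<n} (D (sel m)). C' (sel m) e * X (shift m e))"
        using X(1) m by (simp add: rel_def)
      also have "\<dots> = \<gamma> (sel m) * (\<Sum>e\<in>expos {..<n} (D (sel m)). C (sel m) e * X (shift m e))"
        using C' sel_nred(1) [OF m] by (simp add: sum_distrib_left mult_ac)
      finally show "(\<Sum>e\<in>expos {..<n} (D (sel m)). C (sel m) e * X (shift m e)) = 0"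
        using \<gamma> [OF sel_nred(1) [OF m]] by simp
    qed
    moreover have "m \<in> big" using m by (simp add: nred_def)
    ultimately have "dl C * X m = (\<Sum>b\<in>red. K C m b * X b)" by (rule K_reduction)
    then show "X m = 0" using X(2) assms(1) by (simp add: good_def)
  qed
  then show ?thesis using assms(1) z by (simp add: good_def)
qed

text \<open>The Jacobian at a zero of a good system is invertible, so its image contains the unit
  vector \<open>i\<close>. Applied to a determinant equation this exhibits a line on which the zero
  is a simple root.\<close>

lemma good_has_direction:
  assumes "good C" "x \<in> zeros C" "i < n"
  obtains v where "\<And>j. n \<le> j \<Longrightarrow> v j = 0"
    "((\<lambda>z. ev C i (\<lambda>j. x j + z * v j)) has_field_derivative 1) (at 0)"
proof -
  have "Determinant.det (mat n n (\<lambda>(i, j). jac C i j x x)) \<noteq> 0"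
    using jdet_nonzero [OF assms(1,2)] by (simp add: jdet_def)
  then obtain w where w: "w \<in> carrier_vec n" "mat n n (\<lambda>(i, j). jac C i j x x) *\<^sub>v w = unit_vec n i"
    using solve_linear_system [of "mat n n (\<lambda>(i, j). jac C i j x x)" n "unit_vec n i"] by auto
  have "(\<Sum>j<n. jac C i j x x * w $ j) = 1"
    using arg_cong [OF w(2), of "\<lambda>u. u $ i"] w(1) assms(3) by (simp add: scalar_prod_def atLeast0LessThan)
  then have "(\<Sum>j<n. jac C i j x x * (if j < n then w $ j else 0)) = 1" by simp
  then show ?thesis
    using that [of "\<lambda>j. if j < n then w $ j else 0"] has_field_derivative_ev [of C i x "\<lambda>j. if j < n then w $ j else 0"]
    by simp
qed

end

section \<open>Projective points\<close>

lemma proj_point_smult: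
  assumes "a \<noteq> 0"
  shows "proj_point (a \<cdot>\<^sub>v v) = proj_point v"
proof
  show "proj_point (a \<cdot>\<^sub>v v) \<subseteq> proj_point v"
  proof
    fix w assume "w \<in> proj_point (a \<cdot>\<^sub>v v)"
    then obtain c where "w = c \<cdot>\<^sub>v (a \<cdot>\<^sub>v v)" "c \<noteq> 0" by (auto simp: proj_point_def)
    then have "w = (c * a) \<cdot>\<^sub>v v" "c * a \<noteq> 0" using assms by (auto simp: smult_smult_assoc)
    then show "w \<in> proj_point v" unfolding proj_point_def by blast
  qed
  show "proj_point v \<subseteq> proj_point (a \<cdot>\<^sub>v v)"
  proof
    fix w assume "w \<in> proj_point v"
    then obtain c where "w = c \<cdot>\<^sub>v v" "c \<noteq> 0" by (auto simp: proj_point_def)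
    then have "w = (c / a) \<cdot>\<^sub>v (a \<cdot>\<^sub>v v)" "c / a \<noteq> 0" using assms by (auto simp: smult_smult_assoc)
    then show "w \<in> proj_point (a \<cdot>\<^sub>v v)" unfolding proj_point_def by blast
  qed
qed

lemma in_proj_point: "v \<in> proj_point v"
proof -
  have "v = 1 \<cdot>\<^sub>v v" by simp
  then show ?thesis unfolding proj_point_def by (metis (mono_tags, lifting) mem_Collect_eq zero_neq_one)
qed

lemma proj_spaceE:
  assumes "x \<in> proj_space m"
  obtains v where "v \<in> carrier_vec m" "v \<noteq> 0\<^sub>v m" "x = proj_point v" "v \<in> x"
  using assms in_proj_point by (auto simp: proj_space_def)

lemma proj_space_mem:
  assumes "x \<in> proj_space m" "v \<in> x"
  shows "v \<in> carrier_vec m" "v \<noteq> 0\<^sub>v m" "x = proj_point v"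
proof -
  obtain u where u: "u \<in> carrier_vec m" "u \<noteq> 0\<^sub>v m" "x = proj_point u" by (rule proj_spaceE [OF assms(1)])
  then obtain c where c: "v = c \<cdot>\<^sub>v u" "c \<noteq> 0" using assms(2) by (auto simp: proj_point_def)
  show "v \<in> carrier_vec m" using c u by simp
  show "x = proj_point v" using c u proj_point_smult by simp
  show "v \<noteq> 0\<^sub>v m"
  proof
    assume "v = 0\<^sub>v m"
    have "u = 0\<^sub>v m"
    proof (rule eq_vecI)
      fix i assume "i < dim_vec (0\<^sub>v m :: complex vec)"
      then have i: "i < m" by simp
      have "c * u $ i = 0" using arg_cong [OF \<open>v = 0\<^sub>v m\<close>, of "\<lambda>v. v $ i"] c u i by simp
      then show "u $ i = 0\<^sub>v m $ i" using c i by simp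
    qed (use u in simp)
    then show False using u by simp
  qed
qed

text \<open>A chosen point of the projectivized kernel, meaningful when \<open>M\<close> is
  singular; it is the only one under \<open>ker_line\<close>.\<close>

definition ker_point :: "nat \<Rightarrow> complex mat \<Rightarrow> complex vec set" where
  "ker_point m M = proj_point (SOME v. v \<in> carrier_vec m \<and> v \<noteq> 0\<^sub>v m \<and> M *\<^sub>v v = 0\<^sub>v m)"

lemma kernel_of_proj_point:
  fixes M :: "complex mat"
  assumes M: "M \<in> carrier_mat m m" and v: "v \<in> carrier_vec m" "M *\<^sub>v v = 0\<^sub>v m" and u: "u \<in> proj_point v"
  shows "M *\<^sub>v u = 0\<^sub>v m"
proof -
  obtain c where "u = c \<cdot>\<^sub>v v" using u by (auto simp: proj_point_def)
  then have "M *\<^sub>v u = c \<cdot>\<^sub>v 0\<^sub>v m" using M v by (simp add: mult_mat_vec)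
  then show ?thesis by (intro eq_vecI) auto
qed

lemma ker_point:
  fixes M :: "complex mat"
  assumes M: "M \<in> carrier_mat m m" "Determinant.det M = 0"
  shows "ker_point m M \<in> proj_space m" "\<And>v. v \<in> ker_point m M \<Longrightarrow> M *\<^sub>v v = 0\<^sub>v m"
proof -
  have "\<exists>v. v \<in> carrier_vec m \<and> v \<noteq> 0\<^sub>v m \<and> M *\<^sub>v v = 0\<^sub>v m"
    using det_0_iff_vec_prod_zero [OF M(1)] M(2) by blast
  from someI_ex [OF this] obtain u where u: "ker_point m M = proj_point u" "u \<in> carrier_vec m" "u \<noteq> 0\<^sub>v m" "M *\<^sub>v u = 0\<^sub>v m"
    unfolding ker_point_def by blast
  show "ker_point m M \<in> proj_space m" using u by (auto simp: proj_space_def)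
  show "M *\<^sub>v v = 0\<^sub>v m" if "v \<in> ker_point m M" for v
    using kernel_of_proj_point [OF M(1) u(2,4)] that u(1) by simp
qed

text \<open>The kernel has dimension at most 1, phrased projectively.\<close>

definition ker_line :: "nat \<Rightarrow> complex mat \<Rightarrow> bool" where
  "ker_line m M \<longleftrightarrow> (\<forall>u v. u \<in> carrier_vec m \<longrightarrow> v \<in> carrier_vec m \<longrightarrow> u \<noteq> 0\<^sub>v m \<longrightarrow> v \<noteq> 0\<^sub>v m \<longrightarrow>
     M *\<^sub>v u = 0\<^sub>v m \<longrightarrow> M *\<^sub>v v = 0\<^sub>v m \<longrightarrow> proj_point u = proj_point v)"

lemma ker_line_point:
  fixes M :: "complex mat"
  assumes M: "M \<in> carrier_mat m m" "Determinant.det M = 0" "ker_line m M"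
    and x: "x \<in> proj_space m" "\<forall>v\<in>x. M *\<^sub>v v = 0\<^sub>v m"
  shows "x = ker_point m M"
proof -
  obtain v where v: "v \<in> carrier_vec m" "v \<noteq> 0\<^sub>v m" "x = proj_point v" "v \<in> x" by (rule proj_spaceE [OF x(1)])
  obtain u where u: "u \<in> carrier_vec m" "u \<noteq> 0\<^sub>v m" "ker_point m M = proj_point u" "u \<in> ker_point m M"
    by (rule proj_spaceE [OF ker_point(1) [OF M(1,2)]])
  have "proj_point v = proj_point u"
    using M(3) v u x(2) ker_point(2) [OF M(1,2) u(4)] unfolding ker_line_def by blast
  then show ?thesis using v u by simp
qed

lemma ker_line_of_adj:
  fixes M :: "complex mat"
  assumes M: "M \<in> carrier_mat m m" and det: "Determinant.det M = 0"
    and rc: "r < m" "c < m" "adj_mat M $$ (r, c) \<noteq> 0"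
  shows "ker_line m M"
  unfolding ker_line_def
proof (intro allI impI)
  note K = kernel_spanned_by_adj_column [OF M det rc]
  define w where "w = col (adj_mat M) c"
  have *: "proj_point v = proj_point w" if "v \<in> carrier_vec m" "v \<noteq> 0\<^sub>v m" "M *\<^sub>v v = 0\<^sub>v m" for v
  proof -
    define a where "a = v $ r / w $ r"
    have eq: "v = a \<cdot>\<^sub>v w" using K(4) [OF that(1,3)] by (simp add: w_def a_def)
    have "a \<noteq> 0"
    proof
      assume "a = 0"
      then have "v = 0 \<cdot>\<^sub>v w" using eq by simp
      moreover have "w \<in> carrier_vec m" using K(1) by (simp only: w_def)
      ultimately have "v = 0\<^sub>v m" by (intro eq_vecI) auto
      then show False using that(2) by simp
    qed
    then show ?thesis using proj_point_smult eq by metis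
  qed
  fix u v assume "u \<in> carrier_vec m" "v \<in> carrier_vec m" "u \<noteq> 0\<^sub>v m" "v \<noteq> 0\<^sub>v m" "M *\<^sub>v u = 0\<^sub>v m" "M *\<^sub>v v = 0\<^sub>v m"
  then show "proj_point u = proj_point v" using * by simp
qed

section \<open>The homotopy in adapted coordinates\<close>

text \<open>Collects the data that are fixed before the matrices \<open>R\<close> are drawn.\<close>

locale fp_setup =
  fixes k :: nat and n d :: "nat \<Rightarrow> nat" and A :: "nat \<Rightarrow> nat \<Rightarrow> complex mat"
    and B :: "nat \<Rightarrow> complex mat" and c p q :: "nat \<Rightarrow> complex vec"
  assumes k2: "2 \<le> k"
    and intrinsic: "has_intrinsic_dimension k n A d"
    and B: "i < k \<Longrightarrow> B i \<in> carrier_mat (k - 1) k"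
    and c: "i < k \<Longrightarrow> c i \<in> carrier_vec (k - 1)"
    and p: "i < k \<Longrightarrow> p i \<in> carrier_vec k"
    and Lp: "i < k \<Longrightarrow> L_map (B i) (c i) (p i) = 0\<^sub>v (k - 1)"
    and q: "i < k \<Longrightarrow> q i \<in> carrier_vec k"
    and kerB: "i < k \<Longrightarrow> mat_kernel (B i) = range (\<lambda>a. a \<cdot>\<^sub>v q i)"
    and card_start: "card (start_solutions k n A p q) = (\<Prod>i<k. d i)"
begin

abbreviation P where "P i \<equiv> pencil_det k (n i) (A i) (p i) (q i)"

abbreviation H where "H i lam \<equiv> H_mat k (n i) (A i) lam"

lemma d_pos: "i < k \<Longrightarrow> 0 < d i" and total_degree: "i < k \<Longrightarrow> total_degree (det_H_poly k (n i) (A i)) = d i"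
  using intrinsic by (auto simp: has_intrinsic_dimension_def)

lemma degree_P: "i < k \<Longrightarrow> degree (P i) \<le> d i"
  using degree_pencil_det [OF p q] total_degree by metis

lemma poly_P: "i < k \<Longrightarrow> poly (P i) \<beta> = Determinant.det (H i (\<beta> \<cdot>\<^sub>v q i + p i))"
  using poly_pencil_det p q by blast

lemma simple_ker_line:
  assumes "i < k" "P i \<noteq> 0" "Polynomial.order \<beta> (P i) = 1"
  shows "ker_line (n i) (H i (\<beta> \<cdot>\<^sub>v q i + p i))" "Determinant.det (H i (\<beta> \<cdot>\<^sub>v q i + p i)) = 0"
proof -
  have "poly (P i) \<beta> = 0" using assms by (simp add: order_root)
  then show det: "Determinant.det (H i (\<beta> \<cdot>\<^sub>v q i + p i)) = 0" using poly_P assms(1) by simp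
  obtain r s where "r < n i" "s < n i" "adj_mat (H i (\<beta> \<cdot>\<^sub>v q i + p i)) $$ (r, s) \<noteq> 0"
    by (rule adj_nonzero_of_simple_root [OF p [OF assms(1)] q [OF assms(1)] assms(2,3)])
  then show "ker_line (n i) (H i (\<beta> \<cdot>\<^sub>v q i + p i))" using ker_line_of_adj det by auto
qed

text \<open>At a simple root the kernel is a line, so the eigenpair is a function of
  \<open>\<beta>\<close>.\<close>

lemma card_simple_le:
  assumes i: "i < k"
  shows "card (simple_gep_eigenpairs k (n i) (A i) (p i) (q i)) \<le> card {\<beta>. P i \<noteq> 0 \<and> Polynomial.order \<beta> (P i) = 1}"
    and "finite {\<beta>. P i \<noteq> 0 \<and> Polynomial.order \<beta> (P i) = 1}"
    and "finite (simple_gep_eigenpairs k (n i) (A i) (p i) (q i))"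
proof -
  define Z where "Z = {\<beta>. P i \<noteq> 0 \<and> Polynomial.order \<beta> (P i) = 1}"
  have "Z \<subseteq> {\<beta>. P i \<noteq> 0 \<and> poly (P i) \<beta> = 0}" by (auto simp: Z_def order_root)
  moreover have "finite {\<beta>. P i \<noteq> 0 \<and> poly (P i) \<beta> = 0}" by (cases "P i = 0") (auto simp: poly_roots_finite)
  ultimately have fin: "finite Z" by (rule finite_subset)
  define g where "g \<beta> = (\<beta> \<cdot>\<^sub>v q i + p i, ker_point (n i) (H i (\<beta> \<cdot>\<^sub>v q i + p i)))" for \<beta>
  have sub: "simple_gep_eigenpairs k (n i) (A i) (p i) (q i) \<subseteq> g ` Z"
  proof
    fix e assume "e \<in> simple_gep_eigenpairs k (n i) (A i) (p i) (q i)"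
    then obtain \<beta> x where e: "e = (\<beta> \<cdot>\<^sub>v q i + p i, x)" "x \<in> proj_space (n i)"
        "\<forall>v\<in>x. H i (\<beta> \<cdot>\<^sub>v q i + p i) *\<^sub>v v = 0\<^sub>v (n i)" "P i \<noteq> 0" "Polynomial.order \<beta> (P i) = 1"
      unfolding simple_gep_eigenpairs_def by blast
    have "x = ker_point (n i) (H i (\<beta> \<cdot>\<^sub>v q i + p i))"
      by (rule ker_line_point [OF H_mat_carrier simple_ker_line(2) [OF i e(4,5)] simple_ker_line(1) [OF i e(4,5)] e(2,3)])
    then have "e = g \<beta>" "\<beta> \<in> Z" using e by (auto simp: g_def Z_def)
    then show "e \<in> g ` Z" by blast
  qed
  show "card (simple_gep_eigenpairs k (n i) (A i) (p i) (q i)) \<le> card {\<beta>. P i \<noteq> 0 \<and> Polynomial.order \<beta> (P i) = 1}"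
    using card_mono [OF finite_imageI [OF fin] sub] card_image_le [OF fin, of g] by (simp add: Z_def)
  show "finite {\<beta>. P i \<noteq> 0 \<and> Polynomial.order \<beta> (P i) = 1}" using fin by (simp add: Z_def)
  show "finite (simple_gep_eigenpairs k (n i) (A i) (p i) (q i))" by (rule finite_subset [OF sub finite_imageI [OF fin]])
qed

text \<open>Each factor of the cardinality of the start set is at most the number of simple roots of
  its pencil, which is at most the number of roots, the degree and \<open>d i\<close> in turn. As
  the products agree and all \<open>d i\<close> are positive, equality holds throughout for every
  \<open>i\<close>.\<close>

lemma pencil_simple:
  assumes i: "i < k"
  shows "P i \<noteq> 0" "degree (P i) = d i" "card {\<beta>. poly (P i) \<beta> = 0} = d i"
    "\<And>\<beta>. poly (P i) \<beta> = 0 \<Longrightarrow> Polynomial.order \<beta> (P i) = 1"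
proof -
  define s where "s i = card (simple_gep_eigenpairs k (n i) (A i) (p i) (q i))" for i
  have prod: "(\<Prod>i<k. s i) = (\<Prod>i<k. d i)"
    using card_start by (simp add: start_solutions_def card_PiE s_def)
  have s_le_roots: "s j \<le> card {\<beta>. P j \<noteq> 0 \<and> Polynomial.order \<beta> (P j) = 1}" if "j < k" for j
    using card_simple_le(1) [OF that] by (simp add: s_def)
  have roots_le: "card {\<beta>. P j \<noteq> 0 \<and> Polynomial.order \<beta> (P j) = 1} \<le> card {\<beta>. poly (P j) \<beta> = 0}"
      "card {\<beta>. poly (P j) \<beta> = 0} \<le> d j" if "j < k" "P j \<noteq> 0" for j
  proof -
    have "finite {\<beta>. poly (P j) \<beta> = 0}" using that(2) by (rule poly_roots_finite)
    then show "card {\<beta>. P j \<noteq> 0 \<and> Polynomial.order \<beta> (P j) = 1} \<le> card {\<beta>. poly (P j) \<beta> = 0}"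
      by (rule card_mono) (auto simp: order_root)
    show "card {\<beta>. poly (P j) \<beta> = 0} \<le> d j"
      using card_poly_roots_bound [OF that(2)] degree_P [OF that(1)] by simp
  qed
  have s_le: "s j \<le> d j" if "j < k" for j
  proof (cases "P j = 0")
    case True
    then show ?thesis using s_le_roots [OF that] by simp
  next
    case False
    then show ?thesis using s_le_roots [OF that] roots_le [OF that] by simp
  qed
  have si: "s i = d i"
  proof (rule ccontr)
    assume "s i \<noteq> d i"
    then have "s i < d i" using s_le [OF i] by simp
    \<comment> \<open>A deficit in one factor cannot be compensated, as the other factors are
      bounded by the positive \<open>d j\<close>.\<close>
    have "(\<Prod>j<k. s j) = s i * (\<Prod>j\<in>{..<k} - {i}. s j)" using i by (subst prod.remove [of _ i]) auto
    also have "\<dots> \<le> s i * (\<Prod>j\<in>{..<k} - {i}. d j)" by (intro mult_left_mono prod_mono) (use s_le in auto)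
    also have "\<dots> < d i * (\<Prod>j\<in>{..<k} - {i}. d j)"
      using \<open>s i < d i\<close> d_pos by (intro mult_strict_right_mono prod_pos) auto
    also have "\<dots> = (\<Prod>j<k. d j)" using i by (subst prod.remove [of _ i]) auto
    finally show False using prod by simp
  qed
  show P0: "P i \<noteq> 0"
  proof
    assume "P i = 0"
    then show False using s_le_roots [OF i] si d_pos [OF i] by simp
  qed
  note c = roots_le [OF i P0]
  show ci: "card {\<beta>. poly (P i) \<beta> = 0} = d i" using c s_le_roots [OF i] si by simp
  show "degree (P i) = d i" using card_poly_roots_bound [OF P0] ci degree_P [OF i] by simp
  have fin: "finite {\<beta>. poly (P i) \<beta> = 0}" using P0 by (rule poly_roots_finite)
  have "{\<beta>. P i \<noteq> 0 \<and> Polynomial.order \<beta> (P i) = 1} = {\<beta>. poly (P i) \<beta> = 0}"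
    by (rule card_subset_eq [OF fin]) (use c ci s_le_roots [OF i] si in \<open>auto simp: order_root\<close>)
  then show "Polynomial.order \<beta> (P i) = 1" if "poly (P i) \<beta> = 0" for \<beta> using that by blast
qed

text \<open>All roots are simple by \<open>pencil_simple\<close>, so the set of all eigenpairs,
  which has to be the solution set at the start, is the one counted in the hypothesis.\<close>

lemma gep_eq_simple:
  assumes i: "i < k"
  shows "gep_eigenpairs k (n i) (A i) (p i) (q i) = simple_gep_eigenpairs k (n i) (A i) (p i) (q i)"
proof
  show "simple_gep_eigenpairs k (n i) (A i) (p i) (q i) \<subseteq> gep_eigenpairs k (n i) (A i) (p i) (q i)"
    unfolding simple_gep_eigenpairs_def gep_eigenpairs_def by blast
  show "gep_eigenpairs k (n i) (A i) (p i) (q i) \<subseteq> simple_gep_eigenpairs k (n i) (A i) (p i) (q i)"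
  proof
    fix e assume "e \<in> gep_eigenpairs k (n i) (A i) (p i) (q i)"
    then obtain \<beta> x where e: "e = (\<beta> \<cdot>\<^sub>v q i + p i, x)" "x \<in> proj_space (n i)"
        "\<forall>v\<in>x. H i (\<beta> \<cdot>\<^sub>v q i + p i) *\<^sub>v v = 0\<^sub>v (n i)"
      unfolding gep_eigenpairs_def by blast
    obtain v where v: "v \<in> carrier_vec (n i)" "v \<noteq> 0\<^sub>v (n i)" "x = proj_point v" "v \<in> x" by (rule proj_spaceE [OF e(2)])
    then have "Determinant.det (H i (\<beta> \<cdot>\<^sub>v q i + p i)) = 0"
      using det_0_iff_vec_prod_zero [OF H_mat_carrier] e(3) by blast
    then have "poly (P i) \<beta> = 0" using poly_P [OF i] by simp
    then have "Polynomial.order \<beta> (P i) = 1" using pencil_simple(4) [OF i] by blast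
    then show "e \<in> simple_gep_eigenpairs k (n i) (A i) (p i) (q i)"
      unfolding simple_gep_eigenpairs_def using e pencil_simple(1) [OF i] by blast
  qed
qed

definition ST where "ST i = (SOME (S, T). S \<in> carrier_mat k k \<and> T \<in> carrier_mat k k \<and> S * T = 1\<^sub>m k \<and> T * S = 1\<^sub>m k \<and>
    (\<forall>v\<in>carrier_vec k. \<forall>r<k - 1. (S *\<^sub>v v) $ r = (B i *\<^sub>v v) $ r) \<and> S *\<^sub>v q i = unit_vec k (k - 1))"

definition S where "S i = fst (ST i)"
definition T where "T i = snd (ST i)"

lemma ST:
  assumes i: "i < k"
  shows "S i \<in> carrier_mat k k" "T i \<in> carrier_mat k k" "S i * T i = 1\<^sub>m k" "T i * S i = 1\<^sub>m k"
    "\<And>v r. v \<in> carrier_vec k \<Longrightarrow> r < k - 1 \<Longrightarrow> (S i *\<^sub>v v) $ r = (B i *\<^sub>v v) $ r"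
    "S i *\<^sub>v q i = unit_vec k (k - 1)"
proof -
  define Q where "Q X = (case X of (U, V) \<Rightarrow> U \<in> carrier_mat k k \<and> V \<in> carrier_mat k k \<and> U * V = 1\<^sub>m k \<and> V * U = 1\<^sub>m k \<and>
    (\<forall>v\<in>carrier_vec k. \<forall>r<k - 1. (U *\<^sub>v v) $ r = (B i *\<^sub>v v) $ r) \<and> U *\<^sub>v q i = unit_vec k (k - 1))" for X
  have k1: "1 \<le> k" using k2 by simp
  have "\<exists>x. Q x"
    using adapted_coordinates [OF k1 B [OF i] q [OF i] kerB [OF i]] by (auto simp: Q_def)
  then have "Q (ST i)" unfolding ST_def Q_def [symmetric] by (rule someI_ex)
  then show "S i \<in> carrier_mat k k" "T i \<in> carrier_mat k k" "S i * T i = 1\<^sub>m k" "T i * S i = 1\<^sub>m k"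
    "\<And>v r. v \<in> carrier_vec k \<Longrightarrow> r < k - 1 \<Longrightarrow> (S i *\<^sub>v v) $ r = (B i *\<^sub>v v) $ r"
    "S i *\<^sub>v q i = unit_vec k (k - 1)"
    by (auto simp: Q_def S_def T_def split: prod.splits)
qed

definition block :: "nat \<Rightarrow> (nat \<Rightarrow> complex) \<Rightarrow> complex vec" where
  "block i \<zeta> = vec k (\<lambda>r. \<zeta> (i * k + r))"

text \<open>Inverse of the adapted coordinates, centred at \<open>p i\<close>: the first
  \<open>k - 1\<close> entries of block \<open>i\<close> become the components of
  \<open>L_i\<close>, the last one the parameter along \<open>q i\<close>.\<close>

definition lamb :: "nat \<Rightarrow> (nat \<Rightarrow> complex) \<Rightarrow> complex vec" where
  "lamb i \<zeta> = T i *\<^sub>v block i \<zeta> + p i"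

text \<open>Flattens the \<open>k\<close> blocks into one sequence that vanishes from index
  \<open>k * k\<close> on, the form of points in \<open>square_system\<close>.\<close>

definition coords :: "(nat \<Rightarrow> complex vec) \<Rightarrow> nat \<Rightarrow> complex" where
  "coords lam j = (if j < k * k then (S (j div k) *\<^sub>v (lam (j div k) - p (j div k))) $ (j mod k) else 0)"

lemma k_pos: "0 < k"
  using k2 by simp

lemma div_less: "j < k * k \<Longrightarrow> j div k < k" and mod_less: "j mod k < k"
  using k_pos by (auto simp: less_mult_imp_div_less)

lemma index_less: "i < k \<Longrightarrow> r < k \<Longrightarrow> i * k + r < k * k"
proof -
  assume "i < k" "r < k"
  then have "i * k + r < i * k + k" by simp
  also have "\<dots> = Suc i * k" by simp
  also have "\<dots> \<le> k * k" using \<open>i < k\<close> by (intro mult_right_mono) auto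
  finally show ?thesis .
qed

lemma block_carrier [simp]: "block i \<zeta> \<in> carrier_vec k"
  by (simp add: block_def)

lemma lamb_carrier: "i < k \<Longrightarrow> lamb i \<zeta> \<in> carrier_vec k"
  using ST(2) [of i] p [of i] by (auto simp: lamb_def intro!: add_carrier_vec mult_mat_vec_carrier)

lemma coords_lamb:
  assumes "\<forall>j\<ge>k * k. \<zeta> j = 0"
  shows "coords (\<lambda>i. lamb i \<zeta>) = \<zeta>"
proof
  fix j show "coords (\<lambda>i. lamb i \<zeta>) j = \<zeta> j"
  proof (cases "j < k * k")
    case True
    define i where "i = j div k"
    have i: "i < k" using div_less True by (simp add: i_def)
    have "lamb i \<zeta> - p i = T i *\<^sub>v block i \<zeta>"
      using p [OF i] ST(2) [OF i] unfolding lamb_def by (intro eq_vecI) auto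
    then have "S i *\<^sub>v (lamb i \<zeta> - p i) = block i \<zeta>"
      using ST(1-3) [OF i] by (simp add: assoc_mult_mat_vec [symmetric])
    then show ?thesis using True mod_less [of j] by (simp add: coords_def i_def [symmetric] block_def) (simp add: i_def)
  qed (use assms in \<open>auto simp: coords_def\<close>)
qed

lemma lamb_coords:
  assumes i: "i < k" and "lam i \<in> carrier_vec k"
  shows "lamb i (coords lam) = lam i"
proof -
  have w: "lam i - p i \<in> carrier_vec k" using assms p [OF i] by simp
  have "block i (coords lam) = S i *\<^sub>v (lam i - p i)"
  proof (rule eq_vecI)
    fix r assume "r < dim_vec (S i *\<^sub>v (lam i - p i))"
    then have r: "r < k" using ST(1) [OF i] by simp
    then have "(i * k + r) div k = i" "(i * k + r) mod k = r" using k_pos by auto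
    then show "block i (coords lam) $ r = (S i *\<^sub>v (lam i - p i)) $ r"
      using r index_less [OF i r] by (simp add: block_def coords_def)
  qed (use ST(1) [OF i] in \<open>simp add: block_def\<close>)
  then have "T i *\<^sub>v block i (coords lam) = lam i - p i"
    using ST(1,2,4) [OF i] w by (simp add: assoc_mult_mat_vec [symmetric])
  then have "lamb i (coords lam) = (lam i - p i) + p i" by (simp add: lamb_def)
  then show ?thesis using assms p [OF i] by (auto intro!: eq_vecI)
qed

lemma coords_points: "\<forall>j\<ge>k * k. coords lam j = 0"
  by (auto simp: coords_def)

text \<open>The rows of \<open>S i\<close> above the last act as those of \<open>B i\<close>, and
  \<open>S i * T i\<close> is the identity; the constant part drops out since \<open>L_i\<close>
  vanishes at \<open>p i\<close>.\<close>

lemma L_lamb: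
  assumes i: "i < k" and r: "r < k - 1"
  shows "L_map (B i) (c i) (lamb i \<zeta>) $ r = \<zeta> (i * k + r)"
proof -
  have Tb: "T i *\<^sub>v block i \<zeta> \<in> carrier_vec k" using ST(2) [OF i] by simp
  have "(B i *\<^sub>v (T i *\<^sub>v block i \<zeta>)) $ r = (S i *\<^sub>v (T i *\<^sub>v block i \<zeta>)) $ r" using ST(5) [OF i Tb r] ..
  also have "\<dots> = \<zeta> (i * k + r)"
    using ST(1-3) [OF i] r by (simp add: assoc_mult_mat_vec [symmetric] block_def)
  finally have 1: "(B i *\<^sub>v (T i *\<^sub>v block i \<zeta>)) $ r = \<zeta> (i * k + r)" .
  have "(B i *\<^sub>v p i + c i) $ r = 0" using Lp [OF i] r by (simp add: L_map_def)
  then have 2: "(B i *\<^sub>v p i) $ r + c i $ r = 0" using B [OF i] c [OF i] r by simp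
  have "B i *\<^sub>v lamb i \<zeta> = B i *\<^sub>v (T i *\<^sub>v block i \<zeta>) + B i *\<^sub>v p i"
    unfolding lamb_def by (rule mult_add_distrib_mat_vec [OF B [OF i] Tb p [OF i]])
  then have "L_map (B i) (c i) (lamb i \<zeta>) $ r = (B i *\<^sub>v (T i *\<^sub>v block i \<zeta>)) $ r + ((B i *\<^sub>v p i) $ r + c i $ r)"
    using B [OF i] c [OF i] r by (simp add: L_map_def)
  then show ?thesis using 1 2 by simp
qed

end

section \<open>The square system behind the homotopy\<close>

context fp_setup
begin

text \<open>The indices of the linear equations and at the same time of the variables that are
  components of the \<open>L_i\<close>.\<close>

definition Y :: "nat set" where "Y = {j. j < k * k \<and> j mod k \<noteq> k - 1}"

definition DD :: "nat \<Rightarrow> nat" where "DD j = (if j mod k = k - 1 then d (j div k) else 1)"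

text \<open>Preferring the linear variables makes the Macaulay system of the start system triangular.\<close>

definition sl :: "(nat \<Rightarrow> nat) \<Rightarrow> nat" where
  "sl m = (if \<exists>y\<in>Y. m y \<noteq> 0 then SOME y. y \<in> Y \<and> m y \<noteq> 0 else SOME i. i < k * k \<and> DD i \<le> m i)"

lemma sl_Y: "y \<in> Y \<Longrightarrow> m y \<noteq> 0 \<Longrightarrow> sl m \<in> Y \<and> m (sl m) \<noteq> 0"
proof -
  assume y: "y \<in> Y" "m y \<noteq> 0"
  then have "\<exists>y. y \<in> Y \<and> m y \<noteq> 0" by blast
  from someI_ex [OF this] show ?thesis using y unfolding sl_def by auto
qed

sublocale ss: square_system "k * k" DD sl
proof
  show "1 \<le> DD i" if "i < k * k" for i
    using d_pos [OF div_less [OF that]] by (simp add: DD_def)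
  fix m assume ex: "\<exists>i<k * k. DD i \<le> m i"
  show "sl m < k * k \<and> DD (sl m) \<le> m (sl m)"
  proof (cases "\<exists>y\<in>Y. m y \<noteq> 0")
    case True
    then have "sl m \<in> Y" "m (sl m) \<noteq> 0" using sl_Y by blast+
    then show ?thesis by (auto simp: Y_def DD_def)
  next
    case False
    then have "sl m = (SOME i. i < k * k \<and> DD i \<le> m i)" by (simp add: sl_def)
    then show ?thesis using someI_ex [OF ex] by simp
  qed
qed

lemma index_div: "r < k \<Longrightarrow> (i * k + r) div k = i" and index_mod: "r < k \<Longrightarrow> (i * k + r) mod k = r"
  using k_pos by auto

text \<open>The variables of block \<open>i\<close> suffice, since \<open>lamb i\<close> depends on
  no others. This support is what later forces every other monomial of top degree to contain a
  variable of \<open>Y\<close>.\<close>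

definition cf :: "nat \<Rightarrow> (nat \<Rightarrow> nat) \<Rightarrow> complex" where
  "cf i = (SOME c. \<forall>\<zeta>. Determinant.det (H i (lamb i \<zeta>)) =
     (\<Sum>e\<in>expos {i * k..<i * k + k} (d i). c e * mon (k * k) e \<zeta>))"

definition CF :: "nat \<Rightarrow> (nat \<Rightarrow> nat) \<Rightarrow> complex" where
  "CF i e = (if e \<in> expos {i * k..<i * k + k} (d i) then cf i e else 0)"

lemma lamb_index:
  assumes i: "i < k" and j: "j < k"
  shows "lamb i \<zeta> $ j = (\<Sum>r<k. T i $$ (j, r) * \<zeta> (i * k + r)) + p i $ j"
  using ST(2) [OF i] p [OF i] j by (simp add: lamb_def scalar_prod_def block_def atLeast0LessThan)

lemma pfun_lamb:
  assumes i: "i < k" and j: "j < k" and S: "finite S'" and sub: "{i * k..<i * k + k} \<subseteq> S'"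
  shows "pfun (k * k) S' 1 (\<lambda>\<zeta>. lamb i \<zeta> $ j)"
proof -
  have "pfun (k * k) S' (0 + 1) (\<lambda>\<zeta>. T i $$ (j, r) * \<zeta> (i * k + r))" if "r < k" for r
    by (rule pfun_mult [OF S pfun_const [OF S] pfun_var [OF S]]) (use that sub index_less [OF i] in auto)
  then have "pfun (k * k) S' 1 (\<lambda>\<zeta>. (\<Sum>r<k. T i $$ (j, r) * \<zeta> (i * k + r)) + p i $ j)"
    by (intro pfun_add [OF S] pfun_sum [OF S] pfun_const [OF S]) simp
  then show ?thesis unfolding lamb_index [OF i j] .
qed

lemma cf:
  assumes i: "i < k"
  shows "Determinant.det (H i (lamb i \<zeta>)) = (\<Sum>e\<in>expos {i * k..<i * k + k} (d i). cf i e * mon (k * k) e \<zeta>)"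
proof -
  have S: "finite {i * k..<i * k + k}" by simp
  from pfun_det [where k = k and l = "\<lambda>\<zeta> j. lamb i \<zeta> $ j" and m = "n i" and A = "A i", OF S pfun_lamb [OF i _ S order_refl]]
  have "\<exists>c. \<forall>\<zeta>. Determinant.det (H i (lamb i \<zeta>)) = (\<Sum>e\<in>expos {i * k..<i * k + k} (d i). c e * mon (k * k) e \<zeta>)"
    unfolding pfun_def total_degree [OF i] H_mat_def by simp
  from someI_ex [OF this] show ?thesis unfolding cf_def by blast
qed

lemma expos_block_subset: "i < k \<Longrightarrow> expos {i * k..<i * k + k} d' \<subseteq> expos {..<k * k} d'"
proof
  fix e assume i: "i < k" and e: "e \<in> expos {i * k..<i * k + k} d'"
  have sub: "{i * k..<i * k + k} \<subseteq> {..<k * k}"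
  proof
    fix j assume "j \<in> {i * k..<i * k + k}"
    then have "j = i * k + (j - i * k)" "j - i * k < k" by auto
    then show "j \<in> {..<k * k}" using index_less [OF i] by (metis lessThan_iff)
  qed
  have "sum e {..<k * k} = sum e {i * k..<i * k + k}"
    by (rule sum.mono_neutral_right [OF _ sub]) (use e in \<open>auto simp: expos_def\<close>)
  moreover have "e j = 0" if "j \<notin> {..<k * k}" for j
  proof -
    have "j \<notin> {i * k..<i * k + k}" using sub that by blast
    then show ?thesis using e by (simp add: expos_def)
  qed
  ultimately show "e \<in> expos {..<k * k} d'" using e by (simp add: expos_def)
qed

lemma CF_sum:
  assumes i: "i < k"
  shows "(\<Sum>e\<in>expos {..<k * k} (d i). CF i e * mon (k * k) e \<zeta>) = Determinant.det (H i (lamb i \<zeta>))"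
  unfolding cf [OF i]
  by (rule sum.mono_neutral_cong_right [OF _ expos_block_subset [OF i]]) (auto simp: CF_def)

text \<open>Coefficients of the differences of consecutive \<lambda> as affine functions of the
  coordinates. The matrices \<open>R\<close> combine these coefficients linearly, which makes
  \<open>b\<close> and \<open>\<omega>\<close> enter \<open>Par\<close> only through their
  product.\<close>

definition al :: "nat \<Rightarrow> (nat \<Rightarrow> nat) \<Rightarrow> complex" where
  "al s = (SOME c. \<forall>\<zeta>. (D_mat k *\<^sub>v stack k (\<lambda>i. lamb i \<zeta>)) $ s =
     (\<Sum>e\<in>expos {..<k * k} 1. c e * mon (k * k) e \<zeta>))"

lemma al:
  assumes s: "s < k * (k - 1)"
  shows "(D_mat k *\<^sub>v stack k (\<lambda>i. lamb i \<zeta>)) $ s = (\<Sum>e\<in>expos {..<k * k} 1. al s e * mon (k * k) e \<zeta>)"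
proof -
  have S: "finite {..<k * k}" by simp
  have "pfun (k * k) {..<k * k} (0 + 1) (\<lambda>\<zeta>. D_mat k $$ (s, t) * lamb (t div k) \<zeta> $ (t mod k))" if "t < k * k" for t
  proof (rule pfun_mult [OF S pfun_const [OF S] pfun_lamb [OF _ _ S]])
    show "t div k < k" "t mod k < k" using div_less [OF that] mod_less by auto
    show "{t div k * k..<t div k * k + k} \<subseteq> {..<k * k}"
    proof
      fix j assume "j \<in> {t div k * k..<t div k * k + k}"
      then have "j = t div k * k + (j - t div k * k)" "j - t div k * k < k" by auto
      then show "j \<in> {..<k * k}" using index_less [OF div_less [OF that]] by (metis lessThan_iff)
    qed
  qed
  then have "pfun (k * k) {..<k * k} 1 (\<lambda>\<zeta>. \<Sum>t<k * k. D_mat k $$ (s, t) * lamb (t div k) \<zeta> $ (t mod k))"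
    by (intro pfun_sum [OF S]) simp
  moreover have "(D_mat k *\<^sub>v stack k (\<lambda>i. lamb i \<zeta>)) $ s = (\<Sum>t<k * k. D_mat k $$ (s, t) * lamb (t div k) \<zeta> $ (t mod k))" for \<zeta>
    using s by (simp add: D_mat_def stack_def scalar_prod_def power2_eq_square atLeast0LessThan)
  ultimately have "\<exists>c. \<forall>\<zeta>. (D_mat k *\<^sub>v stack k (\<lambda>i. lamb i \<zeta>)) $ s = (\<Sum>e\<in>expos {..<k * k} 1. c e * mon (k * k) e \<zeta>)"
    unfolding pfun_def by simp
  from someI_ex [OF this] show ?thesis unfolding al_def by blast
qed

text \<open>Equation \<open>i * k + (k - 1)\<close> is \<open>det H\<^sub>i = 0\<close>, and for \<open>r < k - 1\<close> equation \<open>i * k + r\<close> is component \<open>r\<close> of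
  \<open>a L\<^sub>i + b G\<^sub>i = 0\<close>; in the adapted coordinates, component \<open>r\<close> of \<open>L\<^sub>i\<close> is variable \<open>i * k + r\<close>.\<close>

definition Par :: "complex \<Rightarrow> complex \<Rightarrow> (nat \<times> nat \<times> nat \<Rightarrow> complex) \<Rightarrow> nat \<Rightarrow> (nat \<Rightarrow> nat) \<Rightarrow> complex" where
  "Par a b \<omega> j e = (if k * k \<le> j then 0 else if j mod k = k - 1 then CF (j div k) e
     else a * (if e = (\<lambda>l. if l = j then 1 else 0) then 1 else 0) +
       b * (\<Sum>s<k * (k - 1). \<omega> (j div k, j mod k, s) * al s e))"

lemma ev_Par_det:
  assumes i: "i < k"
  shows "ss.ev (Par a b \<omega>) (i * k + (k - 1)) \<zeta> = Determinant.det (H i (lamb i \<zeta>))"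
proof -
  have km: "k - 1 < k" using k_pos by simp
  note j = index_div [OF km, of i] index_mod [OF km, of i] index_less [OF i km]
  have "DD (i * k + (k - 1)) = d i" unfolding DD_def j(1,2) by simp
  then have "ss.ev (Par a b \<omega>) (i * k + (k - 1)) \<zeta> = (\<Sum>e\<in>expos {..<k * k} (d i). CF i e * mon (k * k) e \<zeta>)"
    unfolding ss.ev_def by (intro sum.cong) (use j in \<open>auto simp: Par_def\<close>)
  then show ?thesis using CF_sum [OF i] by simp
qed

lemma G_map_index:
  assumes i: "i < k" and r: "r < k - 1"
  shows "G_map k (R_of k \<omega> i) lam $ r = (\<Sum>s<k * (k - 1). \<omega> (i, r, s) * (D_mat k *\<^sub>v stack k lam) $ s)"
  using r by (simp add: G_map_def R_of_def scalar_prod_def atLeast0LessThan D_mat_def)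

lemma ev_Par_lin:
  assumes i: "i < k" and r: "r < k - 1"
  shows "ss.ev (Par a b \<omega>) (i * k + r) \<zeta> =
    a * L_map (B i) (c i) (lamb i \<zeta>) $ r + b * G_map k (R_of k \<omega> i) (\<lambda>i. lamb i \<zeta>) $ r"
proof -
  define j where "j = i * k + r"
  have rk: "r < k" using r by simp
  have j: "j div k = i" "j mod k = r" "j < k * k"
    using index_div [OF rk] index_mod [OF rk] index_less [OF i rk] by (auto simp: j_def)
  define u where "u = (\<lambda>l. if l = j then 1 else 0 :: nat)"
  have D: "DD j = 1" using j r by (simp add: DD_def)
  have u: "u \<in> expos {..<k * k} 1" using j(3) by (auto simp: expos_def u_def)
  have "ss.ev (Par a b \<omega>) j \<zeta> = (\<Sum>e\<in>expos {..<k * k} 1. Par a b \<omega> j e * mon (k * k) e \<zeta>)"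
    unfolding ss.ev_def D ..
  also have "\<dots> = (\<Sum>e\<in>expos {..<k * k} 1. a * (if e = u then mon (k * k) u \<zeta> else 0) +
      b * (\<Sum>s<k * (k - 1). \<omega> (i, r, s) * (al s e * mon (k * k) e \<zeta>)))"
  proof (intro sum.cong refl)
    fix e
    have "Par a b \<omega> j e = a * (if e = u then 1 else 0) + b * (\<Sum>s<k * (k - 1). \<omega> (i, r, s) * al s e)"
      using j r by (simp add: Par_def u_def)
    then show "Par a b \<omega> j e * mon (k * k) e \<zeta> = a * (if e = u then mon (k * k) u \<zeta> else 0) +
      b * (\<Sum>s<k * (k - 1). \<omega> (i, r, s) * (al s e * mon (k * k) e \<zeta>))"
      by (auto simp: algebra_simps sum_distrib_left sum_distrib_right)
  qed
  also have "\<dots> = a * (\<Sum>e\<in>expos {..<k * k} 1. if e = u then mon (k * k) u \<zeta> else 0) +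
      b * (\<Sum>e\<in>expos {..<k * k} 1. \<Sum>s<k * (k - 1). \<omega> (i, r, s) * (al s e * mon (k * k) e \<zeta>))"
    by (simp only: sum.distrib sum_distrib_left)
  also have "(\<Sum>e\<in>expos {..<k * k} 1. if e = u then mon (k * k) u \<zeta> else 0) = \<zeta> j"
    using u mon_unit [OF j(3), of \<zeta>] by (simp add: u_def)
  also have "(\<Sum>e\<in>expos {..<k * k} 1. \<Sum>s<k * (k - 1). \<omega> (i, r, s) * (al s e * mon (k * k) e \<zeta>)) =
      (\<Sum>s<k * (k - 1). \<omega> (i, r, s) * (D_mat k *\<^sub>v stack k (\<lambda>i. lamb i \<zeta>)) $ s)"
    by (subst sum.swap) (intro sum.cong refl, simp add: al sum_distrib_left)
  finally show ?thesis by (simp add: j_def L_lamb [OF i r] G_map_index [OF i r])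
qed

lemma zeros_Par:
  "\<zeta> \<in> ss.zeros (Par a b \<omega>) \<longleftrightarrow> (\<forall>j\<ge>k * k. \<zeta> j = 0) \<and> (\<forall>i<k. Determinant.det (H i (lamb i \<zeta>)) = 0 \<and>
     (\<forall>r<k - 1. a * L_map (B i) (c i) (lamb i \<zeta>) $ r + b * G_map k (R_of k \<omega> i) (\<lambda>i. lamb i \<zeta>) $ r = 0))"
    (is "?l \<longleftrightarrow> ?p \<and> ?r")
proof
  assume l: ?l
  then have z: "ss.ev (Par a b \<omega>) j \<zeta> = 0" if "j < k * k" for j using that by (simp add: ss.zeros_def)
  show "?p \<and> ?r"
  proof (intro conjI allI impI)
    show "\<zeta> j = 0" if "k * k \<le> j" for j using l that by (simp add: ss.zeros_def ss.points_def)
    fix i assume i: "i < k"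
    show "Determinant.det (H i (lamb i \<zeta>)) = 0"
      using z [OF index_less [OF i, of "k - 1"]] k_pos ev_Par_det [OF i] by simp
    fix r assume r: "r < k - 1"
    show "a * L_map (B i) (c i) (lamb i \<zeta>) $ r + b * G_map k (R_of k \<omega> i) (\<lambda>i. lamb i \<zeta>) $ r = 0"
      using z [OF index_less [OF i, of r]] r ev_Par_lin [OF i r] by simp
  qed
next
  assume pr: "?p \<and> ?r"
  have "ss.ev (Par a b \<omega>) j \<zeta> = 0" if j: "j < k * k" for j
  proof -
    have i: "j div k < k" by (rule div_less [OF j])
    have jr: "j = j div k * k + j mod k" by simp
    show ?thesis
    proof (cases "j mod k = k - 1")
      case True
      then have "j = j div k * k + (k - 1)" using jr by simp
      then show ?thesis using ev_Par_det [OF i, of a b \<omega> \<zeta>] pr i by metis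
    next
      case False
      then have r: "j mod k < k - 1" using mod_less [of j] by simp
      then show ?thesis using ev_Par_lin [OF i r, of a b \<omega> \<zeta>] pr i jr by metis
    qed
  qed
  then show ?l using pr by (simp add: ss.zeros_def ss.points_def)
qed

section \<open>The start system is good\<close>

definition axis :: "nat \<Rightarrow> complex \<Rightarrow> nat \<Rightarrow> complex" where
  "axis i \<beta> = (\<lambda>j. if j = i * k + (k - 1) then \<beta> else 0)"

lemma lamb_on_axis:
  assumes i: "i < k" and \<zeta>: "\<And>r. r < k - 1 \<Longrightarrow> \<zeta> (i * k + r) = 0" "\<zeta> (i * k + (k - 1)) = \<beta>"
  shows "lamb i \<zeta> = \<beta> \<cdot>\<^sub>v q i + p i"
proof -
  have "block i \<zeta> = \<beta> \<cdot>\<^sub>v unit_vec k (k - 1)"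
  proof (rule eq_vecI)
    fix r assume "r < dim_vec (\<beta> \<cdot>\<^sub>v unit_vec k (k - 1) :: complex vec)"
    then have "r < k" by simp
    then show "block i \<zeta> $ r = (\<beta> \<cdot>\<^sub>v unit_vec k (k - 1)) $ r"
      using \<zeta> by (cases "r = k - 1") (auto simp: block_def)
  qed (simp add: block_def)
  moreover have "T i *\<^sub>v unit_vec k (k - 1) = q i"
  proof -
    have "T i *\<^sub>v (S i *\<^sub>v q i) = (T i * S i) *\<^sub>v q i"
      by (rule assoc_mult_mat_vec [OF ST(2,1) [OF i] q [OF i], symmetric])
    then show ?thesis using ST(4,6) [OF i] q [OF i] by simp
  qed
  ultimately have "T i *\<^sub>v block i \<zeta> = \<beta> \<cdot>\<^sub>v q i"
    using mult_mat_vec [OF ST(2) [OF i], of "unit_vec k (k - 1)" \<beta>] by simp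
  then show ?thesis by (simp add: lamb_def)
qed

text \<open>On the axis of block \<open>i\<close> the determinant becomes the pencil polynomial
  \<open>P i\<close>, whose degree is exactly \<open>d i\<close> by the count of start solutions;
  the coefficient in question is its leading one.\<close>

lemma CF_axis:
  assumes i: "i < k"
  shows "CF i (\<lambda>l. if l = i * k + (k - 1) then d i else 0) \<noteq> 0"
proof -
  define j where "j = i * k + (k - 1)"
  have j: "j < k * k" using index_less [OF i, of "k - 1"] k_pos by (simp add: j_def)
  define Q where "Q = (\<Sum>e\<le>d i. monom (CF i (\<lambda>l. if l = j then e else 0)) e)"
  have "poly (P i) \<beta> = poly Q \<beta>" for \<beta>
  proof -
    have 0: "CF i e * mon (k * k) e (axis i \<beta>) = 0" if e: "\<exists>l. l \<noteq> j \<and> e l \<noteq> 0" for e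
    proof (cases "e \<in> expos {..<k * k} (d i)")
      case True
      from e obtain l where l: "l \<noteq> j" "e l \<noteq> 0" by blast
      then have "l < k * k" using True by (auto simp: expos_def)
      moreover have "axis i \<beta> l = 0" using l by (simp add: axis_def j_def)
      ultimately have "mon (k * k) e (axis i \<beta>) = 0"
        unfolding mon_def using l by (intro prod_zero) (auto intro!: bexI [of _ l])
      then show ?thesis by simp
    next
      case False
      then have "CF i e = 0" using expos_block_subset [OF i] by (auto simp: CF_def)
      then show ?thesis by simp
    qed
    have ax: "axis i \<beta> j = \<beta>" by (simp add: axis_def j_def)
    have "lamb i (axis i \<beta>) = \<beta> \<cdot>\<^sub>v q i + p i"
      by (rule lamb_on_axis [OF i]) (auto simp: axis_def)
    then have "poly (P i) \<beta> = (\<Sum>e\<in>expos {..<k * k} (d i). CF i e * mon (k * k) e (axis i \<beta>))"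
      using poly_P [OF i] CF_sum [OF i] by simp
    also have "\<dots> = (\<Sum>e\<le>d i. CF i (\<lambda>l. if l = j then e else 0) * mon (k * k) (\<lambda>l. if l = j then e else 0) (axis i \<beta>))"
      by (rule sum_expos_single [OF j]) (rule 0)
    also have "\<dots> = poly Q \<beta>" by (simp add: mon_single [OF j] ax Q_def poly_sum poly_monom)
    finally show ?thesis .
  qed
  then have "P i = Q" by (simp add: poly_eq_poly_eq_iff [symmetric] fun_eq_iff)
  moreover have "coeff Q (d i) = CF i (\<lambda>l. if l = j then d i else 0)"
    by (simp add: Q_def coeff_sum)
  moreover have "coeff (P i) (d i) \<noteq> 0" using pencil_simple(1,2) [OF i] by (metis leading_coeff_0_iff)
  ultimately show ?thesis by (simp add: j_def)
qed

text \<open>At the start the linear equations are the variables in \<open>Y\<close>, and modulo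
  these each determinant equation keeps only powers of the variable along \<open>q i\<close>, with
  nonzero coefficient at the power \<open>d i\<close>.\<close>

lemma dl_start: "ss.dl (Par 1 0 \<omega>) \<noteq> 0"
proof (rule ss.dl_nonzero_triangular [of Y])
  fix i e assume "i \<in> Y" "i < k * k"
  then show "Par 1 0 \<omega> i e = (if e = (\<lambda>j. if j = i then 1 else 0) then 1 else 0)"
    by (simp add: Par_def Y_def)
next
  fix i assume "i \<in> Y"
  then show "i < k * k \<and> DD i = 1" by (simp add: Y_def DD_def)
next
  fix m :: "nat \<Rightarrow> nat" and i assume "i \<in> Y" "m i \<noteq> 0"
  then show "sl m \<in> Y" using sl_Y by blast
next
  fix j assume j: "j < k * k" "j \<notin> Y"
  then have jm: "j mod k = k - 1" by (simp add: Y_def)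
  then have DDj: "DD j = d (j div k)" by (simp add: DD_def)
  have eq: "j = j div k * k + (k - 1)" using jm by (metis div_mult_mod_eq)
  have "Par 1 0 \<omega> j (\<lambda>l. if l = j then DD j else 0) = CF (j div k) (\<lambda>l. if l = j then d (j div k) else 0)"
    unfolding DDj using j jm by (simp add: Par_def)
  then show "Par 1 0 \<omega> j (\<lambda>l. if l = j then DD j else 0) \<noteq> 0"
    using CF_axis [OF div_less [OF j(1)]] eq by metis
next
  fix j e assume j: "j < k * k" "j \<notin> Y" and e: "sum e {..<k * k} = DD j"
    and ne: "e \<noteq> (\<lambda>l. if l = j then DD j else 0)" and nz: "Par 1 0 \<omega> j e \<noteq> 0"
  define i where "i = j div k"
  have i: "i < k" using div_less [OF j(1)] by (simp add: i_def)
  have jm: "j mod k = k - 1" using j by (simp add: Y_def)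
  then have eq: "j = i * k + (k - 1)" unfolding i_def by (metis div_mult_mod_eq)
  have "CF i e \<noteq> 0" using nz j jm by (simp add: Par_def i_def)
  then have eb: "e \<in> expos {i * k..<i * k + k} (d i)" by (simp add: CF_def split: if_splits)
  \<comment> \<open>Within block \<open>i\<close> every index but the last belongs to
    \<open>Y\<close>. A monomial avoiding \<open>Y\<close> is thus a power of the last variable, and
    its degree makes it the excluded one.\<close>
  show "\<exists>y\<in>Y. e y \<noteq> 0"
  proof (rule ccontr)
    assume neg: "\<not> ?thesis"
    have e0: "e l = 0" if "l \<noteq> j" for l
    proof (cases "l \<in> {i * k..<i * k + k}")
      case True
      define r where "r = l - i * k"
      have r: "l = i * k + r" "r < k" using True by (auto simp: r_def)
      then have "r \<noteq> k - 1" using that eq by auto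
      then have "l \<in> Y" using r index_less [OF i r(2)] index_mod [OF r(2)] by (simp add: Y_def)
      then show ?thesis using neg by blast
    next
      case False
      then show ?thesis using eb by (auto simp: expos_def)
    qed
    have "sum e {..<k * k} = (\<Sum>l<k * k. if l = j then e j else 0)" by (intro sum.cong) (auto simp: e0)
    then have "e j = DD j" using e j(1) by simp
    then have "e = (\<lambda>l. if l = j then DD j else 0)" by (intro ext) (simp add: e0)
    then show False using ne by simp
  qed
qed

text \<open>Choosing one root of each pencil for the last coordinate of its block, with all other
  coordinates 0, gives zeros. Reduced exponents number them: the exponent at the last index of block
  \<open>i\<close>, being less than \<open>d i\<close>, selects a root, and the exponents at
  \<open>Y\<close> are 0.\<close>

lemma good_start: "ss.good (Par 1 0 \<omega>)"
proof -
  have "\<exists>f. bij_betw f {0..<d i} {\<beta>. poly (P i) \<beta> = 0}" if "i < k" for i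
    using ex_bij_betw_nat_finite [OF poly_roots_finite [OF pencil_simple(1) [OF that]]] pencil_simple(3) [OF that] by simp
  then obtain rt where rt: "\<And>i. i < k \<Longrightarrow> bij_betw (rt i) {0..<d i} {\<beta>. poly (P i) \<beta> = 0}" by metis
  define f where "f a = (\<lambda>j. if j < k * k \<and> j \<notin> Y then rt (j div k) (a j) else 0)" for a :: "nat \<Rightarrow> nat"
  have Yj: "i * k + r \<in> Y \<longleftrightarrow> r \<noteq> k - 1" if "i < k" "r < k" for i r
    using index_less [OF that] index_mod [OF that(2)] by (simp add: Y_def)
  have DDY: "DD j = d (j div k)" if "j < k * k" "j \<notin> Y" for j
    using that by (simp add: Y_def DD_def)
  have DY: "DD j = 1" if "j \<in> Y" for j using that by (simp add: Y_def DD_def)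
  have "f a \<in> ss.zeros (Par 1 0 \<omega>)" if a: "a \<in> ss.red" for a
    unfolding zeros_Par
  proof (intro conjI allI impI)
    show "f a j = 0" if "k * k \<le> j" for j using that by (simp add: f_def)
    fix i assume i: "i < k"
    define j where "j = i * k + (k - 1)"
    have j: "j < k * k" "j \<notin> Y" "j div k = i"
      using index_less [OF i, of "k - 1"] Yj [OF i, of "k - 1"] index_div [of "k - 1" i] k_pos by (auto simp: j_def)
    have "a j < DD j" using a j(1) by (simp add: ss.red_def)
    then have "a j < d i" using DDY [OF j(1,2)] j(3) by simp
    then have root: "poly (P i) (rt i (a j)) = 0" using rt [OF i] by (auto simp: bij_betw_def)
    have "lamb i (f a) = rt i (a j) \<cdot>\<^sub>v q i + p i"
    proof (rule lamb_on_axis [OF i])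
      show "f a (i * k + r) = 0" if "r < k - 1" for r using Yj [OF i, of r] that by (simp add: f_def)
      show "f a (i * k + (k - 1)) = rt i (a j)" using j unfolding j_def [symmetric] by (simp add: f_def)
    qed
    then show "Determinant.det (H i (lamb i (f a))) = 0" using root poly_P [OF i] by simp
    fix r assume r: "r < k - 1"
    have "L_map (B i) (c i) (lamb i (f a)) $ r = 0"
      using L_lamb [OF i r] Yj [OF i, of r] r by (simp add: f_def)
    then show "1 * L_map (B i) (c i) (lamb i (f a)) $ r + 0 * G_map k (R_of k \<omega> i) (\<lambda>i. lamb i (f a)) $ r = 0"
      by simp
  qed
  then have sub: "f ` ss.red \<subseteq> ss.zeros (Par 1 0 \<omega>)" by auto
  have "inj_on f ss.red"
  proof (rule inj_onI, rule ext)
    fix a b j assume ab: "a \<in> ss.red" "b \<in> ss.red" "f a = f b"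
    consider "k * k \<le> j" | "j \<in> Y" | "j < k * k" "j \<notin> Y" by fastforce
    then show "a j = b j"
    proof cases
      case 1
      then show ?thesis using ab by (simp add: ss.red_def)
    next
      case 2
      then have "j < k * k" by (simp add: Y_def)
      then have "a j < DD j" "b j < DD j" using ab(1,2) by (auto simp: ss.red_def)
      then show ?thesis using DY [OF 2] by simp
    next
      case 3
      have "a j < d (j div k)" "b j < d (j div k)" using ab(1,2) 3 DDY by (auto simp: ss.red_def)
      moreover have "rt (j div k) (a j) = rt (j div k) (b j)" using fun_cong [OF ab(3), of j] 3 by (simp add: f_def)
      ultimately show ?thesis using rt [OF div_less [OF 3(1)]] by (auto simp: bij_betw_def dest: inj_onD)
    qed
  qed
  then have "card (f ` ss.red) = ss.N" by (simp add: card_image ss.N_def)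
  then have "ss.N \<le> card (ss.zeros (Par 1 0 \<omega>))"
    using card_mono [OF ss.zeros_bound(1) [OF dl_start] sub] by simp
  then have "card (ss.zeros (Par 1 0 \<omega>)) = ss.N"
    using ss.zeros_bound(2) [OF dl_start [of \<omega>]] by (rule antisym [rotated])
  then show ?thesis using dl_start [of \<omega>] by (simp add: ss.good_def)
qed

section \<open>Complex lines through the start system, and genericity\<close>

lemma polyfam_Par1: "ss.polyfam (\<lambda>z. Par 1 z \<omega>)"
  unfolding ss.polyfam_def
proof (intro allI impI)
  fix j e
  define s where "s = (\<Sum>s<k * (k - 1). \<omega> (j div k, j mod k, s) * al s e)"
  show "\<exists>f. \<forall>z. Par 1 z \<omega> j e = poly f z"
    by (rule exI [of _ "if k * k \<le> j then 0 else if j mod k = k - 1 then [:CF (j div k) e:]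
        else [:if e = (\<lambda>l. if l = j then 1 else 0) then 1 else 0, s:]"]) (simp add: Par_def s_def)
qed

lemma polyfam_Par: "ss.polyfam (\<lambda>z. Par (1 - z) z \<omega>)"
  unfolding ss.polyfam_def
proof (intro allI impI)
  fix j e
  define s where "s = (\<Sum>s<k * (k - 1). \<omega> (j div k, j mod k, s) * al s e)"
  define u where "u = (if e = (\<lambda>l. if l = j then 1 else 0) then 1 else 0 :: complex)"
  show "\<exists>f. \<forall>z. Par (1 - z) z \<omega> j e = poly f z"
    by (rule exI [of _ "if k * k \<le> j then 0 else if j mod k = k - 1 then [:CF (j div k) e:]
        else [:u, s - u:]"], unfold Par_def s_def [symmetric] u_def [symmetric]) (simp add: algebra_simps)
qed

text \<open>The parameter \<open>s\<close> stands for \<open>t / (1 - t)\<close>, so that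
  \<open>t\<close> in \<open>[0, 1)\<close> runs through a full ray from the start system.\<close>

definition generic :: "(nat \<times> nat \<times> nat \<Rightarrow> complex) \<Rightarrow> bool" where
  "generic \<omega> \<longleftrightarrow> (\<forall>s\<ge>0. ss.dl (Par 1 (of_real s) \<omega>) * ss.hdet (Par 1 (of_real s) \<omega>) \<noteq> 0)"

text \<open>\<open>z\<close> and \<open>\<omega>\<close> enter the coefficients only through their
  product, which is the homogeneity needed for rotating the ray; at \<open>z = 0\<close> the system
  is the start system, where both determinants are nonzero.\<close>

lemma AE_generic: "AE \<omega> in R_lebesgue k. generic \<omega>"
  unfolding R_lebesgue_def generic_def
proof (rule AE_no_zero_on_ray)
  define I where "I = {..<k} \<times> {..<k - 1} \<times> {..<k * (k - 1)}"
  show "finite ({..<k} \<times> {..<k - 1} \<times> {..<k * (k - 1)})" by simp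
  fix z \<omega> u
  have alg: "fun_algebra (borel_measurable M :: ('x \<Rightarrow> complex) set)" for M :: "'x measure"
    unfolding fun_algebra_def by auto
  have meas: "(\<lambda>\<omega>. Par 1 z \<omega> j e) \<in> borel_measurable (PiM I (\<lambda>_. lborel))" if "j < k * k" for j e
  proof (cases "j mod k = k - 1")
    case False
    have jm: "j mod k < k - 1" using False mod_less [of j] by linarith
    have "(j div k, j mod k, s) \<in> I" if "s < k * (k - 1)" for s
      using that div_less [OF \<open>j < k * k\<close>] jm by (auto simp: I_def simp del: One_nat_def)
    then have comp: "(\<lambda>\<omega>. \<omega> (j div k, j mod k, s)) \<in> borel_measurable (PiM I (\<lambda>_. lborel))" if "s < k * (k - 1)" for s
      using measurable_component_singleton [of "(j div k, j mod k, s)" I "\<lambda>_. lborel :: complex measure"] that by simp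
    have eq: "(\<lambda>\<omega>. Par 1 z \<omega> j e) = (\<lambda>\<omega>. (if e = (\<lambda>l. if l = j then 1 else 0) then 1 else 0) +
        z * (\<Sum>s<k * (k - 1). \<omega> (j div k, j mod k, s) * al s e))"
      using False \<open>j < k * k\<close> by (simp add: Par_def fun_eq_iff)
    show ?thesis unfolding eq
      by (intro borel_measurable_add borel_measurable_times borel_measurable_const borel_measurable_sum)
        (use comp in simp)
  next
    case True
    have eq: "(\<lambda>\<omega>. Par 1 z \<omega> j e) = (\<lambda>\<omega>. if k * k \<le> j then 0 else CF (j div k) e)"
      using True by (simp add: Par_def fun_eq_iff)
    show ?thesis unfolding eq by simp
  qed
  show "(\<lambda>\<omega>. ss.dl (Par 1 z \<omega>) * ss.hdet (Par 1 z \<omega>)) \<in>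
      borel_measurable (PiM ({..<k} \<times> {..<k - 1} \<times> {..<k * (k - 1)}) (\<lambda>_. lborel))"
    using ss.fun_algebra_dl [where C = "Par 1 z", OF alg meas] ss.fun_algebra_hdet [where C = "Par 1 z", OF alg meas]
    unfolding I_def by (rule borel_measurable_times)
  have ent: "(\<lambda>z. Par 1 z \<omega> j e) \<in> {f. \<exists>p. \<forall>z. f z = poly p z}" if "j < k * k" for j e
    using polyfam_Par1 that by (simp add: ss.polyfam_def)
  obtain p1 where p1: "\<And>z. ss.dl (Par 1 z \<omega>) = poly p1 z"
    using ss.fun_algebra_dl [where C = "\<lambda>z. Par 1 z \<omega>", OF ss.fun_algebra_poly ent] by blast
  obtain p2 where p2: "\<And>z. ss.hdet (Par 1 z \<omega>) = poly p2 z"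
    using ss.fun_algebra_hdet [where C = "\<lambda>z. Par 1 z \<omega>", OF ss.fun_algebra_poly ent] by blast
  show "\<exists>p. \<forall>z. ss.dl (Par 1 z \<omega>) * ss.hdet (Par 1 z \<omega>) = poly p z"
    by (rule exI [of _ "p1 * p2"]) (simp add: p1 p2)
  show "ss.dl (Par 1 0 \<omega>) * ss.hdet (Par 1 0 \<omega>) \<noteq> 0"
    using dl_start ss.hdet_nonzero [OF good_start] by simp
  have "Par 1 z (scale_fun ({..<k} \<times> {..<k - 1} \<times> {..<k * (k - 1)}) u \<omega>) = Par 1 (z * u) \<omega>"
  proof (intro ext)
    fix j e
    have "scale_fun ({..<k} \<times> {..<k - 1} \<times> {..<k * (k - 1)}) u \<omega> (j div k, j mod k, s) = u * \<omega> (j div k, j mod k, s)"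
      if "j < k * k" "j mod k \<noteq> k - 1" "s < k * (k - 1)" for s
    proof -
      have "j mod k < k - 1" using that(2) mod_less [of j] by linarith
      then show ?thesis using that div_less [OF that(1)] by (simp add: scale_fun_def)
    qed
    then show "Par 1 z (scale_fun ({..<k} \<times> {..<k - 1} \<times> {..<k * (k - 1)}) u \<omega>) j e = Par 1 (z * u) \<omega> j e"
      by (simp add: Par_def sum_distrib_left mult_ac)
  qed
  then show "ss.dl (Par 1 z (scale_fun ({..<k} \<times> {..<k - 1} \<times> {..<k * (k - 1)}) u \<omega>)) *
      ss.hdet (Par 1 z (scale_fun ({..<k} \<times> {..<k - 1} \<times> {..<k * (k - 1)}) u \<omega>)) =
      ss.dl (Par 1 (z * u) \<omega>) * ss.hdet (Par 1 (z * u) \<omega>)" by simp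
qed

text \<open>Dividing the linear equations by \<open>1 - t\<close> turns the coefficients into those
  of \<open>Par 1 s\<close> with \<open>s = t / (1 - t)\<close>, and goodness is insensitive to this
  factor.\<close>

lemma good_Par:
  assumes "generic \<omega>" and t: "0 \<le> t" "t < 1"
  shows "ss.good (Par (1 - of_real t) (of_real t) \<omega>)"
proof -
  define s where "s = t / (1 - t)"
  have "0 \<le> s" using t by (simp add: s_def)
  then have "ss.dl (Par 1 (of_real s) \<omega>) \<noteq> 0" "ss.hdet (Par 1 (of_real s) \<omega>) \<noteq> 0"
    using assms(1) by (auto simp: generic_def)
  then have g: "ss.good (Par 1 (of_real s) \<omega>)"
    using ss.good_on_line(1) [OF polyfam_Par1 good_start] by blast
  have 1: "complex_of_real 1 - of_real t = of_real (1 - t)" by simp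
  have st: "(1 - t) * s = t" using t by (simp add: s_def)
  show ?thesis
  proof (rule ss.good_scale [OF g, where \<gamma> = "\<lambda>j. if j mod k = k - 1 then 1 else of_real (1 - t)"])
    show "(if j mod k = k - 1 then 1 else complex_of_real (1 - t)) \<noteq> 0" for j using t by auto
    fix j e assume j: "j < k * k"
    have "complex_of_real t = of_real (1 - t) * of_real s" using st by (metis of_real_mult)
    then show "Par (1 - of_real t) (of_real t) \<omega> j e =
        (if j mod k = k - 1 then 1 else complex_of_real (1 - t)) * Par 1 (of_real s) \<omega> j e"
      using j by (simp add: Par_def distrib_left mult.assoc)
  qed
qed

end

text \<open>The complex derivatives of all orders, restricted to real arguments, serve as the
  required sequence of derivatives.\<close>

lemma holomorphic_C_infinity:
  assumes W: "open W" "g holomorphic_on W" and T: "\<And>t. t \<in> T \<Longrightarrow> complex_of_real t \<in> W"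
  shows "C_infinity_on T (\<lambda>t. g (of_real t))"
  unfolding C_infinity_on_def
proof (intro exI [of _ "\<lambda>m t. (deriv ^^ m) g (of_real t)"] conjI ballI allI)
  fix m t assume t: "t \<in> T"
  have "((deriv ^^ m) g has_field_derivative (deriv ^^ Suc m) g (of_real t)) (at (of_real t))"
    using holomorphic_derivI [OF holomorphic_higher_deriv [OF W(2,1)] W(1) T [OF t]] by simp
  then have "((\<lambda>t. (deriv ^^ m) g (of_real t)) has_vector_derivative (deriv ^^ Suc m) g (of_real t)) (at t)"
    by (rule has_vector_derivative_real_field)
  then show "((\<lambda>t. (deriv ^^ m) g (of_real t)) has_vector_derivative (deriv ^^ Suc m) g (of_real t)) (at t within T)"
    by (rule has_vector_derivative_at_within)
qed simp

lemma fun_algebra_holomorphic: "fun_algebra {f. f holomorphic_on W}"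
  by (auto simp: fun_algebra_def intro!: holomorphic_intros)

section \<open>Limits in the solution space\<close>

lemma limitin_cvec_topology:
  assumes "\<And>t. f t \<in> carrier_vec m" "l \<in> carrier_vec m" "\<And>j. j < m \<Longrightarrow> ((\<lambda>t. f t $ j) \<longlongrightarrow> l $ j) F"
  shows "limitin (cvec_topology m) f l F"
  unfolding limitin_def topspace_cvec_topology
proof (intro conjI allI impI)
  define h where "h = (\<lambda>v :: complex vec. \<lambda>j\<in>{..<m}. v $ j)"
  fix U assume U: "openin (cvec_topology m) U \<and> l \<in> U"
  then obtain V where V: "openin (product_topology (\<lambda>_. euclidean) {..<m}) V" "U = h -` V \<inter> carrier_vec m"
    unfolding cvec_topology_def openin_pullback_topology h_def by blast
  have "limitin (product_topology (\<lambda>_. euclidean) {..<m}) (\<lambda>t. h (f t)) (h l) F"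
    unfolding limitin_componentwise by (auto simp: h_def assms)
  then have "\<forall>\<^sub>F t in F. h (f t) \<in> V" using V U unfolding limitin_def by blast
  then show "\<forall>\<^sub>F t in F. f t \<in> U" by eventually_elim (use V assms in auto)
qed (rule assms)

lemma limitin_proj_topology:
  assumes f: "\<And>t. f t \<in> carrier_vec m" "\<And>t. f t \<noteq> 0\<^sub>v m" and l: "l \<in> carrier_vec m" "l \<noteq> 0\<^sub>v m"
    and lim: "\<And>j. j < m \<Longrightarrow> ((\<lambda>t. f t $ j) \<longlongrightarrow> l $ j) F"
  shows "limitin (proj_topology m) (\<lambda>t. proj_point (f t)) (proj_point l) F"
proof -
  have "limitin (subtopology (cvec_topology m) (carrier_vec m - {0\<^sub>v m})) f l F"
    unfolding limitin_subtopology using limitin_cvec_topology [OF f(1) l(1) lim] f l by simp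
  from continuous_map_limit [OF quotient_imp_continuous_map [OF quotient_map_proj_point] this]
  show ?thesis by (simp add: o_def)
qed

lemma limitin_fp_topology:
  assumes "\<And>i. i < k \<Longrightarrow> limitin (cvec_topology k) (\<lambda>t. fst (z t i)) (fst (l i)) F"
    "\<And>i. i < k \<Longrightarrow> limitin (proj_topology (n i)) (\<lambda>t. snd (z t i)) (snd (l i)) F"
    and "\<And>t. z t \<in> fp_space k n" "l \<in> fp_space k n"
  shows "limitin (fp_topology k n) z l F"
  unfolding fp_topology_def limitin_componentwise
proof (intro conjI ballI)
  show "l \<in> extensional {..<k}" using assms(4) by (auto simp: fp_space_def PiE_def)
  show "\<forall>\<^sub>F t in F. z t \<in> topspace (product_topology (\<lambda>i. prod_topology (cvec_topology k) (proj_topology (n i))) {..<k})"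
    using assms(3) topspace_fp_topology [of k n] unfolding fp_topology_def by simp
  fix i assume "i \<in> {..<k}"
  then show "limitin (prod_topology (cvec_topology k) (proj_topology (n i))) (\<lambda>t. z t i) (l i) F"
    unfolding limitin_pairwise using assms(1,2) by (simp add: o_def)
qed

lemma limitin_imp_derived_set:
  assumes "limitin X y z sequentially" "\<And>m :: nat. y m \<in> S" "\<And>m. y m \<noteq> z"
  shows "z \<in> X derived_set_of S"
  unfolding derived_set_of_def
proof (intro CollectI conjI allI impI)
  show "z \<in> topspace X" using assms(1) by (simp add: limitin_def)
  fix T assume "z \<in> T \<and> openin X T"
  then have "\<forall>\<^sub>F m in sequentially. y m \<in> T" using assms(1) by (simp add: limitin_def)
  from eventually_happens' [OF sequentially_bot this] obtain m where "y m \<in> T" by blast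
  then show "\<exists>y\<noteq>z. y \<in> S \<and> y \<in> T" using assms(2,3) by blast
qed

text \<open>Dividing by the sum of the norms of the components gives representatives that are
  bounded and whose limits cannot be zero.\<close>

lemma proj_space_normalized:
  assumes "x \<in> proj_space m"
  obtains v where "v \<in> x" "\<And>j. j < m \<Longrightarrow> norm (v $ j) \<le> 1" "1 \<le> (\<Sum>j<m. norm (v $ j))"
proof -
  obtain u where u: "u \<in> carrier_vec m" "u \<noteq> 0\<^sub>v m" "x = proj_point u" by (rule proj_spaceE [OF assms])
  define s where "s = (\<Sum>j<m. norm (u $ j))"
  obtain j where j: "j < m" "u $ j \<noteq> 0" using u by (metis carrier_vecD eq_vecI index_zero_vec)
  have le: "norm (u $ j) \<le> s" if "j < m" for j
    unfolding s_def by (rule member_le_sum) (use that in auto)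
  have "0 < norm (u $ j)" using j by simp
  then have s: "0 < s" using le [OF j(1)] by linarith
  define v where "v = complex_of_real (inverse s) \<cdot>\<^sub>v u"
  have "inverse s \<noteq> 0" using s by simp
  then have s0: "complex_of_real (inverse s) \<noteq> 0" by (metis of_real_eq_0_iff)
  have vj: "norm (v $ j) = norm (u $ j) / s" if "j < m" for j
    using that u s by (simp add: v_def norm_mult norm_inverse divide_inverse mult.commute)
  show ?thesis
  proof (rule that)
    show "v \<in> x" unfolding u(3) proj_point_def v_def using s0 by blast
    show "norm (v $ j) \<le> 1" if "j < m" for j using vj [OF that] le [OF that] s by simp
    have "(\<Sum>j<m. norm (v $ j)) = (\<Sum>j<m. norm (u $ j) / s)" by (simp add: vj)
    also have "\<dots> = s / s" by (simp only: s_def sum_divide_distrib)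
    finally have "(\<Sum>j<m. norm (v $ j)) = s / s" .
    then show "1 \<le> (\<Sum>j<m. norm (v $ j))" using s by simp
  qed
qed

lemma tendsto_H_mat:
  assumes "\<And>j. j < k \<Longrightarrow> ((\<lambda>t. lam t $ j) \<longlongrightarrow> l $ j) F" "r < m" "s < m"
  shows "((\<lambda>t. H_mat k m A (lam t) $$ (r, s)) \<longlongrightarrow> H_mat k m A l $$ (r, s)) F"
proof -
  have "((\<lambda>t. A 0 $$ (r, s) - (\<Sum>j<k. lam t $ j * A (Suc j) $$ (r, s))) \<longlongrightarrow>
      A 0 $$ (r, s) - (\<Sum>j<k. l $ j * A (Suc j) $$ (r, s))) F"
    by (intro tendsto_diff tendsto_const tendsto_sum tendsto_mult assms(1)) simp
  then show ?thesis using assms(2,3) by (simp add: H_mat_def mep_matrix_def)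
qed

text \<open>By compactness of projective space, solutions of the eigenvalue problems subconverge to the
  unique solution over the limit of the \<open>\<lambda>\<close>.\<close>

lemma kernel_limit:
  fixes lam :: "nat \<Rightarrow> nat \<Rightarrow> complex vec"
  assumes lam: "\<And>i j. i < k \<Longrightarrow> j < k \<Longrightarrow> (\<lambda>m. lam m i $ j) \<longlonglongrightarrow> fst (z i) $ j"
      "\<And>m i. i < k \<Longrightarrow> lam m i \<in> carrier_vec k"
    and x: "\<And>m i. i < k \<Longrightarrow> x m i \<in> proj_space (n i)"
      "\<And>m i v. i < k \<Longrightarrow> v \<in> x m i \<Longrightarrow> H_mat k (n i) (A i) (lam m i) *\<^sub>v v = 0\<^sub>v (n i)"
    and line: "\<And>i. i < k \<Longrightarrow> ker_line (n i) (H_mat k (n i) (A i) (fst (z i)))"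
    and z: "z \<in> fp_space k n" "\<And>i v. i < k \<Longrightarrow> v \<in> snd (z i) \<Longrightarrow> H_mat k (n i) (A i) (fst (z i)) *\<^sub>v v = 0\<^sub>v (n i)"
  obtains r where "strict_mono (r :: nat \<Rightarrow> nat)"
    "limitin (fp_topology k n) (\<lambda>m. \<lambda>i\<in>{..<k}. (lam (r m) i, x (r m) i)) z sequentially"
proof -
  have "\<exists>v. v \<in> x m i \<and> (\<forall>j<n i. norm (v $ j) \<le> 1) \<and> 1 \<le> (\<Sum>j<n i. norm (v $ j))" if "i < k" for m i
    by (rule proj_space_normalized [OF x(1) [OF that, of m]]) blast
  note ex = this
  define v where "v m i = (SOME v. v \<in> x m i \<and> (\<forall>j<n i. norm (v $ j) \<le> 1) \<and> 1 \<le> (\<Sum>j<n i. norm (v $ j)))" for m i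
  have "v m i \<in> x m i \<and> (\<forall>j<n i. norm (v m i $ j) \<le> 1) \<and> 1 \<le> (\<Sum>j<n i. norm (v m i $ j))" if "i < k" for m i
    unfolding v_def by (rule someI_ex) (rule ex [OF that])
  then have v: "\<And>m i. i < k \<Longrightarrow> v m i \<in> x m i"
      "\<And>m i j. i < k \<Longrightarrow> j < n i \<Longrightarrow> norm (v m i $ j) \<le> 1"
      "\<And>m i. i < k \<Longrightarrow> 1 \<le> (\<Sum>j<n i. norm (v m i $ j))" by blast+
  define f where "f m = (\<lambda>(i, j). if i < k \<and> j < n i then v m i $ j else 0)" for m
  have "norm (f m ij) \<le> 1" for m ij using v(2) by (cases ij) (auto simp: f_def)
  then obtain r l where r: "strict_mono (r :: nat \<Rightarrow> nat)" "\<And>ij. (\<lambda>m. f (r m) ij) \<longlonglongrightarrow> l ij"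
    using bounded_functions_convergent_subseq [of f "\<lambda>_. 1"] by blast
  define w where "w i = vec (n i) (\<lambda>j. l (i, j))" for i
  have vw: "(\<lambda>m. v (r m) i $ j) \<longlonglongrightarrow> w i $ j" if "i < k" "j < n i" for i j
    using r(2) [of "(i, j)"] that by (simp add: f_def w_def)
  have lamr: "(\<lambda>m. lam (r m) i $ j) \<longlonglongrightarrow> fst (z i) $ j" if "i < k" "j < k" for i j
    using LIMSEQ_subseq_LIMSEQ [OF lam(1) [OF that] r(1)] by (simp add: o_def)
  have vc: "v m i \<in> carrier_vec (n i)" "v m i \<noteq> 0\<^sub>v (n i)" "x m i = proj_point (v m i)" if "i < k" for m i
    using proj_space_mem [OF x(1) [OF that] v(1) [OF that]] by auto
  have wc: "w i \<in> carrier_vec (n i)" for i by (simp add: w_def)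
  \<comment> \<open>The normalization survives the limit: the norms of the components still sum to
    at least 1.\<close>
  have w0: "w i \<noteq> 0\<^sub>v (n i)" if "i < k" for i
  proof
    assume "w i = 0\<^sub>v (n i)"
    have "(\<lambda>m. \<Sum>j<n i. norm (v (r m) i $ j)) \<longlonglongrightarrow> (\<Sum>j<n i. norm (w i $ j))"
      by (intro tendsto_intros vw that) auto
    then have "1 \<le> (\<Sum>j<n i. norm (w i $ j))" by (rule LIMSEQ_le_const) (use v(3) that in auto)
    then show False using \<open>w i = 0\<^sub>v (n i)\<close> by simp
  qed
  have Hw: "H_mat k (n i) (A i) (fst (z i)) *\<^sub>v w i = 0\<^sub>v (n i)" if i: "i < k" for i
  proof (rule eq_vecI)
    fix s assume "s < dim_vec (0\<^sub>v (n i) :: complex vec)"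
    then have s: "s < n i" by simp
    have row: "(H_mat k (n i) (A i) l' *\<^sub>v u) $ s = (\<Sum>t<n i. H_mat k (n i) (A i) l' $$ (s, t) * u $ t)"
      if "u \<in> carrier_vec (n i)" for l' u
      using that s carrier_matD [OF H_mat_carrier [of k "n i" "A i" l']] by (simp add: scalar_prod_def atLeast0LessThan)
    have "(\<lambda>m. \<Sum>t<n i. H_mat k (n i) (A i) (lam (r m) i) $$ (s, t) * v (r m) i $ t) \<longlonglongrightarrow>
        (\<Sum>t<n i. H_mat k (n i) (A i) (fst (z i)) $$ (s, t) * w i $ t)"
      by (intro tendsto_sum tendsto_mult vw tendsto_H_mat lamr) (use i s in auto)
    moreover have "(\<Sum>t<n i. H_mat k (n i) (A i) (lam (r m) i) $$ (s, t) * v (r m) i $ t) = 0" for m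
      unfolding row [OF vc(1) [OF i], symmetric] x(2) [OF i v(1) [OF i]] using s by simp
    ultimately have "(\<Sum>t<n i. H_mat k (n i) (A i) (fst (z i)) $$ (s, t) * w i $ t) = 0"
      by (simp add: LIMSEQ_const_iff)
    then show "(H_mat k (n i) (A i) (fst (z i)) *\<^sub>v w i) $ s = 0\<^sub>v (n i) $ s" using row [OF wc] s by simp
  qed (use carrier_matD [OF H_mat_carrier [of k "n i" "A i" "fst (z i)"]] in simp)
  have zi: "fst (z i) \<in> carrier_vec k" "snd (z i) \<in> proj_space (n i)" if "i < k" for i
    using PiE_mem [OF z(1) [unfolded fp_space_def], of i] that by auto
  have zw: "snd (z i) = proj_point (w i)" if i: "i < k" for i
  proof -
    obtain u where u: "u \<in> carrier_vec (n i)" "u \<noteq> 0\<^sub>v (n i)" "snd (z i) = proj_point u" "u \<in> snd (z i)"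
      by (rule proj_spaceE [OF zi(2) [OF i]])
    then show ?thesis using line [OF i] wc w0 [OF i] Hw [OF i] z(2) [OF i u(4)] unfolding ker_line_def by blast
  qed
  have "limitin (fp_topology k n) (\<lambda>m. \<lambda>i\<in>{..<k}. (lam (r m) i, x (r m) i)) z sequentially"
  proof (rule limitin_fp_topology [OF _ _ _ z(1)])
    fix i assume i: "i < k"
    have "limitin (cvec_topology k) (\<lambda>m. lam (r m) i) (fst (z i)) sequentially"
      by (rule limitin_cvec_topology) (use lam(2) zi lamr i in auto)
    then show "limitin (cvec_topology k) (\<lambda>m. fst ((\<lambda>i\<in>{..<k}. (lam (r m) i, x (r m) i)) i)) (fst (z i)) sequentially"
      using i by simp
    have "limitin (proj_topology (n i)) (\<lambda>m. proj_point (v (r m) i)) (proj_point (w i)) sequentially"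
      by (rule limitin_proj_topology) (use vc wc w0 vw i in auto)
    then show "limitin (proj_topology (n i)) (\<lambda>m. snd ((\<lambda>i\<in>{..<k}. (lam (r m) i, x (r m) i)) i)) (snd (z i)) sequentially"
      using i zw [OF i] vc(3) [OF i] by simp
  next
    show "(\<lambda>i\<in>{..<k}. (lam (r m) i, x (r m) i)) \<in> fp_space k n" for m
      using lam(2) x(1) by (auto simp: fp_space_def)
  qed
  then show ?thesis using that r(1) by blast
qed

section \<open>Solutions of the homotopy\<close>

text \<open>The quantifier over all families of representatives splits into one per block, because a
  family may be changed at a single index. The abstract \<open>g\<close> covers the start system,
  the target system and the homotopy alike.\<close>

lemma solutions_iff:
  assumes F: "\<And>lam x. set (F lam x) = (\<lambda>i. H_mat k (n i) (A i) (lam i) *\<^sub>v x i) ` {..<k} \<union> (\<lambda>i. g i lam) ` {..<k}"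
    and g: "\<And>i lam. i < k \<Longrightarrow> g i lam \<in> carrier_vec m"
  shows "z \<in> solutions k n F \<longleftrightarrow> z \<in> fp_space k n \<and>
    (\<forall>i<k. \<forall>v\<in>snd (z i). H_mat k (n i) (A i) (fst (z i)) *\<^sub>v v = 0\<^sub>v (n i)) \<and>
    (\<forall>i<k. \<forall>r<m. g i (\<lambda>i. fst (z i)) $ r = 0)"
proof -
  have dim: "dim_vec (H_mat k (n i) (A i) l *\<^sub>v v) = n i" for i l v
    using carrier_matD [OF H_mat_carrier [of k "n i" "A i" l]] by simp
  have g0: "g i lam = 0\<^sub>v (dim_vec (g i lam)) \<longleftrightarrow> (\<forall>r<m. g i lam $ r = 0)" if "i < k" for i lam
    using g [OF that, of lam] by (auto intro!: eq_vecI)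
  have ne: "\<exists>u. u \<in> snd (z i)" if "z \<in> fp_space k n" "i < k" for i
  proof -
    have "snd (z i) \<in> proj_space (n i)" using PiE_mem [OF that(1) [unfolded fp_space_def], of i] that(2) by auto
    then show ?thesis by (rule proj_spaceE) blast
  qed
  show ?thesis
  proof
    assume "z \<in> solutions k n F"
    then have z: "z \<in> fp_space k n" and sol: "\<And>x w. (\<And>i. i < k \<Longrightarrow> x i \<in> snd (z i)) \<Longrightarrow>
        w \<in> set (F (\<lambda>i. fst (z i)) x) \<Longrightarrow> w = 0\<^sub>v (dim_vec w)"
      unfolding solutions_def by blast+
    define x0 where "x0 i = (SOME u. u \<in> snd (z i))" for i
    have x0: "x0 i \<in> snd (z i)" if "i < k" for i unfolding x0_def by (rule someI_ex) (rule ne [OF z that])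
    have 1: "H_mat k (n i) (A i) (fst (z i)) *\<^sub>v v = 0\<^sub>v (n i)" if "i < k" "v \<in> snd (z i)" for i v
    proof -
      have "H_mat k (n i) (A i) (fst (z i)) *\<^sub>v (x0(i := v)) i \<in> set (F (\<lambda>i. fst (z i)) (x0(i := v)))"
        unfolding F using that(1) by blast
      from sol [OF _ this] x0 that dim show ?thesis by auto
    qed
    have 2: "g i (\<lambda>i. fst (z i)) $ r = 0" if "i < k" "r < m" for i r
    proof -
      have "g i (\<lambda>i. fst (z i)) \<in> set (F (\<lambda>i. fst (z i)) x0)" unfolding F using that(1) by blast
      from sol [OF x0 this] g0 [OF that(1)] that(2) show ?thesis by auto
    qed
    show "z \<in> fp_space k n \<and> (\<forall>i<k. \<forall>v\<in>snd (z i). H_mat k (n i) (A i) (fst (z i)) *\<^sub>v v = 0\<^sub>v (n i)) \<and>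
      (\<forall>i<k. \<forall>r<m. g i (\<lambda>i. fst (z i)) $ r = 0)" using z 1 2 by blast
  next
    assume R: "z \<in> fp_space k n \<and> (\<forall>i<k. \<forall>v\<in>snd (z i). H_mat k (n i) (A i) (fst (z i)) *\<^sub>v v = 0\<^sub>v (n i)) \<and>
      (\<forall>i<k. \<forall>r<m. g i (\<lambda>i. fst (z i)) $ r = 0)"
    have "w = 0\<^sub>v (dim_vec w)" if x: "\<forall>i<k. x i \<in> snd (z i)" and w: "w \<in> set (F (\<lambda>i. fst (z i)) x)" for x w
      using w unfolding F
    proof
      assume "w \<in> (\<lambda>i. H_mat k (n i) (A i) (fst (z i)) *\<^sub>v x i) ` {..<k}"
      then obtain i where i: "i < k" "w = H_mat k (n i) (A i) (fst (z i)) *\<^sub>v x i" by auto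
      then show ?thesis using R x dim by simp
    next
      assume "w \<in> (\<lambda>i. g i (\<lambda>i. fst (z i))) ` {..<k}"
      then obtain i where i: "i < k" "w = g i (\<lambda>i. fst (z i))" by auto
      then show ?thesis using R g0 [OF i(1)] by blast
    qed
    then show "z \<in> solutions k n F" using R unfolding solutions_def by blast
  qed
qed

lemma map2_map: "map2 f (map a xs) (map b xs) = map (\<lambda>i. f (a i) (b i)) xs"
  by (induction xs) auto

lemma set_homotopy:
  "set (homotopy (Q_FP k n A B c) (P_FP k n A R) t lam x) =
     (\<lambda>i. H_mat k (n i) (A i) (lam i) *\<^sub>v x i) ` {..<k} \<union>
     (\<lambda>i. of_real (1 - t) \<cdot>\<^sub>v L_map (B i) (c i) (lam i) + of_real t \<cdot>\<^sub>v G_map k (R i) lam) ` {..<k}"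
proof -
  \<comment> \<open>The eigenvalue blocks are common to both systems, and weights with sum 1 leave
    them unchanged.\<close>
  have "complex_of_real (1 - t) \<cdot>\<^sub>v u + of_real t \<cdot>\<^sub>v u = u" for u
    by (intro eq_vecI) (auto simp: algebra_simps)
  then show ?thesis
    unfolding homotopy_def Q_FP_def P_FP_def
    by (subst zip_append) (auto simp: map2_map atLeast0LessThan)
qed

context fp_setup
begin

text \<open>Along a suitable direction the determinant of \<open>H i\<close> has derivative 1 at the
  zero; restricted to this line it is a pencil determinant with simple root 0, so the argument for
  simple eigenvalues applies.\<close>

lemma good_adj:
  assumes g: "ss.good (Par a b \<omega>)" and \<zeta>: "\<zeta> \<in> ss.zeros (Par a b \<omega>)" and i: "i < k"
  obtains r s where "r < n i" "s < n i" "adj_mat (H i (lamb i \<zeta>)) $$ (r, s) \<noteq> 0"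
proof -
  define j where "j = i * k + (k - 1)"
  have j: "j < k * k" using index_less [OF i, of "k - 1"] k_pos by (simp add: j_def)
  obtain v where v: "((\<lambda>z. ss.ev (Par a b \<omega>) j (\<lambda>l. \<zeta> l + z * v l)) has_field_derivative 1) (at 0)"
    by (rule ss.good_has_direction [OF g \<zeta> j]) blast
  define w where "w = T i *\<^sub>v block i v"
  have w: "w \<in> carrier_vec k" unfolding w_def by (rule mult_mat_vec_carrier [OF ST(2) [OF i] block_carrier])
  have lam: "lamb i (\<lambda>l. \<zeta> l + z * v l) = z \<cdot>\<^sub>v w + lamb i \<zeta>" for z
  proof -
    have "block i (\<lambda>l. \<zeta> l + z * v l) = block i \<zeta> + z \<cdot>\<^sub>v block i v" by (intro eq_vecI) (auto simp: block_def)
    then have "T i *\<^sub>v block i (\<lambda>l. \<zeta> l + z * v l) = T i *\<^sub>v block i \<zeta> + T i *\<^sub>v (z \<cdot>\<^sub>v block i v)"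
      using mult_add_distrib_mat_vec [OF ST(2) [OF i] block_carrier, of "z \<cdot>\<^sub>v block i v"] by simp
    also have "T i *\<^sub>v (z \<cdot>\<^sub>v block i v) = z \<cdot>\<^sub>v w"
      unfolding w_def by (rule mult_mat_vec [OF ST(2) [OF i] block_carrier])
    finally show ?thesis using w p [OF i] ST(2) [OF i] unfolding lamb_def by (intro eq_vecI) auto
  qed
  \<comment> \<open>A pencil with base point \<open>lamb i \<zeta>\<close> and direction
    \<open>w\<close>, which in general is not parallel to \<open>q i\<close>.\<close>
  define f where "f = pencil_det k (n i) (A i) (lamb i \<zeta>) w"
  have f: "poly f z = Determinant.det (H i (z \<cdot>\<^sub>v w + lamb i \<zeta>))" for z
    unfolding f_def by (rule poly_pencil_det [OF lamb_carrier [OF i] w])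
  have "ss.ev (Par a b \<omega>) j (\<lambda>l. \<zeta> l + z * v l) = poly f z" for z
    unfolding j_def ev_Par_det [OF i] lam f ..
  then have "(poly f has_field_derivative 1) (at 0)" using v by simp
  then have d: "poly (pderiv f) 0 = 1" by (rule DERIV_unique [OF poly_DERIV])
  have "0 \<cdot>\<^sub>v w + lamb i \<zeta> = lamb i \<zeta>" using w lamb_carrier [OF i, of \<zeta>] by (intro eq_vecI) auto
  then have "poly f 0 = 0" using f [of 0] \<zeta> i by (simp add: zeros_Par)
  moreover have f0: "f \<noteq> 0" using d by auto
  moreover have "Polynomial.order 0 (pderiv f) = 0" using d by (intro order_0I) simp
  ultimately have "Polynomial.order 0 f = 1" by (simp add: order_pderiv)
  then obtain r s where "r < n i" "s < n i" "adj_mat (H i (0 \<cdot>\<^sub>v w + lamb i \<zeta>)) $$ (r, s) \<noteq> 0"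
    using adj_nonzero_of_simple_root [OF lamb_carrier [OF i] w] f0 unfolding f_def by metis
  then show ?thesis using that \<open>0 \<cdot>\<^sub>v w + lamb i \<zeta> = lamb i \<zeta>\<close> by simp
qed

lemma good_ker_line:
  assumes "ss.good (Par a b \<omega>)" "\<zeta> \<in> ss.zeros (Par a b \<omega>)" "i < k"
  shows "ker_line (n i) (H i (lamb i \<zeta>))"
proof -
  obtain r s where "r < n i" "s < n i" "adj_mat (H i (lamb i \<zeta>)) $$ (r, s) \<noteq> 0" by (rule good_adj [OF assms])
  moreover have "Determinant.det (H i (lamb i \<zeta>)) = 0" using assms by (simp add: zeros_Par)
  ultimately show ?thesis using ker_line_of_adj [OF H_mat_carrier] by blast
qed

section \<open>Zeros of the square system and solutions of the homotopy\<close>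

definition pt :: "(nat \<Rightarrow> complex) \<Rightarrow> fp_point" where
  "pt \<zeta> = (\<lambda>i\<in>{..<k}. (lamb i \<zeta>, ker_point (n i) (H i (lamb i \<zeta>))))"

lemma coords_cong: "(\<And>i. i < k \<Longrightarrow> lam i = lam' i) \<Longrightarrow> coords lam = coords lam'"
  by (auto simp: coords_def div_less)

lemma G_map_cong: "(\<And>i. i < k \<Longrightarrow> lam i = lam' i) \<Longrightarrow> G_map k R lam = G_map k R lam'"
proof -
  assume "\<And>i. i < k \<Longrightarrow> lam i = lam' i"
  then have "stack k lam = stack k lam'"
    unfolding stack_def by (intro eq_vecI) (auto simp: power2_eq_square div_less)
  then show ?thesis by (simp add: G_map_def)
qed

lemma inj_on_pt: "inj_on pt (ss.zeros C)"
proof (rule inj_onI)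
  fix x y assume xy: "x \<in> ss.zeros C" "y \<in> ss.zeros C" "pt x = pt y"
  have "lamb i x = lamb i y" if "i < k" for i
    using fun_cong [OF xy(3), of i] that by (simp add: pt_def)
  then have "coords (\<lambda>i. lamb i x) = coords (\<lambda>i. lamb i y)" by (rule coords_cong)
  moreover have "\<forall>j\<ge>k * k. x j = 0" "\<forall>j\<ge>k * k. y j = 0" using xy by (auto simp: ss.zeros_def ss.points_def)
  ultimately show "x = y" using coords_lamb by metis
qed

text \<open>One form for all systems: the weights \<open>1, 0\<close> give the start system,
  \<open>0, 1\<close> the target system and \<open>1 - t, t\<close> the homotopy.\<close>

definition Sol :: "complex \<Rightarrow> complex \<Rightarrow> (nat \<times> nat \<times> nat \<Rightarrow> complex) \<Rightarrow> fp_point set" where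
  "Sol a b \<omega> = {z \<in> fp_space k n. (\<forall>i<k. \<forall>v\<in>snd (z i). H i (fst (z i)) *\<^sub>v v = 0\<^sub>v (n i)) \<and>
     (\<forall>i<k. \<forall>r<k - 1. a * L_map (B i) (c i) (fst (z i)) $ r + b * G_map k (R_of k \<omega> i) (\<lambda>i. fst (z i)) $ r = 0)}"

lemma L_carrier: "i < k \<Longrightarrow> L_map (B i) (c i) lam \<in> carrier_vec (k - 1)"
  using c [of i] unfolding L_map_def by (auto intro!: carrier_vecI)

lemma G_carrier: "G_map k (R_of k \<omega> i) lam \<in> carrier_vec (k - 1)"
  by (auto simp: G_map_def R_of_def intro!: carrier_vecI)

lemma solutions_homotopy:
  "solutions k n (homotopy (Q_FP k n A B c) (P_FP k n A (R_of k \<omega>)) t) = Sol (1 - of_real t) (of_real t) \<omega>"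
proof (rule Set.set_eqI)
  fix z
  define g where "g i lam = complex_of_real (1 - t) \<cdot>\<^sub>v L_map (B i) (c i) (lam i) +
    complex_of_real t \<cdot>\<^sub>v G_map k (R_of k \<omega> i) lam" for i lam
  have g: "g i lam \<in> carrier_vec (k - 1)" if "i < k" for i lam
    using L_carrier [OF that] G_carrier [of \<omega> i lam] by (simp add: g_def)
  have "g i lam $ r = (1 - of_real t) * L_map (B i) (c i) (lam i) $ r + of_real t * G_map k (R_of k \<omega> i) lam $ r"
    if "i < k" "r < k - 1" for i lam r
    using carrier_vecD [OF L_carrier [OF that(1)]] carrier_vecD [OF G_carrier [of \<omega> i lam]] that(2) by (simp add: g_def)
  moreover note solutions_iff [where g = g and A = A and m = "k - 1" and z = z, OF _ g,
      of "homotopy (Q_FP k n A B c) (P_FP k n A (R_of k \<omega>)) t"]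
  moreover have "set (homotopy (Q_FP k n A B c) (P_FP k n A (R_of k \<omega>)) t lam x) =
    (\<lambda>i. H i (lam i) *\<^sub>v x i) ` {..<k} \<union> (\<lambda>i. g i lam) ` {..<k}" for lam x
    unfolding set_homotopy g_def ..
  ultimately show "z \<in> solutions k n (homotopy (Q_FP k n A B c) (P_FP k n A (R_of k \<omega>)) t) \<longleftrightarrow>
      z \<in> Sol (1 - of_real t) (of_real t) \<omega>"
    unfolding Sol_def by auto
qed

lemma solutions_Q: "solutions k n (Q_FP k n A B c) = Sol 1 0 \<omega>"
proof (rule Set.set_eqI)
  fix z
  have "set (Q_FP k n A B c lam x) = (\<lambda>i. H i (lam i) *\<^sub>v x i) ` {..<k} \<union> (\<lambda>i. L_map (B i) (c i) (lam i)) ` {..<k}" for lam x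
    unfolding Q_FP_def by (auto simp: atLeast0LessThan)
  from solutions_iff [where g = "\<lambda>i lam. L_map (B i) (c i) (lam i)" and A = A and m = "k - 1" and z = z, OF this L_carrier]
  show "z \<in> solutions k n (Q_FP k n A B c) \<longleftrightarrow> z \<in> Sol 1 0 \<omega>" unfolding Sol_def by auto
qed

lemma solutions_P: "solutions k n (P_FP k n A (R_of k \<omega>)) = Sol 0 1 \<omega>"
proof (rule Set.set_eqI)
  fix z
  have "set (P_FP k n A (R_of k \<omega>) lam x) = (\<lambda>i. H i (lam i) *\<^sub>v x i) ` {..<k} \<union> (\<lambda>i. G_map k (R_of k \<omega> i) lam) ` {..<k}" for lam x
    unfolding P_FP_def by (auto simp: atLeast0LessThan)
  from solutions_iff [where g = "\<lambda>i lam. G_map k (R_of k \<omega> i) lam" and A = A and m = "k - 1" and z = z, OF this G_carrier]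
  show "z \<in> solutions k n (P_FP k n A (R_of k \<omega>)) \<longleftrightarrow> z \<in> Sol 0 1 \<omega>" unfolding Sol_def by auto
qed

lemma fp_spaceD: "z \<in> fp_space k n \<Longrightarrow> i < k \<Longrightarrow> fst (z i) \<in> carrier_vec k \<and> snd (z i) \<in> proj_space (n i)"
  unfolding fp_space_def by (drule PiE_mem [where x = i]) auto

lemma Sol_det:
  assumes "z \<in> Sol a b \<omega>" "i < k"
  shows "Determinant.det (H i (fst (z i))) = 0"
proof -
  have "snd (z i) \<in> proj_space (n i)" using assms fp_spaceD unfolding Sol_def by blast
  then obtain v where v: "v \<in> carrier_vec (n i)" "v \<noteq> 0\<^sub>v (n i)" "v \<in> snd (z i)" by (rule proj_spaceE)
  then have "H i (fst (z i)) *\<^sub>v v = 0\<^sub>v (n i)" using assms unfolding Sol_def by blast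
  then show ?thesis using det_0_iff_vec_prod_zero [OF H_mat_carrier] v by blast
qed

lemma Sol_lamb:
  assumes "z \<in> Sol a b \<omega>" "i < k"
  shows "lamb i (coords (\<lambda>i. fst (z i))) = fst (z i)"
  using assms lamb_coords [OF assms(2), of "\<lambda>i. fst (z i)"] fp_spaceD [of z i] unfolding Sol_def by blast

lemma Sol_coords:
  assumes z: "z \<in> Sol a b \<omega>"
  shows "coords (\<lambda>i. fst (z i)) \<in> ss.zeros (Par a b \<omega>)"
proof -
  define \<zeta> where "\<zeta> = coords (\<lambda>i. fst (z i))"
  have l: "lamb i \<zeta> = fst (z i)" if "i < k" for i using Sol_lamb [OF z that] by (simp add: \<zeta>_def)
  have "G_map k R (\<lambda>i. lamb i \<zeta>) = G_map k R (\<lambda>i. fst (z i))" for R by (rule G_map_cong) (rule l)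
  moreover have pts: "\<forall>j\<ge>k * k. \<zeta> j = 0" unfolding \<zeta>_def by (rule coords_points)
  ultimately have "\<zeta> \<in> ss.zeros (Par a b \<omega>)"
    unfolding zeros_Par using z Sol_det [OF z] pts by (auto simp: l Sol_def)
  then show ?thesis by (simp add: \<zeta>_def)
qed

lemma pt_Sol:
  assumes \<zeta>: "\<zeta> \<in> ss.zeros (Par a b \<omega>)"
  shows "pt \<zeta> \<in> Sol a b \<omega>"
proof -
  have det: "Determinant.det (H i (lamb i \<zeta>)) = 0" if "i < k" for i using \<zeta> that by (simp add: zeros_Par)
  have "pt \<zeta> \<in> fp_space k n"
    unfolding pt_def fp_space_def by (auto intro!: lamb_carrier ker_point(1) [OF H_mat_carrier] det)
  moreover have "H i (fst (pt \<zeta> i)) *\<^sub>v v = 0\<^sub>v (n i)" if "i < k" "v \<in> snd (pt \<zeta> i)" for i v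
    using ker_point(2) [OF H_mat_carrier det [OF that(1)]] that by (simp add: pt_def)
  moreover have "G_map k R (\<lambda>i. fst (pt \<zeta> i)) = G_map k R (\<lambda>i. lamb i \<zeta>)" for R
    by (rule G_map_cong) (simp add: pt_def)
  ultimately show ?thesis using \<zeta> by (auto simp: Sol_def zeros_Par pt_def)
qed

lemma Sol_pt:
  assumes z: "z \<in> Sol a b \<omega>" and line: "\<And>i. i < k \<Longrightarrow> ker_line (n i) (H i (fst (z i)))"
  shows "z = pt (coords (\<lambda>i. fst (z i)))"
proof
  fix i show "z i = pt (coords (\<lambda>i. fst (z i))) i"
  proof (cases "i < k")
    case True
    have "snd (z i) = ker_point (n i) (H i (fst (z i)))"
      by (rule ker_line_point [OF H_mat_carrier Sol_det [OF z True] line [OF True]])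
        (use z True fp_spaceD in \<open>auto simp: Sol_def\<close>)
    then show ?thesis using Sol_lamb [OF z True] True by (simp add: pt_def prod_eq_iff)
  next
    case False
    then show ?thesis using z by (auto simp: Sol_def fp_space_def pt_def PiE_def extensional_def)
  qed
qed

text \<open>Goodness makes all kernels lines, so the eigenvectors are determined by the
  \<lambda>.\<close>

lemma Sol_good: "ss.good (Par a b \<omega>) \<Longrightarrow> Sol a b \<omega> = pt ` ss.zeros (Par a b \<omega>)"
proof
  assume g: "ss.good (Par a b \<omega>)"
  show "pt ` ss.zeros (Par a b \<omega>) \<subseteq> Sol a b \<omega>" using pt_Sol by blast
  show "Sol a b \<omega> \<subseteq> pt ` ss.zeros (Par a b \<omega>)"
  proof
    fix z assume z: "z \<in> Sol a b \<omega>"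
    have "ker_line (n i) (H i (fst (z i)))" if "i < k" for i
      using good_ker_line [OF g Sol_coords [OF z] that] Sol_lamb [OF z that] by simp
    from Sol_pt [OF z this] Sol_coords [OF z] show "z \<in> pt ` ss.zeros (Par a b \<omega>)" by blast
  qed
qed

text \<open>\<open>L_i\<close> vanishes exactly on the line through \<open>p i\<close> in direction
  \<open>q i\<close>, because it vanishes at \<open>p i\<close> and the kernel of \<open>B i\<close>
  is spanned by \<open>q i\<close>.\<close>

lemma start_set:
  "finite (\<Pi>\<^sub>E i\<in>{..<k}. gep_eigenpairs k (n i) (A i) (p i) (q i))"
  "Sol 1 0 \<omega> = (\<Pi>\<^sub>E i\<in>{..<k}. gep_eigenpairs k (n i) (A i) (p i) (q i))"
proof -
  show "finite (\<Pi>\<^sub>E i\<in>{..<k}. gep_eigenpairs k (n i) (A i) (p i) (q i))"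
    by (rule finite_PiE) (auto simp: gep_eq_simple card_simple_le(3))
  have Lq: "(\<forall>r<k - 1. L_map (B i) (c i) l $ r = 0) \<longleftrightarrow> (\<exists>\<beta>. l = \<beta> \<cdot>\<^sub>v q i + p i)"
    if i: "i < k" and l: "l \<in> carrier_vec k" for i l
  proof -
    have Bp: "(B i *\<^sub>v p i) $ r + c i $ r = 0" if "r < k - 1" for r
    proof -
      have "(B i *\<^sub>v p i + c i) $ r = 0" using Lp [OF i] that by (simp add: L_map_def)
      then show ?thesis using B [OF i] c [OF i] that by simp
    qed
    have lp: "l - p i \<in> carrier_vec k" using l p [OF i] by simp
    have Ll: "L_map (B i) (c i) l $ r = (B i *\<^sub>v (l - p i)) $ r" if "r < k - 1" for r
    proof -
      have "B i *\<^sub>v (l - p i) = B i *\<^sub>v l - B i *\<^sub>v p i" by (rule mult_minus_distrib_mat_vec [OF B [OF i] l p [OF i]])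
      then show ?thesis using Bp [OF that] B [OF i] c [OF i] that by (simp add: L_map_def) (simp add: eq_neg_iff_add_eq_0 [symmetric])
    qed
    have "(\<forall>r<k - 1. L_map (B i) (c i) l $ r = 0) \<longleftrightarrow> B i *\<^sub>v (l - p i) = 0\<^sub>v (k - 1)"
    proof -
      define u where "u = B i *\<^sub>v (l - p i)"
      have "dim_vec u = k - 1" using B [OF i] by (simp add: u_def)
      then have "(\<forall>r<k - 1. u $ r = 0) \<longleftrightarrow> u = 0\<^sub>v (k - 1)" by (auto intro!: eq_vecI)
      then show ?thesis by (simp add: Ll u_def [symmetric])
    qed
    also have "\<dots> \<longleftrightarrow> l - p i \<in> mat_kernel (B i)" using mat_kernel [OF B [OF i]] lp by auto
    also have "\<dots> \<longleftrightarrow> (\<exists>\<beta>. l - p i = \<beta> \<cdot>\<^sub>v q i)" unfolding kerB [OF i] by auto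
    also have "\<dots> \<longleftrightarrow> (\<exists>\<beta>. l = \<beta> \<cdot>\<^sub>v q i + p i)"
    proof -
      have "l - p i = u \<longleftrightarrow> l = u + p i" if "u \<in> carrier_vec k" for u
        using l p [OF i] that by (auto intro!: eq_vecI)
      then show ?thesis using q [OF i] by simp
    qed
    finally show ?thesis .
  qed
  show "Sol 1 0 \<omega> = (\<Pi>\<^sub>E i\<in>{..<k}. gep_eigenpairs k (n i) (A i) (p i) (q i))"
  proof (intro Set.set_eqI iffI)
    fix z assume z: "z \<in> Sol 1 0 \<omega>"
    show "z \<in> (\<Pi>\<^sub>E i\<in>{..<k}. gep_eigenpairs k (n i) (A i) (p i) (q i))"
    proof (rule PiE_I)
      fix i assume "i \<in> {..<k}"
      then have i: "i < k" by simp
      have zi: "fst (z i) \<in> carrier_vec k" "snd (z i) \<in> proj_space (n i)"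
        using z fp_spaceD [of z i] i unfolding Sol_def by auto
      have "\<forall>r<k - 1. L_map (B i) (c i) (fst (z i)) $ r = 0" using z i unfolding Sol_def by auto
      then obtain \<beta> where "fst (z i) = \<beta> \<cdot>\<^sub>v q i + p i" using Lq [OF i zi(1)] by blast
      moreover have "\<forall>v\<in>snd (z i). H i (fst (z i)) *\<^sub>v v = 0\<^sub>v (n i)" using z i unfolding Sol_def by blast
      ultimately show "z i \<in> gep_eigenpairs k (n i) (A i) (p i) (q i)"
        unfolding gep_eigenpairs_def using zi by (intro CollectI exI [of _ \<beta>] exI [of _ "snd (z i)"]) (simp add: prod_eq_iff)
    next
      fix i assume "i \<notin> {..<k}"
      then show "z i = undefined" using z unfolding Sol_def fp_space_def by auto
    qed
  next
    fix z assume z: "z \<in> (\<Pi>\<^sub>E i\<in>{..<k}. gep_eigenpairs k (n i) (A i) (p i) (q i))"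
    have zi: "\<exists>\<beta>. fst (z i) = \<beta> \<cdot>\<^sub>v q i + p i \<and> snd (z i) \<in> proj_space (n i) \<and>
        (\<forall>v\<in>snd (z i). H i (fst (z i)) *\<^sub>v v = 0\<^sub>v (n i))" if "i < k" for i
      using PiE_mem [OF z, of i] that unfolding gep_eigenpairs_def by auto
    have car: "fst (z i) \<in> carrier_vec k" if "i < k" for i
      using zi [OF that] p [OF that] q [OF that] by auto
    have "z \<in> fp_space k n"
      unfolding fp_space_def
    proof (rule PiE_I)
      fix i assume "i \<in> {..<k}"
      then show "z i \<in> carrier_vec k \<times> proj_space (n i)" using car [of i] zi [of i] by (auto simp: mem_Times_iff)
    next
      fix i assume "i \<notin> {..<k}"
      then show "z i = undefined" using z by auto
    qed
    moreover have "\<forall>r<k - 1. L_map (B i) (c i) (fst (z i)) $ r = 0" if "i < k" for i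
      using zi [OF that] Lq [OF that car [OF that]] by blast
    ultimately show "z \<in> Sol 1 0 \<omega>" unfolding Sol_def using zi by auto
  qed
qed

end

text \<open>An open rectangle around the segment. \<open>h b\<close> is the margin at which it would
  reach \<open>b\<close>; points with real part at least 1 are cut off by the edge
  \<open>Re z < 1\<close>, so the parameter 1 may itself be in \<open>X\<close>.\<close>

lemma convex_neighbourhood_avoiding_finite:
  assumes fin: "finite X" and X: "\<And>t. 0 \<le> t \<Longrightarrow> t < 1 \<Longrightarrow> complex_of_real t \<notin> X"
  obtains W where "open W" "convex W" "\<And>t. 0 \<le> t \<Longrightarrow> t < 1 \<Longrightarrow> complex_of_real t \<in> W" "W \<inter> X = {}"
proof -
  define h where "h b = max (- Re b) \<bar>Im b\<bar>" for b
  define \<eta> where "\<eta> = Min (insert 1 (h ` {b \<in> X. Re b < 1}))"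
  have fin': "finite (insert 1 (h ` {b \<in> X. Re b < 1}))" using fin by simp
  have hpos: "0 < h b" if "b \<in> X" "Re b < 1" for b
  proof (rule ccontr)
    assume "\<not> 0 < h b"
    then have "0 \<le> Re b" "Im b = 0" by (auto simp: h_def)
    moreover have "b = complex_of_real (Re b)" using \<open>Im b = 0\<close> by (simp add: complex_eq_iff)
    ultimately show False using X [of "Re b"] that by simp
  qed
  have \<eta>: "0 < \<eta>" unfolding \<eta>_def using fin' hpos by (subst Min_gr_iff) auto
  define W where "W = ({z. Re z < 1} \<inter> {z. - \<eta> < Re z}) \<inter> ({z. Im z < \<eta>} \<inter> {z. - \<eta> < Im z})"
  show ?thesis
  proof (rule that)
    show "open W"
      unfolding W_def by (intro open_Int open_halfspace_Re_lt open_halfspace_Re_gt open_halfspace_Im_lt open_halfspace_Im_gt)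
    show "convex W"
      unfolding W_def using convex_halfspace_Re_gt [of "- \<eta>"] convex_halfspace_Im_gt [of "- \<eta>"]
      by (intro convex_Int convex_halfspace_Re_lt convex_halfspace_Im_lt) (auto simp: Collect_mono_iff)
    show "complex_of_real t \<in> W" if "0 \<le> t" "t < 1" for t using that \<eta> by (auto simp: W_def)
    show "W \<inter> X = {}"
    proof (rule ccontr)
      assume "W \<inter> X \<noteq> {}"
      then obtain b where b: "b \<in> W" "b \<in> X" by blast
      then have "\<eta> \<le> h b" unfolding \<eta>_def by (intro Min_le [OF fin']) (auto simp: W_def)
      then show False using b by (auto simp: W_def h_def)
    qed
  qed
qed

section \<open>Smoothness of the paths and their behaviour at isolated solutions\<close>

context fp_setup
begin

lemma fun_algebra_lamb:
  assumes \<A>: "fun_algebra \<A>" and \<gamma>: "\<And>j. j < k * k \<Longrightarrow> (\<lambda>x. \<gamma> x j) \<in> \<A>" and i: "i < k"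
  shows "j < k \<Longrightarrow> (\<lambda>x. lamb i (\<gamma> x) $ j) \<in> \<A>"
    and "r < n i \<Longrightarrow> s < n i \<Longrightarrow> (\<lambda>x. adj_mat (H i (lamb i (\<gamma> x))) $$ (r, s)) \<in> \<A>"
proof -
  have lam: "(\<lambda>x. lamb i (\<gamma> x) $ j) \<in> \<A>" if j: "j < k" for j
  proof -
    have "(\<lambda>x. T i $$ (j, r) * \<gamma> x (i * k + r)) \<in> \<A>" if "r < k" for r
      by (rule fun_algebra_mult [OF \<A> fun_algebra_const [OF \<A>] \<gamma> [OF index_less [OF i that]]])
    then have "(\<lambda>x. \<Sum>r<k. T i $$ (j, r) * \<gamma> x (i * k + r)) \<in> \<A>" by (intro fun_algebra_sum [OF \<A>]) simp
    then show ?thesis unfolding lamb_index [OF i j] by (rule fun_algebra_add [OF \<A> _ fun_algebra_const [OF \<A>]])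
  qed
  then show "j < k \<Longrightarrow> (\<lambda>x. lamb i (\<gamma> x) $ j) \<in> \<A>" .
  have ent: "(\<lambda>x. A i 0 $$ (r, s) - (\<Sum>j<k. lamb i (\<gamma> x) $ j * A i (Suc j) $$ (r, s))) \<in> \<A>" for r s
  proof -
    have "(\<lambda>x. lamb i (\<gamma> x) $ j * A i (Suc j) $$ (r, s)) \<in> \<A>" if "j < k" for j
      by (rule fun_algebra_mult [OF \<A> lam [OF that] fun_algebra_const [OF \<A>]])
    then have "(\<lambda>x. \<Sum>j<k. lamb i (\<gamma> x) $ j * A i (Suc j) $$ (r, s)) \<in> \<A>" by (intro fun_algebra_sum [OF \<A>]) simp
    then show ?thesis
      unfolding diff_conv_add_uminus by (intro fun_algebra_add [OF \<A> fun_algebra_const [OF \<A>]] fun_algebra_uminus [OF \<A>])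
  qed
  show "(\<lambda>x. adj_mat (H i (lamb i (\<gamma> x))) $$ (r, s)) \<in> \<A>" if "r < n i" "s < n i"
    unfolding H_mat_def mep_matrix_def by (rule fun_algebra_adj_mat [OF \<A> ent that])
qed

text \<open>The \<lambda> are affine in holomorphic functions. For the projective part, a column of
  the adjugate that is nonzero at \<open>s\<close> still spans the kernel at nearby parameters and
  is holomorphic, which gives the local lift.\<close>

lemma smooth_pt:
  assumes W: "open W" "\<And>t. 0 \<le> t \<Longrightarrow> t < 1 \<Longrightarrow> complex_of_real t \<in> W"
    and hol: "\<And>j. j < k * k \<Longrightarrow> (\<lambda>z. \<gamma> z j) holomorphic_on W"
    and \<gamma>: "\<And>z. z \<in> W \<Longrightarrow> ss.good (Par (1 - z) z \<omega>)" "\<And>z. z \<in> W \<Longrightarrow> \<gamma> z \<in> ss.zeros (Par (1 - z) z \<omega>)"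
  shows "smooth_fp_path k n (\<lambda>t. pt (\<gamma> (of_real t)))"
proof -
  have hol': "(\<lambda>z. \<gamma> z j) \<in> {f. f holomorphic_on W}" if "j < k * k" for j using hol that by simp
  have lam: "(\<lambda>z. lamb i (\<gamma> z) $ j) holomorphic_on W" if "i < k" "j < k" for i j
    using fun_algebra_lamb(1) [where \<gamma> = \<gamma>, OF fun_algebra_holomorphic hol' that] by simp
  have adj: "(\<lambda>z. adj_mat (H i (lamb i (\<gamma> z))) $$ (r, s)) holomorphic_on W" if "i < k" "r < n i" "s < n i" for i r s
    using fun_algebra_lamb(2) [where \<gamma> = \<gamma>, OF fun_algebra_holomorphic hol' that] by simp
  show ?thesis
    unfolding smooth_fp_path_def
  proof (intro conjI ballI allI impI)
    fix t :: real assume "t \<in> {0..<1}"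
    then show "pt (\<gamma> (of_real t)) \<in> fp_space k n"
      using pt_Sol [OF \<gamma>(2) [OF W(2) [of t]]] by (simp add: Sol_def)
  next
    fix i j assume ij: "i < k" "j < k"
    have "C_infinity_on {0..<1} (\<lambda>t. lamb i (\<gamma> (of_real t)) $ j)"
      by (rule holomorphic_C_infinity [OF W(1) lam [OF ij]]) (auto intro: W(2))
    then show "C_infinity_on {0..<1} (\<lambda>t. fst (pt (\<gamma> (of_real t)) i) $ j)" using ij by (simp add: pt_def)
  next
    fix i assume i: "i < k"
    have det: "Determinant.det (H i (lamb i (\<gamma> z))) = 0" if "z \<in> W" for z
      using \<gamma>(2) [OF that] i by (simp add: zeros_Par)
    show "smooth_proj_path (n i) (\<lambda>t. snd (pt (\<gamma> (of_real t)) i))"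
      unfolding smooth_proj_path_def
    proof
      fix s :: real assume "s \<in> {0..<1}"
      then have s: "complex_of_real s \<in> W" using W(2) by simp
      obtain r c where rc: "r < n i" "c < n i" "adj_mat (H i (lamb i (\<gamma> (of_real s)))) $$ (r, c) \<noteq> 0"
        by (rule good_adj [OF \<gamma>(1) [OF s] \<gamma>(2) [OF s] i])
      define g where "g z = adj_mat (H i (lamb i (\<gamma> z))) $$ (r, c)" for z
      have "continuous_on W g"
        unfolding g_def using adj [OF i rc(1,2)] by (rule holomorphic_on_imp_continuous_on)
      then have "open (W \<inter> g -` (- {0}))" using W(1) by (intro continuous_open_preimage) auto
      moreover have "complex_of_real s \<in> W \<inter> g -` (- {0})" using s rc(3) by (simp add: g_def)
      ultimately obtain e where e: "0 < e" "ball (complex_of_real s) e \<subseteq> W \<inter> g -` (- {0})"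
        using open_contains_ball by blast
      define v where "v t = col (adj_mat (H i (lamb i (\<gamma> (complex_of_real t))))) c" for t
      have near: "complex_of_real t \<in> W" "g (of_real t) \<noteq> 0" if "t \<in> ball s e" for t
      proof -
        have "complex_of_real t \<in> ball (of_real s) e" using that by (simp add: dist_of_real)
        then have "complex_of_real t \<in> W \<inter> g -` (- {0})" using e(2) by blast
        then show "complex_of_real t \<in> W" "g (of_real t) \<noteq> 0" by auto
      qed
      have "v t \<in> carrier_vec (n i) - {0\<^sub>v (n i)} \<and> snd (pt (\<gamma> (of_real t)) i) = proj_point (v t)"
        if t: "t \<in> ball s e" for t
      proof -
        have M: "H i (lamb i (\<gamma> (of_real t))) \<in> carrier_mat (n i) (n i)" by simp
        have a: "adj_mat (H i (lamb i (\<gamma> (of_real t)))) $$ (r, c) \<noteq> 0" using near(2) [OF t] by (simp add: g_def)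
        note d = det [OF near(1) [OF t]]
        note K = kernel_spanned_by_adj_column [OF M d rc(1,2) a, folded v_def]
        have v0: "v t \<noteq> 0\<^sub>v (n i)" using K(2) rc(1) by auto
        have "proj_point (v t) \<in> proj_space (n i)" using K(1) v0 by (auto simp: proj_space_def)
        moreover have "\<forall>u\<in>proj_point (v t). H i (lamb i (\<gamma> (of_real t))) *\<^sub>v u = 0\<^sub>v (n i)"
          using kernel_of_proj_point [OF M K(1,3)] by blast
        ultimately have "proj_point (v t) = ker_point (n i) (H i (lamb i (\<gamma> (of_real t))))"
          by (rule ker_line_point [OF M d ker_line_of_adj [OF M d rc(1,2) a]])
        then show ?thesis using K(1) v0 i by (simp add: pt_def)
      qed
      moreover have "C_infinity_on ({0..<1} \<inter> ball s e) (\<lambda>t. v t $ j)" if j: "j < n i" for j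
      proof -
        have "v t $ j = adj_mat (H i (lamb i (\<gamma> (of_real t)))) $$ (j, c)" for t
          using adj_mat(1) [OF H_mat_carrier [of k "n i" "A i" "lamb i (\<gamma> (of_real t))"]] j rc(2) by (simp add: v_def)
        moreover have "C_infinity_on ({0..<1} \<inter> ball s e) (\<lambda>t. adj_mat (H i (lamb i (\<gamma> (of_real t)))) $$ (j, c))"
          by (rule holomorphic_C_infinity [OF W(1) adj [OF i j rc(2)]]) (auto intro: W(2))
        ultimately show ?thesis by simp
      qed
      ultimately show "\<exists>e>0. \<exists>v. (\<forall>t\<in>{0..<1} \<inter> ball s e. v t \<in> carrier_vec (n i) - {0\<^sub>v (n i)} \<and>
          snd (pt (\<gamma> (of_real t)) i) = proj_point (v t)) \<and> (\<forall>j<n i. C_infinity_on ({0..<1} \<inter> ball s e) (\<lambda>t. v t $ j))"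
        using e(1) by (intro exI [of _ e] exI [of _ v] conjI) auto
    qed
  qed
qed

text \<open>Convergence of the coordinates gives that of the \<lambda>; the chosen kernel points
  follow along a subsequence because the kernels at the limit are lines.\<close>

lemma pt_subsequence_limit:
  assumes y: "\<And>m. \<exists>a b. y m \<in> ss.zeros (Par a b \<omega>)" and x: "x \<in> ss.zeros (Par a b \<omega>)"
    and lim: "\<And>j. j < k * k \<Longrightarrow> (\<lambda>m. y m j) \<longlonglongrightarrow> x j"
    and line: "\<And>i. i < k \<Longrightarrow> ker_line (n i) (H i (lamb i x))"
  obtains r where "strict_mono (r :: nat \<Rightarrow> nat)" "limitin (fp_topology k n) (\<lambda>m. pt (y (r m))) (pt x) sequentially"
proof -
  have det: "Determinant.det (H i (lamb i (y m))) = 0" if "i < k" for m i using y [of m] that by (auto simp: zeros_Par)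
  have "pt x \<in> Sol a b \<omega>" by (rule pt_Sol [OF x])
  then have px: "pt x \<in> fp_space k n" "\<And>i v. i < k \<Longrightarrow> v \<in> snd (pt x i) \<Longrightarrow> H i (fst (pt x i)) *\<^sub>v v = 0\<^sub>v (n i)"
    unfolding Sol_def by auto
  have fp: "fst (pt x i) = lamb i x" if "i < k" for i using that by (simp add: pt_def)
  have "(\<lambda>m. lamb i (y m) $ j) \<longlonglongrightarrow> fst (pt x i) $ j" if "i < k" "j < k" for i j
    unfolding fp [OF that(1)] lamb_index [OF that]
    by (intro tendsto_intros lim index_less that) auto
  moreover have "ker_line (n i) (H i (fst (pt x i)))" if "i < k" for i using line that by (simp add: fp)
  moreover have "lamb i (y m) \<in> carrier_vec k" if "i < k" for m i using that by (rule lamb_carrier)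
  moreover have "ker_point (n i) (H i (lamb i (y m))) \<in> proj_space (n i)" if "i < k" for m i
    by (rule ker_point(1) [OF H_mat_carrier det [OF that]])
  moreover have "H i (lamb i (y m)) *\<^sub>v v = 0\<^sub>v (n i)" if "i < k" "v \<in> ker_point (n i) (H i (lamb i (y m)))" for m i v
    by (rule ker_point(2) [OF H_mat_carrier det [OF that(1)] that(2)])
  ultimately obtain r where r: "strict_mono (r :: nat \<Rightarrow> nat)"
    "limitin (fp_topology k n) (\<lambda>m. \<lambda>i\<in>{..<k}. (lamb i (y (r m)), ker_point (n i) (H i (lamb i (y (r m)))))) (pt x) sequentially"
    using kernel_limit [where lam = "\<lambda>m i. lamb i (y m)" and x = "\<lambda>m i. ker_point (n i) (H i (lamb i (y m)))" and z = "pt x" and A = A and k = k and n = n] px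
    by (smt (verit, best))
  then show ?thesis using that by (simp add: pt_def)
qed

text \<open>If a kernel contained a second direction \<open>y\<close>, the vectors
  \<open>w + y / (m + 1)\<close> would give solutions with the same \<lambda> that converge to
  \<open>z\<close> without being equal to it.\<close>

lemma isolated_ker_line:
  assumes z: "z \<in> Sol a b \<omega>" "z \<notin> fp_topology k n derived_set_of Sol a b \<omega>" and i: "i < k"
  shows "ker_line (n i) (H i (fst (z i)))"
proof (rule ccontr)
  define M where "M = H i (fst (z i))"
  have M: "M \<in> carrier_mat (n i) (n i)" by (simp add: M_def)
  assume "\<not> ker_line (n i) (H i (fst (z i)))"
  then obtain u v where uv: "u \<in> carrier_vec (n i)" "v \<in> carrier_vec (n i)" "u \<noteq> 0\<^sub>v (n i)" "v \<noteq> 0\<^sub>v (n i)"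
      "M *\<^sub>v u = 0\<^sub>v (n i)" "M *\<^sub>v v = 0\<^sub>v (n i)" "proj_point u \<noteq> proj_point v"
    unfolding ker_line_def M_def by blast
  have zf: "z \<in> fp_space k n" using z(1) by (simp add: Sol_def)
  obtain w where w: "w \<in> carrier_vec (n i)" "w \<noteq> 0\<^sub>v (n i)" "snd (z i) = proj_point w" "w \<in> snd (z i)"
    using fp_spaceD [OF zf i] proj_spaceE by metis
  have Mw: "M *\<^sub>v w = 0\<^sub>v (n i)" using z(1) i w(4) unfolding Sol_def M_def by blast
  \<comment> \<open>\<open>u\<close> and \<open>v\<close> represent different points, so at least
    one of them differs from the point of \<open>w\<close>.\<close>
  obtain y where y: "y \<in> carrier_vec (n i)" "y \<noteq> 0\<^sub>v (n i)" "M *\<^sub>v y = 0\<^sub>v (n i)" "proj_point y \<noteq> proj_point w"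
    using uv by metis
  define a' where "a' m = complex_of_real (inverse (real (Suc m)))" for m
  define s where "s m = w + a' m \<cdot>\<^sub>v y" for m
  have s: "s m \<in> carrier_vec (n i)" for m using w y by (simp add: s_def)
  have neq: "s m \<noteq> \<beta> \<cdot>\<^sub>v w" for m \<beta>
  proof
    assume "s m = \<beta> \<cdot>\<^sub>v w"
    have eq: "a' m \<cdot>\<^sub>v y = (\<beta> - 1) \<cdot>\<^sub>v w"
    proof (rule eq_vecI)
      fix j assume "j < dim_vec ((\<beta> - 1) \<cdot>\<^sub>v w)"
      then have j: "j < n i" using w by simp
      have "s m $ j = (\<beta> \<cdot>\<^sub>v w) $ j" using \<open>s m = \<beta> \<cdot>\<^sub>v w\<close> by simp
      then show "(a' m \<cdot>\<^sub>v y) $ j = ((\<beta> - 1) \<cdot>\<^sub>v w) $ j" using j w y by (simp add: s_def algebra_simps)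
    qed (use w y in simp)
    have "inverse (real (Suc m)) \<noteq> 0" by simp
    then have a0: "a' m \<noteq> 0" unfolding a'_def by (metis of_real_eq_0_iff)
    have "y = inverse (a' m) \<cdot>\<^sub>v (a' m \<cdot>\<^sub>v y)" using a0 by (simp add: smult_smult_assoc)
    also have "\<dots> = (inverse (a' m) * (\<beta> - 1)) \<cdot>\<^sub>v w" unfolding eq by (simp add: smult_smult_assoc)
    finally have yw: "y = (inverse (a' m) * (\<beta> - 1)) \<cdot>\<^sub>v w" .
    show False
    proof (cases "inverse (a' m) * (\<beta> - 1) = 0")
      case True
      then have "y = 0 \<cdot>\<^sub>v w" using yw by metis
      then have "y = 0\<^sub>v (n i)" using w by (intro eq_vecI) auto
      then show False using y by simp
    next
      case False
      then show False using proj_point_smult yw y(4) by metis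
    qed
  qed
  have Ms: "M *\<^sub>v s m = 0\<^sub>v (n i)" for m
  proof -
    have "M *\<^sub>v s m = M *\<^sub>v w + M *\<^sub>v (a' m \<cdot>\<^sub>v y)"
      unfolding s_def using y by (intro mult_add_distrib_mat_vec [OF M w(1)]) simp
    also have "M *\<^sub>v (a' m \<cdot>\<^sub>v y) = a' m \<cdot>\<^sub>v (M *\<^sub>v y)" by (rule mult_mat_vec [OF M y(1)])
    also have "\<dots> = 0\<^sub>v (n i)" using y(3) by (intro eq_vecI) auto
    finally show ?thesis using Mw by simp
  qed
  have s0: "s m \<noteq> 0\<^sub>v (n i)" for m
  proof -
    have "0 \<cdot>\<^sub>v w = 0\<^sub>v (n i)" using w by (intro eq_vecI) auto
    then show ?thesis using neq [of m 0] by simp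
  qed
  have sp: "proj_point (s m) \<noteq> proj_point w" for m
  proof
    assume "proj_point (s m) = proj_point w"
    then have "s m \<in> proj_point w" using in_proj_point [of "s m"] by simp
    then show False using neq [of m] by (auto simp: proj_point_def)
  qed
  define f where "f m = z(i := (fst (z i), proj_point (s m)))" for m
  have ff: "f m \<in> fp_space k n" for m
  proof -
    have "proj_point (s m) \<in> proj_space (n i)" using s s0 by (auto simp: proj_space_def)
    then show ?thesis using zf i fp_spaceD [OF zf i] unfolding f_def fp_space_def by (auto simp: PiE_def Pi_def extensional_def)
  qed
  have fst_f: "fst (f m j) = fst (z j)" for m j by (simp add: f_def)
  have fS: "f m \<in> Sol a b \<omega>" for m
  proof -
    have "H j (fst (z j)) *\<^sub>v v = 0\<^sub>v (n j)" if "j < k" "v \<in> snd (f m j)" for j v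
    proof (cases "j = i")
      case True
      then show ?thesis using kernel_of_proj_point [OF M s Ms] that by (simp add: f_def M_def)
    next
      case False
      then show ?thesis using z(1) that by (simp add: f_def Sol_def)
    qed
    then show ?thesis using ff [of m] z(1) unfolding Sol_def by (simp add: fst_f)
  qed
  have "a' \<longlonglongrightarrow> 0"
    unfolding a'_def [abs_def] using tendsto_of_real [OF LIMSEQ_inverse_real_of_nat, where ?'a = complex]
    by (simp only: of_real_0)
  have "limitin (fp_topology k n) f z sequentially"
  proof (rule limitin_fp_topology [OF _ _ ff zf])
    fix j assume j: "j < k"
    show "limitin (cvec_topology k) (\<lambda>m. fst (f m j)) (fst (z j)) sequentially"
      unfolding fst_f using fp_spaceD [OF zf j] by (simp add: topspace_cvec_topology)
    show "limitin (proj_topology (n j)) (\<lambda>m. snd (f m j)) (snd (z j)) sequentially"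
    proof (cases "j = i")
      case True
      have "(\<lambda>m. s m $ t) \<longlonglongrightarrow> w $ t" if "t < n i" for t
      proof -
        have "(\<lambda>m. w $ t + a' m * y $ t) \<longlonglongrightarrow> w $ t + 0 * y $ t"
          by (intro tendsto_intros \<open>a' \<longlonglongrightarrow> 0\<close>)
        then show ?thesis using that w y by (simp add: s_def)
      qed
      then have "limitin (proj_topology (n i)) (\<lambda>m. proj_point (s m)) (proj_point w) sequentially"
        by (rule limitin_proj_topology [OF s s0 w(1,2)])
      then show ?thesis using True w(3) by (simp add: f_def)
    next
      case False
      then show ?thesis using fp_spaceD [OF zf j] by (simp add: f_def topspace_proj_topology)
    qed
  qed
  moreover have "f m \<noteq> z" for m
  proof
    assume "f m = z"
    from fun_cong [OF this, of i] show False using sp [of m] w(3) by (simp add: f_def prod_eq_iff)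
  qed
  ultimately show False using limitin_imp_derived_set fS z(2) by metis
qed

text \<open>Zeros accumulating at \<open>x\<close> would produce solutions accumulating at
  \<open>pt x\<close>: their kernel points converge along a subsequence because the kernels over
  \<open>x\<close> are lines, and \<open>pt\<close> is injective on zeros.\<close>

lemma isolated_zero:
  assumes z: "z \<in> Sol a b \<omega>" "z \<notin> fp_topology k n derived_set_of Sol a b \<omega>"
  defines "x \<equiv> coords (\<lambda>i. fst (z i))"
  shows "z = pt x" "x \<in> ss.zeros (Par a b \<omega>)" "\<And>i. i < k \<Longrightarrow> ker_line (n i) (H i (lamb i x))"
    "\<exists>r>0. \<forall>y\<in>ss.zeros (Par a b \<omega>). ss.pd y x \<le> r \<longrightarrow> y = x"
proof -
  show zx: "z = pt x" unfolding x_def using z(1) by (rule Sol_pt) (rule isolated_ker_line [OF z])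
  show x: "x \<in> ss.zeros (Par a b \<omega>)" unfolding x_def by (rule Sol_coords [OF z(1)])
  show line: "ker_line (n i) (H i (lamb i x))" if "i < k" for i
    using isolated_ker_line [OF z that] Sol_lamb [OF z(1) that] by (simp add: x_def)
  show "\<exists>r>0. \<forall>y\<in>ss.zeros (Par a b \<omega>). ss.pd y x \<le> r \<longrightarrow> y = x"
  proof (rule ccontr)
    assume neg: "\<not> ?thesis"
    define Q where "Q m y \<longleftrightarrow> y \<in> ss.zeros (Par a b \<omega>) \<and> ss.pd y x \<le> inverse (real (Suc m)) \<and> y \<noteq> x" for m y
    define y where "y m = (SOME y. Q m y)" for m
    have y: "y m \<in> ss.zeros (Par a b \<omega>) \<and> ss.pd (y m) x \<le> inverse (real (Suc m)) \<and> y m \<noteq> x" for m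
    proof -
      have "0 < inverse (real (Suc m))" by simp
      then have "\<exists>y. Q m y" using neg unfolding Q_def by blast
      then have "Q m (y m)" unfolding y_def by (rule someI_ex)
      then show ?thesis unfolding Q_def .
    qed
    have "(\<lambda>m. y m j) \<longlonglongrightarrow> x j" if "j < k * k" for j
    proof -
      have "norm (y m j - x j) \<le> inverse (real (Suc m))" for m
        using ss.norm_le_pd [OF that, of "y m" x] y [of m] by linarith
      then have "(\<lambda>m. y m j - x j) \<longlonglongrightarrow> 0"
        by (intro Lim_null_comparison [OF _ LIMSEQ_inverse_real_of_nat]) auto
      then show ?thesis using LIM_zero_iff by blast
    qed
    moreover have "\<exists>a b. y m \<in> ss.zeros (Par a b \<omega>)" for m using y by blast
    ultimately obtain r where r: "limitin (fp_topology k n) (\<lambda>m. pt (y (r m))) (pt x) sequentially"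
      using pt_subsequence_limit [of y \<omega> x a b] x line by metis
    have "pt x \<in> fp_topology k n derived_set_of Sol a b \<omega>"
    proof (rule limitin_imp_derived_set [OF r])
      show "pt (y (r m)) \<in> Sol a b \<omega>" for m using y pt_Sol by blast
      show "pt (y (r m)) \<noteq> pt x" for m using y [of "r m"] inj_onD [OF inj_on_pt _ _ x] by blast
    qed
    then show False using z(2) zx by simp
  qed
qed

text \<open>A sequence of parameters tending to 1 from the left whose points stay outside a
  neighbourhood of \<open>pt x\<close> is impossible, since by \<open>pt_subsequence_limit\<close> a
  subsequence of the points converges to \<open>pt x\<close>.\<close>

lemma pt_limit:
  assumes g: "\<And>t. 0 \<le> t \<Longrightarrow> t < 1 \<Longrightarrow> g t \<in> ss.zeros (Par (1 - of_real t) (of_real t) \<omega>)"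
    and x: "x \<in> ss.zeros (Par a b \<omega>)" and line: "\<And>i. i < k \<Longrightarrow> ker_line (n i) (H i (lamb i x))"
    and lim: "\<And>j. j < k * k \<Longrightarrow> ((\<lambda>t. g t j) \<longlongrightarrow> x j) (at_left (1 :: real))"
  shows "limitin (fp_topology k n) (\<lambda>t. pt (g t)) (pt x) (at_left 1)"
  unfolding limitin_def
proof (intro conjI allI impI)
  show "pt x \<in> topspace (fp_topology k n)" using pt_Sol [OF x] by (simp add: topspace_fp_topology Sol_def)
  fix U assume U: "openin (fp_topology k n) U \<and> pt x \<in> U"
  show "\<forall>\<^sub>F t in at_left 1. pt (g t) \<in> U"
  proof (rule sequentially_imp_eventually_at_left [of 0])
    fix f :: "nat \<Rightarrow> real" assume f: "\<And>m. 0 < f m" "\<And>m. f m < 1" "f \<longlonglongrightarrow> 1"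
    show "\<forall>\<^sub>F m in sequentially. pt (g (f m)) \<in> U"
    proof (rule ccontr)
      assume "\<not> ?thesis"
      then have "\<forall>N. \<exists>m\<ge>N. pt (g (f m)) \<notin> U" by (auto simp: eventually_sequentially)
      then obtain s where s: "\<And>N. N \<le> s N" "\<And>N. pt (g (f (s N))) \<notin> U" by metis
      have "filterlim s at_top sequentially"
        by (rule filterlim_at_top_mono [OF filterlim_ident]) (simp add: s)
      then have "(\<lambda>N. f (s N)) \<longlonglongrightarrow> 1" using f(3) by (rule filterlim_compose [rotated])
      then have fl: "filterlim (\<lambda>N. f (s N)) (at_left 1) sequentially"
        unfolding filterlim_at using f(2) by (auto intro!: always_eventually simp: less_imp_neq)
      have "(\<lambda>N. g (f (s N)) j) \<longlonglongrightarrow> x j" if "j < k * k" for j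
        by (rule filterlim_compose [OF lim [OF that] fl])
      moreover have "\<exists>a b. g (f (s N)) \<in> ss.zeros (Par a b \<omega>)" for N
        using g [of "f (s N)"] f(1,2) less_imp_le by blast
      ultimately obtain r where r: "limitin (fp_topology k n) (\<lambda>m. pt (g (f (s (r m))))) (pt x) sequentially"
        using pt_subsequence_limit [of "\<lambda>N. g (f (s N))" \<omega> x a b] x line by metis
      then have "\<forall>\<^sub>F m in sequentially. pt (g (f (s (r m)))) \<in> U" using U unfolding limitin_def by blast
      then show False using s(2) by (auto simp: eventually_sequentially)
    qed
  qed simp
qed

text \<open>The sections live over a neighbourhood of \<open>[0, 1)\<close> in the complex plane, so
  their restrictions to real parameters are smooth up to and including \<open>t = 0\<close>.\<close>

lemma generic_chosen_correctly:
  assumes gen: "generic \<omega>"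
  shows "fp_chosen_correctly k n A B c p q (R_of k \<omega>)"
proof -
  define C where "C z = Par (1 - z) z \<omega>" for z
  have poly: "ss.polyfam C" unfolding C_def by (rule polyfam_Par)
  have goodC: "ss.good (C (of_real t))" if "0 \<le> t" "t < 1" for t
    unfolding C_def using good_Par [OF gen that] .
  then have g0: "ss.good (C 0)" using goodC [of 0] by simp
  \<comment> \<open>The start system lies on the line and is good, so neither \<open>dl\<close> nor
    \<open>hdet\<close> vanishes identically on it.\<close>
  have "finite {z. \<not> ss.good (C z)}"
    by (rule ss.good_on_line(2) [OF poly g0, of 0]) (use g0 ss.hdet_nonzero [OF g0] in \<open>auto simp: ss.good_def\<close>)
  moreover have "complex_of_real t \<notin> {z. \<not> ss.good (C z)}" if "0 \<le> t" "t < 1" for t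
    using goodC [OF that] by simp
  ultimately obtain W where W: "open W" "convex W" "\<And>t. 0 \<le> t \<Longrightarrow> t < 1 \<Longrightarrow> complex_of_real t \<in> W"
      and WX: "W \<inter> {z. \<not> ss.good (C z)} = {}"
    by (rule convex_neighbourhood_avoiding_finite) blast+
  have gW: "ss.good (C z)" if "z \<in> W" for z using WX that by blast
  have "0 \<in> W" using W(3) [of 0] by simp
  obtain \<Gamma> where \<Gamma>: "finite \<Gamma>" "\<And>\<gamma> j. \<gamma> \<in> \<Gamma> \<Longrightarrow> continuous_on W (\<lambda>z. \<gamma> z j)"
      "\<And>z. z \<in> W \<Longrightarrow> bij_betw (\<lambda>\<gamma>. \<gamma> z) \<Gamma> (ss.zeros (C z))"
    by (rule ss.global_sections [OF poly W(1,2) gW \<open>0 \<in> W\<close>]) blast+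
  have \<Gamma>z: "\<gamma> z \<in> ss.zeros (C z)" if "\<gamma> \<in> \<Gamma>" "z \<in> W" for \<gamma> z
    using \<Gamma>(3) [OF that(2)] that(1) by (auto simp: bij_betw_def)
  define G where "G = (\<lambda>\<gamma> t. pt (\<gamma> (complex_of_real t))) ` \<Gamma>"
  let ?X = "fp_topology k n"
  have sol: "solutions k n (homotopy (Q_FP k n A B c) (P_FP k n A (R_of k \<omega>)) t) = pt ` ss.zeros (C (of_real t))"
    if "0 \<le> t" "t < 1" for t
    unfolding solutions_homotopy C_def by (rule Sol_good) (rule good_Par [OF gen that])
  have finG: "finite G" using \<Gamma>(1) by (simp add: G_def)
  have smooth: "smooth_fp_path k n \<gamma>" if \<gamma>G: "\<gamma> \<in> G" for \<gamma>
  proof -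
    obtain \<delta> where \<delta>: "\<delta> \<in> \<Gamma>" "\<gamma> = (\<lambda>t. pt (\<delta> (of_real t)))" using \<gamma>G by (auto simp: G_def)
    have "(\<lambda>z. \<delta> z j) holomorphic_on W" if "j < k * k" for j
      by (rule ss.section_holomorphic [OF poly W(1) gW \<Gamma>z [OF \<delta>(1)] \<Gamma>(2) [OF \<delta>(1)] that])
    then show ?thesis
      unfolding \<delta>(2) using gW \<Gamma>z [OF \<delta>(1)] unfolding C_def by (intro smooth_pt [OF W(1,3)])
  qed
  have cover: "solutions k n (homotopy (Q_FP k n A B c) (P_FP k n A (R_of k \<omega>)) t) = (\<lambda>\<gamma>. \<gamma> t) ` G"
      "inj_on (\<lambda>\<gamma>. \<gamma> t) G" if t: "t \<in> {0..<1}" for t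
  proof -
    have tW: "complex_of_real t \<in> W" using W(3) t by simp
    note b = \<Gamma>(3) [OF tW]
    have "(\<lambda>\<gamma>. \<gamma> t) ` G = pt ` (\<lambda>\<gamma>. \<gamma> (of_real t)) ` \<Gamma>" by (auto simp: G_def image_image)
    also have "(\<lambda>\<gamma>. \<gamma> (of_real t)) ` \<Gamma> = ss.zeros (C (of_real t))" using b by (simp add: bij_betw_def)
    finally show "solutions k n (homotopy (Q_FP k n A B c) (P_FP k n A (R_of k \<omega>)) t) = (\<lambda>\<gamma>. \<gamma> t) ` G"
      using sol [of t] t by simp
    show "inj_on (\<lambda>\<gamma>. \<gamma> t) G"
    proof (rule inj_onI)
      fix \<gamma> \<gamma>' assume "\<gamma> \<in> G" "\<gamma>' \<in> G" and eq: "\<gamma> t = \<gamma>' t"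
      then obtain \<delta> \<delta>' where \<delta>: "\<delta> \<in> \<Gamma>" "\<gamma> = (\<lambda>t. pt (\<delta> (of_real t)))"
          "\<delta>' \<in> \<Gamma>" "\<gamma>' = (\<lambda>t. pt (\<delta>' (of_real t)))" by (auto simp: G_def)
      have "\<delta> (of_real t) = \<delta>' (of_real t)"
        by (rule inj_onD [OF inj_on_pt _ \<Gamma>z [OF \<delta>(1) tW] \<Gamma>z [OF \<delta>(3) tW]]) (use eq \<delta> in simp)
      then have "\<delta> = \<delta>'" using inj_onD [OF bij_betw_imp_inj_on [OF b] _ \<delta>(1,3)] by simp
      then show "\<gamma> = \<gamma>'" using \<delta> by simp
    qed
  qed
  have endpoint: "\<exists>\<gamma>\<in>G. \<gamma> 0 \<in> solutions k n (Q_FP k n A B c) \<and> limitin ?X \<gamma> z (at_left 1)"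
    if z: "z \<in> Sol 0 1 \<omega>" "z \<notin> ?X derived_set_of Sol 0 1 \<omega>" for z
  proof -
    define x where "x = coords (\<lambda>i. fst (z i))"
    note x = isolated_zero [OF z, folded x_def]
    obtain r where r: "0 < r" "\<And>y. y \<in> ss.zeros (Par 0 1 \<omega>) \<Longrightarrow> ss.pd y x \<le> r \<Longrightarrow> y = x" using x(4) by blast
    \<comment> \<open>The sections along the real parameters, still in coordinates, where isolated
      zeros are treated; \<open>pt\<close> is applied only afterwards.\<close>
    define \<Gamma>' where "\<Gamma>' = (\<lambda>\<gamma> t. \<gamma> (complex_of_real t)) ` \<Gamma>"
    have lim1: "(complex_of_real \<longlongrightarrow> 1) (at_left 1)"
      using tendsto_of_real [OF tendsto_ident_at [of 1 "{..<1}"], where ?'a = complex] by simp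
    obtain \<gamma> where \<gamma>: "\<gamma> \<in> \<Gamma>'" "\<And>j. j < k * k \<Longrightarrow> ((\<lambda>t. \<gamma> t j) \<longlongrightarrow> x j) (at_left 1)"
    proof (rule ss.path_to_isolated_zero [of \<Gamma>' "\<lambda>t. C (of_real t)" "Par 0 1 \<omega>" x r])
      show "finite \<Gamma>'" using \<Gamma>(1) by (simp add: \<Gamma>'_def)
      show "ss.zeros (C (of_real t)) = (\<lambda>\<gamma>. \<gamma> t) ` \<Gamma>'" if "t \<in> {0..<1}" for t
        using \<Gamma>(3) [of "of_real t"] W(3) [of t] that by (auto simp: \<Gamma>'_def bij_betw_def image_image)
      show "continuous_on {0..<1} (\<lambda>t. \<gamma> t j)" if \<gamma>G: "\<gamma> \<in> \<Gamma>'" for \<gamma> j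
      proof -
        obtain \<delta> where \<delta>: "\<delta> \<in> \<Gamma>" "\<gamma> = (\<lambda>t. \<delta> (of_real t))" using \<gamma>G by (auto simp: \<Gamma>'_def)
        show ?thesis unfolding \<delta>(2)
          by (rule continuous_on_compose2 [OF \<Gamma>(2) [OF \<delta>(1)]]) (auto intro!: continuous_intros W(3))
      qed
      show "ss.good (C (of_real t))" if "t \<in> {0..<1}" for t using goodC that by simp
      show "((\<lambda>t. C (complex_of_real t) i e) \<longlongrightarrow> Par 0 1 \<omega> i e) (at_left 1)" if "i < k * k" for i e
        using ss.polyfam_tendsto [OF poly lim1] that by (simp add: ss.sys_tendsto_def C_def)
    qed (use x(2) r in blast)+
    then obtain \<delta> where \<delta>: "\<delta> \<in> \<Gamma>" "\<gamma> = (\<lambda>t. \<delta> (of_real t))" by (auto simp: \<Gamma>'_def)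
    have \<gamma>z: "\<gamma> t \<in> ss.zeros (Par (1 - of_real t) (of_real t) \<omega>)" if "0 \<le> t" "t < 1" for t
      using \<Gamma>z [OF \<delta>(1) W(3) [OF that]] by (simp add: \<delta>(2) C_def)
    have "limitin ?X (\<lambda>t. pt (\<gamma> t)) z (at_left 1)"
      unfolding x(1) by (rule pt_limit [OF \<gamma>z x(2,3) \<gamma>(2)])
    moreover have "(\<lambda>t. pt (\<gamma> t)) \<in> G" using \<delta> by (auto simp: G_def)
    moreover have "pt (\<gamma> 0) \<in> solutions k n (Q_FP k n A B c)"
      unfolding solutions_Q [of \<omega>] using pt_Sol [OF \<gamma>z [of 0]] by simp
    ultimately show ?thesis by (intro bexI [of _ "\<lambda>t. pt (\<gamma> t)"] conjI)
  qed
  show ?thesis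
    unfolding fp_chosen_correctly_def chosen_correctly_def solutions_P
  proof (intro conjI exI [of _ G] ballI impI)
    show "finite (\<Pi>\<^sub>E i\<in>{..<k}. gep_eigenpairs k (n i) (A i) (p i) (q i))" by (rule start_set(1))
    show "solutions k n (Q_FP k n A B c) = (\<Pi>\<^sub>E i\<in>{..<k}. gep_eigenpairs k (n i) (A i) (p i) (q i))"
      unfolding solutions_Q [of \<omega>] by (rule start_set(2))
  qed (use finG smooth cover endpoint in blast)+
qed

end

theorem theorem5p4:
  fixes k :: nat
    and n d :: "nat \<Rightarrow> nat"
    and A :: "nat \<Rightarrow> nat \<Rightarrow> complex mat"
    and B :: "nat \<Rightarrow> complex mat"
    and c p q :: "nat \<Rightarrow> complex vec"
    and f :: "(nat \<times> nat \<times> nat \<Rightarrow> complex) \<Rightarrow> ennreal"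
  assumes "k \<ge> 2"
    and "\<And>i. i < k \<Longrightarrow> n i \<ge> 1"
    and "\<And>i j. i < k \<Longrightarrow> j \<le> k \<Longrightarrow> A i j \<in> carrier_mat (n i) (n i)"
    and "has_intrinsic_dimension k n A d"
    and "\<And>i. i < k \<Longrightarrow> B i \<in> carrier_mat (k - 1) k"
    and "\<And>i. i < k \<Longrightarrow> c i \<in> carrier_vec (k - 1)"
    and "\<And>i. i < k \<Longrightarrow> vec_space.rank (k - 1) (B i) = k - 1"
    and "\<And>i. i < k \<Longrightarrow> p i \<in> carrier_vec k"
    and "\<And>i. i < k \<Longrightarrow> L_map (B i) (c i) (p i) = 0\<^sub>v (k - 1)"
    and "\<And>i. i < k \<Longrightarrow> q i \<in> carrier_vec k"
    and "\<And>i. i < k \<Longrightarrow> mat_kernel (B i) = range (\<lambda>a. a \<cdot>\<^sub>v q i)"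
    and "card (start_solutions k n A p q) = (\<Prod>i<k. d i)"
    and "f \<in> borel_measurable (R_lebesgue k)"
    and "prob_space (density (R_lebesgue k) f)"
  shows "AE \<omega> in density (R_lebesgue k) f. fp_chosen_correctly k n A B c p q (R_of k \<omega>)"
proof -
  interpret fp_setup k n d A B c p q by unfold_locales (use assms in auto)
  \<comment> \<open>The density measure charges only the set where \<open>f\<close> is positive, and
    an exceptional set of Lebesgue measure zero remains null for it.\<close>
  have "AE \<omega> in R_lebesgue k. 0 < f \<omega> \<longrightarrow> fp_chosen_correctly k n A B c p q (R_of k \<omega>)"
    using AE_generic by eventually_elim (simp add: generic_chosen_correctly)
  then show ?thesis by (simp add: AE_density [OF assms(13)])
qed

end
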